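(* Suppose there is a constant $\epsilon_1>0$ such that for every $\widetilde u_1\in\mathcal L^2_{\mathcal F}([s,T],\mathbb R^m)$, $$\mathbb E\Big[\int_s^T\langle D_1\widetilde X,\widetilde X\rangle+\langle E_1\widetilde u_1,\widetilde u_1\rangle\,dt+\langle G_1\widetilde X(T),\widetilde X(T)\rangle\Big]\ \ge\ \epsilon_1\,\mathbb E\int_s^T|\widetilde u_1|^2dt ,$$ where $\widetilde X\in\mathcal L^2_{\mathcal F}(\Omega,C([s,T],\mathbb R^n))$ is the unique solution of $d\widetilde X=[A\widetilde X+B_1\widetilde u_1]dt+C\widetilde X\,dB(t)$, $\widetilde X(s)=0$. Then, for the strategy $u_2$ announced by the leader, an optimal feedback strategy of the follower (a minimizer of $u_1\mapsto J_1(X,u_1,u_2)$ over $\mathcal L^2_{\mathcal F}([s,T],\mathbb R^m)$) is given by $$u_1^*=-E_1^{-1}B_1^\top(\phi_1X^*+\psi_1),$$ where $X^*$ is the corresponding state, $(\phi_1,\widetilde\phi_1)$ is the solution of the stochastic Riccati equation $$\begin{cases}d\phi_1=-\big[D_1+\phi_1A+A^\top\phi_1+\widetilde\phi_1C+C^\top\widetilde\phi_1+C^\top\phi_1C-\phi_1S_1\phi_1\big]dt+\widetilde\phi_1dB(t),\quad t\in[s,T],\\ \phi_1(T)=G_1,\end{cases}$$ and $(\psi_1,\widetilde\psi_1)$ is the solution of the BSDE $$\begin{cases}d\psi_1=-\big[(A^\top-\phi_1S_1)\psi_1+C^\top\widetilde\psi_1+\phi_1B_2u_2\big]dt+\widetilde\psi_1dB(t),\quad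 t\in[s,T],\\ \psi_1(T)=0,\end{cases}$$ with $S_1=B_1E_1^{-1}B_1^\top$.
   Context: $0\le s<T$. On a complete filtered probability space satisfying the usual conditions, $B$ is a standard one-dimensional Brownian motion and $\mathcal F=\{\mathcal F_t\}$ is the filtration it generates. $\mathcal S^k$ is the space of symmetric real $k\times k$ matrices. For a Euclidean space $\mathcal H$: $\mathcal L^2_{\mathcal F}([s,T],\mathcal H)$ is the space of $\mathcal F$-progressively measurable $\mathcal H$-valued processes $X$ with $\mathbb E\int_s^T|X|^2dt<\infty$; $\mathcal L^2_{\mathcal F}(\Omega,C([s,T],\mathcal H))$ is the space of continuous progressively measurable processes with $\mathbb E[\sup_{t\in[s,T]}|X(t)|^2]<\infty$; $\mathcal L^\infty_{\mathcal F}(\Omega,C([s,T],\mathcal H))$ is the space of continuous progressively measurable processes with $\operatorname{esssup}_\omega\sup_t|X(t)|<\infty$. The coefficients $A,C$ ($\mathbb R^{n\times n}$-valued), $B_1,B_2$ ($\mathbb R^{n\times m}$-valued), $D_1$ ($\mathcal S^n$-valued), $E_1$ ($\mathcal S^m$-valued) are bounded $\mathcal F$-progressively measurable processes, $E_1$ is invertible, and $G_1$ is a bounded $\mathcal F_T$-measurable $\mathcal S^n$-valued random variable ($D_1,E_1,G_1$ need not be positive definite). $\xi\in\mathbb R^n$ is fixed and $u_2\in\mathcal L^2_{\mathcal F}([s,T],\mathbb R^m)$. For $u_1\in\mathcal L^2_{\mathcal F}([s,T],\mathbb R^m)$ the state $X$ solves $$dX=[AX+B_1u_1+B_2u_2]dt+CX\,dB(t),\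 t\in[s,T],\qquad X(s)=\xi,$$ and $$J_1(X,u_1,u_2)=\mathbb E\Big[\int_s^T\langle D_1X,X\rangle+\langle E_1u_1,u_1\rangle dt+\langle G_1X(T),X(T)\rangle\Big].$$ Solutions are taken with $(\phi_1,\widetilde\phi_1)\in\mathcal L^\infty_{\mathcal F}(\Omega,C([s,T],\mathcal S^n))\times\mathcal L^2_{\mathcal F}([s,T],\mathcal S^n)$ and $(\psi_1,\widetilde\psi_1)\in\mathcal L^2_{\mathcal F}(\Omega,C([s,T],\mathbb R^n))\times\mathcal L^2_{\mathcal F}([s,T],\mathbb R^n)$; under the coercivity hypothesis of the theorem the Riccati equation has a unique solution in this class (a known result on indefinite stochastic LQ problems with random coefficients, Sun, Xiong and Yong), and then so does the BSDE. The $t$-dependence of processes is suppressed. *)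

theory Defs
  imports "HOL-Probability.Probability"
begin

section \<open>Brownian motion and its filtration\<close>

definition standard_brownian_motion :: "'w measure \<Rightarrow> (real \<Rightarrow> 'w \<Rightarrow> real) \<Rightarrow> bool" where
  "standard_brownian_motion M B \<longleftrightarrow>
     (\<forall>t\<ge>0. B t \<in> borel_measurable M) \<and>
     (AE \<omega> in M. B 0 \<omega> = 0) \<and>
     (\<forall>\<omega>\<in>space M. continuous_on {0..} (\<lambda>t. B t \<omega>)) \<and>
     (\<forall>r t. 0 \<le> r \<longrightarrow> r < t \<longrightarrow>
        distributed M lborel (\<lambda>\<omega>. B t \<omega> - B r \<omega>) (normal_density 0 (sqrt (t - r)))) \<and>
     (\<forall>(N::nat) \<tau>. 0 \<le> \<tau> 0 \<longrightarrow> (\<forall>i<N. \<tau> i < \<tau> (Suc i)) \<longrightarrow>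
        prob_space.indep_vars M (\<lambda>_. borel) (\<lambda>i \<omega>. B (\<tau> (Suc i)) \<omega> - B (\<tau> i) \<omega>) {..<N})"

text \<open>The filtration generated by \<open>B\<close>, augmented by the null sets.\<close>

definition brownian_filtration ::
    "'w measure \<Rightarrow> (real \<Rightarrow> 'w \<Rightarrow> real) \<Rightarrow> real \<Rightarrow> 'w measure" where
  "brownian_filtration M B t =
     sigma (space M)
       ({B r -` S \<inter> space M |r S. 0 \<le> r \<and> r \<le> t \<and> S \<in> sets borel} \<union> null_sets M)"

definition usual_conditions :: "'w measure \<Rightarrow> (real \<Rightarrow> 'w measure) \<Rightarrow> bool" where
  "usual_conditions M F \<longleftrightarrow>
     complete_measure M \<and>
     filtration (space M) F \<and>
     (\<forall>t. sets (F t) \<subseteq> sets M) \<and>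
     null_sets M \<subseteq> sets (F 0) \<and>
     (\<forall>t\<ge>0. (\<Inter>r\<in>{t<..}. sets (F r)) = sets (F t))"

section \<open>Spaces of processes\<close>

text \<open>The set \<open>H\<close> is the linear space in which the processes take their values; it is
  either all of the ambient Euclidean type or the subspace of symmetric matrices.\<close>

definition prog_measurable ::
    "'w measure \<Rightarrow> (real \<Rightarrow> 'w measure) \<Rightarrow> real \<Rightarrow> real \<Rightarrow> 'h set
      \<Rightarrow> (real \<Rightarrow> 'w \<Rightarrow> 'h::euclidean_space) set" where
  "prog_measurable M F s T H =
     {X. (\<forall>t\<in>{s..T}. (\<lambda>(r, \<omega>). X r \<omega>) \<in>
             borel_measurable (restrict_space borel {s..t} \<Otimes>\<^sub>M F t)) \<and>
         (\<forall>t\<in>{s..T}. \<forall>\<omega>\<in>space M. X t \<omega> \<in> H)}"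

definition bounded_prog ::
    "'w measure \<Rightarrow> (real \<Rightarrow> 'w measure) \<Rightarrow> real \<Rightarrow> real \<Rightarrow> 'h set
      \<Rightarrow> (real \<Rightarrow> 'w \<Rightarrow> 'h::euclidean_space) set" where
  "bounded_prog M F s T H =
     {X \<in> prog_measurable M F s T H.
        \<exists>K. \<forall>t\<in>{s..T}. \<forall>\<omega>\<in>space M. norm (X t \<omega>) \<le> K}"

definition L2_prog ::
    "'w measure \<Rightarrow> (real \<Rightarrow> 'w measure) \<Rightarrow> real \<Rightarrow> real \<Rightarrow> 'h set
      \<Rightarrow> (real \<Rightarrow> 'w \<Rightarrow> 'h::euclidean_space) set" where
  "L2_prog M F s T H =
     {X \<in> prog_measurable M F s T H.
        (\<integral>\<^sup>+ \<omega>. (\<integral>\<^sup>+ t\<in>{s..T}. ennreal ((norm (X t \<omega>))\<^sup>2) \<partial>lborel) \<partial>M) < \<infinity>}"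

definition cont_prog ::
    "'w measure \<Rightarrow> (real \<Rightarrow> 'w measure) \<Rightarrow> real \<Rightarrow> real \<Rightarrow> 'h set
      \<Rightarrow> (real \<Rightarrow> 'w \<Rightarrow> 'h::euclidean_space) set" where
  "cont_prog M F s T H =
     {X \<in> prog_measurable M F s T H. \<forall>\<omega>\<in>space M. continuous_on {s..T} (\<lambda>t. X t \<omega>)}"

definition L2_cont ::
    "'w measure \<Rightarrow> (real \<Rightarrow> 'w measure) \<Rightarrow> real \<Rightarrow> real \<Rightarrow> 'h set
      \<Rightarrow> (real \<Rightarrow> 'w \<Rightarrow> 'h::euclidean_space) set" where
  "L2_cont M F s T H =
     {X \<in> cont_prog M F s T H.
        (\<integral>\<^sup>+ \<omega>. (SUP t\<in>{s..T}. ennreal ((norm (X t \<omega>))\<^sup>2)) \<partial>M) < \<infinity>}"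

definition Linf_cont ::
    "'w measure \<Rightarrow> (real \<Rightarrow> 'w measure) \<Rightarrow> real \<Rightarrow> real \<Rightarrow> 'h set
      \<Rightarrow> (real \<Rightarrow> 'w \<Rightarrow> 'h::euclidean_space) set" where
  "Linf_cont M F s T H =
     {X \<in> cont_prog M F s T H.
        esssup M (\<lambda>\<omega>. SUP t\<in>{s..T}. ereal (norm (X t \<omega>))) < \<infinity>}"

definition sym_matrices :: "(real^'k^'k) set" where
  "sym_matrices = {P. transpose P = P}"

section \<open>The Ito integral\<close>

definition simple_integrand ::
    "'w measure \<Rightarrow> (real \<Rightarrow> 'w measure) \<Rightarrow> real \<Rightarrow> real
      \<Rightarrow> nat \<Rightarrow> (nat \<Rightarrow> real) \<Rightarrow> (nat \<Rightarrow> 'w \<Rightarrow> 'h::euclidean_space) \<Rightarrow> bool" where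
  "simple_integrand M F s T N \<tau> \<eta> \<longleftrightarrow>
     \<tau> 0 = s \<and> \<tau> N = T \<and> (\<forall>i<N. \<tau> i < \<tau> (Suc i)) \<and>
     (\<forall>i<N. \<eta> i \<in> borel_measurable (F (\<tau> i)) \<and> (\<exists>K. \<forall>\<omega>\<in>space M. norm (\<eta> i \<omega>) \<le> K))"

definition simple_process ::
    "nat \<Rightarrow> (nat \<Rightarrow> real) \<Rightarrow> (nat \<Rightarrow> 'w \<Rightarrow> 'h::euclidean_space) \<Rightarrow> real \<Rightarrow> 'w \<Rightarrow> 'h" where
  "simple_process N \<tau> \<eta> t \<omega> = (\<Sum>i<N. indicator {\<tau> i<..\<tau> (Suc i)} t *\<^sub>R \<eta> i \<omega>)"

definition simple_ito ::
    "(real \<Rightarrow> 'w \<Rightarrow> real) \<Rightarrow> nat \<Rightarrow> (nat \<Rightarrow> real) \<Rightarrow> (nat \<Rightarrow> 'w \<Rightarrow> 'h::euclidean_space)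
      \<Rightarrow> real \<Rightarrow> 'w \<Rightarrow> 'h" where
  "simple_ito B N \<tau> \<eta> t \<omega> =
     (\<Sum>i<N. (B (min (\<tau> (Suc i)) t) \<omega> - B (min (\<tau> i) t) \<omega>) *\<^sub>R \<eta> i \<omega>)"

text \<open>\<open>ito_integral M F B s T Y I\<close>: \<open>I\<close> is a continuous version of the process
  \<open>t \<mapsto> \<integral>\<^sub>s\<^sup>t Y dB\<close>, the \<open>L\<^sup>2\<close>-limit of the integrals of simple processes approximating \<open>Y\<close>.
  By the Ito isometry, \<open>I\<close> is determined by \<open>Y\<close> up to indistinguishability, whatever the
  approximating sequence.\<close>

definition ito_integral ::
    "'w measure \<Rightarrow> (real \<Rightarrow> 'w measure) \<Rightarrow> (real \<Rightarrow> 'w \<Rightarrow> real) \<Rightarrow> real \<Rightarrow> real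
      \<Rightarrow> (real \<Rightarrow> 'w \<Rightarrow> 'h::euclidean_space) \<Rightarrow> (real \<Rightarrow> 'w \<Rightarrow> 'h) \<Rightarrow> bool" where
  "ito_integral M F B s T Y I \<longleftrightarrow>
     Y \<in> L2_prog M F s T UNIV \<and> I \<in> cont_prog M F s T UNIV \<and>
     (\<exists>N \<tau> \<eta>.
        (\<forall>k::nat. simple_integrand M F s T (N k) (\<tau> k) (\<eta> k)) \<and>
        (\<lambda>k. \<integral>\<^sup>+ \<omega>. (\<integral>\<^sup>+ t\<in>{s..T}.
               ennreal ((norm (simple_process (N k) (\<tau> k) (\<eta> k) t \<omega> - Y t \<omega>))\<^sup>2) \<partial>lborel) \<partial>M)
          \<longlonglongrightarrow> 0 \<and>
        (\<forall>t\<in>{s..T}.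
          (\<lambda>k. \<integral>\<^sup>+ \<omega>. ennreal ((norm (simple_ito B (N k) (\<tau> k) (\<eta> k) t \<omega> - I t \<omega>))\<^sup>2) \<partial>M)
            \<longlonglongrightarrow> 0))"

text \<open>\<open>ito_differential M F B s T X b \<sigma>\<close> is the equation
  \<open>dX = b dt + \<sigma> dB(t)\<close>, \<open>t \<in> [s, T]\<close>.\<close>

definition ito_differential ::
    "'w measure \<Rightarrow> (real \<Rightarrow> 'w measure) \<Rightarrow> (real \<Rightarrow> 'w \<Rightarrow> real) \<Rightarrow> real \<Rightarrow> real
      \<Rightarrow> (real \<Rightarrow> 'w \<Rightarrow> 'h::euclidean_space) \<Rightarrow> (real \<Rightarrow> 'w \<Rightarrow> 'h) \<Rightarrow> (real \<Rightarrow> 'w \<Rightarrow> 'h) \<Rightarrow> bool"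
  where
  "ito_differential M F B s T X b \<sigma> \<longleftrightarrow>
     (AE \<omega> in M. set_integrable lborel {s..T} (\<lambda>r. b r \<omega>)) \<and>
     (\<exists>I. ito_integral M F B s T \<sigma> I \<and>
        (AE \<omega> in M. \<forall>t\<in>{s..T}.
           X t \<omega> = X s \<omega> + (LINT r:{s..t}|lborel. b r \<omega>) + I t \<omega>))"

section \<open>The linear-quadratic problem\<close>

text \<open>\<open>X\<close> solves \<open>dX = [A X + b] dt + C X dB(t)\<close>, \<open>X(s) = \<xi>\<close>.\<close>

definition linear_state ::
    "'w measure \<Rightarrow> (real \<Rightarrow> 'w measure) \<Rightarrow> (real \<Rightarrow> 'w \<Rightarrow> real) \<Rightarrow> real \<Rightarrow> real
      \<Rightarrow> (real \<Rightarrow> 'w \<Rightarrow> real^'n^'n) \<Rightarrow> (real \<Rightarrow> 'w \<Rightarrow> real^'n^'n)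
      \<Rightarrow> (real \<Rightarrow> 'w \<Rightarrow> real^'n) \<Rightarrow> real^'n \<Rightarrow> (real \<Rightarrow> 'w \<Rightarrow> real^'n) \<Rightarrow> bool" where
  "linear_state M F B s T A C b \<xi> X \<longleftrightarrow>
     X \<in> L2_cont M F s T UNIV \<and>
     ito_differential M F B s T X
       (\<lambda>t \<omega>. A t \<omega> *v X t \<omega> + b t \<omega>) (\<lambda>t \<omega>. C t \<omega> *v X t \<omega>) \<and>
     (AE \<omega> in M. X s \<omega> = \<xi>)"

definition quadratic_cost ::
    "'w measure \<Rightarrow> real \<Rightarrow> real
      \<Rightarrow> (real \<Rightarrow> 'w \<Rightarrow> real^'n^'n) \<Rightarrow> (real \<Rightarrow> 'w \<Rightarrow> real^'m^'m) \<Rightarrow> ('w \<Rightarrow> real^'n^'n)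
      \<Rightarrow> (real \<Rightarrow> 'w \<Rightarrow> real^'n) \<Rightarrow> (real \<Rightarrow> 'w \<Rightarrow> real^'m) \<Rightarrow> real" where
  "quadratic_cost M s T D E G X u =
     (LINT \<omega>|M.
        (LINT t:{s..T}|lborel.
           (D t \<omega> *v X t \<omega>) \<bullet> X t \<omega> + (E t \<omega> *v u t \<omega>) \<bullet> u t \<omega>)
        + (G \<omega> *v X T \<omega>) \<bullet> X T \<omega>)"

end

theory Submission
  imports Defs
begin

text \<open>
  Let \<open>X\<^sup>*, u\<^sup>*\<close> be the state and control of the feedback, let \<open>X, u\<close> be any competitor, and put \<open>Y = X - X\<^sup>*\<close>,
  \<open>v = u - u\<^sup>*\<close>. Then \<open>J(X, u) = J(X\<^sup>*, u\<^sup>*) + 2 Q + J(Y, v)\<close> with a bilinear cross term \<open>Q\<close>, and \<open>J(Y, v)\<close> is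
  nonnegative by coercivity. The product formulas for \<open>E \<langle>\<phi>\<^sub>1 X\<^sup>*, Y\<rangle>\<close> and \<open>E \<langle>\<psi>\<^sub>1, Y\<rangle>\<close>, combined with the
  two backward equations, give \<open>Q = 0\<close>. Since the martingale part of \<open>\<phi>\<^sub>1\<close> is only square integrable, the
  triple product is expanded along partitions with cutoffs; the terms containing it cancel against the drift
  before the cutoffs are removed. Coercivity also forces \<open>E\<^sub>1 \<ge> \<epsilon>\<^sub>1 / 2\<close> almost everywhere, so that \<open>S\<^sub>1\<close> is essentially
  bounded and the closed-loop equation is solvable by Picard iteration.
\<close>

text \<open>The obstacle is \<open>\<phi>t\<^sub>1\<close> multiplied by two states. The states are
  square integrable uniformly in time, \<open>\<phi>t\<^sub>1\<close> is only square integrable over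
  time and sample point, so such a product need not be integrable. Hence
  \<open>\<phi>\<^sub>1 X\<close> cannot first be given an equation of its own and then be paired
  with \<open>Y\<close>: the three factors are expanded together, on finite grids, with both states
  stopped at a level \<open>m\<close>. There the offending terms of the Riccati drift meet the
  covariation terms, and what remains is a product of two square-integrable functions that vanishes
  with the mesh. The mesh must therefore go to zero before \<open>m\<close> grows.

  Pointwise invertibility of the control weight does not bound its inverse. Without such a bound
  neither the closed-loop drift nor membership of the feedback in the space of controls would be
  under control, and coercivity is the only quantitative hypothesis from which it can come.

  The Ito integral is given as a relation, through limits of simple integrals. Its existence,
  linearity, isometry and maximal inequality are derived from independence and moments of Brownian
  increments; the fourth moment is what makes third-order terms disappear.\<close>

abbreviation (input) "meas == borel_measurable"
abbreviation (input) lims (infixr "---->" 60) where "f ----> l == f \<longlonglongrightarrow> l"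

section \<open>Square-integrable real functions, Cauchy-Schwarz, limits of products\<close>

definition sq_int :: "'a measure => ('a => real) => bool" where
  "sq_int M f \<longleftrightarrow> f : meas M & integrable M (%x. (f x)^2)"

lemma sq_int_measurable[measurable_dest]: "sq_int M f ==> f : meas M"
  by (simp add: sq_int_def)

lemma sq_int_integrable: "sq_int M f ==> integrable M (%x. (f x)^2)"
  by (simp add: sq_int_def)

lemma sq_int_bound:
  assumes "sq_int M g" "f : meas M" "AE x in M. \<bar>f x\<bar> <= K * \<bar>g x\<bar>"
  shows "sq_int M f"
  unfolding sq_int_def
proof
  show "integrable M (%x. (f x)^2)"
  proof (rule Bochner_Integration.integrable_bound[of _ "%x. K^2 * (g x)^2"])
    show "integrable M (%x. K^2 * (g x)^2)" using assms(1) by (simp add: sq_int_def)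
    show "(%x. (f x)^2) : meas M" using assms(2) by simp
    show "AE x in M. norm ((f x)^2) <= norm (K^2 * (g x)^2)"
      using assms(3)
    proof eventually_elim
      case (elim x)
      then have "\<bar>f x\<bar>^2 <= (K * \<bar>g x\<bar>)^2" by (intro power_mono) auto
      then show ?case by (simp add: power_mult_distrib abs_mult)
    qed
  qed
qed fact

lemma sq_int_mult:
  assumes "sq_int M f" "sq_int M g"
  shows "integrable M (%x. f x * g x)"
proof (rule Bochner_Integration.integrable_bound[of _ "%x. (f x)^2 + (g x)^2"])
  show "integrable M (%x. (f x)^2 + (g x)^2)" using assms by (simp add: sq_int_def)
  show "(%x. f x * g x) : meas M"
    using assms by (auto simp: sq_int_def intro: borel_measurable_times)
  have "\<bar>a * b\<bar> <= a^2 + b^2" for a b :: real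
  proof -
    have "2 * (\<bar>a\<bar> * \<bar>b\<bar>) <= a^2 + b^2" using sum_squares_bound[of "\<bar>a\<bar>" "\<bar>b\<bar>"] by simp
    moreover have "0 <= \<bar>a\<bar> * \<bar>b\<bar>" by simp
    ultimately show ?thesis unfolding abs_mult by linarith
  qed
  then show "AE x in M. norm (f x * g x) <= norm ((f x)^2 + (g x)^2)"
    by (intro AE_I2) auto
qed

lemma sq_int_add:
  assumes "sq_int M f" "sq_int M g"
  shows "sq_int M (%x. f x + g x)"
proof -
  have "(%x. (f x + g x)^2) = (%x. (f x)^2 + (g x)^2 + 2 * (f x * g x))"
    by (auto simp: power2_eq_square algebra_simps)
  with sq_int_mult[OF assms] assms show ?thesis
    by (auto simp: sq_int_def)
qed

lemma sq_int_cmult: "sq_int M f ==> sq_int M (%x. c * f x)"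
  by (auto simp: sq_int_def power_mult_distrib)

lemma sq_int_diff:
  assumes "sq_int M f" "sq_int M g"
  shows "sq_int M (%x. f x - g x)"
  using sq_int_add[OF assms(1) sq_int_cmult[OF assms(2), of "-1"]] by simp

lemma sq_int_zero: "sq_int M (%x. 0)"
  by (simp add: sq_int_def)

lemma sq_int_sum:
  assumes "!!i. i : I ==> sq_int M (f i)"
  shows "sq_int M (%x. SUM i:I. f i x)"
  using assms
  by (induction I rule: infinite_finite_induct) (auto intro: sq_int_add sq_int_zero)

lemma sq_int_bounded_mult:
  assumes "sq_int M f" "Z : meas M" "AE x in M. \<bar>Z x\<bar> <= K"
  shows "sq_int M (%x. Z x * f x)"
proof (rule sq_int_bound[OF assms(1), where K = K])
  show "AE x in M. \<bar>Z x * f x\<bar> <= K * \<bar>f x\<bar>"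
    using assms(3) by eventually_elim (simp add: abs_mult mult_right_mono)
qed (use assms in \<open>auto simp: sq_int_def\<close>)

lemma sq_int_bounded:
  assumes "finite_measure M" "Z : meas M" "AE x in M. \<bar>Z x\<bar> <= K"
  shows "sq_int M Z"
proof -
  interpret finite_measure M by fact
  have "sq_int M (%x. Z x * 1)"
    by (rule sq_int_bounded_mult[OF _ assms(2,3)]) (simp add: sq_int_def)
  then show ?thesis by simp
qed

lemma (in finite_measure) sq_int_imp_integrable:
  assumes "sq_int M f" shows "integrable M f"
  using sq_int_mult[OF assms sq_int_bounded[of M "%_. 1" 1]] finite_measure_axioms by simp

text \<open>\<open>A\<close>, \<open>2 * D\<close> and \<open>C\<close> are the coefficients of a
  quadratic polynomial in \<open>y\<close> that is the integral of a square. Being nonnegative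
  everywhere, it has no positive discriminant.\<close>

lemma cauchy_schwarz_integral:
  assumes f: "sq_int M f" and g: "sq_int M g"
  shows "(LINT x|M. \<bar>f x * g x\<bar>) <= sqrt (LINT x|M. (f x)^2) * sqrt (LINT x|M. (g x)^2)"
proof -
  define A where "A = (LINT x|M. (f x)^2)"
  define C where "C = (LINT x|M. (g x)^2)"
  define D where "D = (LINT x|M. \<bar>f x * g x\<bar>)"
  note [simp] = sq_int_integrable[OF f] sq_int_integrable[OF g] sq_int_mult[OF f g]
  have A: "A >= 0" and C: "C >= 0" and D: "D >= 0" by (auto simp: A_def C_def D_def)
  have *: "0 <= y^2 * A + 2 * y * D + C" for y
  proof -
    have "y^2 * A + 2 * y * D + C = (LINT x|M. y^2 * (f x)^2 + 2 * y * \<bar>f x * g x\<bar> + (g x)^2)"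
      by (simp add: A_def C_def D_def)
    also have "... = (LINT x|M. (y * \<bar>f x\<bar> + \<bar>g x\<bar>)^2)"
      by (simp add: power2_sum power_mult_distrib abs_mult algebra_simps)
    also have "... >= 0" by simp
    finally show ?thesis .
  qed
  have "D^2 <= A * C"
  proof (cases "A = 0")
    case True
    have "D = 0"
    proof (rule ccontr)
      assume "D ~= 0"
      \<comment> \<open>For \<open>A = 0\<close> the polynomial is affine in \<open>y\<close>; at
        this \<open>y\<close> it takes the value -1.\<close>
      then show False using *[of "- (C + 1) / (2 * D)"] True by (simp add: field_simps)
    qed
    then show ?thesis using True by simp
  next
    case False
    then have "A > 0" using A by simp
    have "0 <= A * ((- D / A)^2 * A + 2 * (- D / A) * D + C)"
      using *[of "- D / A"] \<open>A > 0\<close> by (intro mult_nonneg_nonneg) auto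
    also have "... = A * C - D^2" using \<open>A > 0\<close> by (simp add: field_simps power2_eq_square)
    finally show ?thesis by simp
  qed
  then have "D <= sqrt (A * C)" using D by (metis real_le_rsqrt)
  then show ?thesis by (simp add: A_def C_def D_def real_sqrt_mult)
qed

text \<open>With \<open>u = f k - f'\<close> and \<open>v = g k - g'\<close> the products differ by
  \<open>u v + f' v + u g'\<close>, and Cauchy-Schwarz makes each term small. The bounded weight
  \<open>Z\<close> will be a test variable, possibly times the indicator of a time interval.\<close>

lemma integral_mult_tendsto_L2:
  assumes f: "!!k. sq_int M (f k)" "sq_int M f'"
    and g: "!!k. sq_int M (g k)" "sq_int M g'"
    and cf: "(%k. LINT x|M. (f k x - f' x)^2) ----> 0" and cg: "(%k. LINT x|M. (g k x - g' x)^2) ----> 0"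
    and Z: "Z : meas M" "AE x in M. \<bar>Z x\<bar> <= K"
  shows "(%k. LINT x|M. Z x * f k x * g k x) ----> (LINT x|M. Z x * f' x * g' x)"
proof -
  have df: "sq_int M (%x. f k x - f' x)" for k using f by (intro sq_int_diff)
  have dg: "sq_int M (%x. g k x - g' x)" for k using g by (intro sq_int_diff)
  define e where "e k = \<bar>K\<bar> * (sqrt (LINT x|M. (f k x - f' x)^2) * sqrt (LINT x|M. (g k x - g' x)^2)
     + sqrt (LINT x|M. (f' x)^2) * sqrt (LINT x|M. (g k x - g' x)^2)
     + sqrt (LINT x|M. (f k x - f' x)^2) * sqrt (LINT x|M. (g' x)^2))" for k
  have "e ----> \<bar>K\<bar> * (sqrt 0 * sqrt 0 + sqrt (LINT x|M. (f' x)^2) * sqrt 0 + sqrt 0 * sqrt (LINT x|M. (g' x)^2))"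
    unfolding e_def by (intro tendsto_intros cf cg)
  then have e: "e ----> 0" by simp
  have I: "integrable M (%x. Z x * u x * v x)" if "sq_int M u" "sq_int M v" for u v
    using sq_int_mult[OF sq_int_bounded_mult[OF that(1) Z] that(2)] .
  have "norm ((LINT x|M. Z x * f k x * g k x) - (LINT x|M. Z x * f' x * g' x)) <= e k" for k
  proof -
    let ?u = "%x. f k x - f' x" and ?v = "%x. g k x - g' x"
    have "(LINT x|M. Z x * f k x * g k x) - (LINT x|M. Z x * f' x * g' x) =
       (LINT x|M. Z x * f k x * g k x - Z x * f' x * g' x)"
      using I[OF f(1) g(1)] I[OF f(2) g(2)] by simp
    also have "norm ... <= (LINT x|M. norm (Z x * f k x * g k x - Z x * f' x * g' x))" by simp
    also have "... <= (LINT x|M. \<bar>K\<bar> * (\<bar>?u x * ?v x\<bar> + \<bar>f' x * ?v x\<bar> + \<bar>?u x * g' x\<bar>))"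
    proof (rule integral_mono_AE)
      show "AE x in M. norm (Z x * f k x * g k x - Z x * f' x * g' x) <=
         \<bar>K\<bar> * (\<bar>?u x * ?v x\<bar> + \<bar>f' x * ?v x\<bar> + \<bar>?u x * g' x\<bar>)"
        using Z(2)
      proof eventually_elim
        case (elim x)
        have eq: "Z x * f k x * g k x - Z x * f' x * g' x = Z x * (?u x * ?v x + f' x * ?v x + ?u x * g' x)"
          by (simp add: algebra_simps)
        show ?case
          unfolding eq real_norm_def abs_mult[of "Z x"] using elim by (intro mult_mono) linarith+
      qed
    qed (use I[OF f(1) g(1)] I[OF f(2) g(2)] sq_int_mult[OF df dg] sq_int_mult[OF f(2) dg]
           sq_int_mult[OF df g(2)] in simp_all)
    also have "... = \<bar>K\<bar> * ((LINT x|M. \<bar>?u x * ?v x\<bar>) + (LINT x|M. \<bar>f' x * ?v x\<bar>) + (LINT x|M. \<bar>?u x * g' x\<bar>))"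
      using sq_int_mult[OF df dg] sq_int_mult[OF f(2) dg] sq_int_mult[OF df g(2)] by simp
    also have "... <= e k"
      unfolding e_def using cauchy_schwarz_integral[OF df dg] cauchy_schwarz_integral[OF f(2) dg]
         cauchy_schwarz_integral[OF df g(2)] by (intro mult_left_mono add_mono) auto
    finally show ?thesis .
  qed
  then have "(%k. (LINT x|M. Z x * f k x * g k x) - (LINT x|M. Z x * f' x * g' x)) ----> 0"
    by (intro Lim_null_comparison[OF _ e] always_eventually) auto
  then show ?thesis by (simp add: LIM_zero_iff)
qed

lemma sq_int_iff_nn:
  "sq_int M f \<longleftrightarrow> f : meas M & (\<integral>\<^sup>+x. ennreal ((f x)^2) \<partial>M) < \<infinity>"
  by (auto simp: sq_int_def integrable_iff_bounded)

lemma nn_integral_sq_eq: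
  assumes "sq_int M f"
  shows "(\<integral>\<^sup>+x. ennreal ((f x)^2) \<partial>M) = ennreal (LINT x|M. (f x)^2)"
  using assms by (intro nn_integral_eq_integral) (auto simp: sq_int_def)

text \<open>The definition of the Ito integral measures errors by nonnegative integrals that may be
  infinite; this passes to real integrals, where squares can be expanded.\<close>

lemma tendsto_nn_sq_iff:
  assumes "!!k. sq_int M (f k)"
  shows "((%k. \<integral>\<^sup>+x. ennreal ((f k x)^2) \<partial>M) ----> 0) \<longleftrightarrow> ((%k. LINT x|M. (f k x)^2) ----> 0)"
proof -
  have "(%k. \<integral>\<^sup>+x. ennreal ((f k x)^2) \<partial>M) = (%k. ennreal (LINT x|M. (f k x)^2))"
    using nn_integral_sq_eq[OF assms] by auto
  moreover have "((%k. ennreal (LINT x|M. (f k x)^2)) ----> ennreal 0) \<longleftrightarrow> ((%k. LINT x|M. (f k x)^2) ----> 0)"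
    by (rule tendsto_ennreal_iff) auto
  ultimately show ?thesis by simp
qed

section \<open>Brownian increments\<close>

text \<open>\<open>F_eq\<close> supplies the generator on which independence of future increments is
  checked; \<open>uc\<close> supplies completeness, so that a process can be altered on a null set
  without losing adaptedness.\<close>

locale brownian = prob_space M for M :: "'w measure" +
  fixes B :: "real => 'w => real" and F :: "real => 'w measure" and s T :: real
  assumes s0: "0 <= s" and sT: "s < T"
    and BM: "standard_brownian_motion M B"
    and F_eq: "F = brownian_filtration M B"
    and uc: "usual_conditions M F"
begin

abbreviation nn_expectation (binder "EM " 10) where "nn_expectation f == nn_integral M f"
abbreviation "PM == prog_measurable M F s T UNIV"
abbreviation "BP == bounded_prog M F s T UNIV"
abbreviation "L2P == L2_prog M F s T UNIV"
abbreviation "CP == cont_prog M F s T UNIV"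
abbreviation "L2C == L2_cont M F s T UNIV"
abbreviation "ito == ito_integral M F B s T"
abbreviation "ito_eq == ito_differential M F B s T"
abbreviation "lin_state == linear_state M F B s T"

lemma space_F[simp]: "space (F t) = space M"
  using uc by (simp add: usual_conditions_def filtration_def)

lemma sets_F_M: "sets (F t) \<subseteq> sets M"
  using uc by (simp add: usual_conditions_def)

lemma sets_F_mono: "r <= t ==> sets (F r) \<subseteq> sets (F t)"
  using uc by (simp add: usual_conditions_def filtration_def)

lemma null_sets_F: "0 <= t ==> null_sets M \<subseteq> sets (F t)"
  using uc sets_F_mono[of 0 t] by (auto simp: usual_conditions_def)

lemma measurable_F_M: "f : measurable (F t) N ==> f : measurable M N"
  using sets_F_M[of t] by (auto simp: measurable_def)

lemma measurable_F_mono: "f : measurable (F r) N ==> r <= t ==> f : measurable (F t) N"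
  using sets_F_mono[of r t] by (auto simp: measurable_def)

text \<open>By completeness every subset of a null set lies in every \<open>F t\<close> with
  \<open>t\<close> nonnegative. Path integrals make sense only almost surely, and this keeps them
  adapted after repair on the exceptional set.\<close>

lemma measurable_F_AE_cong:
  fixes f g :: "'w => 'b::topological_space"
  assumes f: "f : meas (F t)" and t: "0 <= t" and eq: "AE w in M. f w = g w"
  shows "g : meas (F t)"
proof (rule measurableI)
  obtain N where N: "N : null_sets M" "!!w. w : space M - N ==> f w = g w"
    using eq by (auto elim!: AE_E3)
  have sub: "A : sets (F t)" if "A \<subseteq> N" for A
    using uc N(1) that null_sets_F[OF t] complete_measure.complete2[of M A N]
    by (auto simp: usual_conditions_def complete_measure.complete intro: null_sets_subset)

  fix S :: "'b set" assume S: "S : sets borel"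
  have "g -` S \<inter> space M = ((f -` S \<inter> space (F t)) - (N \<inter> (f -` S \<inter> space (F t)))) \<union> (N \<inter> (g -` S \<inter> space M))"
    using N(2) null_setsD2[OF N(1)] sets.sets_into_space[of N M] by auto
  also have "... : sets (F t)"
    by (intro sets.Un sets.Diff measurable_sets[OF f S] sub) auto
  finally show "g -` S \<inter> space (F t) : sets (F t)" by simp
qed simp

lemma B_meas_F: "0 <= r ==> r <= t ==> B r : meas (F t)"
proof (rule measurableI)
  fix S :: "real set" assume S: "S : sets borel" and r: "0 <= r" "r <= t"
  have "{B r -` S \<inter> space M |r S. 0 <= r & r <= t & S : sets borel} \<union> null_sets M \<subseteq> Pow (space M)"
    using sets.sets_into_space by (auto dest!: null_setsD2)
  then show "B r -` S \<inter> space (F t) : sets (F t)"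
    unfolding space_F unfolding F_eq brownian_filtration_def using S r
    by (subst sets_measure_of) (auto intro!: sigma_sets.Basic)
qed simp

lemma B_meas[measurable]: "0 <= r ==> B r : meas M"
  using B_meas_F[of r r] measurable_F_M by blast

lemma B_cont: "w : space M ==> continuous_on {0..} (%t. B t w)"
  using BM by (simp add: standard_brownian_motion_def)

text \<open>The definition of Brownian motion speaks only of successive increments along one grid.
  Values of \<open>B\<close> at finitely many times up to \<open>r\<close> are sums of such
  increments, all preceding the one from \<open>r\<close> to \<open>t\<close>.\<close>

lemma indep_cylinder_increment:
  assumes r: "0 <= r" "r < t" and J: "finite J" "J \<subseteq> {0..r}" and S: "!!q. S q : sets (borel :: real measure)"
    and D: "D : sets (borel :: real measure)"
  shows "prob ({w : space M. ALL q:J. B q w : S q} \<inter> ((%w. B t w - B r w) -` D \<inter> space M)) =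
     prob {w : space M. ALL q:J. B q w : S q} * prob ((%w. B t w - B r w) -` D \<inter> space M)"
proof -
  \<comment> \<open>With 0 in the grid each \<open>B q\<close> is almost surely a sum of initial
    increments; with \<open>r\<close> as last point, the next increment is exactly the one to be
    separated.\<close>
  define Q where "Q = J \<union> {0, r}"
  have Q: "finite Q" "Q \<subseteq> {0..r}" using J r by (auto simp: Q_def)
  define L where "L = sorted_list_of_set Q"
  have L: "set L = Q" "sorted L" "distinct L" "sorted_wrt (<) L" using Q by (auto simp: L_def)
  define n where "n = length L - 1"
  have lenL: "length L = Suc n"
    using L(1) by (cases L) (auto simp: n_def Q_def)
  have Ln: "L ! n = r"
  proof -
    obtain i where i: "i < length L" "L ! i = r" using L(1) by (metis in_set_conv_nth insertCI Q_def UnI2)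
    have "L ! i <= L ! n" using L(2) i lenL by (intro sorted_nth_mono) auto
    moreover have "L ! n : Q" using L(1) lenL by (metis nth_mem lessI)
    ultimately show ?thesis using i Q by auto
  qed
  have L0: "L ! 0 = 0"
  proof -
    obtain i where i: "i < length L" "L ! i = 0" using L(1) by (metis in_set_conv_nth insertCI Q_def UnI2)
    have "L ! 0 <= L ! i" using L(2) i lenL by (intro sorted_nth_mono) auto
    moreover have "L ! 0 : Q" using L(1) lenL by (metis nth_mem zero_less_Suc)
    ultimately show ?thesis using i Q by auto
  qed
  define \<tau> where "\<tau> i = (if i <= n then L ! i else t)" for i
  have mono: "ALL i<Suc n. \<tau> i < \<tau> (Suc i)"
  proof (intro allI impI)
    fix i assume "i < Suc n"
    show "\<tau> i < \<tau> (Suc i)"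
    proof (cases "i = n")
      case True then show ?thesis using Ln r by (simp add: \<tau>_def)
    next
      case False
      then have "i < n" using \<open>i < Suc n\<close> by simp
      then show ?thesis using L(4) lenL by (simp add: \<tau>_def sorted_wrt_nth_less)
    qed
  qed
  define X where "X i w = B (\<tau> (Suc i)) w - B (\<tau> i) w" for i w
  have ind: "indep_vars (%_. borel) X {..<Suc n}"
  proof -
    have "0 <= \<tau> 0" by (simp add: \<tau>_def L0)
    then show ?thesis using BM mono unfolding standard_brownian_motion_def X_def by blast
  qed
  have iv: "indep_var (PiM {..<n} (%_. borel)) (%w. restrict (%i. X i w) {..<n}) (PiM {n} (%_. borel)) (%w. restrict (%i. X i w) {n})"
    by (rule indep_var_restrict[OF ind]) auto
  have "ALL q:J. EX i<=n. \<tau> i = q"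
  proof
    fix q assume "q : J"
    then obtain i where "i < length L" "L ! i = q" using L(1) by (metis in_set_conv_nth Q_def UnI1)
    then show "EX i<=n. \<tau> i = q" using lenL by (auto simp: \<tau>_def intro!: exI[of _ i])
  qed
  then obtain k where k: "!!q. q : J ==> k q <= n & \<tau> (k q) = q" by metis
  \<comment> \<open>The cylinder written through the increments before \<open>r\<close>. As
    \<open>B 0 = 0\<close> holds only almost surely, the two events agree up to a null set.\<close>
  define g where "g f = (if ALL q:J. (SUM i<k q. f i) : S q then 1 else 0 :: real)" for f :: "nat => real"
  have gm: "g : meas (PiM {..<n} (%_. borel))"
  proof -
    have [measurable]: "(%f. SUM i<k q. f i) : meas (PiM {..<n} (%_. borel :: real measure))" if "q : J" for q
      using k[OF that] by (intro borel_measurable_sum measurable_component_singleton) auto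
    have "{f : space (PiM {..<n} (%_. borel :: real measure)). ALL q:J. (SUM i<k q. f i) : S q} : sets (PiM {..<n} (%_. borel))"
      by (intro sets.sets_Collect_finite_All[OF _ J(1)]) (use S in measurable)
    then show ?thesis unfolding g_def by (intro measurable_If) auto
  qed
  define h where "h f = f n" for f :: "nat => real"
  have hm: "h : meas (PiM {n} (%_. borel))"
    unfolding h_def by (intro measurable_component_singleton) auto
  have iv2: "indep_var borel (g \<circ> (%w. restrict (%i. X i w) {..<n})) borel (h \<circ> (%w. restrict (%i. X i w) {n}))"
    by (rule indep_var_compose[OF iv gm hm])
  have heq: "(h \<circ> (%w. restrict (%i. X i w) {n})) = (%w. B t w - B r w)"
    by (auto simp: h_def X_def \<tau>_def Ln fun_eq_iff)
  let ?C = "{w : space M. ALL q:J. B q w : S q}"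
  let ?C' = "(g \<circ> (%w. restrict (%i. X i w) {..<n})) -` {1} \<inter> space M"
  let ?D = "(%w. B t w - B r w) -` D \<inter> space M"
  have Bq[measurable]: "B q : meas M" if "q : J" for q using J that by (intro B_meas) auto
  have Cm: "?C : sets M" by (intro sets.sets_Collect_finite_All[OF _ J(1)]) (use S in measurable)
  have C'm: "?C' : sets M" using iv2 by (auto simp: indep_var_rv1 intro!: measurable_sets[of _ M borel])
  have Dm: "?D : sets M"
    using B_meas[of t] B_meas[of r] D r by (intro measurable_sets[of _ M borel]) auto
  have AEeq: "AE w in M. w : ?C \<longleftrightarrow> w : ?C'"
  proof -
    have "AE w in M. B 0 w = 0" using BM by (simp add: standard_brownian_motion_def)
    then show ?thesis
    proof (eventually_elim)
      case (elim w)
      have "(SUM i<k q. restrict (%i. X i w) {..<n} i) = B q w" if "q : J" for q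
      proof -
        have "(SUM i<k q. restrict (%i. X i w) {..<n} i) = (SUM i<k q. X i w)"
          using k[OF that] by (intro sum.cong) auto
        also have "... = B (\<tau> (k q)) w - B (\<tau> 0) w"
          unfolding X_def by (rule sum_lessThan_telescope)
        finally show ?thesis using k[OF that] elim L0 by (auto simp: \<tau>_def)
      qed
      then show ?case by (auto simp: g_def)
    qed
  qed
  have 1: "prob ?C = prob ?C'" by (intro finite_measure_eq_AE Cm C'm AEeq)
  have 2: "prob (?C \<inter> ?D) = prob (?C' \<inter> ?D)"
    using AEeq by (intro finite_measure_eq_AE sets.Int Cm C'm Dm) auto
  have "?C' \<inter> ?D = (%w. ((g \<circ> (%w. restrict (%i. X i w) {..<n})) w, (h \<circ> (%w. restrict (%i. X i w) {n})) w)) -` ({1} \<times> D) \<inter> space M"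
    unfolding heq by auto
  then have "prob (?C' \<inter> ?D) = prob ?C' * prob ?D"
    using indep_varD[OF iv2, of "{1}" D] D unfolding heq by simp
  then show ?thesis using 1 2 by simp
qed

text \<open>Cylinder events together with the null sets form an intersection-stable generator of
  \<open>F r\<close>, so independence from the increment extends to all of \<open>F r\<close>. The
  explicit form of the filtration enters through this generator.\<close>

lemma indep_increment:
  assumes r: "0 <= r" "r < t" and Z: "Z : meas (F r)"
  shows "indep_var borel (Z :: 'w => real) borel (%w. B t w - B r w)"
proof -
  define cyl where "cyl = {{w : space M. ALL q:J. B q w : S q} | J S. finite J & J \<subseteq> {0..r} & (ALL q. S q : sets (borel :: real measure))}"
  define G where "G = cyl \<union> null_sets M"
  define H where "H = {(%w. B t w - B r w) -` D \<inter> space M | D. D : sets borel}"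
  have cyl_sets: "cyl \<subseteq> events"
  proof
    fix A assume "A : cyl"
    then obtain J S where A: "A = {w : space M. ALL q:J. B q w : S q}" "finite J" "J \<subseteq> {0..r}" "ALL q. S q : sets borel"
      by (auto simp: cyl_def)
    have [measurable]: "B q : meas M" if "q : J" for q using A that by (intro B_meas) auto
    show "A : events" unfolding A(1)
      by (intro sets.sets_Collect_finite_All[OF _ A(2)]) (use A(4) in measurable)
  qed
  have Gs: "G \<subseteq> events" using cyl_sets by (auto simp: G_def)
  have Hs: "H \<subseteq> events" using r by (auto simp: H_def)
  have "indep_set G H"
  proof (rule indep_setI[OF Gs Hs])
    fix a b assume a: "a : G" and b: "b : H"
    from b obtain D where D: "D : sets borel" "b = (%w. B t w - B r w) -` D \<inter> space M" by (auto simp: H_def)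
    show "prob (a \<inter> b) = prob a * prob b"
    proof (cases "a : null_sets M")
      case True
      then have "a \<inter> b : null_sets M" using b Hs by (intro null_set_Int2) auto
      with True show ?thesis by (simp add: measure_eq_0_null_sets)
    next
      case False
      then obtain J S where "a = {w : space M. ALL q:J. B q w : S q}" "finite J" "J \<subseteq> {0..r}" "ALL q. S q : sets borel"
        using a by (auto simp: G_def cyl_def)
      then show ?thesis using indep_cylinder_increment[OF r, of J S D] D by simp
    qed
  qed
  moreover have "Int_stable G"
  proof (rule Int_stableI)
    fix a b assume a: "a : G" and b: "b : G"
    show "a \<inter> b : G"
    proof (cases "a : null_sets M \<or> b : null_sets M")
      case True
      then have "a \<inter> b : null_sets M" using a b Gs by (auto intro: null_set_Int1 null_set_Int2)
      then show ?thesis by (simp add: G_def)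
    next
      case False
      then obtain J S J' S' where
        *: "a = {w : space M. ALL q:J. B q w : S q}" "finite J" "J \<subseteq> {0..r}" "ALL q. S q : sets borel"
        "b = {w : space M. ALL q:J'. B q w : S' q}" "finite J'" "J' \<subseteq> {0..r}" "ALL q. S' q : sets borel"
        using a b by (auto simp: G_def cyl_def)
      define S'' where "S'' q = (if q : J then S q else UNIV) \<inter> (if q : J' then S' q else UNIV)" for q
      have "a \<inter> b = {w : space M. ALL q:J \<union> J'. B q w : S'' q}"
        using * by (auto simp: S''_def split: if_splits)
      moreover have "ALL q. S'' q : sets borel" using * by (auto simp: S''_def)
      ultimately have "a \<inter> b : cyl" unfolding cyl_def using * by (intro CollectI exI[of _ "J \<union> J'"] exI[of _ S'']) auto
      then show ?thesis by (simp add: G_def)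
    qed
  qed
  moreover have "Int_stable H"
    unfolding H_def by (rule Int_stableI) (auto, metis (no_types, lifting) Int_assoc Int_left_commute inf.idem sets.Int vimage_Int)
  ultimately have ind: "indep_set (sigma_sets (space M) G) (sigma_sets (space M) H)"
    by (rule indep_set_sigma_sets)
  have "sets (F r) \<subseteq> sigma_sets (space M) G"
  proof -
    let ?g = "{B q -` S \<inter> space M |q S. 0 <= q & q <= r & S : sets borel} \<union> null_sets M"
    have "?g \<subseteq> Pow (space M)"
      using sets.sets_into_space by (auto dest!: null_setsD2)
    then have "sets (F r) = sigma_sets (space M) ?g"
      unfolding F_eq brownian_filtration_def by (rule sets_measure_of)
    moreover have "?g \<subseteq> sigma_sets (space M) G"
    proof
      fix A assume "A : ?g"
      then consider "A : null_sets M" | q S where "A = B q -` S \<inter> space M" "0 <= q" "q <= r" "S : sets borel" by auto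
      then show "A : sigma_sets (space M) G"
      proof cases
        case 1 then show ?thesis by (auto simp: G_def)
      next
        case 2
        then have "A : cyl" unfolding cyl_def by (intro CollectI exI[of _ "{q}"] exI[of _ "%_. S"]) auto
        then show ?thesis by (auto simp: G_def)
      qed
    qed
    ultimately show ?thesis using sigma_sets_mono[of ?g "space M" G] by simp
  qed
  moreover have "{Z -` A \<inter> space M |A. A : sets borel} \<subseteq> sets (F r)"
    using measurable_sets[OF Z] by auto
  ultimately have Zs: "{Z -` A \<inter> space M |A. A : sets borel} \<subseteq> sigma_sets (space M) G" by blast
  have "indep_set (sigma_sets (space M) {Z -` A \<inter> space M |A. A : sets borel}) (sigma_sets (space M) H)"
  proof (rule indep_setI)
    have *: "sigma_sets (space M) {Z -` A \<inter> space M |A. A : sets borel} \<subseteq> sigma_sets (space M) G"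
      by (rule sigma_sets_mono[OF Zs])
    then show "sigma_sets (space M) {Z -` A \<inter> space M |A. A : sets borel} \<subseteq> events"
      using indep_setD_ev1[OF ind] by auto
    show "sigma_sets (space M) H \<subseteq> events" using indep_setD_ev2[OF ind] .
    fix a b assume "a : sigma_sets (space M) {Z -` A \<inter> space M |A. A : sets borel}" "b : sigma_sets (space M) H"
    then show "prob (a \<inter> b) = prob a * prob b" using indep_setD[OF ind] * by auto
  qed
  then show ?thesis unfolding indep_var_eq H_def using measurable_F_M[OF Z] r by simp
qed

text \<open>Gaussian moments; \<open>r = t\<close> is separate because the degenerate law has no
  density. The fourth moment is used in \<open>simple_ito_fourth_moment\<close>.\<close>

lemma increment_moments:
  assumes "0 <= r" "r <= t"
  shows "integrable M (%w. (B t w - B r w) ^ k)"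
    and "(LINT w|M. B t w - B r w) = 0"
    and "(LINT w|M. (B t w - B r w)^2) = t - r"
    and "(LINT w|M. (B t w - B r w)^4) = 3 * (t - r)^2"
proof -
  have "integrable M (%w. (B t w - B r w) ^ k) & (LINT w|M. B t w - B r w) = 0 &
    (LINT w|M. (B t w - B r w)^2) = t - r & (LINT w|M. (B t w - B r w)^4) = 3 * (t - r)^2"
  proof (cases "r = t")
    case True then show ?thesis by (cases k) auto
  next
    case False
    then have lt: "r < t" using assms by simp
    then have d: "distributed M lborel (%w. B t w - B r w) (%x. ennreal (normal_density 0 (sqrt (t - r)) x))"
      using BM assms by (simp add: standard_brownian_motion_def)
    have eq: "(LINT w|M. (B t w - B r w) ^ j) = (LINT x|lborel. normal_density 0 (sqrt (t - r)) x * (x - 0) ^ j)" for j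
      using distributed_integral[OF d, of "%x. x ^ j"] lt by (simp add: normal_density_nonneg)
    have int: "integrable M (%w. (B t w - B r w) ^ k)"
      using distributed_integrable[OF d, of "%x. x ^ k"] lt integrable_normal_moment[of "sqrt (t - r)" 0 k]
      by (simp add: normal_density_nonneg)
    have "(LINT w|M. (B t w - B r w) ^ 1) = 0"
      unfolding eq using integral_normal_moment_odd[of "sqrt (t - r)" 0 0] lt by simp
    moreover have "(LINT w|M. (B t w - B r w) ^ 2) = t - r"
      unfolding eq using integral_normal_moment_even[of "sqrt (t - r)" 0 1] lt by (simp add: fact_numeral)
    moreover have "(LINT w|M. (B t w - B r w) ^ 4) = 3 * (t - r)^2"
      unfolding eq using integral_normal_moment_even[of "sqrt (t - r)" 0 2] lt
      by (simp add: fact_numeral power_divide power2_eq_square field_simps)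
    ultimately show ?thesis using int by simp
  qed
  then show "integrable M (%w. (B t w - B r w) ^ k)"
    and "(LINT w|M. B t w - B r w) = 0"
    and "(LINT w|M. (B t w - B r w)^2) = t - r"
    and "(LINT w|M. (B t w - B r w)^4) = 3 * (t - r)^2" by auto
qed

lemma increment_indep_mult:
  assumes r: "0 <= r" "r <= t" and Z: "Z : meas (F r)" "integrable M (Z :: 'w => real)"
  shows "integrable M (%w. Z w * (B t w - B r w) ^ k)"
    and "(LINT w|M. Z w * (B t w - B r w) ^ k) = (LINT w|M. Z w) * (LINT w|M. (B t w - B r w) ^ k)"
proof -
  have "integrable M (%w. Z w * (B t w - B r w) ^ k) &
     (LINT w|M. Z w * (B t w - B r w) ^ k) = (LINT w|M. Z w) * (LINT w|M. (B t w - B r w) ^ k)"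
  proof (cases "r = t")
    case True then show ?thesis using Z by (cases k) (auto simp: prob_space)
  next
    case False
    have "indep_var borel (Z :: 'w => real) borel (%w. B t w - B r w)"
      using False r Z by (intro indep_increment) auto
    from indep_var_compose[OF this, of "%x. x" borel "%x. x ^ k" borel]
    have "indep_var borel Z borel (%w. (B t w - B r w) ^ k)" by (simp add: comp_def)
    then show ?thesis
      using indep_var_lebesgue_integral[of Z "%w. (B t w - B r w) ^ k"]
        indep_var_integrable[of Z "%w. (B t w - B r w) ^ k"] Z(2) increment_moments(1)[OF r] by simp
  qed
  then show "integrable M (%w. Z w * (B t w - B r w) ^ k)"
    and "(LINT w|M. Z w * (B t w - B r w) ^ k) = (LINT w|M. Z w) * (LINT w|M. (B t w - B r w) ^ k)" by auto
qed

end

section \<open>The Ito isometry\<close>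

lemma measure_lborel_Ioc_max: "measure lborel {a<..b} = max 0 (b - a :: real)"
  by (cases "a <= b") (auto simp: measure_def)

context brownian
begin

section \<open>The product of the sample space with the time interval\<close>

definition lam :: "real measure" where "lam = restrict_space lborel {s..T}"

definition Pm :: "('w \<times> real) measure" where "Pm = M \<Otimes>\<^sub>M lam"

abbreviation nn_expectation_Pm (binder "EP " 10) where "nn_expectation_Pm f \<equiv> nn_integral Pm f"

text \<open>Processes take the time first, while the iterated integrals of the problem have the
  sample point outside. The exchange of arguments turns these into Fubini integrals over
  \<open>Pm\<close>.\<close>

definition ev :: "(real => 'w => 'h) => 'w \<times> real => 'h" where "ev X z = X (snd z) (fst z)"

lemma ev_pair[simp]: "ev X (w, t) = X t w" by (simp add: ev_def)

lemma space_lam[simp]: "space lam = {s..T}" by (simp add: lam_def space_restrict_space)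

lemma space_Pm: "space Pm = space M \<times> {s..T}" by (simp add: Pm_def space_pair_measure)

lemma sets_lam: "sets lam = sets (restrict_space borel {s..T})"
  unfolding lam_def by (rule sets_restrict_space_cong) simp

lemma finite_measure_lam: "finite_measure lam"
  by (rule finite_measureI) (simp add: lam_def emeasure_restrict_space space_restrict_space emeasure_lborel_Icc_eq)

sublocale lam: finite_measure lam by (rule finite_measure_lam)

sublocale pmf: pair_sigma_finite M lam by unfold_locales

lemma finite_measure_Pm: "finite_measure Pm"
  unfolding Pm_def by (rule finite_measure_pair_measure) (unfold_locales)

sublocale Pm: finite_measure Pm by (rule finite_measure_Pm)

lemma measurable_lamI: "f : meas borel ==> f : meas lam"
  unfolding lam_def by (intro measurable_restrict_space1) simp

lemma fst_Pm[measurable]: "fst : measurable Pm M" by (simp add: Pm_def)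
lemma snd_Pm[measurable]: "snd : meas Pm"
  unfolding Pm_def by (rule measurable_compose[OF measurable_snd]) (simp add: measurable_lamI)

lemma Pm_fstI: "f : meas M ==> (%z. f (fst z)) : meas Pm"
  by (rule measurable_compose[OF fst_Pm])

lemma Pm_sndI: "f : meas borel ==> (%z. f (snd z)) : meas Pm"
  by (rule measurable_compose[OF snd_Pm])

text \<open>Progressive measurability at the final time, with \<open>F T\<close> weakened to
  \<open>M\<close>.\<close>

lemma prog_ev:
  assumes "X : prog_measurable M F s T H" shows "ev X : meas Pm"
proof -
  have "(%(r, w). X r w) : meas (restrict_space borel {s..T} \<Otimes>\<^sub>M F T)"
    using assms sT by (auto simp: prog_measurable_def)
  moreover have "(%z. (snd z, fst z)) : measurable Pm (restrict_space borel {s..T} \<Otimes>\<^sub>M F T)"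
  proof (rule measurable_Pair)
    show "snd : measurable Pm (restrict_space borel {s..T})"
      by (rule measurable_restrict_space2) (auto simp: space_Pm snd_Pm)
    have "(%x. x) : measurable M (F T)" by (rule measurable_F_M[of _ T]) simp
    then show "fst : measurable Pm (F T)" using measurable_compose[OF fst_Pm] by auto
  qed
  ultimately have "(%z. (%(r, w). X r w) (snd z, fst z)) : meas Pm"
    by (rule measurable_compose[rotated])
  then show ?thesis by (simp add: ev_def[abs_def])
qed

lemma prog_adapted:
  assumes "X : prog_measurable M F s T H" "t : {s..T}" shows "X t : meas (F t)"
proof -
  have 1: "(%(r, w). X r w) : meas (restrict_space borel {s..t} \<Otimes>\<^sub>M F t)"
    using assms by (auto simp: prog_measurable_def)
  have "(%w. (t, w)) : measurable (F t) (restrict_space borel {s..t} \<Otimes>\<^sub>M F t)"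
    using assms by (intro measurable_Pair measurable_const) (auto simp: space_restrict_space)
  from measurable_compose[OF this 1] show ?thesis by simp
qed

lemma nn_Pm:
  assumes "f : meas Pm"
  shows "(EP z. f z) = (EM w. (\<integral>\<^sup>+t\<in>{s..T}. f (w, t) \<partial>lborel))"
proof -
  have "(EP z. f z) = (EM w. (\<integral>\<^sup>+t. f (w, t) \<partial>lam))"
    unfolding Pm_def by (rule lam.nn_integral_fst[symmetric]) (use assms in \<open>simp add: Pm_def\<close>)
  also have "... = (EM w. (\<integral>\<^sup>+t\<in>{s..T}. f (w, t) \<partial>lborel))"
    unfolding lam_def by (subst nn_integral_restrict_space) auto
  finally show ?thesis .
qed

lemma Pm_fubini:
  fixes f :: "'w \<times> real => real"
  assumes "integrable Pm f"
  shows "(LINT z|Pm. f z) = (LINT w|M. (LINT t|lam. f (w, t)))"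
  using pmf.integral_fst'[of f] assms by (simp add: Pm_def)

lemma L2_prog_iff:
  "X : L2_prog M F s T H \<longleftrightarrow> X : prog_measurable M F s T H & sq_int Pm (%z. norm (ev X z))"
proof (cases "X : prog_measurable M F s T H")
  case True
  have [measurable]: "ev X : meas Pm" by (rule prog_ev[OF True])
  have "(EP z. ennreal ((norm (ev X z))^2)) =
     (EM w. (\<integral>\<^sup>+ t\<in>{s..T}. ennreal ((norm (X t w))^2) \<partial>lborel))"
    by (subst nn_Pm) auto
  then show ?thesis using True by (auto simp: L2_prog_def sq_int_iff_nn)
qed (auto simp: L2_prog_def)

lemma L2_prog_sq: "X : L2_prog M F s T H ==> sq_int Pm (ev (X :: real => 'w => real))"
  by (auto simp: L2_prog_iff sq_int_def prog_ev)

lemma increment_mean_zero: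
  assumes "0 <= r" "r <= t" "Y : meas (F r)" "integrable M (Y :: 'w => real)"
  shows "integrable M (%w. Y w * (B t w - B r w))" "(LINT w|M. Y w * (B t w - B r w)) = 0"
  using increment_indep_mult[OF assms, of 1] increment_moments(2)[OF assms(1,2)] by simp_all

lemma increment_sq:
  assumes "0 <= r" "r <= t" shows "sq_int M (%w. B t w - B r w)"
  using increment_moments(1)[OF assms, of 2] assms by (auto simp: sq_int_def)

lemma integrable_bounded_mult:
  fixes f Z :: "'w => real"
  assumes "integrable M f" "Z : meas M" "!!w. w : space M ==> \<bar>Z w\<bar> <= K"
  shows "integrable M (%w. Z w * f w)"
proof (rule Bochner_Integration.integrable_bound[of _ "%w. K * f w"])
  show "AE w in M. norm (Z w * f w) <= norm (K * f w)"
  proof (rule AE_I2)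
    fix w assume "w : space M"
    then have "\<bar>Z w\<bar> <= \<bar>K\<bar>" using assms(3) by force
    then show "norm (Z w * f w) <= norm (K * f w)" by (simp add: abs_mult mult_right_mono)
  qed
qed (use assms in auto)

text \<open>Split at \<open>\<gamma>\<close> and at the smaller right end point. In a product of
  increments over disjoint intervals the later one is independent of all the rest and has mean zero;
  only the square over the common part survives.\<close>

lemma pair_increment_aux:
  assumes t: "0 <= \<alpha>" "\<alpha> <= \<gamma>" "\<alpha> < \<beta>" "\<gamma> < \<delta>"
    and W: "W : meas (F \<gamma>)" "!!w. w : space M ==> \<bar>W w\<bar> <= K"
  shows "(LINT w|M. W w * ((B \<beta> w - B \<alpha> w) * (B \<delta> w - B \<gamma> w))) = (LINT w|M. W w) * max 0 (min \<beta> \<delta> - \<gamma>)"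
proof -
  note WM[measurable] = measurable_F_M[OF W(1)]
  have Wint: "integrable M W"
    using integrable_bounded_mult[of "%_. 1", OF _ WM W(2)] by simp
  have sqB: "sq_int M (%w. B q w - B p w)" if "0 <= p" "p <= q" for p q
    using increment_sq that by auto
  have zero: "(LINT w|M. W w * ((B q w - B p w) * (B v w - B u w))) = 0"
    if "0 <= p" "p <= q" "q <= u" "\<gamma> <= u" "u <= v" for p q u v
  proof -
    have 1: "integrable M (%w. W w * (B q w - B p w))"
      by (rule integrable_bounded_mult[OF sq_int_imp_integrable[OF sqB] WM W(2)]) (use that in auto)
    have 2: "(%w. W w * (B q w - B p w)) : meas (F u)"
      using measurable_F_mono[OF W(1)] that by (intro borel_measurable_times borel_measurable_diff B_meas_F) auto
    show ?thesis using increment_mean_zero(2)[OF _ _ 2 1, of v] that by (simp add: mult.assoc)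
  qed
  have int: "integrable M (%w. W w * ((B q w - B p w) * (B v w - B u w)))"
    if "0 <= p" "p <= q" "0 <= u" "u <= v" for p q u v
    by (rule integrable_bounded_mult[OF sq_int_mult[OF sqB sqB] WM W(2)]) (use that in auto)
  show ?thesis
  proof (cases "\<beta> <= \<gamma>")
    case True
    then show ?thesis using zero[of \<alpha> \<beta> \<gamma> \<delta>] t by simp
  next
    case False
    \<comment> \<open>The interval that ends later sticks out over \<open>[m, m']\<close>, so one
      decomposition covers both orders of the right end points.\<close>
    define m where "m = min \<beta> \<delta>"
    define m' where "m' = max \<beta> \<delta>"
    have m: "\<gamma> < m" "m <= m'" using False t by (auto simp: m_def m'_def)
    have 0: "W w * ((B \<beta> w - B \<alpha> w) * (B \<delta> w - B \<gamma> w)) =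
        W w * ((B \<gamma> w - B \<alpha> w) * (B \<delta> w - B \<gamma> w)) + W w * (B m w - B \<gamma> w)^2
        + W w * ((B m w - B \<gamma> w) * (B m' w - B m w))" for w
      by (cases "\<beta> <= \<delta>") (simp_all add: m_def m'_def min_def max_def algebra_simps power2_eq_square)
    have i: "integrable M (%w. W w * (B m w - B \<gamma> w)^2)"
      and e: "(LINT w|M. W w * (B m w - B \<gamma> w)^2) = (LINT w|M. W w) * (m - \<gamma>)"
      using increment_indep_mult[OF _ _ W(1) Wint, of m 2] increment_moments(3)[of \<gamma> m] m t by auto
    show ?thesis
      unfolding 0
      using int[of \<alpha> \<gamma> \<gamma> \<delta>] int[of \<gamma> m m m'] zero[of \<alpha> \<gamma> \<gamma> \<delta>] zero[of \<gamma> m m m'] i e m t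
      by (simp add: m_def[symmetric])
  qed
qed

text \<open>Adaptedness of a weight is asked only if its interval is nondegenerate. After a grid has
  been clamped to \<open>[r, t]\<close>, cells beyond \<open>t\<close> collapse to the point
  \<open>t\<close>, at which their weights need not be measurable.\<close>

lemma pair_increment:
  assumes t: "0 <= \<alpha>" "\<alpha> <= \<beta>" "0 <= \<gamma>" "\<gamma> <= \<delta>"
    and U: "U : meas M" "!!w. w : space M ==> \<bar>U w\<bar> <= K" "\<alpha> < \<beta> ==> U : meas (F \<alpha>)"
    and V: "V : meas M" "!!w. w : space M ==> \<bar>V w\<bar> <= L" "\<gamma> < \<delta> ==> V : meas (F \<gamma>)"
  shows "(LINT w|M. (U w * (B \<beta> w - B \<alpha> w)) * (V w * (B \<delta> w - B \<gamma> w))) =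
      (LINT w|M. U w * V w) * max 0 (min \<beta> \<delta> - max \<alpha> \<gamma>)"
proof (cases "\<alpha> = \<beta> \<or> \<gamma> = \<delta>")
  case True
  then show ?thesis using t by auto
next
  case False
  then have lt: "\<alpha> < \<beta>" "\<gamma> < \<delta>" using t by auto
  have Wb: "\<bar>U w * V w\<bar> <= K * L" if "w : space M" for w
    using U(2)[OF that] V(2)[OF that] by (simp add: abs_mult mult_mono)
  show ?thesis
  proof (cases "\<alpha> <= \<gamma>")
    case True
    have "(%w. U w * V w) : meas (F \<gamma>)"
      using measurable_F_mono[OF U(3) True] V(3) lt by auto
    from pair_increment_aux[OF t(1) True lt this Wb] show ?thesis
      using True by (simp add: max_def ac_simps)
  next
    case False
    then have le: "\<gamma> <= \<alpha>" by simp
    have "(%w. U w * V w) : meas (F \<alpha>)"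
      using measurable_F_mono[OF V(3) le] U(3) lt by auto
    from pair_increment_aux[OF t(3) le lt(2,1) this Wb] show ?thesis
      using le by (simp add: max.absorb1 ac_simps min.commute)
  qed
qed

section \<open>Grids, simple integrands and their covariance\<close>

lemma grid_mono:
  assumes "ALL i<N. \<tau> i < \<tau> (Suc i)" "i <= j" "j <= N" shows "\<tau> i <= (\<tau> j :: real)"
  using assms(2,3)
proof (induction j)
  case (Suc j)
  show ?case
  proof (cases "i = Suc j")
    case False
    then have "\<tau> i <= \<tau> j" using Suc by auto
    also have "\<tau> j < \<tau> (Suc j)" using assms(1) Suc by auto
    finally show ?thesis by simp
  qed simp
qed simp

lemma simple_integrand_range:
  assumes "simple_integrand M F s T N \<tau> \<eta>" "i <= N" shows "s <= \<tau> i" "\<tau> i <= T"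
  using assms grid_mono[of N \<tau> 0 i] grid_mono[of N \<tau> i N] by (auto simp: simple_integrand_def)

definition clamp :: "real => real => real => real" where "clamp r t x = max r (min x t)"

text \<open>Taking the difference of the values at \<open>t\<close> and \<open>r\<close> projects
  every grid point onto \<open>[r, t]\<close>; cells outside collapse and drop out.\<close>

lemma simple_ito_increment:
  assumes "r <= t"
  shows "simple_ito B N \<tau> \<eta> t w - simple_ito B N \<tau> \<eta> r w =
     (SUM i<N. (B (clamp r t (\<tau> (Suc i))) w - B (clamp r t (\<tau> i)) w) *\<^sub>R \<eta> i w)"
proof -
  have *: "B (min x t) w - B (min x r) w = B (clamp r t x) w - B r w" for x
    using assms by (cases "x <= r") (auto simp: clamp_def min_def max_def)
  have "(B (min x t) w - B (min y t) w) - (B (min x r) w - B (min y r) w) =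
     B (clamp r t x) w - B (clamp r t y) w" for x y using *[of x] *[of y] by simp
  then show ?thesis
    by (simp add: simple_ito_def sum_subtractf[symmetric] scaleR_diff_left[symmetric])
qed

lemma simple_integrand_meas:
  assumes "simple_integrand M F s T N \<tau> \<eta>" "i < N"
  shows "\<eta> i : meas M" "EX K. ALL w:space M. norm (\<eta> i w) <= K" "\<eta> i : meas (F (\<tau> i))"
  using assms measurable_F_M[of "\<eta> i" "\<tau> i" borel] by (auto simp: simple_integrand_def)

lemma mult_sum_sum:
  "Z * (SUM i:A. f i) * (SUM j:C. g j) = (SUM i:A. SUM j:C. Z * f i * (g j :: real))"
  unfolding mult.assoc sum_product by (simp add: sum_distrib_left)

lemma integral_double_sum:
  fixes h :: "nat => nat => 'c => real"
  assumes "!!i j. i < N ==> j < N' ==> integrable Q (h i j)" "!!i j. i < N ==> j < N' ==> (LINT x|Q. h i j x) = v i j"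
  shows "(LINT x|Q. (SUM i<N. SUM j<N'. h i j x)) = (SUM i<N. SUM j<N'. v i j)"
proof -
  have "(LINT x|Q. (SUM i<N. SUM j<N'. h i j x)) = (SUM i<N. LINT x|Q. (SUM j<N'. h i j x))"
    using assms(1) by (intro Bochner_Integration.integral_sum Bochner_Integration.integrable_sum) auto
  also have "... = (SUM i<N. SUM j<N'. LINT x|Q. h i j x)"
    using assms(1) by (intro sum.cong refl Bochner_Integration.integral_sum) auto
  also have "... = (SUM i<N. SUM j<N'. v i j)" using assms(2) by (intro sum.cong refl) auto
  finally show ?thesis .
qed

text \<open>Both sides become double sums over pairs of cells, with the overlap length
  \<open>m i j\<close> on the left and the overlap interval \<open>I i j\<close> on the right. Since
  \<open>pair_increment\<close> treats arbitrary intervals, no common refinement of the two grids is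
  formed. The weight \<open>Z\<close> makes this an isometry conditional on
  \<open>F r\<close>.\<close>

lemma simple_ito_cov:
  fixes \<eta> \<eta>' :: "nat => 'w => real"
  assumes s1: "simple_integrand M F s T N \<tau> \<eta>" and s2: "simple_integrand M F s T N' \<tau>' \<eta>'"
    and rt: "s <= r" "r <= t" "t <= T"
    and Z: "Z : meas (F r)" "!!w. w : space M ==> \<bar>Z w\<bar> <= K"
  shows "(LINT w|M. Z w * (simple_ito B N \<tau> \<eta> t w - simple_ito B N \<tau> \<eta> r w)
             * (simple_ito B N' \<tau>' \<eta>' t w - simple_ito B N' \<tau>' \<eta>' r w)) =
     (LINT z|Pm. (Z (fst z) * indicator {r<..t} (snd z)) * ev (simple_process N \<tau> \<eta>) z * ev (simple_process N' \<tau>' \<eta>') z)"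
proof -
  let ?c = "clamp r t"
  let ?D = "%i w. B (?c (\<tau> (Suc i))) w - B (?c (\<tau> i)) w"
  let ?D' = "%i w. B (?c (\<tau>' (Suc i))) w - B (?c (\<tau>' i)) w"
  have c0: "0 <= ?c x" "r <= ?c x" "?c x <= t" for x using s0 rt by (auto simp: clamp_def)
  have cm: "x <= y ==> ?c x <= ?c y" for x y by (auto simp: clamp_def)
  have cF: "f : meas (F (?c x))" if "f : meas (F x)" "?c x < ?c y" for x y and f :: "'w => real"
    using that(2) by (intro measurable_F_mono[OF that(1)]) (auto simp: clamp_def)
  note ZM[measurable] = measurable_F_M[OF Z(1)]
  define m where "m i j = max 0 (min (?c (\<tau> (Suc i))) (?c (\<tau>' (Suc j))) - max (?c (\<tau> i)) (?c (\<tau>' j)))" for i j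
  have pair: "(LINT w|M. ((Z w * \<eta> i w) * ?D i w) * (\<eta>' j w * ?D' j w)) = (LINT w|M. (Z w * \<eta> i w) * \<eta>' j w) * m i j"
    and pint: "integrable M (%w. ((Z w * \<eta> i w) * ?D i w) * (\<eta>' j w * ?D' j w))"
    and eint: "integrable M (%w. (Z w * \<eta> i w) * \<eta>' j w)"
    if ij: "i < N" "j < N'" for i j
  proof -
    from simple_integrand_meas[OF s1 ij(1)] obtain Ki where Ki: "!!w. w : space M ==> \<bar>\<eta> i w\<bar> <= Ki" by auto
    from simple_integrand_meas[OF s2 ij(2)] obtain Kj where Kj: "!!w. w : space M ==> \<bar>\<eta>' j w\<bar> <= Kj" by auto
    note [measurable] = simple_integrand_meas(1)[OF s1 ij(1)] simple_integrand_meas(1)[OF s2 ij(2)]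
    have ZK: "\<bar>Z w * \<eta> i w\<bar> <= K * Ki" if "w : space M" for w
      using Z(2)[OF that] Ki[OF that] by (simp add: abs_mult mult_mono)
    have ti: "\<tau> i <= \<tau> (Suc i)" "\<tau>' j <= \<tau>' (Suc j)" using s1 s2 ij by (auto simp: simple_integrand_def less_imp_le)
    show "(LINT w|M. ((Z w * \<eta> i w) * ?D i w) * (\<eta>' j w * ?D' j w)) = (LINT w|M. (Z w * \<eta> i w) * \<eta>' j w) * m i j"
      unfolding m_def
    proof (rule pair_increment)
      show "(%w. Z w * \<eta> i w) : meas (F (?c (\<tau> i)))" if "?c (\<tau> i) < ?c (\<tau> (Suc i))"
        by (intro borel_measurable_times cF[OF simple_integrand_meas(3)[OF s1 ij(1)] that] measurable_F_mono[OF Z(1)] c0)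
      show "\<eta>' j : meas (F (?c (\<tau>' j)))" if "?c (\<tau>' j) < ?c (\<tau>' (Suc j))"
        by (intro cF[OF simple_integrand_meas(3)[OF s2 ij(2)] that])
    qed (use ZK Kj c0 cm ti in \<open>auto\<close>)
    show "integrable M (%w. ((Z w * \<eta> i w) * ?D i w) * (\<eta>' j w * ?D' j w))"
    proof (intro sq_int_mult sq_int_bounded_mult increment_sq)
      show "AE w in M. \<bar>Z w * \<eta> i w\<bar> <= K * Ki" using ZK by auto
      show "AE w in M. \<bar>\<eta>' j w\<bar> <= Kj" using Kj by auto
    qed (use c0 cm ti in auto)
    show "integrable M (%w. (Z w * \<eta> i w) * \<eta>' j w)"
      using integrable_bounded_mult[OF integrable_bounded_mult[of "%_. 1" "\<eta>' j" Kj] _ ZK] Kj by simp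
  qed
  have "(LINT w|M. Z w * (simple_ito B N \<tau> \<eta> t w - simple_ito B N \<tau> \<eta> r w)
             * (simple_ito B N' \<tau>' \<eta>' t w - simple_ito B N' \<tau>' \<eta>' r w)) =
      (LINT w|M. (SUM i<N. SUM j<N'. ((Z w * \<eta> i w) * ?D i w) * (\<eta>' j w * ?D' j w)))"
    unfolding simple_ito_increment[OF rt(2)] mult_sum_sum
    by (intro Bochner_Integration.integral_cong refl sum.cong) (simp add: ac_simps)
  also have "... = (SUM i<N. SUM j<N'. (LINT w|M. (Z w * \<eta> i w) * \<eta>' j w) * m i j)"
    using pint pair by (rule integral_double_sum)
  finally have L: "(LINT w|M. Z w * (simple_ito B N \<tau> \<eta> t w - simple_ito B N \<tau> \<eta> r w)
             * (simple_ito B N' \<tau>' \<eta>' t w - simple_ito B N' \<tau>' \<eta>' r w)) =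
     (SUM i<N. SUM j<N'. (LINT w|M. (Z w * \<eta> i w) * \<eta>' j w) * m i j)" .
  define I where "I i j = {max (?c (\<tau> i)) (?c (\<tau>' j))<..min (?c (\<tau> (Suc i))) (?c (\<tau>' (Suc j)))}" for i j
  have ind: "indicator {r<..t} x * indicator {a<..b} x = (indicator {?c a<..?c b} x :: real)" for a b x
    using rt by (auto simp: indicator_def clamp_def)
  have ind2: "(indicator {r<..t} x :: real) = indicator {r<..t} x * indicator {r<..t} x" for x
    by (auto simp: indicator_def)
  have ind3: "indicator {a<..b} x * indicator {c<..d} x = (indicator {max a c<..min b d} x :: real)" for a b c d x :: real
    by (auto simp: indicator_def)
  have pw: "indicator {r<..t} x * (indicator {\<tau> i<..\<tau> (Suc i)} x * indicator {\<tau>' j<..\<tau>' (Suc j)} x) = (indicator (I i j) x :: real)" for i j x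
    unfolding I_def ind3[symmetric] ind[symmetric] by (subst ind2) simp
  have Ilam: "measure lam (I i j) = m i j" if "i < N" "j < N'" for i j
  proof -
    have "I i j \<subseteq> {s..T}" using c0 rt by (auto simp: I_def) (smt (verit) c0(2) c0(3))+
    then have "measure lam (I i j) = measure lborel (I i j)"
      unfolding lam_def by (subst measure_restrict_space) auto
    also have "... = m i j"
      unfolding I_def m_def by (rule measure_lborel_Ioc_max)
    finally show ?thesis .
  qed
  have Iset: "I i j : sets lam" for i j
    unfolding lam_def sets_restrict_space I_def using c0 rt 
    by (intro image_eqI[of _ _ "I i j"]) (auto simp: I_def, (smt (verit) c0(2) c0(3))+)
  have Rint: "integrable Pm (%z. ((Z (fst z) * \<eta> i (fst z)) * \<eta>' j (fst z)) * indicator (I i j) (snd z))"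
    and Req: "(LINT z|Pm. ((Z (fst z) * \<eta> i (fst z)) * \<eta>' j (fst z)) * indicator (I i j) (snd z)) = (LINT w|M. (Z w * \<eta> i w) * \<eta>' j w) * m i j"
    if ij: "i < N" "j < N'" for i j
  proof -
    from simple_integrand_meas[OF s1 ij(1)] obtain Ki where Ki: "!!w. w : space M ==> \<bar>\<eta> i w\<bar> <= Ki" by auto
    from simple_integrand_meas[OF s2 ij(2)] obtain Kj where Kj: "!!w. w : space M ==> \<bar>\<eta>' j w\<bar> <= Kj" by auto
    note [measurable] = simple_integrand_meas(1)[OF s1 ij(1)] simple_integrand_meas(1)[OF s2 ij(2)]
    have bd: "\<bar>((Z w * \<eta> i w) * \<eta>' j w) * indicator (I i j) x\<bar> <= K * Ki * Kj" if "w : space M" for w x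
    proof -
      have "\<bar>((Z w * \<eta> i w) * \<eta>' j w) * indicator (I i j) x\<bar> <= \<bar>Z w\<bar> * \<bar>\<eta> i w\<bar> * \<bar>\<eta>' j w\<bar>"
        by (auto simp: abs_mult indicator_def)
      also have "... <= K * Ki * Kj" using Z(2)[OF that] Ki[OF that] Kj[OF that]
        by (intro mult_mono mult_nonneg_nonneg) (auto intro: order_trans[OF abs_ge_zero])
      finally show ?thesis .
    qed
    have [measurable]: "I i j : sets borel" by (simp add: I_def)
    show int: "integrable Pm (%z. ((Z (fst z) * \<eta> i (fst z)) * \<eta>' j (fst z)) * indicator (I i j) (snd z))"
      using bd by (intro Pm.integrable_const_bound[of _ "K * Ki * Kj"] AE_I2) (auto simp: space_Pm)
    show "(LINT z|Pm. ((Z (fst z) * \<eta> i (fst z)) * \<eta>' j (fst z)) * indicator (I i j) (snd z)) = (LINT w|M. (Z w * \<eta> i w) * \<eta>' j w) * m i j"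
      using Pm_fubini[OF int] Iset[of i j] Ilam[OF ij] sets.Int_space_eq2[OF Iset[of i j]] by simp
  qed
  have "(LINT z|Pm. (Z (fst z) * indicator {r<..t} (snd z)) * ev (simple_process N \<tau> \<eta>) z * ev (simple_process N' \<tau>' \<eta>') z) =
     (LINT z|Pm. (SUM i<N. SUM j<N'. ((Z (fst z) * \<eta> i (fst z)) * \<eta>' j (fst z)) * indicator (I i j) (snd z)))"
    unfolding ev_def simple_process_def mult_sum_sum
    by (intro Bochner_Integration.integral_cong refl sum.cong) (simp add: pw[symmetric] ac_simps)
  also have "... = (SUM i<N. SUM j<N'. (LINT w|M. (Z w * \<eta> i w) * \<eta>' j w) * m i j)"
    using Rint Req by (rule integral_double_sum)
  finally show ?thesis using L by simp
qed

lemma simple_ito_meas: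
  assumes "simple_integrand M F s T N \<tau> \<eta>" "t : {s..T}"
  shows "simple_ito B N \<tau> \<eta> t : meas (F t)"
  unfolding simple_ito_def
proof (intro borel_measurable_sum)
  fix i assume "i : {..<N}"
  then have i: "i < N" by simp
  have m: "0 <= \<tau> i" "\<tau> i <= \<tau> (Suc i)" using simple_integrand_range(1)[OF assms(1), of i] i s0 assms(1)
    by (auto simp: simple_integrand_def less_imp_le)
  show "(%w. (B (min (\<tau> (Suc i)) t) w - B (min (\<tau> i) t) w) *\<^sub>R \<eta> i w) : meas (F t)"
  proof (cases "\<tau> i <= t")
    case True
    then show ?thesis using simple_integrand_meas(3)[OF assms(1) i] m s0 assms(2)
      by (intro borel_measurable_scaleR borel_measurable_diff B_meas_F) (auto intro: measurable_F_mono)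
  next
    case False
    then show ?thesis using m by (simp add: min_def)
  qed
qed

lemma simple_ito_start:
  assumes "simple_integrand M F s T N \<tau> \<eta>" shows "simple_ito B N \<tau> \<eta> s w = 0"
proof -
  have "min (\<tau> i) s = s" if "i <= N" for i using simple_integrand_range(1)[OF assms that] by simp
  then show ?thesis by (simp add: simple_ito_def)
qed

lemma simple_ito_sq:
  fixes \<eta> :: "nat => 'w => real"
  assumes "simple_integrand M F s T N \<tau> \<eta>" "t : {s..T}"
  shows "sq_int M (simple_ito B N \<tau> \<eta> t)"
proof -
  have "sq_int M (%w. SUM i<N. \<eta> i w * (B (min (\<tau> (Suc i)) t) w - B (min (\<tau> i) t) w))"
  proof (intro sq_int_sum)
    fix i assume "i : {..<N}"
    then have i: "i < N" by simp
    obtain K where K: "ALL w:space M. norm (\<eta> i w) <= K" using simple_integrand_meas(2)[OF assms(1) i] by auto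
    have m: "0 <= \<tau> i" "\<tau> i <= \<tau> (Suc i)" using simple_integrand_range(1)[OF assms(1), of i] i s0 assms(1)
      by (auto simp: simple_integrand_def less_imp_le)
    show "sq_int M (%w. \<eta> i w * (B (min (\<tau> (Suc i)) t) w - B (min (\<tau> i) t) w))"
      by (rule sq_int_bounded_mult[OF increment_sq simple_integrand_meas(1)[OF assms(1) i], where K = K])
         (use K m s0 assms(2) in auto)
  qed
  then show ?thesis by (simp add: simple_ito_def[abs_def] mult.commute)
qed

lemma simple_process_ev:
  fixes \<eta> :: "nat => 'w => 'h::euclidean_space"
  assumes "simple_integrand M F s T N \<tau> \<eta>"
  shows "ev (simple_process N \<tau> \<eta>) : meas Pm"
  unfolding ev_def[abs_def] simple_process_def
proof (intro borel_measurable_sum borel_measurable_scaleR)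
  fix i assume "i : {..<N}"
  then show "(%z. \<eta> i (fst z)) : meas Pm"
    using simple_integrand_meas(1)[OF assms] by (intro Pm_fstI) auto
  show "(%x. indicator {\<tau> i<..\<tau> (Suc i)} (snd x) :: real) : meas Pm"
    by (intro Pm_sndI) simp
qed

lemma simple_process_bounded:
  fixes \<eta> :: "nat => 'w => 'h::euclidean_space"
  assumes "simple_integrand M F s T N \<tau> \<eta>"
  shows "EX K. ALL t. ALL w:space M. norm (simple_process N \<tau> \<eta> t w) <= K"
proof -
  have "ALL i. EX K. i < N --> (ALL w:space M. norm (\<eta> i w) <= K)" using simple_integrand_meas(2)[OF assms] by auto
  then obtain K where K: "!!i w. i < N ==> w : space M ==> norm (\<eta> i w) <= K i" by metis
  have "norm (simple_process N \<tau> \<eta> t w) <= (SUM i<N. K i)" if "w : space M" for t w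
    unfolding simple_process_def
  proof (rule sum_norm_le)
    fix i assume "i : {..<N}"
    then have "norm (\<eta> i w) <= K i" using K that by auto
    then show "norm ((indicator {\<tau> i<..\<tau> (Suc i)} t :: real) *\<^sub>R \<eta> i w) <= K i"
      by (auto simp: indicator_def intro: order_trans[OF norm_ge_zero])
  qed
  then show ?thesis by blast
qed

lemma simple_process_sq:
  fixes \<eta> :: "nat => 'w => real"
  assumes "simple_integrand M F s T N \<tau> \<eta>"
  shows "sq_int Pm (ev (simple_process N \<tau> \<eta>))"
proof -
  obtain K where "ALL t. ALL w:space M. norm (simple_process N \<tau> \<eta> t w) <= K"
    using simple_process_bounded[OF assms] by auto
  then show ?thesis
    by (intro sq_int_bounded[OF finite_measure_Pm simple_process_ev[OF assms], where K = K] AE_I2)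
       (auto simp: space_Pm)
qed

section \<open>From simple integrands to the Ito integral\<close>

lemma ito_component:
  assumes "ito Y I" "b : Basis"
  shows "ito (%t w. Y t w \<bullet> b) (%t w. I t w \<bullet> b)"
proof -
  from assms(1) obtain N \<tau> \<eta> where
    1: "!!k::nat. simple_integrand M F s T (N k) (\<tau> k) (\<eta> k)" and
    2: "(%k. EM w. (\<integral>\<^sup>+ t\<in>{s..T}. ennreal ((norm (simple_process (N k) (\<tau> k) (\<eta> k) t w - Y t w))^2) \<partial>lborel)) ----> 0" and
    3: "!!t. t : {s..T} ==> (%k. EM w. ennreal ((norm (simple_ito B (N k) (\<tau> k) (\<eta> k) t w - I t w))^2)) ----> 0"
    and Y: "Y : L2P" and I: "I : CP"
    unfolding ito_integral_def by blast
  have prog: "(%t w. X t w \<bullet> b) : PM" if "X : PM" for X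
    using that by (auto simp: prog_measurable_def split_beta')
  have le: "ennreal ((norm (x \<bullet> b))^2) <= ennreal ((norm x)^2)" for x
    using Basis_le_norm[OF assms(2), of x] by (intro ennreal_leI power_mono) auto
  have sp: "simple_process n \<tau> (%i w. \<eta> i w \<bullet> b) t w = simple_process n \<tau> \<eta> t w \<bullet> b" for n \<tau> \<eta> t and w :: 'w
    by (simp add: simple_process_def inner_sum_left)
  have si: "simple_ito B n \<tau> (%i w. \<eta> i w \<bullet> b) t w = simple_ito B n \<tau> \<eta> t w \<bullet> b" for n \<tau> \<eta> t w
    by (simp add: simple_ito_def inner_sum_left)
  show ?thesis
    unfolding ito_integral_def
  proof (intro conjI exI[of _ N] exI[of _ \<tau>] exI[of _ "%k i w. \<eta> k i w \<bullet> b"] allI ballI)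
    have "(EM w. (\<integral>\<^sup>+ t\<in>{s..T}. ennreal ((norm (Y t w \<bullet> b))^2) \<partial>lborel)) <=
      (EM w. (\<integral>\<^sup>+ t\<in>{s..T}. ennreal ((norm (Y t w))^2) \<partial>lborel))"
      by (intro nn_integral_mono mult_right_mono le) auto
    then show "(%t w. Y t w \<bullet> b) : L2P"
      using Y prog by (auto simp: L2_prog_def intro: le_less_trans)
    show "(%t w. I t w \<bullet> b) : CP"
      using I prog by (auto simp: cont_prog_def intro!: continuous_intros)
    show "simple_integrand M F s T (N k) (\<tau> k) (%i w. \<eta> k i w \<bullet> b)" for k
    proof -
      have "EX K. ALL w:space M. norm (\<eta> k i w \<bullet> b) <= K" if "i < N k" for i
        using simple_integrand_meas(2)[OF 1 that] Basis_le_norm[OF assms(2)] by (auto intro: order_trans)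
      then show ?thesis using 1[of k] by (auto simp: simple_integrand_def)
    qed
    show "(%k. EM w. (\<integral>\<^sup>+ t\<in>{s..T}. ennreal ((norm (simple_process (N k) (\<tau> k) (%i w. \<eta> k i w \<bullet> b) t w - Y t w \<bullet> b))^2) \<partial>lborel)) ----> 0"
      by (rule tendsto_sandwich[OF _ _ tendsto_const 2])
         (auto intro!: always_eventually nn_integral_mono mult_right_mono le simp: sp inner_diff_left[symmetric] simp del: real_norm_def)
    show "(%k. EM w. ennreal ((norm (simple_ito B (N k) (\<tau> k) (%i w. \<eta> k i w \<bullet> b) t w - I t w \<bullet> b))^2)) ----> 0" if "t : {s..T}" for t
      by (rule tendsto_sandwich[OF _ _ tendsto_const 3[OF that]])
         (auto intro!: always_eventually nn_integral_mono le simp: si inner_diff_left[symmetric] simp del: real_norm_def)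
  qed
qed

lemma ito_approx:
  fixes \<sigma> I :: "real => 'w => real"
  assumes "ito \<sigma> I"
  obtains N \<tau> \<eta> where
    "!!k::nat. simple_integrand M F s T (N k) (\<tau> k) (\<eta> k)"
    "(%k. LINT z|Pm. (ev (simple_process (N k) (\<tau> k) (\<eta> k)) z - ev \<sigma> z)^2) ----> 0"
    "!!t. t : {s..T} ==> sq_int M (I t)"
    "!!t. t : {s..T} ==> (%k. LINT w|M. (simple_ito B (N k) (\<tau> k) (\<eta> k) t w - I t w)^2) ----> 0"
proof -
  from assms obtain N \<tau> \<eta> where
    1: "!!k::nat. simple_integrand M F s T (N k) (\<tau> k) (\<eta> k)" and
    2: "(%k. EM w. (\<integral>\<^sup>+ t\<in>{s..T}. ennreal ((norm (simple_process (N k) (\<tau> k) (\<eta> k) t w - \<sigma> t w))^2) \<partial>lborel)) ----> 0" and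
    3: "!!t. t : {s..T} ==> (%k. EM w. ennreal ((norm (simple_ito B (N k) (\<tau> k) (\<eta> k) t w - I t w))^2)) ----> 0"
    and Y: "\<sigma> : L2P" and I: "I : CP"
    unfolding ito_integral_def by blast
  have sqs: "sq_int Pm (%z. ev (simple_process (N k) (\<tau> k) (\<eta> k)) z - ev \<sigma> z)" for k
    by (intro sq_int_diff simple_process_sq[OF 1] L2_prog_sq[OF Y])
  have Im: "I t : meas M" if "t : {s..T}" for t
  proof -
    have "I : PM" using I by (simp add: cont_prog_def)
    from measurable_F_M[OF prog_adapted[OF this that]] show ?thesis .
  qed
  have c2: "(%k. LINT z|Pm. (ev (simple_process (N k) (\<tau> k) (\<eta> k)) z - ev \<sigma> z)^2) ----> 0"
    using 2 unfolding tendsto_nn_sq_iff[OF sqs, symmetric]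
    by (subst nn_Pm) (use sqs in \<open>auto simp: sq_int_def intro!: measurable_compose[OF _ measurable_ennreal]\<close>)
  \<comment> \<open>The definition asks only for continuity and measurability of \<open>I\<close>;
    square integrability comes from one approximating integral at finite distance.\<close>
  have sqI: "sq_int M (I t)" if t: "t : {s..T}" for t
  proof -
    have "eventually (%k. (EM w. ennreal ((norm (simple_ito B (N k) (\<tau> k) (\<eta> k) t w - I t w))^2)) < 1) sequentially"
      using 3[OF t] by (rule order_tendstoD) simp
    then obtain k where k: "(EM w. ennreal ((norm (simple_ito B (N k) (\<tau> k) (\<eta> k) t w - I t w))^2)) < 1"
      by (auto simp: eventually_sequentially)
    have "sq_int M (%w. simple_ito B (N k) (\<tau> k) (\<eta> k) t w - I t w)"
      unfolding sq_int_iff_nn using k Im[OF t] simple_ito_sq[OF 1 t, of k]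
      by (auto simp: sq_int_def intro: less_trans)
    from sq_int_diff[OF simple_ito_sq[OF 1 t, of k] this] show ?thesis by simp
  qed
  have c3: "(%k. LINT w|M. (simple_ito B (N k) (\<tau> k) (\<eta> k) t w - I t w)^2) ----> 0" if t: "t : {s..T}" for t
    using 3[OF t] tendsto_nn_sq_iff[of M "%k w. simple_ito B (N k) (\<tau> k) (\<eta> k) t w - I t w"]
      sq_int_diff[OF simple_ito_sq[OF 1 t] sqI[OF t]] by simp
  from that[OF 1 c2 sqI c3] show thesis .
qed

lemma L2_tendsto_diff:
  assumes "!!k. sq_int N (f k)" "!!k. sq_int N (g k)" "sq_int N f'" "sq_int N g'"
    "(%k. LINT x|N. (f k x - f' x)^2) ----> 0" "(%k. LINT x|N. (g k x - g' x)^2) ----> 0"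
  shows "(%k. LINT x|N. ((f k x - g k x) - (f' x - g' x))^2) ----> 0"
proof (rule tendsto_sandwich[OF _ _ tendsto_const])
  have df: "sq_int N (%x. f k x - f' x)" and dg: "sq_int N (%x. g k x - g' x)" for k
    using assms by (auto intro: sq_int_diff)
  have "(LINT x|N. ((f k x - g k x) - (f' x - g' x))^2) <= (LINT x|N. 2 * (f k x - f' x)^2 + 2 * (g k x - g' x)^2)" for k
  proof (rule integral_mono)
    show "integrable N (%x. ((f k x - g k x) - (f' x - g' x))^2)"
      using sq_int_diff[OF df dg, of k k] by (simp add: sq_int_def algebra_simps)
    show "integrable N (%x. 2 * (f k x - f' x)^2 + 2 * (g k x - g' x)^2)"
      using df[of k] dg[of k] by (simp add: sq_int_def)
    fix x
    have "0 <= ((f k x - f' x) + (g k x - g' x))^2" by simp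
    then show "((f k x - g k x) - (f' x - g' x))^2 <= 2 * (f k x - f' x)^2 + 2 * (g k x - g' x)^2"
      by (simp add: power2_eq_square algebra_simps)
  qed
  then show "\<forall>\<^sub>F k in sequentially. (LINT x|N. ((f k x - g k x) - (f' x - g' x))^2) <=
     2 * (LINT x|N. (f k x - f' x)^2) + 2 * (LINT x|N. (g k x - g' x)^2)"
    using df dg by (auto simp: sq_int_def)
  show "(%k. 2 * (LINT x|N. (f k x - f' x)^2) + 2 * (LINT x|N. (g k x - g' x)^2)) ----> 0"
    using tendsto_add[OF tendsto_mult_left[OF assms(5), of 2] tendsto_mult_left[OF assms(6), of 2]] by simp
qed auto

text \<open>Each side is the limit of the simple case, by \<open>integral_mult_tendsto_L2\<close> on
  \<open>M\<close> and on \<open>Pm\<close>; approximations of the two integrals may use unrelated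
  grids.\<close>

lemma ito_cov:
  fixes \<sigma> I \<theta> J :: "real => 'w => real"
  assumes I: "ito \<sigma> I" and J: "ito \<theta> J"
    and rt: "s <= r" "r <= t" "t <= T"
    and Z: "Z : meas (F r)" "!!w. w : space M ==> \<bar>Z w\<bar> <= K"
  shows "(LINT w|M. Z w * (I t w - I r w) * (J t w - J r w)) =
     (LINT z|Pm. (Z (fst z) * indicator {r<..t} (snd z)) * ev \<sigma> z * ev \<theta> z)"
proof -
  from ito_approx[OF I] obtain N \<tau> \<eta> where
    a: "!!k::nat. simple_integrand M F s T (N k) (\<tau> k) (\<eta> k)"
    "(%k. LINT z|Pm. (ev (simple_process (N k) (\<tau> k) (\<eta> k)) z - ev \<sigma> z)^2) ----> 0"
    "!!t. t : {s..T} ==> sq_int M (I t)"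
    "!!t. t : {s..T} ==> (%k. LINT w|M. (simple_ito B (N k) (\<tau> k) (\<eta> k) t w - I t w)^2) ----> 0" by blast
  from ito_approx[OF J] obtain N' \<tau>' \<eta>' where
    b: "!!k::nat. simple_integrand M F s T (N' k) (\<tau>' k) (\<eta>' k)"
    "(%k. LINT z|Pm. (ev (simple_process (N' k) (\<tau>' k) (\<eta>' k)) z - ev \<theta> z)^2) ----> 0"
    "!!t. t : {s..T} ==> sq_int M (J t)"
    "!!t. t : {s..T} ==> (%k. LINT w|M. (simple_ito B (N' k) (\<tau>' k) (\<eta>' k) t w - J t w)^2) ----> 0" by blast
  have r: "r : {s..T}" and t: "t : {s..T}" using rt by auto
  have sig: "sq_int Pm (ev \<sigma>)" "sq_int Pm (ev \<theta>)"
    using I J by (auto simp: ito_integral_def intro: L2_prog_sq)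
  note ZM[measurable] = measurable_F_M[OF Z(1)]
  have L: "(%k. LINT w|M. Z w * (simple_ito B (N k) (\<tau> k) (\<eta> k) t w - simple_ito B (N k) (\<tau> k) (\<eta> k) r w)
      * (simple_ito B (N' k) (\<tau>' k) (\<eta>' k) t w - simple_ito B (N' k) (\<tau>' k) (\<eta>' k) r w))
     ----> (LINT w|M. Z w * (I t w - I r w) * (J t w - J r w))"
    by (rule integral_mult_tendsto_L2[where K = K])
       (intro sq_int_diff simple_ito_sq[OF a(1)] simple_ito_sq[OF b(1)] a(3) b(3) r t
          L2_tendsto_diff a(4) b(4) ZM | use Z in force)+
  have R: "(%k. LINT z|Pm. (Z (fst z) * indicator {r<..t} (snd z)) * ev (simple_process (N k) (\<tau> k) (\<eta> k)) z * ev (simple_process (N' k) (\<tau>' k) (\<eta>' k)) z)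
     ----> (LINT z|Pm. (Z (fst z) * indicator {r<..t} (snd z)) * ev \<sigma> z * ev \<theta> z)"
  proof (rule integral_mult_tendsto_L2[where K = "\<bar>K\<bar>"])
    show "AE x in Pm. \<bar>Z (fst x) * indicator {r<..t} (snd x)\<bar> <= \<bar>K\<bar>"
      using Z(2) by (intro AE_I2) (force simp: space_Pm abs_mult indicator_def)
  qed (intro simple_process_sq a b sig borel_measurable_times Pm_fstI Pm_sndI ZM | simp)+
  from R have "(%k. LINT w|M. Z w * (simple_ito B (N k) (\<tau> k) (\<eta> k) t w - simple_ito B (N k) (\<tau> k) (\<eta> k) r w)
      * (simple_ito B (N' k) (\<tau>' k) (\<eta>' k) t w - simple_ito B (N' k) (\<tau>' k) (\<eta>' k) r w))
      ----> (LINT z|Pm. (Z (fst z) * indicator {r<..t} (snd z)) * ev \<sigma> z * ev \<theta> z)"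
    by (subst simple_ito_cov[OF a(1) b(1) rt Z])
  with L show ?thesis by (rule LIMSEQ_unique)
qed

lemma simple_ito_mean:
  fixes \<eta> :: "nat => 'w => real"
  assumes s1: "simple_integrand M F s T N \<tau> \<eta>" and rt: "s <= r" "r <= t" "t <= T"
    and Z: "Z : meas (F r)" "!!w. w : space M ==> \<bar>Z w\<bar> <= K"
  shows "(LINT w|M. Z w * (simple_ito B N \<tau> \<eta> t w - simple_ito B N \<tau> \<eta> r w)) = 0"
proof -
  let ?c = "clamp r t"
  have c0: "0 <= ?c x" "r <= ?c x" "?c x <= t" for x using s0 rt by (auto simp: clamp_def)
  have *: "(LINT w|M. (Z w * \<eta> i w) * (B (?c (\<tau> (Suc i))) w - B (?c (\<tau> i)) w)) = 0 &
     integrable M (%w. (Z w * \<eta> i w) * (B (?c (\<tau> (Suc i))) w - B (?c (\<tau> i)) w))" if i: "i < N" for i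
  proof (cases "?c (\<tau> i) < ?c (\<tau> (Suc i))")
    case True
    obtain Ki where Ki: "!!w. w : space M ==> \<bar>\<eta> i w\<bar> <= Ki" using simple_integrand_meas(2)[OF s1 i] by auto
    have "integrable M (%w. Z w * (\<eta> i w * 1))"
      by (intro integrable_bounded_mult[OF _ measurable_F_M[OF Z(1)] Z(2)]
          integrable_bounded_mult[OF _ simple_integrand_meas(1)[OF s1 i] Ki]) auto
    moreover have "\<tau> i <= ?c (\<tau> i)" using True by (auto simp: clamp_def)
    then have "(%w. Z w * \<eta> i w) : meas (F (?c (\<tau> i)))"
      by (intro borel_measurable_times measurable_F_mono[OF Z(1)] measurable_F_mono[OF simple_integrand_meas(3)[OF s1 i]] c0)
    ultimately show ?thesis
      using increment_mean_zero[of "?c (\<tau> i)" "?c (\<tau> (Suc i))" "%w. Z w * \<eta> i w"] True c0 by auto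
  next
    case False
    moreover have "?c (\<tau> i) <= ?c (\<tau> (Suc i))" using s1 i by (auto simp: simple_integrand_def clamp_def less_imp_le intro!: max.mono min.mono)
    ultimately have "?c (\<tau> i) = ?c (\<tau> (Suc i))" by simp
    then show ?thesis by simp
  qed
  have "(LINT w|M. Z w * (simple_ito B N \<tau> \<eta> t w - simple_ito B N \<tau> \<eta> r w)) =
     (LINT w|M. (SUM i<N. (Z w * \<eta> i w) * (B (?c (\<tau> (Suc i))) w - B (?c (\<tau> i)) w)))"
    by (rule Bochner_Integration.integral_cong[OF refl])
       (simp add: simple_ito_increment[OF rt(2)] sum_distrib_left ac_simps)
  also have "... = 0" using * by (subst Bochner_Integration.integral_sum) auto
  finally show ?thesis .
qed

lemma ito_mean:
  fixes \<sigma> I :: "real => 'w => real"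
  assumes I: "ito \<sigma> I"
    and rt: "s <= r" "r <= t" "t <= T"
    and Z: "Z : meas (F r)" "!!w. w : space M ==> \<bar>Z w\<bar> <= K"
  shows "(LINT w|M. Z w * (I t w - I r w)) = 0"
proof -
  from ito_approx[OF I] obtain N \<tau> \<eta> where
    a: "!!k::nat. simple_integrand M F s T (N k) (\<tau> k) (\<eta> k)"
    "(%k. LINT z|Pm. (ev (simple_process (N k) (\<tau> k) (\<eta> k)) z - ev \<sigma> z)^2) ----> 0"
    "!!t. t : {s..T} ==> sq_int M (I t)"
    "!!t. t : {s..T} ==> (%k. LINT w|M. (simple_ito B (N k) (\<tau> k) (\<eta> k) t w - I t w)^2) ----> 0" by blast
  have r: "r : {s..T}" and t: "t : {s..T}" using rt by auto
  note ZM[measurable] = measurable_F_M[OF Z(1)]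
  have "(%k. LINT w|M. Z w * (simple_ito B (N k) (\<tau> k) (\<eta> k) t w - simple_ito B (N k) (\<tau> k) (\<eta> k) r w) * 1)
     ----> (LINT w|M. Z w * (I t w - I r w) * 1)"
    by (rule integral_mult_tendsto_L2[where K = K])
       (intro sq_int_diff simple_ito_sq[OF a(1)] a(3) r t
          L2_tendsto_diff a(4) ZM | use Z in \<open>force simp: sq_int_def\<close>)+
  then show ?thesis using simple_ito_mean[OF a(1) rt Z] by (simp add: LIMSEQ_const_iff)
qed

lemma ito_sq: "ito \<sigma> I ==> t : {s..T} ==> sq_int M (I t :: 'w => real)"
  by (erule ito_approx) auto

text \<open>Simple integrals vanish at \<open>s\<close> everywhere, but the limit determines
  \<open>I\<close> only almost surely.\<close>

lemma ito_start:
  assumes I: "ito \<sigma> (I :: real => 'w => 'h::euclidean_space)"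
  shows "AE w in M. I s w = 0"
proof -
  have "AE w in M. I s w \<bullet> b = 0" if b: "b : Basis" for b
  proof -
    have Ib: "ito (%t w. \<sigma> t w \<bullet> b) (%t w. I t w \<bullet> b)" by (rule ito_component[OF I b])
    from ito_approx[OF this] obtain N \<tau> \<eta> where
      a: "!!k::nat. simple_integrand M F s T (N k) (\<tau> k) (\<eta> k)"
      "(%k. LINT z|Pm. (ev (simple_process (N k) (\<tau> k) (\<eta> k)) z - ev (%t w. \<sigma> t w \<bullet> b) z)^2) ----> 0"
      "!!t. t : {s..T} ==> sq_int M (%w. I t w \<bullet> b)"
      "!!t. t : {s..T} ==> (%k. LINT w|M. (simple_ito B (N k) (\<tau> k) (\<eta> k) t w - I t w \<bullet> b)^2) ----> 0" by blast
    have s: "s : {s..T}" using sT by simp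
    have "(LINT w|M. (I s w \<bullet> b)^2) = 0"
      using a(4)[OF s] by (simp add: simple_ito_start[OF a(1)] LIMSEQ_const_iff)
    then show ?thesis
      using integral_nonneg_eq_0_iff_AE[of M "%w. (I s w \<bullet> b)^2"] ito_sq[OF Ib s] by (simp add: sq_int_def)
  qed
  then have "AE w in M. ALL b:Basis. I s w \<bullet> b = 0" by (intro AE_finite_allI[OF finite_Basis])
  then show ?thesis by eventually_elim (auto intro: euclidean_eqI)
qed

end

section \<open>Martingales and the maximal inequality\<close>

primrec runmax :: "(nat => real) => nat => real" where
  "runmax x 0 = x 0"
| "runmax x (Suc k) = max (runmax x k) (x (Suc k))"

lemma runmax_ge: "j <= k ==> x j <= runmax x k"
  by (induction k) (auto simp: le_Suc_eq intro: order_trans)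

text \<open>A maximal inequality for a single path. With \<open>m\<close> the running maximum, the
  transform satisfies \<open>SUM m dx <= m x - m^2 / 2\<close> at the final index, and
  \<open>(m - 2 x)^2\<close> is nonnegative. The subtracted sum has nonnegative mean for a
  submartingale.\<close>

lemma doob_pathwise:
  fixes x :: "nat => real"
  assumes "!!k. 0 <= x k"
  shows "(runmax x N)^2 <= 4 * (x N)^2 - 4 * (SUM j<N. runmax x j * (x (Suc j) - x j))"
proof -
  have *: "(SUM j<N. runmax x j * (x (Suc j) - x j)) <= runmax x N * x N - (runmax x N)^2 / 2"
  proof (induction N)
    case 0 then show ?case using assms[of 0] by (simp add: power2_eq_square)
  next
    case (Suc N)
    let ?m = "runmax x N" and ?y = "x (Suc N)"
    have "(SUM j<Suc N. runmax x j * (x (Suc j) - x j)) <= ?m * ?y - ?m^2 / 2"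
      using Suc by (simp add: algebra_simps)
    also have "... <= max ?m ?y * ?y - (max ?m ?y)^2 / 2"
    proof (cases "?y <= ?m")
      \<comment> \<open>At a new maximum the right-hand side gains half of
        \<open>(?y - ?m)^2\<close>; otherwise both sides agree.\<close>
      case False
      have "0 <= (?y - ?m)^2" by simp
      then have "?m * ?y - ?m^2 / 2 <= ?y * ?y - ?y^2 / 2" by (simp add: power2_eq_square algebra_simps)
      then show ?thesis using False by (simp add: max_def)
    qed (simp add: max_def)
    finally show ?case by simp
  qed
  have "0 <= (runmax x N - 2 * x N)^2" by simp
  then show ?thesis using * by (simp add: power2_eq_square algebra_simps)
qed

section \<open>Continuous adapted processes\<close>

context brownian
begin

text \<open>Sampling at times rounded down to multiples of \<open>1 / Suc n\<close>, and clamped to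
  \<open>[s, t]\<close>, uses values up to time \<open>t\<close> only and is jointly measurable as a
  countable gluing. Continuity gives the limit.\<close>

lemma adapted_cont_prog:
  fixes X :: "real => 'w => 'h::euclidean_space"
  assumes ad: "!!t. t : {s..T} ==> X t : meas (F t)"
    and co: "!!w. w : space M ==> continuous_on {s..T} (%t. X t w)"
  shows "X : CP"
proof -
  have "(%(r, w). X r w) : meas (restrict_space borel {s..t} \<Otimes>\<^sub>M F t)" if t: "t : {s..T}" for t
  proof -
    let ?R = "restrict_space borel {s..t} \<Otimes>\<^sub>M F t"
    define q where "q n i = min t (max s (of_int i / real (Suc n)))" for n and i :: int
    define fl where "fl n r = \<lfloor>real (Suc n) * r\<rfloor>" for n and r :: real
    have qr: "q n i : {s..t}" for n i using t by (auto simp: q_def)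
    have fst': "fst : meas ?R"
      by (rule measurable_compose[OF measurable_fst]) (simp add: measurable_restrict_space1)
    have m: "(%z. X (q n (fl n (fst z))) (snd z)) : meas ?R" for n
    proof (rule measurable_compose_countable'[where I = UNIV and f = "%i z. X (q n i) (snd z)" and g = "%z. fl n (fst z)"])
      fix i :: int
      have "X (q n i) : meas (F t)"
        using ad[of "q n i"] qr[of n i] t by (auto intro: measurable_F_mono)
      then show "(%z. X (q n i) (snd z)) : meas ?R" by (rule measurable_compose[OF measurable_snd])
      show "(%z. fl n (fst z)) : measurable ?R (count_space UNIV)"
        unfolding fl_def by (rule measurable_compose[OF _ measurable_real_floor]) (intro borel_measurable_times fst' measurable_const, simp)
    qed auto
    have "(%z. X (fst z) (snd z)) : meas ?R"
    proof (rule borel_measurable_LIMSEQ_metric[OF m])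
      fix z assume "z : space ?R"
      then have z: "fst z : {s..t}" "snd z : space M" by (auto simp: space_pair_measure space_restrict_space)
      have "(%n. of_int (fl n (fst z)) / real (Suc n)) ----> fst z"
      proof (rule tendsto_sandwich[OF _ _ _ tendsto_const])
        show "\<forall>\<^sub>F n in sequentially. fst z - 1 / real (Suc n) <= of_int (fl n (fst z)) / real (Suc n)"
        proof (intro always_eventually allI)
          fix n
          have "real (Suc n) * fst z - 1 <= of_int (fl n (fst z))" unfolding fl_def by linarith
          then have "(real (Suc n) * fst z - 1) / real (Suc n) <= of_int (fl n (fst z)) / real (Suc n)"
            by (intro divide_right_mono) auto
          then show "fst z - 1 / real (Suc n) <= of_int (fl n (fst z)) / real (Suc n)"
            by (simp add: diff_divide_distrib del: of_nat_Suc)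
        qed
        show "\<forall>\<^sub>F n in sequentially. of_int (fl n (fst z)) / real (Suc n) <= fst z"
        proof (intro always_eventually allI)
          fix n
          have "of_int (fl n (fst z)) <= real (Suc n) * fst z" unfolding fl_def by linarith
          then have "of_int (fl n (fst z)) / real (Suc n) <= (real (Suc n) * fst z) / real (Suc n)"
            by (intro divide_right_mono) auto
          then show "of_int (fl n (fst z)) / real (Suc n) <= fst z" by (simp del: of_nat_Suc)
        qed
        have "(%n. fst z - 1 / real (Suc n)) ----> fst z - 0"
          by (intro tendsto_diff tendsto_const LIMSEQ_Suc lim_1_over_n)
        then show "(%n. fst z - 1 / real (Suc n)) ----> fst z" by simp
      qed
      then have "(%n. q n (fl n (fst z))) ----> min t (max s (fst z))"
        unfolding q_def by (intro tendsto_min tendsto_max tendsto_const)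
      moreover have "min t (max s (fst z)) = fst z" using z by auto
      ultimately have "(%n. q n (fl n (fst z))) ----> fst z" by simp
      then show "(%n. X (q n (fl n (fst z))) (snd z)) ----> X (fst z) (snd z)"
        using z t qr by (intro continuous_on_tendsto_compose[OF co[of "snd z"]] always_eventually) (auto intro: order_trans)
    qed
    then show ?thesis by (simp add: split_beta')
  qed
  then show ?thesis using co by (auto simp: cont_prog_def prog_measurable_def)
qed

lemma cont_prog_adapted: "X : cont_prog M F s T H ==> t : {s..T} ==> X t : meas (F t)"
  using prog_adapted by (auto simp: cont_prog_def)

lemma cont_prog_M: "X : cont_prog M F s T H ==> t : {s..T} ==> X t : meas M"
  using measurable_F_M[OF cont_prog_adapted] .

lemma cont_prog_cont: "X : cont_prog M F s T H ==> w : space M ==> continuous_on {s..T} (%t. X t w)"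
  by (auto simp: cont_prog_def)

lemma cont_prog_diff:
  fixes X Y :: "real => 'w => 'h::euclidean_space"
  assumes "X : CP" "Y : CP"
  shows "(%t w. X t w - Y t w) : CP"
  by (intro adapted_cont_prog borel_measurable_diff continuous_on_diff cont_prog_adapted[OF assms(1)]
        cont_prog_adapted[OF assms(2)] cont_prog_cont[OF assms(1)] cont_prog_cont[OF assms(2)])

lemma cont_prog_inner:
  fixes X :: "real => 'w => 'h::euclidean_space"
  assumes "X : CP"
  shows "(%t w. X t w \<bullet> b) : CP"
  by (intro adapted_cont_prog borel_measurable_inner continuous_on_inner continuous_on_const
        cont_prog_adapted[OF assms] cont_prog_cont[OF assms]) simp_all

section \<open>Uniform grids and suprema over time\<close>

definition gr :: "nat => nat => real" where "gr n i = s + real i * (T - s) / real (Suc n)"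

lemma gr_0[simp]: "gr n 0 = s" by (simp add: gr_def)
lemma gr_last[simp]: "gr n (Suc n) = T" by (simp add: gr_def del: of_nat_Suc)
lemma gr_step: "gr n (Suc i) = gr n i + (T - s) / real (Suc n)"
  unfolding gr_def of_nat_Suc[of i] distrib_right add_divide_distrib by simp
lemma gr_less: "gr n i < gr n (Suc i)" using sT by (simp add: gr_step del: of_nat_Suc)
lemma gr_range: "i <= Suc n ==> gr n i : {s..T}"
  using grid_mono[of "Suc n" "gr n" 0 i] grid_mono[of "Suc n" "gr n" i "Suc n"] gr_less by auto

text \<open>The last grid point not after \<open>t\<close>. At \<open>t = T\<close> it is
  \<open>Suc n\<close>, the right end of the grid, not the index of a cell.\<close>

definition idx :: "nat => real => nat" where "idx n t = nat \<lfloor>(t - s) * real (Suc n) / (T - s)\<rfloor>"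

lemma idx_le: "t : {s..T} ==> idx n t <= Suc n"
proof -
  assume t: "t : {s..T}"
  have "(t - s) * real (Suc n) <= (T - s) * real (Suc n)" using t by (intro mult_right_mono) auto
  then have "(t - s) * real (Suc n) / (T - s) <= real (Suc n)" using sT by (simp add: field_simps)
  then have "\<lfloor>(t - s) * real (Suc n) / (T - s)\<rfloor> <= int (Suc n)" by linarith
  then show ?thesis by (simp add: idx_def)
qed

lemma gr_idx_le: "t : {s..T} ==> gr n (idx n t) <= t & t < gr n (Suc (idx n t))"
proof -
  assume t: "t : {s..T}"
  let ?x = "(t - s) * real (Suc n) / (T - s)"
  have "?x >= 0" using t sT by simp
  then have "real (idx n t) <= ?x" "?x < real (idx n t) + 1" unfolding idx_def by linarith+
  then have "real (idx n t) * (T - s) <= (t - s) * real (Suc n)" "(t - s) * real (Suc n) < (real (idx n t) + 1) * (T - s)"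
    using sT by (simp_all add: field_simps del: of_nat_Suc)
  then have "real (idx n t) * (T - s) / real (Suc n) <= t - s" "t - s < (real (idx n t) + 1) * (T - s) / real (Suc n)"
    by (simp_all add: field_simps del: of_nat_Suc)
  then show ?thesis by (simp add: gr_def add_ac)
qed

lemma gr_idx_tendsto: assumes t: "t : {s..T}" shows "(%n. gr n (idx n t)) ----> t"
proof (rule tendsto_sandwich[OF _ _ _ tendsto_const])
  show "\<forall>\<^sub>F n in sequentially. t - (T - s) / real (Suc n) <= gr n (idx n t)"
    using gr_idx_le[OF t] by (intro always_eventually) (auto simp: gr_step less_imp_le algebra_simps simp del: of_nat_Suc)
  show "\<forall>\<^sub>F n in sequentially. gr n (idx n t) <= t" using gr_idx_le[OF t] by auto
  have "(%n. t - (T - s) / real (Suc n)) ----> t - 0"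
    by (intro tendsto_diff tendsto_const LIMSEQ_Suc lim_const_over_n)
  then show "(%n. t - (T - s) / real (Suc n)) ----> t" by simp
qed

definition supsq :: "(real => 'w => 'h::euclidean_space) => 'w => ennreal" where
  "supsq X w = (SUP t\<in>{s..T}. ennreal ((norm (X t w))^2))"

lemma supsq_ge: "t : {s..T} ==> ennreal ((norm (X t w))^2) <= supsq X w"
  unfolding supsq_def by (rule SUP_upper)

lemma cont_norm_sq_lim:
  assumes "continuous_on {s..T} (%t. X t w)" "t : {s..T}"
  shows "(%n. ennreal ((norm (X (gr n (idx n t)) w))^2)) ----> ennreal ((norm (X t w))^2)"
proof -
  have "(%n. X (gr n (idx n t)) w) ----> X t w"
    using assms gr_range idx_le[OF assms(2)]
    by (intro continuous_on_tendsto_compose[OF assms(1)] gr_idx_tendsto always_eventually) auto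
  then show ?thesis by (intro tendsto_ennrealI tendsto_power tendsto_norm)
qed

text \<open>Continuity reduces the supremum over an interval to the countable set of all grid points
  of all uniform grids; this is what makes it measurable.\<close>

lemma supsq_countable:
  assumes "continuous_on {s..T} (%t. X t w)"
  shows "supsq X w = (SUP q\<in>{(n, i). i <= Suc n}. ennreal ((norm (X (gr (fst q) (snd q)) w))^2))" (is "_ = ?S")
proof (rule antisym)
  show "supsq X w <= ?S"
    unfolding supsq_def
  proof (rule SUP_least)
    fix t assume t: "t : {s..T}"
    show "ennreal ((norm (X t w))^2) <= ?S"
    proof (rule LIMSEQ_le_const2[OF cont_norm_sq_lim[where X = X and w = w, OF assms t]])
      show "EX N. ALL n>=N. ennreal ((norm (X (gr n (idx n t)) w))^2) <= ?S"
      proof (intro exI[of _ 0] allI impI)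
        fix n
        show "ennreal ((norm (X (gr n (idx n t)) w))^2) <= ?S"
          using idx_le[OF t, of n] by (intro SUP_upper2[of "(n, idx n t)"]) auto
      qed
    qed
  qed
  show "?S <= supsq X w"
    unfolding supsq_def using gr_range by (intro SUP_mono) (auto intro!: bexI)
qed

lemma supsq_meas[measurable]:
  assumes "X : CP" shows "supsq X : meas M"
proof -
  have "(%w. SUP q\<in>{(n, i). i <= Suc n}. ennreal ((norm (X (gr (fst q) (snd q)) w))^2)) : meas M"
  proof (rule borel_measurable_SUP)
    fix q assume "q : {(n::nat, i). i <= Suc n}"
    then have [measurable]: "X (gr (fst q) (snd q)) : meas M"
      using gr_range by (intro cont_prog_M[OF assms]) auto
    show "(%w. ennreal ((norm (X (gr (fst q) (snd q)) w))^2)) : meas M" by measurable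
  qed auto
  then show ?thesis
    by (rule measurable_cong[THEN iffD1, rotated]) (simp add: supsq_countable[OF cont_prog_cont[OF assms]])
qed

lemma supsq_component:
  fixes X :: "real => 'w => 'h::euclidean_space"
  shows "supsq X w <= (SUM b:Basis. supsq (%t w. X t w \<bullet> b) w)"
  unfolding supsq_def[of X]
proof (rule SUP_least)
  fix t assume t: "t : {s..T}"
  have "(norm (X t w))^2 = (SUM b:Basis. (norm (X t w \<bullet> b))^2)"
    using euclidean_inner[of "X t w" "X t w"] by (simp add: power2_norm_eq_inner) (simp add: power2_eq_square)
  then have "ennreal ((norm (X t w))^2) = (SUM b:Basis. ennreal ((norm (X t w \<bullet> b))^2))"
    by (simp add: sum_ennreal)
  also have "... <= (SUM b:Basis. supsq (%t w. X t w \<bullet> b) w)" by (intro sum_mono supsq_ge t)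
  finally show "ennreal ((norm (X t w))^2) <= (SUM b:Basis. supsq (%t w. X t w \<bullet> b) w)" .
qed

text \<open>The martingale property without conditional expectations: increments after
  \<open>r\<close> are orthogonal to bounded \<open>F r\<close>-measurable variables.\<close>

definition mgale :: "(real => 'w => real) => bool" where
  "mgale I \<longleftrightarrow> (ALL t:{s..T}. I t : meas (F t) & sq_int M (I t)) &
    (ALL r t Z K. s <= r --> r <= t --> t <= T --> Z : meas (F r) --> (ALL w:space M. \<bar>Z w\<bar> <= (K::real)) -->
       (LINT w|M. Z w * (I t w - I r w)) = 0)"

lemma mgale_ad: "mgale I ==> t : {s..T} ==> I t : meas (F t)"
  and mgale_sq: "mgale I ==> t : {s..T} ==> sq_int M (I t)"
  and mgale_mean: "mgale I ==> s <= r ==> r <= t ==> t <= T ==> Z : meas (F r) ==>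
    ALL w:space M. \<bar>Z w\<bar> <= (K::real) ==> (LINT w|M. Z w * (I t w - I r w)) = 0"
  unfolding mgale_def by blast+

lemma mgale_ito: "ito \<sigma> I ==> mgale I"
  unfolding mgale_def
proof (intro conjI ballI allI impI)
  assume I: "ito \<sigma> I"
  then have *: "I : CP" by (simp add: ito_integral_def)
  show "t : {s..T} ==> I t : meas (F t)" for t by (rule cont_prog_adapted[OF *])
  show "t : {s..T} ==> sq_int M (I t)" for t by (rule ito_sq[OF I])
  show "(LINT w|M. Z w * (I t w - I r w)) = 0" if "s <= r" "r <= t" "t <= T" "Z : meas (F r)" "ALL w:space M. \<bar>Z w\<bar> <= K" for r t Z K
    using ito_mean[OF I that(1-4), of K] that(5) by auto
qed

lemma mgale_diff: assumes "mgale I" "mgale J" shows "mgale (%t w. I t w - J t w)"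
  unfolding mgale_def
proof (intro conjI ballI allI impI)
  show "t : {s..T} ==> (%w. I t w - J t w) : meas (F t)" for t
    by (intro borel_measurable_diff mgale_ad[OF assms(1)] mgale_ad[OF assms(2)])
  show sq: "t : {s..T} ==> sq_int M (%w. I t w - J t w)" for t
    by (intro sq_int_diff mgale_sq[OF assms(1)] mgale_sq[OF assms(2)])
  fix r t Z K assume h: "s <= r" "r <= t" "t <= T" "Z : meas (F r)" "ALL w:space M. \<bar>Z w\<bar> <= (K::real)"
  have i: "integrable M (%w. Z w * (L t w - L r w))" if "mgale L" for L
  proof (rule integrable_bounded_mult[OF _ measurable_F_M[OF h(4)]])
    show "integrable M (%w. L t w - L r w)"
      using h by (intro sq_int_imp_integrable sq_int_diff mgale_sq[OF that]) auto
  qed (use h in auto)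
  have "(LINT w|M. Z w * (I t w - J t w - (I r w - J r w))) = (LINT w|M. Z w * (I t w - I r w) - Z w * (J t w - J r w))"
    by (rule Bochner_Integration.integral_cong) (auto simp: algebra_simps)
  also have "... = 0" using i[OF assms(1)] i[OF assms(2)] mgale_mean[OF assms(1) h] mgale_mean[OF assms(2) h] by simp
  finally show "(LINT w|M. Z w * (I t w - J t w - (I r w - J r w))) = 0" .
qed

text \<open>Truncation at level \<open>n\<close> keeps a test variable \<open>F r\<close>-measurable
  and is dominated by the variable itself, so the orthogonality passes from bounded to
  square-integrable test variables.\<close>

lemma mgale_L2:
  assumes I: "mgale I" and rt: "s <= r" "r <= t" "t <= T" and Z: "Z : meas (F r)" "sq_int M Z"
  shows "(LINT w|M. Z w * (I t w - I r w)) = 0"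
proof -
  define Zn where "Zn n w = max (- real n) (min (real n) (Z w))" for n w
  have sq: "sq_int M (%w. I t w - I r w)" using rt by (intro sq_int_diff mgale_sq[OF I]) auto
  have [measurable]: "(%w. I t w - I r w) : meas M" "Z : meas M"
    using sq Z by (auto simp: sq_int_def)
  have "(%n. LINT w|M. Zn n w * (I t w - I r w)) ----> (LINT w|M. Z w * (I t w - I r w))"
  proof (rule integral_dominated_convergence[where w = "%w. \<bar>Z w * (I t w - I r w)\<bar>"])
    show "integrable M (%w. \<bar>Z w * (I t w - I r w)\<bar>)" using sq_int_mult[OF Z(2) sq] by simp
    show "(%w. Z w * (I t w - I r w)) : meas M" by measurable
    show "(%w. Zn n w * (I t w - I r w)) : meas M" for n unfolding Zn_def by measurable
    have "(%n. Zn n w) ----> Z w" for w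
    proof (rule tendsto_eventually)
      obtain N where "\<bar>Z w\<bar> <= real N" using real_arch_simple by blast
      then show "\<forall>\<^sub>F n in sequentially. Zn n w = Z w"
        unfolding eventually_sequentially Zn_def by (intro exI[of _ N]) auto
    qed
    then show "AE w in M. (%n. Zn n w * (I t w - I r w)) ----> Z w * (I t w - I r w)"
      by (intro AE_I2 tendsto_mult tendsto_const)
    have "\<bar>Zn n w\<bar> <= \<bar>Z w\<bar>" for n w unfolding Zn_def by (auto simp: max_def min_def)
    then show "AE w in M. norm (Zn n w * (I t w - I r w)) <= \<bar>Z w * (I t w - I r w)\<bar>" for n
      by (intro AE_I2) (simp add: abs_mult mult_right_mono)
  qed
  moreover have "(LINT w|M. Zn n w * (I t w - I r w)) = 0" for n
  proof -
    have "Zn n : meas (F r)" unfolding Zn_def[abs_def] using Z(1) by measurable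
    moreover have "ALL w:space M. \<bar>Zn n w\<bar> <= real n" by (auto simp: Zn_def)
    ultimately show ?thesis by (rule mgale_mean[OF I rt])
  qed
  ultimately show ?thesis by (simp add: LIMSEQ_const_iff)
qed

text \<open>Expectation of \<open>doob_pathwise\<close> along \<open>|I|\<close>. What has to be
  shown is that the transform of \<open>|I|\<close> by its running maximum has nonnegative mean,
  which is the submartingale property of \<open>|I|\<close>.\<close>

lemma doob_discrete:
  assumes I: "mgale I" and \<tau>: "!!i j. i <= j ==> j <= N ==> \<tau> i <= \<tau> j" "!!i. i <= N ==> \<tau> i : {s..T}"
  shows "sq_int M (%w. runmax (%i. \<bar>I (\<tau> i) w\<bar>) N)"
    "(LINT w|M. (runmax (%i. \<bar>I (\<tau> i) w\<bar>) N)^2) <= 4 * (LINT w|M. (I (\<tau> N) w)^2)"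
proof -
  let ?d = "%j w. \<bar>I (\<tau> (Suc j)) w\<bar> - \<bar>I (\<tau> j) w\<bar>"
  define m where "m k w = runmax (%i. \<bar>I (\<tau> i) w\<bar>) k" for k w
  have Iad: "I (\<tau> i) : meas (F (\<tau> j))" if "i <= j" "j <= N" for i j
    using \<tau> that by (intro measurable_F_mono[OF mgale_ad[OF I \<tau>(2)]]) auto
  have Isq: "sq_int M (I (\<tau> i))" if "i <= N" for i by (rule mgale_sq[OF I \<tau>(2)[OF that]])
  have mm: "m k : meas (F (\<tau> j))" if "k <= j" "j <= N" for k j
    using that unfolding m_def[abs_def]
  proof (induction k)
    case 0 then show ?case using Iad[of 0 j] by simp
  next
    case (Suc k) then show ?case using Iad[of "Suc k" j] by simp
  qed
  have msq: "sq_int M (m k)" if "k <= N" for k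
    using that
  proof (induction k)
    case 0 then show ?case using Isq[of 0] by (auto simp: m_def[abs_def] sq_int_def)
  next
    case (Suc k)
    have "sq_int M (%w. \<bar>m k w\<bar> + \<bar>I (\<tau> (Suc k)) w\<bar>)"
      using Suc Isq[of "Suc k"] by (intro sq_int_add) (auto simp: sq_int_def)
    then show ?case
    proof (rule sq_int_bound[where K = 1])
      show "m (Suc k) : meas M" using measurable_F_M[OF mm[of "Suc k" "Suc k"]] Suc by simp
    qed (auto simp: m_def)
  qed
  then show "sq_int M (%w. runmax (%i. \<bar>I (\<tau> i) w\<bar>) N)" by (simp add: m_def[abs_def])
  have asq: "sq_int M (%w. \<bar>I (\<tau> i) w\<bar>)" if "i <= N" for i using Isq[OF that] by (auto simp: sq_int_def)
  have int: "integrable M (%w. m j w * ?d j w)" if "j < N" for j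
    using that by (intro sq_int_mult sq_int_diff msq asq) auto
  have pos: "0 <= (LINT w|M. m j w * ?d j w)" if j: "j < N" for j
  proof -
    \<comment> \<open>By convexity \<open>sgn a * (b - a) <= |b| - |a|\<close>; testing the
      martingale with this \<open>Z\<close> therefore bounds the transform of \<open>|I|\<close>
      from below by zero.\<close>
    define Z where "Z w = sgn (I (\<tau> j) w) * m j w" for w
    have Zm: "Z : meas (F (\<tau> j))"
      unfolding Z_def[abs_def] using mm[of j j] Iad[of j j] j by (intro borel_measurable_times borel_measurable_sgn) auto
    have Zsq: "sq_int M Z"
    proof (rule sq_int_bound[OF msq[of j], where K = 1])
      show "Z : meas M" using measurable_F_M[OF Zm] .
    qed (use j in \<open>auto simp: Z_def abs_mult sgn_real_def\<close>)
    have "0 = (LINT w|M. Z w * (I (\<tau> (Suc j)) w - I (\<tau> j) w))"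
      using \<tau> j by (intro mgale_L2[OF I _ _ _ Zm Zsq, symmetric]) auto
    also have "... <= (LINT w|M. m j w * ?d j w)"
    proof (rule integral_mono)
      show "integrable M (%w. Z w * (I (\<tau> (Suc j)) w - I (\<tau> j) w))"
        using j by (intro sq_int_mult Zsq sq_int_diff Isq) auto
      fix w
      have m0: "0 <= m j w" using runmax_ge[of 0 j "%i. \<bar>I (\<tau> i) w\<bar>"] by (simp add: m_def)
      have "sgn a * (b - a) <= \<bar>b\<bar> - \<bar>a\<bar>" for a b :: real by (auto simp: sgn_real_def)
      from mult_left_mono[OF this m0, of "I (\<tau> j) w" "I (\<tau> (Suc j)) w"]
      show "Z w * (I (\<tau> (Suc j)) w - I (\<tau> j) w) <= m j w * ?d j w"
        by (simp add: Z_def ac_simps)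
    qed (rule int[OF j])
    finally show ?thesis .
  qed
  have isum: "integrable M (%w. SUM j<N. m j w * ?d j w)"
    by (intro Bochner_Integration.integrable_sum int) auto
  have isq: "integrable M (%w. (I (\<tau> N) w)^2)" using Isq[of N] by (simp add: sq_int_def)
  have "(LINT w|M. (m N w)^2) <= (LINT w|M. 4 * (I (\<tau> N) w)^2 - 4 * (SUM j<N. m j w * ?d j w))"
  proof (rule integral_mono)
    show "integrable M (%w. (m N w)^2)" using msq by (simp add: sq_int_def)
    show "integrable M (%w. 4 * (I (\<tau> N) w)^2 - 4 * (SUM j<N. m j w * ?d j w))"
      by (intro Bochner_Integration.integrable_diff integrable_mult_right isq isum)
    show "(m N w)^2 <= 4 * (I (\<tau> N) w)^2 - 4 * (SUM j<N. m j w * ?d j w)" for w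
      using doob_pathwise[of "%i. \<bar>I (\<tau> i) w\<bar>" N] by (simp add: m_def)
  qed
  also have "... = 4 * (LINT w|M. (I (\<tau> N) w)^2) - 4 * (SUM j<N. LINT w|M. m j w * ?d j w)"
  proof -
    have "(LINT w|M. (SUM j<N. m j w * ?d j w)) = (SUM j<N. LINT w|M. m j w * ?d j w)"
      by (intro Bochner_Integration.integral_sum int) auto
    then show ?thesis using isq isum by simp
  qed
  also have "... <= 4 * (LINT w|M. (I (\<tau> N) w)^2)" using sum_nonneg[of "{..<N}", OF pos] by simp
  finally show "(LINT w|M. (runmax (%i. \<bar>I (\<tau> i) w\<bar>) N)^2) <= 4 * (LINT w|M. (I (\<tau> N) w)^2)" by (simp add: m_def)
qed

text \<open>Along a continuous path the supremum is approached on uniform grids. As these are not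
  nested, Fatou's lemma takes the place of monotone convergence.\<close>

lemma doob:
  assumes I: "mgale I" "I : CP"
  shows "(EM w. supsq I w) <= ennreal (4 * (LINT w|M. (I T w)^2))"
proof -
  define m where "m n w = runmax (%i. \<bar>I (gr n i) w\<bar>) (Suc n)" for n w
  have d: "sq_int M (m n)" "(LINT w|M. (m n w)^2) <= 4 * (LINT w|M. (I T w)^2)" for n
    using doob_discrete[OF I(1), of "Suc n" "gr n"] grid_mono[of "Suc n" "gr n"] gr_less gr_range
    by (auto simp: m_def[abs_def] simp del: runmax.simps)
  have "(EM w. supsq I w) <= (EM w. liminf (%n. ennreal ((m n w)^2)))"
  proof (rule nn_integral_mono)
    fix w assume ww: "w : space M"
    show "supsq I w <= liminf (%n. ennreal ((m n w)^2))"
      unfolding supsq_def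
    proof (rule SUP_least)
      fix t assume t: "t : {s..T}"
      have "ennreal ((norm (I t w))^2) = liminf (%n. ennreal ((norm (I (gr n (idx n t)) w))^2))"
        using cont_norm_sq_lim[where X = I and w = w, OF cont_prog_cont[OF I(2) ww] t] by (intro lim_imp_Liminf[symmetric]) auto
      also have "... <= liminf (%n. ennreal ((m n w)^2))"
      proof (intro Liminf_mono always_eventually allI ennreal_leI)
        fix n show "(norm (I (gr n (idx n t)) w))^2 <= (m n w)^2"
          using runmax_ge[OF idx_le[OF t], of "%i. \<bar>I (gr n i) w\<bar>" n] unfolding m_def real_norm_def by (intro power_mono) auto
      qed
      finally show "ennreal ((norm (I t w))^2) <= liminf (%n. ennreal ((m n w)^2))" .
    qed
  qed
  also have "... <= liminf (%n. EM w. ennreal ((m n w)^2))"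
    using d by (intro nn_integral_liminf) (auto simp: sq_int_def)
  also have "... <= liminf (%n::nat. ennreal (4 * (LINT w|M. (I T w)^2)))"
    using d by (intro Liminf_mono always_eventually) (auto simp: nn_integral_sq_eq intro: ennreal_leI)
  finally show ?thesis by (simp add: Liminf_const)
qed

text \<open>A geometric rate turns mean-square convergence into uniform convergence of almost every
  path, without passing to a subsequence. This completeness serves the Ito integral as well as the
  Picard iterates.\<close>

lemma cont_limit:
  fixes X :: "nat => real => 'w => 'h::euclidean_space"
  assumes X: "!!k. X k : CP"
    and c: "!!k. (EM w. supsq (%t w. X (Suc k) t w - X k t w) w) <= ennreal (c / 4 ^ k)"
  shows "EX Y:CP. (%k. EM w. supsq (%t w. X k t w - Y t w) w) ----> 0"
proof -

  define e where "e k w = supsq (%t w. X (Suc k) t w - X k t w) w" for k w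
  have em[measurable]: "e k : meas M" for k
    unfolding e_def[abs_def] by (intro supsq_meas cont_prog_diff X)
  \<comment> \<open>The weights \<open>2 ^ k\<close> are summable against the assumed decay
    \<open>4 ^ k\<close> and still leave a geometric rate on every path where \<open>G\<close> is
    finite.\<close>
  define G where "G w = (\<Sum>k. ennreal (2 ^ k) * e k w)" for w
  have Gm[measurable]: "G : meas M" unfolding G_def[abs_def] by measurable
  have GI: "(EM w. G w) <= ennreal (2 * \<bar>c\<bar>)"
  proof -
    have "(EM w. G w) = (\<Sum>k. EM w. ennreal (2 ^ k) * e k w)"
      unfolding G_def by (rule nn_integral_suminf) measurable
    also have "... <= (\<Sum>k. ennreal (\<bar>c\<bar> * (1/2) ^ k))"
    proof (intro suminf_le summableI)
      fix k
      have "(EM w. ennreal (2 ^ k) * e k w) = ennreal (2 ^ k) * (EM w. e k w)"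
        by (rule nn_integral_cmult) measurable
      also have "... <= ennreal (2 ^ k) * ennreal (\<bar>c\<bar> / 4 ^ k)"
      proof (intro mult_left_mono)
        have "c / 4 ^ k <= \<bar>c\<bar> / 4 ^ k" by (intro divide_right_mono) auto
        then show "(EM w. e k w) <= ennreal (\<bar>c\<bar> / 4 ^ k)"
          using order_trans[OF c[of k] ennreal_leI] unfolding e_def by blast
      qed simp
      also have "... = ennreal (\<bar>c\<bar> * (1/2) ^ k)"
      proof -
        have "(2::real) ^ k / 4 ^ k = (1/2) ^ k" by (simp add: power_divide[symmetric])
        then show ?thesis by (simp add: ennreal_mult[symmetric] field_simps)
      qed
      finally show "(EM w. ennreal (2 ^ k) * e k w) <= ennreal (\<bar>c\<bar> * (1/2) ^ k)" .
    qed
    also have "... = ennreal (\<Sum>k. \<bar>c\<bar> * (1/2) ^ k)"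
      by (intro suminf_ennreal2 summable_mult summable_geometric) auto
    also have "(\<Sum>k. \<bar>c\<bar> * (1/2) ^ k :: real) = 2 * \<bar>c\<bar>"
      by (subst suminf_mult) (auto simp: suminf_geometric)
    finally show ?thesis .
  qed
  have Gfin: "AE w in M. G w < \<infinity>"
  proof -
    have "(EM w. G w) < \<top>" using GI by (rule le_less_trans) simp
    then show ?thesis using nn_integral_PInf_AE[of G M] by (auto simp: less_top)
  qed
  \<comment> \<open>From \<open>2 ^ k * e k <= G\<close> each step is at most
    \<open>g * \<rho> ^ k\<close>.\<close>
  define \<rho> :: real where "\<rho> = 1 / sqrt 2"
  have \<rho>: "0 < \<rho>" "\<rho> < 1" by (auto simp: \<rho>_def)
  have \<rho>2: "(\<rho> ^ k)^2 = 1 / 2 ^ k" for k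
  proof -
    have "(\<rho> ^ k)^2 = (\<rho>^2) ^ k" by (simp add: power_mult[symmetric] mult.commute)
    also have "\<rho>^2 = 1 / 2" by (simp add: \<rho>_def power_divide)
    finally show ?thesis by (simp add: power_divide)
  qed
  define g where "g w = sqrt (enn2real (G w))" for w
  have step: "norm (X (Suc k) t w - X k t w) <= g w * \<rho> ^ k" if "G w < \<infinity>" "t : {s..T}" for k t w
  proof -
    have "ennreal (2 ^ k) * ennreal ((norm (X (Suc k) t w - X k t w))^2) <= ennreal (2 ^ k) * e k w"
      unfolding e_def by (intro mult_left_mono supsq_ge[of t "%t w. X (Suc k) t w - X k t w"] that) auto
    also have "... <= G w" unfolding G_def
      using sum_le_suminf[of "%k. ennreal (2 ^ k) * e k w" "{k}"] by (simp add: summableI)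
    also have "... = ennreal (enn2real (G w))" using that by simp
    finally have "2 ^ k * (norm (X (Suc k) t w - X k t w))^2 <= enn2real (G w)"
      by (simp add: ennreal_mult[symmetric] del: ennreal_enn2real)
    then have "(norm (X (Suc k) t w - X k t w))^2 <= (g w * \<rho> ^ k)^2"
      by (simp add: power_mult_distrib \<rho>2 g_def field_simps)
    then show ?thesis by (rule power2_le_imp_le) (use \<rho> in \<open>auto simp: g_def\<close>)
  qed
  have cauchy_bound: "norm (X (k + j) t w - X k t w) <= g w * \<rho> ^ k / (1 - \<rho>)" if "G w < \<infinity>" "t : {s..T}" for k j t w
  proof -
    have "norm (X (k + j) t w - X k t w) <= (SUM i<j. norm (X (Suc (k + i)) t w - X (k + i) t w))"
    proof (induction j)
      case (Suc j)
      have "norm (X (k + Suc j) t w - X k t w) <= norm (X (Suc (k + j)) t w - X (k + j) t w) + norm (X (k + j) t w - X k t w)"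
        using norm_triangle_ineq[of "X (Suc (k + j)) t w - X (k + j) t w" "X (k + j) t w - X k t w"] by simp
      then show ?case using Suc by simp
    qed simp
    also have "... <= (SUM i<j. g w * \<rho> ^ (k + i))" by (intro sum_mono step that)
    also have "... = g w * \<rho> ^ k * (SUM i<j. \<rho> ^ i)" by (simp add: sum_distrib_left power_add ac_simps)
    also have "... <= g w * \<rho> ^ k * (1 / (1 - \<rho>))"
    proof (rule mult_left_mono)
      have "(SUM i<j. \<rho> ^ i) <= (\<Sum>i. \<rho> ^ i)" using \<rho> by (intro sum_le_suminf summable_geometric) auto
      then show "(SUM i<j. \<rho> ^ i) <= 1 / (1 - \<rho>)" using \<rho> by (simp add: suminf_geometric)
    qed (use \<rho> in \<open>auto simp: g_def\<close>)
    finally show ?thesis by simp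
  qed
  have rtend: "(%k. g w * \<rho> ^ k / (1 - \<rho>)) ----> 0" for w
    using \<rho> tendsto_divide[OF tendsto_mult[OF tendsto_const[of "g w"] LIMSEQ_power_zero[of \<rho>]] tendsto_const[of "1 - \<rho>"]] by simp
  \<comment> \<open>The value zero off \<open>G < \<infinity>\<close> keeps every path continuous;
    that set is null and belongs to each \<open>F t\<close>, so adaptedness survives.\<close>
  define Y where "Y t w = (if G w < \<infinity> then lim (%k. X k t w) else 0)" for t w
  have conv: "(%k. X k t w) ----> Y t w" if G: "G w < \<infinity>" and t: "t : {s..T}" for t w
  proof -
    have "Cauchy (%k. X k t w)"
    proof (rule metric_CauchyI)
      fix \<epsilon> :: real assume "\<epsilon> > 0"
      then have "\<forall>\<^sub>F k in sequentially. g w * \<rho> ^ k / (1 - \<rho>) < \<epsilon> / 2" using rtend[of w] by (intro order_tendstoD) auto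
      then obtain k where k: "g w * \<rho> ^ k / (1 - \<rho>) < \<epsilon> / 2" by (auto simp: eventually_sequentially)
      show "EX K. ALL m>=K. ALL n>=K. dist (X m t w) (X n t w) < \<epsilon>"
      proof (intro exI[of _ k] allI impI)
        fix m n assume "k <= m" "k <= n"
        then have "norm (X m t w - X k t w) < \<epsilon> / 2" "norm (X n t w - X k t w) < \<epsilon> / 2"
          using le_less_trans[OF cauchy_bound[OF G t, of k "m - k"] k] le_less_trans[OF cauchy_bound[OF G t, of k "n - k"] k]
          by simp_all
        then show "dist (X m t w) (X n t w) < \<epsilon>"
          using norm_triangle_ineq4[of "X m t w - X k t w" "X n t w - X k t w"] by (simp add: dist_norm)
      qed
    qed
    then have "convergent (%k. X k t w)" by (simp add: Cauchy_convergent_iff)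
    then show ?thesis using G by (simp add: Y_def convergent_LIMSEQ_iff)
  qed
  have dist_bound: "norm (X k t w - Y t w) <= g w * \<rho> ^ k / (1 - \<rho>)" if G: "G w < \<infinity>" and t: "t : {s..T}" for k t w
  proof (rule LIMSEQ_le_const2)
    show "(%j. norm (X k t w - X (k + j) t w)) ----> norm (X k t w - Y t w)"
      using LIMSEQ_ignore_initial_segment[OF conv[OF G t], of k] by (intro tendsto_intros) (simp add: add.commute)
    show "EX N. ALL n>=N. norm (X k t w - X (k + n) t w) <= g w * \<rho> ^ k / (1 - \<rho>)"
      using cauchy_bound[OF G t, of k] by (auto simp: norm_minus_commute)
  qed
  have "Y : CP"
  proof (rule adapted_cont_prog)
    fix t assume t: "t : {s..T}"
    have "{w : space M. ~ G w < \<infinity>} : null_sets M"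
      using Gfin by (intro AE_iff_null_sets[THEN iffD2]) auto
    then have "space M - {w : space M. ~ G w < \<infinity>} : sets (F t)"
      using null_sets_F[of t] t s0 sets.compl_sets[of _ "F t"] by auto
    then have Gs: "{w : space (F t). G w < \<infinity>} : sets (F t)" by (simp add: set_diff_eq Collect_conj_eq[symmetric] cong: conj_cong)
    show "Y t : meas (F t)"
    proof (rule borel_measurable_LIMSEQ_metric)
      show "(%w. if G w < \<infinity> then X k t w else 0) : meas (F t)" for k
        by (intro measurable_If cont_prog_adapted[OF X t] measurable_const Gs) auto
      show "(%k. if G w < \<infinity> then X k t w else 0) ----> Y t w" for w
        using conv[OF _ t, of w] by (cases "G w < \<infinity>") (auto simp: Y_def)
    qed
  next
    fix w assume ww: "w : space M"
    show "continuous_on {s..T} (%t. Y t w)"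
    proof (cases "G w < \<infinity>")
      case True
      show ?thesis
      proof (rule uniform_limit_theorem[where F = sequentially and f = "%k t. X k t w"])
        show "\<forall>\<^sub>F k in sequentially. continuous_on {s..T} (%t. X k t w)"
          using cont_prog_cont[OF X ww] by auto
        show "uniform_limit {s..T} (%k t. X k t w) (%t. Y t w) sequentially"
        proof (rule uniform_limitI)
          fix \<epsilon> :: real assume "\<epsilon> > 0"
          then have "\<forall>\<^sub>F k in sequentially. g w * \<rho> ^ k / (1 - \<rho>) < \<epsilon>" using rtend[of w] by (intro order_tendstoD) auto
          then show "\<forall>\<^sub>F k in sequentially. ALL t:{s..T}. dist (X k t w) (Y t w) < \<epsilon>"
          proof eventually_elim
            case (elim k)
            show ?case unfolding dist_norm using le_less_trans[OF dist_bound[OF True] elim] by blast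
          qed
        qed
      qed simp
    next
      case False then show ?thesis by (simp add: Y_def)
    qed
  qed
  moreover have "(%k. EM w. supsq (%t w. X k t w - Y t w) w) ----> 0"
  proof (rule tendsto_sandwich[OF _ _ tendsto_const])
    show "\<forall>\<^sub>F k in sequentially. (EM w. supsq (%t w. X k t w - Y t w) w) <= ennreal (((1/2) ^ k / (1 - \<rho>)^2) * (2 * \<bar>c\<bar>))"
    proof (intro always_eventually allI)
      fix k
      have "(EM w. supsq (%t w. X k t w - Y t w) w) <= (EM w. ennreal ((1/2) ^ k / (1 - \<rho>)^2) * G w)"
      proof (rule nn_integral_mono_AE)
        show "AE w in M. supsq (%t w. X k t w - Y t w) w <= ennreal ((1/2) ^ k / (1 - \<rho>)^2) * G w"
          using Gfin
        proof eventually_elim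
          case (elim w)
          show ?case unfolding supsq_def
          proof (rule SUP_least)
            fix t assume t: "t : {s..T}"
            have "(norm (X k t w - Y t w))^2 <= (g w * \<rho> ^ k / (1 - \<rho>))^2"
              using dist_bound[OF elim t] by (intro power_mono) auto
            also have "... = (1/2) ^ k / (1 - \<rho>)^2 * enn2real (G w)"
              by (simp add: power_mult_distrib power_divide \<rho>2 g_def)
            finally have "ennreal ((norm (X k t w - Y t w))^2) <= ennreal ((1/2) ^ k / (1 - \<rho>)^2 * enn2real (G w))"
              by (rule ennreal_leI)
            also have "... = ennreal ((1/2) ^ k / (1 - \<rho>)^2) * G w" using elim by (subst ennreal_mult) auto
            finally show "ennreal ((norm (X k t w - Y t w))^2) <= ennreal ((1/2) ^ k / (1 - \<rho>)^2) * G w" .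
          qed
        qed
      qed
      also have "... = ennreal ((1/2) ^ k / (1 - \<rho>)^2) * (EM w. G w)" by (rule nn_integral_cmult) measurable
      also have "... <= ennreal ((1/2) ^ k / (1 - \<rho>)^2) * ennreal (2 * \<bar>c\<bar>)" by (intro mult_left_mono GI) auto
      also have "... = ennreal (((1/2) ^ k / (1 - \<rho>)^2) * (2 * \<bar>c\<bar>))" by (rule ennreal_mult[symmetric]) auto
      finally show "(EM w. supsq (%t w. X k t w - Y t w) w) <= ennreal (((1/2) ^ k / (1 - \<rho>)^2) * (2 * \<bar>c\<bar>))" .
    qed
    have "(%k. ennreal (((1/2) ^ k / (1 - \<rho>)^2) * (2 * \<bar>c\<bar>))) ----> ennreal ((0 / (1 - \<rho>)^2) * (2 * \<bar>c\<bar>))"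
      using \<rho> by (intro tendsto_ennrealI tendsto_mult tendsto_const tendsto_divide LIMSEQ_power_zero) auto
    then show "(%k. ennreal (((1/2) ^ k / (1 - \<rho>)^2) * (2 * \<bar>c\<bar>))) ----> 0" by simp
  qed auto
  ultimately show ?thesis by blast
qed

end

section \<open>Existence of the Ito integral\<close>

text \<open>Lebesgue differentiation for windows ending at \<open>t\<close>, obtained from the
  statement for windows starting at a point by reflecting the line. Only averages over the past lead
  to adapted step functions.\<close>

lemma left_average_AE:
  fixes f :: "real => 'h::euclidean_space"
  assumes f: "integrable lborel f"
  shows "AE t in lborel. ALL e>0. EX d>0. ALL h. 0 < h & h < d -->
     norm ((1 / h) *\<^sub>R (LINT r:{t - h..t}|lborel. f r) - f t) < e"
proof -
  have fm: "integrable lborel (%x. f (- x))" using lborel_integrable_real_affine[OF f, of "-1" 0] by simp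
  have "(%x. f (- x)) integrable_on cbox a b" for a b :: real
    using integrable_on_subcbox[OF integrable_on_lborel[OF fm]] by auto
  then obtain N where N: "negligible N"
    "!!x e. x ~: N ==> 0 < e ==> EX d>0. ALL h. 0 < h & h < d -->
        norm (integral (cbox x (x + h *\<^sub>R One)) (%x. f (- x)) /\<^sub>R h ^ DIM(real) - f (- x)) < e"
    using integrable_ccontinuous_explicit[of "%x. f (- x)"] by metis
  have "AE x in lebesgue. x ~: N" using N(1) by (auto simp: negligible_iff_null_sets intro: AE_not_in)
  then have "AE x in lborel. x ~: N" by (simp add: AE_completion_iff)
  then obtain N' where N': "N' : null_sets lborel" "!!x. x ~: N' ==> x ~: N" by (auto elim!: AE_E3)
  have "AE x in lborel. x ~: N'" using N'(1) by (rule AE_not_in)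
  then have "AE x in lborel. 0 + (-1) * x ~: N'"
    using N'(1) by (intro AE_borel_affine) (auto simp: null_sets_def)
  then show ?thesis
  proof eventually_elim
    case (elim t)
    then have "- t ~: N" using N'(2) by simp
    show ?case
    proof (intro allI impI)
      fix e :: real assume "e > 0"
      from N(2)[OF \<open>- t ~: N\<close> this] obtain d where d: "d > 0"
        "!!h. 0 < h ==> h < d ==> norm (integral (cbox (- t) (- t + h)) (%x. f (- x)) /\<^sub>R h - f t) < e" by auto
      have "integral (cbox (- t) (- t + h)) (%x. f (- x)) = (LINT r:{t - h..t}|lborel. f r)" for h
      proof -
        have "integral {- t..- (t - h)} (%x. f (- x)) = integral {t - h..t} f"
          by (rule Henstock_Kurzweil_Integration.integral_reflect_real)
        moreover have "set_integrable lborel {t - h..t} f"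
          using f unfolding set_integrable_def by (intro integrable_mult_indicator) auto
        ultimately show ?thesis by (simp add: set_borel_integral_eq_integral(2))
      qed
      then show "EX d>0. ALL h. 0 < h & h < d --> norm ((1 / h) *\<^sub>R (LINT r:{t - h..t}|lborel. f r) - f t) < e"
        using d by (intro exI[of _ d]) (auto simp: inverse_eq_divide)
    qed
  qed
qed

lemma norm_set_lint_le:
  fixes f :: "real => 'h::euclidean_space"
  assumes f: "f : meas lborel" "!!r. norm (f r) <= K" and "a <= b"
  shows "set_integrable lborel {a..b} f" "norm (LINT r:{a..b}|lborel. f r) <= K * (b - a)"
proof -
  show int: "set_integrable lborel {a..b} f"
    unfolding set_integrable_def
  proof (rule Bochner_Integration.integrable_bound[of _ "%r. K * indicator {a..b} r"])
    show "AE r in lborel. norm (indicator {a..b} r *\<^sub>R f r) <= norm (K * indicator {a..b} r)"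
      using f(2) by (intro AE_I2) (auto simp: indicator_def intro: order_trans[OF f(2) abs_ge_self])
    show "integrable lborel (%r. K * indicator {a..b} r)"
      by (intro integrable_mult_right integrable_real_indicator) (auto simp: emeasure_lborel_Icc_eq)
  qed (use f in auto)
  have "norm (LINT r:{a..b}|lborel. f r) <= (LINT r|lborel. norm (indicator {a..b} r *\<^sub>R f r))"
    unfolding set_lebesgue_integral_def by (rule integral_norm_bound)
  also have "... <= (LINT r|lborel. K * indicator {a..b} r)"
  proof (rule integral_mono)
    show "integrable lborel (%r. norm (indicator {a..b} r *\<^sub>R f r))" using int unfolding set_integrable_def by (rule integrable_norm)
    show "integrable lborel (%r. K * indicator {a..b} r)"
      by (intro integrable_mult_right integrable_real_indicator) (auto simp: emeasure_lborel_Icc_eq)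
  qed (use f(2) in \<open>auto simp: indicator_def\<close>)
  also have "... = K * (b - a)" using assms(3) by simp
  finally show "norm (LINT r:{a..b}|lborel. f r) <= K * (b - a)" .
qed

text \<open>Moving the window by \<open>t - u\<close> adds the integral over one interval of that
  length and removes the integral over another.\<close>

lemma average_shift:
  fixes f :: "real => 'h::euclidean_space"
  assumes f: "f : meas lborel" "!!r. norm (f r) <= K" and "u <= t" "0 < h"
  shows "norm ((LINT r:{t - h..t}|lborel. f r) - (LINT r:{u - h..u}|lborel. f r)) <= 2 * K * (t - u)"
proof -
  note i = norm_set_lint_le(1)[OF f]
  have I: "(LINT r:{a..c}|lborel. f r) = (LINT r:{a..b}|lborel. f r) + (LINT r:{b..c}|lborel. f r)" if "a <= b" "b <= c" for a b c
  proof -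
    have "integral {a..b} f + integral {b..c} f = integral {a..c} f"
      using i[of a c] that by (intro Henstock_Kurzweil_Integration.integral_combine) (auto intro: set_borel_integral_eq_integral(1))
    then show ?thesis using i[of a b] i[of b c] i[of a c] that by (simp add: set_borel_integral_eq_integral(2))
  qed
  have "(LINT r:{u - h..u}|lborel. f r) + (LINT r:{u..t}|lborel. f r) = (LINT r:{u - h..t - h}|lborel. f r) + (LINT r:{t - h..t}|lborel. f r)"
    using I[of "u - h" u t] I[of "u - h" "t - h" t] assms(3,4) by simp
  then have "(LINT r:{t - h..t}|lborel. f r) - (LINT r:{u - h..u}|lborel. f r) =
     (LINT r:{u..t}|lborel. f r) - (LINT r:{u - h..t - h}|lborel. f r)" by (simp add: algebra_simps)
  also have "norm ... <= K * (t - u) + K * ((t - h) - (u - h))"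
    using norm_set_lint_le(2)[OF f, of u t] norm_set_lint_le(2)[OF f, of "u - h" "t - h"] assms(3)
    by (intro order_trans[OF norm_triangle_ineq4 add_mono]) simp_all
  finally show ?thesis by (simp add: algebra_simps)
qed

lemma ennreal_norm_add_sq:
  fixes a b :: "'h::real_normed_vector"
  shows "ennreal ((norm (a + b))^2) <= 2 * ennreal ((norm a)^2) + 2 * ennreal ((norm b)^2)"
proof -
  have "(norm (a + b))^2 <= (norm a + norm b)^2" by (intro power_mono norm_triangle_ineq) auto
  also have "... <= 2 * (norm a)^2 + 2 * (norm b)^2"
    using sum_squares_bound[of "norm a" "norm b"] by (simp add: power2_sum)
  finally have "ennreal ((norm (a + b))^2) <= ennreal (2 * (norm a)^2 + 2 * (norm b)^2)" by (rule ennreal_leI)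
  then show ?thesis by (simp add: ennreal_mult)
qed

context brownian
begin

text \<open>The squared norm of square-integrable functions on \<open>Pm\<close>, with the value
  infinity allowed; a progressive process lies in \<open>L2P\<close> exactly if it is
  finite.\<close>

definition pn :: "(real => 'w => 'h::euclidean_space) => ennreal" where
  "pn X = (EP z. ennreal ((norm (ev X z))^2))"

lemma pn_iter:
  assumes "ev X : meas Pm"
  shows "(EM w. (\<integral>\<^sup>+ t\<in>{s..T}. ennreal ((norm (X t w))^2) \<partial>lborel)) = pn X"
  unfolding pn_def using assms by (subst nn_Pm) auto

lemma ev_diff: "ev (%t w. X t w - Y t w) = (%z. ev X z - ev Y z)" by (auto simp: ev_def)

lemma L2_prog_pn: "X : L2_prog M F s T H \<longleftrightarrow> X : prog_measurable M F s T H & pn X < \<infinity>"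
  by (cases "X : prog_measurable M F s T H") (auto simp: L2_prog_def pn_iter[OF prog_ev[where H = H]])

lemma pn_diff_triangle:
  assumes "ev X : meas Pm" "ev Y : meas Pm" "ev W : meas Pm"
  shows "pn (%t w. X t w - Y t w) <= 2 * pn (%t w. X t w - W t w) + 2 * pn (%t w. W t w - Y t w)"
proof -
  have "pn (%t w. X t w - Y t w) <= (EP z. 2 * ennreal ((norm (ev X z - ev W z))^2) + 2 * ennreal ((norm (ev W z - ev Y z))^2))"
    unfolding pn_def ev_diff
    using ennreal_norm_add_sq[of "ev X z - ev W z" "ev W z - ev Y z" for z] by (intro nn_integral_mono) simp
  also have "... = 2 * pn (%t w. X t w - W t w) + 2 * pn (%t w. W t w - Y t w)"
    unfolding pn_def ev_diff using assms by (subst nn_integral_add) (auto simp: nn_integral_cmult)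
  finally show ?thesis .
qed

lemma pn_diff_commute: "pn (%t w. X t w - Y t w) = pn (%t w. Y t w - X t w)"
  unfolding pn_def ev_diff by (simp add: norm_minus_commute)

lemma grid_cell:
  assumes "\<tau> 0 < t" "t <= \<tau> N" shows "EX i<N. \<tau> i < t & t <= (\<tau> (Suc i) :: real)"
  using assms(2)
proof (induction N)
  case 0 then show ?case using assms by simp
next
  case (Suc N)
  show ?case
  proof (cases "t <= \<tau> N")
    case True then show ?thesis using Suc by (auto intro: less_SucI)
  next
    case False then show ?thesis using Suc by (intro exI[of _ N]) auto
  qed
qed

lemma simple_process_at:
  assumes \<tau>: "ALL i<N. \<tau> i < \<tau> (Suc i)" and i: "i < N" "\<tau> i < t" "t <= \<tau> (Suc i)"
  shows "simple_process N \<tau> \<eta> t w = \<eta> i w"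
proof -
  have "indicator {\<tau> j<..\<tau> (Suc j)} t *\<^sub>R \<eta> j w = (if j = i then \<eta> i w else 0)" if "j < N" for j
  proof (cases "j = i")
    case False
    have "~ (\<tau> j < t & t <= \<tau> (Suc j))"
    proof (cases "j < i")
      case True
      then have "\<tau> (Suc j) <= \<tau> i" using grid_mono[OF \<tau>, of "Suc j" i] i by auto
      then show ?thesis using i by auto
    next
      case False
      then have "\<tau> (Suc i) <= \<tau> j" using grid_mono[OF \<tau>, of "Suc i" j] \<open>j ~= i\<close> that by auto
      then show ?thesis using i by auto
    qed
    then show ?thesis using False by (auto simp: indicator_def)
  qed (use i in auto)
  then have "simple_process N \<tau> \<eta> t w = (SUM j<N. if j = i then \<eta> i w else 0)"
    unfolding simple_process_def by (intro sum.cong) auto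
  then show ?thesis using i by simp
qed

lemma prog_section:
  fixes Y :: "real => 'w => 'h::euclidean_space"
  assumes "ev Y : meas Pm" "w : space M"
  shows "(%r. indicator {s..T} r *\<^sub>R Y r w) : meas lborel"
proof -
  have "(%t. ev Y (w, t)) : meas lam"
    using assms by (intro measurable_Pair2[of _ M]) (auto simp: Pm_def)
  then show ?thesis
    using borel_measurable_restrict_space_iff[of "{s..T}" lborel "%t. ev Y (w, t)"] unfolding lam_def by simp
qed

text \<open>Windows reaching back before \<open>s\<close> are cut off there. On
  \<open>[s, t]\<close> progressive measurability makes the integrand jointly measurable with
  respect to \<open>F t\<close>, and integrating out the time preserves this.\<close>

lemma adapted_set_lint:
  fixes Y :: "real => 'w => 'h::euclidean_space"
  assumes Y: "Y : PM" and t: "t : {s..T}"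
  shows "(%w. LINT r:{a..t}|lborel. indicator {s..T} r *\<^sub>R Y r w) : meas (F t)"
proof -
  let ?l = "restrict_space lborel {s..t}"
  interpret l: sigma_finite_measure ?l by (rule sigma_finite_measure_restrict_space) (auto intro: sigma_finite_lborel)
  have 1: "(%(r, w). Y r w) : meas (restrict_space borel {s..t} \<Otimes>\<^sub>M F t)"
    using Y t by (auto simp: prog_measurable_def)
  have "(%z. (snd z, fst z)) : measurable (F t \<Otimes>\<^sub>M ?l) (restrict_space borel {s..t} \<Otimes>\<^sub>M F t)"
  proof (rule measurable_Pair)
    have "measurable (F t \<Otimes>\<^sub>M ?l) ?l = measurable (F t \<Otimes>\<^sub>M ?l) (restrict_space borel {s..t})"
      by (intro measurable_cong_sets refl sets_restrict_space_cong) simp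
    then show "snd : measurable (F t \<Otimes>\<^sub>M ?l) (restrict_space borel {s..t})" using measurable_snd[of "F t" ?l] by simp
  qed simp
  from measurable_compose[OF this 1]
  have m: "(%z. Y (snd z) (fst z)) : meas (F t \<Otimes>\<^sub>M ?l)" by simp
  have s: "snd : meas (F t \<Otimes>\<^sub>M ?l)"
    by (rule measurable_compose[OF measurable_snd]) (simp add: measurable_restrict_space1)
  have "(%z. indicator {a..t} (snd z) *\<^sub>R Y (snd z) (fst z)) : meas (F t \<Otimes>\<^sub>M ?l)"
    by (intro borel_measurable_scaleR m measurable_compose[OF s]) simp
  then have "(%w. \<integral>r. indicator {a..t} r *\<^sub>R Y r w \<partial>?l) : meas (F t)"
    by (intro l.borel_measurable_lebesgue_integral) (simp add: split_beta')
  moreover have "(\<integral>r. indicator {a..t} r *\<^sub>R Y r w \<partial>?l) = (LINT r:{a..t}|lborel. indicator {s..T} r *\<^sub>R Y r w)" for w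
    unfolding set_lebesgue_integral_def using t
    by (subst integral_restrict_space) (auto intro!: Bochner_Integration.integral_cong simp: indicator_def)
  ultimately show ?thesis by simp
qed

text \<open>Average over the past window of length \<open>h\<close>, then sample the average at left
  end points of a grid much finer than \<open>h\<close>. The average converges by differentiation;
  the sampling error is at most \<open>2 * K * mesh / h\<close>.\<close>

lemma simple_dense_bounded:
  fixes Y :: "real => 'w => 'h::euclidean_space"
  assumes Y: "Y : PM" and K: "!!t w. t : {s..T} ==> w : space M ==> norm (Y t w) <= K"
  obtains N \<tau> \<eta> where "!!k::nat. simple_integrand M F s T (N k) (\<tau> k) (\<eta> k)"
    "(%k. pn (%t w. simple_process (N k) (\<tau> k) (\<eta> k) t w - Y t w)) ----> 0"
proof -
  have Yev[measurable]: "ev Y : meas Pm" by (rule prog_ev[OF Y])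
  obtain w0 where "w0 : space M" using not_empty by blast
  then have K0: "0 <= K" using K[of s w0] sT by (auto intro: order_trans[OF norm_ge_zero])
  \<comment> \<open>Extension by zero, so that windows near \<open>s\<close> may start before
    \<open>s\<close>.\<close>
  define f where "f w r = indicator {s..T} r *\<^sub>R Y r w" for w r
  have fm: "f w : meas lborel" if "w : space M" for w
    using prog_section[OF Yev that] by (simp add: f_def[abs_def])
  have fK: "norm (f w r) <= K" if "w : space M" for w r
    using K[OF _ that, of r] K0 by (auto simp: f_def indicator_def)
  define av where "av h t w = (1 / h) *\<^sub>R (LINT r:{t - h..t}|lborel. f w r)" for h t w
  define h where "h k = 1 / real (Suc k)" for k
  have h: "0 < h k" for k by (simp add: h_def)
  \<comment> \<open>The square makes the mesh at most \<open>(T - s) * h^2\<close>, so that the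
    sampling error is still of order \<open>h\<close> after division by \<open>h\<close>.\<close>
  define n where "n k = (Suc k)^2" for k
  define \<tau> where "\<tau> k = gr (n k)" for k
  define \<eta> where "\<eta> k i w = av (h k) (\<tau> k i) w" for k i w
  have avK: "norm (av (h k) t w) <= K" if "w : space M" for k t w
  proof -
    have "norm (av (h k) t w) = (1 / h k) * norm (LINT r:{t - h k..t}|lborel. f w r)"
      unfolding av_def using h[of k] by simp
    also have "... <= (1 / h k) * (K * (t - (t - h k)))"
      using h[of k] norm_set_lint_le(2)[OF fm[OF that] fK[OF that], of "t - h k" t] by (intro mult_left_mono) auto
    also have "... = K" using h[of k] by simp
    finally show ?thesis .
  qed
  have simp: "simple_integrand M F s T (Suc (n k)) (\<tau> k) (\<eta> k)" for k
    unfolding simple_integrand_def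
  proof (intro conjI allI impI)
    show "\<tau> k 0 = s" "\<tau> k (Suc (n k)) = T" by (simp_all add: \<tau>_def)
    show "\<tau> k i < \<tau> k (Suc i)" for i by (simp add: \<tau>_def gr_less)
    fix i assume i: "i < Suc (n k)"
    have ti: "\<tau> k i : {s..T}" using gr_range[of i "n k"] i by (simp add: \<tau>_def)
    show "\<eta> k i : meas (F (\<tau> k i))"
      unfolding \<eta>_def[abs_def] av_def f_def by (intro borel_measurable_scaleR adapted_set_lint[OF Y ti] measurable_const) simp
    show "EX K. ALL w:space M. norm (\<eta> k i w) <= K" using avK by (auto simp: \<eta>_def)
  qed
  define P where "P k = simple_process (Suc (n k)) (\<tau> k) (\<eta> k)" for k
  have close: "norm (P k t w - av (h k) t w) <= 2 * K * (T - s) * h k" if ww: "w : space M" and t: "s < t" "t <= T" for k t w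
  proof -
    have "\<tau> k 0 < t" "t <= \<tau> k (Suc (n k))" using t by (auto simp: \<tau>_def)
    from grid_cell[OF this] obtain i where i: "i < Suc (n k)" "\<tau> k i < t" "t <= \<tau> k (Suc i)" by blast
    have "P k t w = \<eta> k i w" unfolding P_def by (rule simple_process_at) (use i in \<open>auto simp: \<tau>_def gr_less\<close>)
    then have "norm (P k t w - av (h k) t w) = norm (av (h k) t w - av (h k) (\<tau> k i) w)"
      by (simp add: \<eta>_def norm_minus_commute)
    also have "... = (1 / h k) * norm ((LINT r:{t - h k..t}|lborel. f w r) - (LINT r:{\<tau> k i - h k..\<tau> k i}|lborel. f w r))"
      unfolding av_def scaleR_diff_right[symmetric] using h[of k] by simp
    also have "... <= (1 / h k) * (2 * K * (t - \<tau> k i))"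
      using average_shift[OF fm[OF ww] fK[OF ww], of "\<tau> k i" t "h k"] h[of k] i by (intro mult_left_mono) auto
    also have "... <= (1 / h k) * (2 * K * ((T - s) * (h k)^2))"
    proof (intro mult_left_mono)
      have "t - \<tau> k i <= (T - s) / real (Suc (n k))" using i(3) by (simp add: \<tau>_def gr_step del: of_nat_Suc)
      also have "... <= (T - s) / (real (Suc k))^2"
      proof (rule frac_le)
        show "(real (Suc k))^2 <= real (Suc (n k))" by (simp add: n_def)
        show "0 < (real (Suc k))^2" by (intro zero_less_power) simp
      qed (use sT in auto)
      also have "... = (T - s) * (h k)^2" by (simp add: h_def power_divide)
      finally show "t - \<tau> k i <= (T - s) * (h k)^2" .
    qed (use K0 h[of k] in auto)
    also have "... = 2 * K * (T - s) * h k" using h[of k] by (simp add: power2_eq_square)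
    finally show ?thesis .
  qed
  have PK: "norm (P k t w) <= K" if ww: "w : space M" for k t w
  proof (cases "s < t & t <= T")
    case True
    then have "\<tau> k 0 < t" "t <= \<tau> k (Suc (n k))" by (auto simp: \<tau>_def)
    from grid_cell[OF this] obtain i where i: "i < Suc (n k)" "\<tau> k i < t" "t <= \<tau> k (Suc i)" by blast
    have "P k t w = \<eta> k i w" unfolding P_def by (rule simple_process_at) (use i in \<open>auto simp: \<tau>_def gr_less\<close>)
    then show ?thesis using avK[OF ww] by (simp add: \<eta>_def)
  next
    case False
    have "indicator {\<tau> k i<..\<tau> k (Suc i)} t = (0::real)" if "i < Suc (n k)" for i
      using False gr_range[of i "n k"] gr_range[of "Suc i" "n k"] that by (auto simp: indicator_def \<tau>_def)
    then have "P k t w = 0" unfolding P_def simple_process_def by simp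
    then show ?thesis using K0 by simp
  qed
  have Pev[measurable]: "ev (P k) : meas Pm" for k unfolding P_def by (rule simple_process_ev[OF simp])
  have bd: "(norm (P k t w - Y t w))^2 <= (2 * K)^2" if "t : {s..T}" "w : space M" for k t w
  proof (intro power_mono)
    show "norm (P k t w - Y t w) <= 2 * K"
      using norm_triangle_ineq4[of "P k t w" "Y t w"] PK[OF that(2), of k t] K[OF that] by simp
  qed auto
  have h0: "(%k. 2 * K * (T - s) * h k) ----> 0"
    unfolding h_def using LIMSEQ_Suc[OF lim_const_over_n[of "2 * K * (T - s)"]] by simp
  \<comment> \<open>The exceptional set of times is known to be null only for each single path.
    Dominated convergence is therefore applied in time for fixed sample point first, and then over
    the sample space.\<close>
  have inner: "(%k. LINT t|lam. (norm (P k t w - Y t w))^2) ----> (LINT t|lam. 0)" if ww: "w : space M" for w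
  proof (rule integral_dominated_convergence[where w = "%_. (2 * K)^2"])
    have "integrable lborel (f w)"
    proof -
      have "(%r. indicator {s..T} r *\<^sub>R f w r) = f w" by (auto simp: f_def indicator_def)
      then show ?thesis using norm_set_lint_le(1)[OF fm[OF ww] fK[OF ww], of s T] sT unfolding set_integrable_def by simp
    qed
    from left_average_AE[OF this] have "AE t in lborel. t : {s..T} --> t ~= s --> (%k. (norm (P k t w - Y t w))^2) ----> 0"
    proof eventually_elim
      case (elim t)
      show ?case
      proof (intro impI)
        assume t: "t : {s..T}" "t ~= s"
        have "(%k. av (h k) t w) ----> f w t"
        proof (rule LIMSEQ_I)
          fix e :: real assume "e > 0"
          from elim[THEN spec, THEN mp, OF this] obtain d where d: "d > 0"
            "!!h. 0 < h ==> h < d ==> norm ((1 / h) *\<^sub>R (LINT r:{t - h..t}|lborel. f w r) - f w t) < e" by (elim exE conjE) simp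
          have "\<forall>\<^sub>F k in sequentially. h k < d"
            unfolding h_def using LIMSEQ_Suc[OF lim_1_over_n] d(1) by (intro order_tendstoD(2)[where y = 0]) auto
          then show "EX no. ALL n>=no. norm (av (h n) t w - f w t) < e"
            unfolding eventually_sequentially
          proof (elim exE, intro exI allI impI)
            fix N k assume "ALL n>=N. h n < d" "N <= k"
            then show "norm (av (h k) t w - f w t) < e" unfolding av_def by (intro d(2) h) auto
          qed
        qed
        moreover have "(%k. P k t w - av (h k) t w) ----> 0"
          using close[OF ww] t by (intro Lim_null_comparison[OF _ h0] always_eventually) auto
        ultimately have "(%k. (P k t w - av (h k) t w) + av (h k) t w) ----> 0 + f w t" by (rule tendsto_add[rotated])
        then have "(%k. P k t w) ----> Y t w" using t by (simp add: f_def)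
        then have "(%k. (norm (P k t w - Y t w))^2) ----> (norm (Y t w - Y t w))^2" by (intro tendsto_intros)
        then show "(%k. (norm (P k t w - Y t w))^2) ----> 0" by simp
      qed
    qed
    moreover have "AE t in lborel. t ~= s" by (rule AE_lborel_singleton)
    ultimately have "AE t in lborel. t : {s..T} --> (%k. (norm (P k t w - Y t w))^2) ----> 0" by eventually_elim auto
    then show "AE t in lam. (%k. (norm (P k t w - Y t w))^2) ----> 0"
      unfolding lam_def by (subst AE_restrict_space_iff) auto
    show "(%t. (norm (P k t w - Y t w))^2) : meas lam" for k
    proof -
      have "(%z. (norm (ev (P k) z - ev Y z))^2) : meas (M \<Otimes>\<^sub>M lam)" using Pev Yev unfolding Pm_def[symmetric] by measurable
      from measurable_Pair2[OF this ww] show ?thesis by simp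
    qed
    show "AE t in lam. norm ((norm (P k t w - Y t w))^2) <= (2 * K)^2" for k
      using bd[OF _ ww] by (intro AE_I2) auto
  qed auto
  have sqP: "sq_int Pm (%z. norm (ev (P k) z - ev Y z))" for k
  proof (rule sq_int_bounded[OF finite_measure_Pm, where K = "2 * K"])
    show "AE z in Pm. \<bar>norm (ev (P k) z - ev Y z)\<bar> <= 2 * K"
      using bd K0 by (intro AE_I2) (auto simp: space_Pm intro: power2_le_imp_le)
  qed measurable
  have outer: "(%k. LINT w|M. (LINT t|lam. (norm (P k t w - Y t w))^2)) ----> (LINT w|M. 0)"
  proof (rule integral_dominated_convergence[where w = "%_. (2 * K)^2 * measure lam (space lam)"])
    show "AE w in M. (%k. LINT t|lam. (norm (P k t w - Y t w))^2) ----> 0" using inner by (intro AE_I2) simp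
    show "(%w. LINT t|lam. (norm (P k t w - Y t w))^2) : meas M" for k
    proof -
      have "(%z. (norm (ev (P k) z - ev Y z))^2) : meas (M \<Otimes>\<^sub>M lam)" using Pev Yev unfolding Pm_def[symmetric] by measurable
      then have "(%(w, t). (norm (P k t w - Y t w))^2) : meas (M \<Otimes>\<^sub>M lam)" by (simp add: split_beta' ev_def)
      from lam.borel_measurable_lebesgue_integral[OF this] show ?thesis .
    qed
    show "AE w in M. norm (LINT t|lam. (norm (P k t w - Y t w))^2) <= (2 * K)^2 * measure lam (space lam)" for k
    proof (rule AE_I2)
      fix w assume ww: "w : space M"
      have "(LINT t|lam. (norm (P k t w - Y t w))^2) <= (LINT t|lam. (2 * K)^2)"
        using bd[OF _ ww] by (intro integral_mono') auto
      then show "norm (LINT t|lam. (norm (P k t w - Y t w))^2) <= (2 * K)^2 * measure lam (space lam)" by (simp add: mult_ac)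
    qed
  qed auto
  have eq: "(LINT w|M. (LINT t|lam. (norm (P k t w - Y t w))^2)) = (LINT z|Pm. (norm (ev (P k) z - ev Y z))^2)" for k
    using Pm_fubini[of "%z. (norm (ev (P k) z - ev Y z))^2"] sqP[of k] by (simp add: sq_int_def)
  have "(%k. EP z. ennreal ((norm (ev (P k) z - ev Y z))^2)) ----> 0"
    using outer unfolding eq by (subst tendsto_nn_sq_iff[OF sqP]) simp
  then have "(%k. pn (%t w. P k t w - Y t w)) ----> 0" unfolding pn_def ev_diff .
  then show thesis using that[OF simp] by (simp add: P_def)
qed

text \<open>Cutting off large values reduces to the bounded case. Both errors are taken below
  \<open>e / 4\<close> since the triangle inequality for squared norms costs a factor 2.\<close>

lemma simple_dense:
  fixes Y :: "real => 'w => 'h::euclidean_space"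
  assumes Y: "Y : L2P" and e: "0 < e"
  shows "EX N \<tau> \<eta>. simple_integrand M F s T N \<tau> \<eta> & pn (%t w. simple_process N \<tau> \<eta> t w - Y t w) < ennreal e"
proof -
  have Yp: "Y : PM" and Yf: "pn Y < \<infinity>" using Y by (auto simp: L2_prog_pn)
  have Yev[measurable]: "ev Y : meas Pm" by (rule prog_ev[OF Yp])
  define W where "W n t w = (if norm (Y t w) <= real n then Y t w else 0)" for n t w
  have Wp: "W n : PM" for n
  proof -
    have "(%(r, w). W n r w) : meas (restrict_space borel {s..t} \<Otimes>\<^sub>M F t)" if "t : {s..T}" for t
    proof -
      have [measurable]: "(%z. Y (fst z) (snd z)) : meas (restrict_space borel {s..t} \<Otimes>\<^sub>M F t)"
        using Yp that by (auto simp: prog_measurable_def split_beta')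
      show ?thesis unfolding W_def split_beta' by measurable
    qed
    then show ?thesis by (auto simp: prog_measurable_def)
  qed
  have "(%n. EP z. ennreal ((norm (ev (W n) z - ev Y z))^2)) ----> (EP z. 0)"
  proof (rule nn_integral_dominated_convergence[where w = "%z. ennreal ((norm (ev Y z))^2)"])
    show "(%z. ennreal ((norm (ev (W n) z - ev Y z))^2)) : meas Pm" for n
      using prog_ev[OF Wp] by measurable
    show "AE z in Pm. ennreal ((norm (ev (W n) z - ev Y z))^2) <= ennreal ((norm (ev Y z))^2)" for n
      by (intro AE_I2) (auto simp: ev_def W_def)
    show "(EP z. ennreal ((norm (ev Y z))^2)) < \<infinity>" using Yf by (simp add: pn_def)
    show "AE z in Pm. (%n. ennreal ((norm (ev (W n) z - ev Y z))^2)) ----> 0"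
    proof (intro AE_I2 tendsto_eventually)
      fix z
      obtain N where "norm (ev Y z) <= real N" using real_arch_simple by blast
      then show "\<forall>\<^sub>F n in sequentially. ennreal ((norm (ev (W n) z - ev Y z))^2) = 0"
        unfolding eventually_sequentially by (intro exI[of _ N]) (auto simp: ev_def W_def)
    qed
  qed auto
  then have "(%n. pn (%t w. W n t w - Y t w)) ----> 0" by (simp add: pn_def ev_diff)
  then have "\<forall>\<^sub>F n in sequentially. pn (%t w. W n t w - Y t w) < ennreal (e / 4)" using e by (intro order_tendstoD) auto
  then obtain n where n: "pn (%t w. W n t w - Y t w) < ennreal (e / 4)" by (auto simp: eventually_sequentially)
  obtain N \<tau> \<eta> where p: "!!k::nat. simple_integrand M F s T (N k) (\<tau> k) (\<eta> k)"
    "(%k. pn (%t w. simple_process (N k) (\<tau> k) (\<eta> k) t w - W n t w)) ----> 0"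
  proof (rule simple_dense_bounded[OF Wp[of n], of "real n"])
    show "norm (W n t w) <= real n" for t w by (simp add: W_def)
  qed blast
  have "\<forall>\<^sub>F k in sequentially. pn (%t w. simple_process (N k) (\<tau> k) (\<eta> k) t w - W n t w) < ennreal (e / 4)"
    using e p(2) by (intro order_tendstoD) auto
  then obtain k where k: "pn (%t w. simple_process (N k) (\<tau> k) (\<eta> k) t w - W n t w) < ennreal (e / 4)" by (auto simp: eventually_sequentially)
  have "pn (%t w. simple_process (N k) (\<tau> k) (\<eta> k) t w - Y t w) <=
    2 * pn (%t w. simple_process (N k) (\<tau> k) (\<eta> k) t w - W n t w) + 2 * pn (%t w. W n t w - Y t w)"
    by (intro pn_diff_triangle simple_process_ev[OF p(1)] Yev prog_ev[OF Wp])
  also have "... < ennreal (2 * (e / 4)) + ennreal (2 * (e / 4))"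
  proof (rule add_strict_mono)
    have "2 * x < ennreal (2 * (e / 4))" if "x < ennreal (e / 4)" for x
    proof -
      have "2 * x < 2 * ennreal (e / 4)" using that by (intro ennreal_mult_strict_left_mono) auto
      moreover have "ennreal (2 * (e / 4)) = 2 * ennreal (e / 4)" using e by (subst ennreal_mult) auto
      ultimately show ?thesis by (simp only:)
    qed
    then show "2 * pn (%t w. simple_process (N k) (\<tau> k) (\<eta> k) t w - W n t w) < ennreal (2 * (e / 4))"
      "2 * pn (%t w. W n t w - Y t w) < ennreal (2 * (e / 4))" using n k by auto
  qed
  also have "... = ennreal e" using e by (simp add: ennreal_plus[symmetric] del: ennreal_plus)
  finally show ?thesis using p(1) by blast
qed

section \<open>Existence and linearity of the integral\<close>

lemma simple_process_prog:
  fixes \<eta> :: "nat => 'w => 'h::euclidean_space"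
  assumes p: "simple_integrand M F s T N \<tau> \<eta>"
  shows "simple_process N \<tau> \<eta> : PM"
proof -
  have "(%(r, w). simple_process N \<tau> \<eta> r w) : meas (restrict_space borel {s..t} \<Otimes>\<^sub>M F t)" if t: "t : {s..T}" for t
    unfolding simple_process_def split_beta'
  proof (intro borel_measurable_sum)
    fix i assume "i : {..<N}"
    then have i: "i < N" by simp
    let ?R = "restrict_space borel {s..t} \<Otimes>\<^sub>M F t"
    show "(%z. indicator {\<tau> i<..\<tau> (Suc i)} (fst z) *\<^sub>R \<eta> i (snd z)) : meas ?R"
    proof (cases "\<tau> i <= t")
      case True
      have "fst : meas ?R"
        by (rule measurable_compose[OF measurable_fst]) (simp add: measurable_restrict_space1)
      moreover have "(%z. \<eta> i (snd z)) : meas ?R"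
        by (rule measurable_compose[OF measurable_snd measurable_F_mono[OF simple_integrand_meas(3)[OF p i] True]])
      moreover have "(indicator {\<tau> i<..\<tau> (Suc i)} :: real => real) : meas borel" by simp
      ultimately show ?thesis using measurable_compose[of fst ?R borel "indicator {\<tau> i<..\<tau> (Suc i)} :: real => real" borel]
        by (intro borel_measurable_scaleR)
    next
      case False
      have "(%z. 0) : meas ?R" by simp
      then show ?thesis
        by (rule measurable_cong[THEN iffD1, rotated])
           (use False in \<open>auto simp: space_pair_measure space_restrict_space indicator_def\<close>)
    qed
  qed
  then show ?thesis by (auto simp: prog_measurable_def)
qed

lemma simple_ito_cont:
  fixes \<eta> :: "nat => 'w => 'h::euclidean_space"
  assumes p: "simple_integrand M F s T N \<tau> \<eta>"
  shows "simple_ito B N \<tau> \<eta> : CP"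
proof (rule adapted_cont_prog[OF simple_ito_meas[OF p]])
  fix w assume ww: "w : space M"
  have "continuous_on {s..T} (%t. B (min (\<tau> i) t) w)" if "i <= N" for i
    using simple_integrand_range(1)[OF p that] s0
    by (intro continuous_on_compose2[OF B_cont[OF ww]] continuous_intros) auto
  then show "continuous_on {s..T} (%t. simple_ito B N \<tau> \<eta> t w)"
    unfolding simple_ito_def by (intro continuous_intros) auto
qed auto

lemma simple_is_ito:
  fixes \<eta> :: "nat => 'w => 'h::euclidean_space"
  assumes p: "simple_integrand M F s T N \<tau> \<eta>"
  shows "ito (simple_process N \<tau> \<eta>) (simple_ito B N \<tau> \<eta>)"
  unfolding ito_integral_def
proof (intro conjI exI[of _ "%_. N"] exI[of _ "%_. \<tau>"] exI[of _ "%_. \<eta>"] allI ballI p simple_ito_cont)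
  obtain K where K: "ALL t. ALL w:space M. norm (simple_process N \<tau> \<eta> t w) <= K" using simple_process_bounded[OF p] by auto
  have [measurable]: "ev (simple_process N \<tau> \<eta>) : meas Pm" by (rule simple_process_ev[OF p])
  have "sq_int Pm (%z. norm (ev (simple_process N \<tau> \<eta>) z))"
  proof (rule sq_int_bounded[OF finite_measure_Pm, where K = K])
    show "AE z in Pm. \<bar>norm (ev (simple_process N \<tau> \<eta>) z)\<bar> <= K" using K by (intro AE_I2) (auto simp: space_Pm)
  qed measurable
  then show "simple_process N \<tau> \<eta> : L2P" using simple_process_prog[OF p] by (simp add: L2_prog_iff)
qed auto

text \<open>Approximating sequences of different integrals live on unrelated grids and cannot be
  subtracted term by term. Linearity is instead read off from the isometry of this combination: for
  \<open>\<sigma>0 = \<sigma>1 - \<sigma>2\<close> the right-hand side is zero.\<close>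

lemma ito_iso3:
  fixes \<sigma>0 \<sigma>1 \<sigma>2 :: "real => 'w => real"
  assumes "ito \<sigma>0 I0" "ito \<sigma>1 I1" "ito \<sigma>2 I2"
    and t: "t : {s..T}"
  shows "(LINT w|M. (I0 t w - I1 t w + I2 t w)^2) = (LINT z|Pm. indicator {s<..t} (snd z) * (ev \<sigma>0 z - ev \<sigma>1 z + ev \<sigma>2 z)^2)"
proof -
  have c: "integrable M (%w. I t w * J t w) & integrable Pm (%z. indicator {s<..t} (snd z) * (ev \<sigma> z * ev \<theta> z)) &
     (LINT w|M. I t w * J t w) = (LINT z|Pm. indicator {s<..t} (snd z) * (ev \<sigma> z * ev \<theta> z))"
    if I: "ito \<sigma> I" and J: "ito \<theta> J" for \<sigma> \<theta> I J :: "real => 'w => real"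
  proof -
    have "sq_int Pm (ev \<sigma>)" "sq_int Pm (ev \<theta>)" using I J by (auto simp: ito_integral_def intro: L2_prog_sq)
    moreover have "sq_int Pm (%z. indicator {s<..t} (snd z) * ev \<sigma> z)"
      by (rule sq_int_bounded_mult[OF calculation(1), where K = 1]) (auto intro!: Pm_sndI simp: indicator_def)
    ultimately have 1: "integrable Pm (%z. indicator {s<..t} (snd z) * (ev \<sigma> z * ev \<theta> z))"
      using sq_int_mult by (fastforce simp: mult.assoc)
    have "(LINT w|M. 1 * (I t w - I s w) * (J t w - J s w)) = (LINT z|Pm. (1 * indicator {s<..t} (snd z)) * ev \<sigma> z * ev \<theta> z)"
      using t by (intro ito_cov[OF I J, where K = 1]) auto
    moreover have "(LINT w|M. 1 * (I t w - I s w) * (J t w - J s w)) = (LINT w|M. I t w * J t w)"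
    proof (rule integral_cong_AE)
      have m: "I s : meas M" "I t : meas M" "J s : meas M" "J t : meas M"
        using ito_sq[OF I] ito_sq[OF J] t sT by (auto simp: sq_int_def)
      show "(%w. 1 * (I t w - I s w) * (J t w - J s w)) : meas M" "(%w. I t w * J t w) : meas M"
        using m by auto
      show "AE w in M. 1 * (I t w - I s w) * (J t w - J s w) = I t w * J t w"
        using ito_start[OF I] ito_start[OF J] by eventually_elim simp
    qed
    ultimately show ?thesis using sq_int_mult[OF ito_sq[OF I t] ito_sq[OF J t]] 1 by (simp add: mult.assoc)
  qed
  note c00 = c[OF assms(1) assms(1)] and c11 = c[OF assms(2) assms(2)] and c22 = c[OF assms(3) assms(3)]
    and c01 = c[OF assms(1) assms(2)] and c02 = c[OF assms(1) assms(3)] and c12 = c[OF assms(2) assms(3)]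
  have e: "(a - b + d)^2 = a * a + b * b + d * d - 2 * (a * b) + 2 * (a * d) - 2 * (b * d)" for a b d :: real
    by (simp add: power2_eq_square algebra_simps)
  have "(LINT w|M. (I0 t w - I1 t w + I2 t w)^2) =
     (LINT w|M. I0 t w * I0 t w) + (LINT w|M. I1 t w * I1 t w) + (LINT w|M. I2 t w * I2 t w)
     - 2 * (LINT w|M. I0 t w * I1 t w) + 2 * (LINT w|M. I0 t w * I2 t w) - 2 * (LINT w|M. I1 t w * I2 t w)"
    unfolding e using c00 c11 c22 c01 c02 c12 by simp
  also have "... = (LINT z|Pm. indicator {s<..t} (snd z) * (ev \<sigma>0 z * ev \<sigma>0 z) + indicator {s<..t} (snd z) * (ev \<sigma>1 z * ev \<sigma>1 z)
     + indicator {s<..t} (snd z) * (ev \<sigma>2 z * ev \<sigma>2 z) - 2 * (indicator {s<..t} (snd z) * (ev \<sigma>0 z * ev \<sigma>1 z))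
     + 2 * (indicator {s<..t} (snd z) * (ev \<sigma>0 z * ev \<sigma>2 z)) - 2 * (indicator {s<..t} (snd z) * (ev \<sigma>1 z * ev \<sigma>2 z)))"
    using c00 c11 c22 c01 c02 c12 by simp
  also have "... = (LINT z|Pm. indicator {s<..t} (snd z) * (ev \<sigma>0 z - ev \<sigma>1 z + ev \<sigma>2 z)^2)"
    unfolding e by (simp add: algebra_simps)
  finally show ?thesis .
qed

lemma ito_zero: "ito (%_ _. 0 :: 'h::euclidean_space) (%_ _. 0)"
proof -
  have "simple_integrand M F s T 1 (%i. if i = 0 then s else T) (%_ _. 0 :: 'h)"
    using sT by (auto simp: simple_integrand_def)
  from simple_is_ito[OF this] show ?thesis
    unfolding simple_process_def[abs_def] simple_ito_def[abs_def] by simp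
qed

lemma ito_iso2:
  fixes \<sigma>1 \<sigma>2 :: "real => 'w => real"
  assumes "ito \<sigma>1 I1" "ito \<sigma>2 I2" and t: "t : {s..T}"
  shows "(LINT w|M. (I1 t w - I2 t w)^2) = (LINT z|Pm. indicator {s<..t} (snd z) * (ev \<sigma>1 z - ev \<sigma>2 z)^2)"
  using ito_iso3[OF ito_zero assms(2,1) t] by (simp add: ev_def)

lemma ennreal_norm_sq_sum:
  fixes x :: "'h::euclidean_space"
  shows "ennreal ((norm x)^2) = (SUM b:Basis. ennreal ((x \<bullet> b)^2))"
proof -
  have "(norm x)^2 = (SUM b:Basis. (x \<bullet> b)^2)"
    using euclidean_inner[of x x] by (simp add: power2_norm_eq_inner) (simp add: power2_eq_square)
  then show ?thesis by (simp add: sum_ennreal)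
qed

lemma ito_iso_vec:
  fixes \<sigma>1 \<sigma>2 :: "real => 'w => 'h::euclidean_space"
  assumes "ito \<sigma>1 I1" "ito \<sigma>2 I2" and t: "t : {s..T}"
  shows "(EM w. ennreal ((norm (I1 t w - I2 t w))^2)) =
    (EP z. indicator {s<..t} (snd z) * ennreal ((norm (ev \<sigma>1 z - ev \<sigma>2 z))^2))"
proof -
  let ?d = "%z. ev \<sigma>1 z - ev \<sigma>2 z"
  have sq: "sq_int M (%w. (I1 t w - I2 t w) \<bullet> b)" if "b : Basis" for b
    using sq_int_diff[OF ito_sq[OF ito_component[OF assms(1) that] t] ito_sq[OF ito_component[OF assms(2) that] t]]
    by (simp add: inner_diff_left)
  have L: "ev (%t w. \<sigma> t w \<bullet> b) = (%z. ev \<sigma> z \<bullet> b)" for \<sigma> and b :: 'h by (auto simp: ev_def)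
  have sqs: "sq_int Pm (%z. (?d z) \<bullet> b)" if "b : Basis" for b
  proof -
    have "sq_int Pm (ev (%t w. \<sigma>1 t w \<bullet> b))" "sq_int Pm (ev (%t w. \<sigma>2 t w \<bullet> b))"
      using ito_component[OF assms(1) that] ito_component[OF assms(2) that] by (auto simp: ito_integral_def intro: L2_prog_sq)
    from sq_int_diff[OF this] show ?thesis by (simp add: L inner_diff_left)
  qed
  have *: "(EM w. ennreal (((I1 t w - I2 t w) \<bullet> b)^2)) = (EP z. indicator {s<..t} (snd z) * ennreal (((?d z) \<bullet> b)^2))"
    if b: "b : Basis" for b
  proof -
    have ind: "sq_int Pm (%z. indicator {s<..t} (snd z) * ((?d z) \<bullet> b))"
      by (rule sq_int_bounded_mult[OF sqs[OF b], where K = 1]) (auto intro!: Pm_sndI simp: indicator_def)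
    have "(EM w. ennreal (((I1 t w - I2 t w) \<bullet> b)^2)) = ennreal (LINT w|M. ((I1 t w - I2 t w) \<bullet> b)^2)"
      by (rule nn_integral_sq_eq[OF sq[OF b]])
    also have "(LINT w|M. ((I1 t w - I2 t w) \<bullet> b)^2) = (LINT z|Pm. indicator {s<..t} (snd z) * ((?d z) \<bullet> b)^2)"
      using ito_iso2[OF ito_component[OF assms(1) b] ito_component[OF assms(2) b] t] by (simp add: L inner_diff_left)
    also have "... = (LINT z|Pm. (indicator {s<..t} (snd z) * ((?d z) \<bullet> b))^2)"
      by (rule Bochner_Integration.integral_cong) (auto simp: indicator_def)
    also have "ennreal ... = (EP z. ennreal ((indicator {s<..t} (snd z) * ((?d z) \<bullet> b))^2))"
      by (rule nn_integral_sq_eq[OF ind, symmetric])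
    also have "... = (EP z. indicator {s<..t} (snd z) * ennreal (((?d z) \<bullet> b)^2))"
      by (rule nn_integral_cong) (auto simp: indicator_def)
    finally show ?thesis .
  qed
  have "(EM w. ennreal ((norm (I1 t w - I2 t w))^2)) = (SUM b:Basis. EM w. ennreal (((I1 t w - I2 t w) \<bullet> b)^2))"
    unfolding ennreal_norm_sq_sum using sq by (intro nn_integral_sum) (auto simp: sq_int_def)
  also have "... = (SUM b:Basis. EP z. indicator {s<..t} (snd z) * ennreal (((?d z) \<bullet> b)^2))"
    using * by (intro sum.cong) auto
  also have "... = (EP z. indicator {s<..t} (snd z) * ennreal ((norm (?d z))^2))"
    unfolding ennreal_norm_sq_sum sum_distrib_left
  proof (rule nn_integral_sum[symmetric])
    fix b :: 'h assume b: "b : Basis"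
    have [measurable]: "(%z. (?d z) \<bullet> b) : meas Pm" using sqs[OF b] by (simp add: sq_int_def)
    show "(%z. indicator {s<..t} (snd z) * ennreal (((?d z) \<bullet> b)^2)) : meas Pm" by measurable
  qed
  finally show ?thesis .
qed

text \<open>The maximal inequality in each coordinate, followed by the isometry at time
  \<open>T\<close>; the 4 is the constant of the maximal inequality.\<close>

lemma ito_sup_diff:
  fixes \<sigma>1 \<sigma>2 :: "real => 'w => 'h::euclidean_space"
  assumes I1: "ito \<sigma>1 I1" and I2: "ito \<sigma>2 I2"
  shows "(EM w. supsq (%t w. I1 t w - I2 t w) w) <= 4 * pn (%t w. \<sigma>1 t w - \<sigma>2 t w)"
proof -
  have c: "I1 : CP" "I2 : CP" using assms by (auto simp: ito_integral_def)
  have cb: "(%t w. (I1 t w - I2 t w) \<bullet> b) : CP" for b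
    by (intro cont_prog_inner cont_prog_diff c)
  have T: "T : {s..T}" using sT by simp
  have D: "(EM w. supsq (%t w. (I1 t w - I2 t w) \<bullet> b) w) <= 4 * (EM w. ennreal (((I1 T w - I2 T w) \<bullet> b)^2))" if b: "b : Basis" for b
  proof -
    have m: "mgale (%t w. (I1 t w - I2 t w) \<bullet> b)"
      using mgale_diff[OF mgale_ito[OF ito_component[OF I1 b]] mgale_ito[OF ito_component[OF I2 b]]]
      by (simp add: inner_diff_left)
    show ?thesis using doob[OF m cb] nn_integral_sq_eq[OF mgale_sq[OF m T]] by (simp add: ennreal_mult)
  qed
  have "(EM w. supsq (%t w. I1 t w - I2 t w) w) <= (EM w. (SUM b:Basis. supsq (%t w. (I1 t w - I2 t w) \<bullet> b) w))"
    by (intro nn_integral_mono supsq_component)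
  also have "... = (SUM b:Basis. EM w. supsq (%t w. (I1 t w - I2 t w) \<bullet> b) w)"
    by (intro nn_integral_sum supsq_meas cb)
  also have "... <= (SUM b:Basis. 4 * (EM w. ennreal (((I1 T w - I2 T w) \<bullet> b)^2)))" by (intro sum_mono D)
  also have "... = 4 * (EM w. ennreal ((norm (I1 T w - I2 T w))^2))"
  proof -
    have "(EM w. ennreal ((norm (I1 T w - I2 T w))^2)) = (SUM b:Basis. EM w. ennreal (((I1 T w - I2 T w) \<bullet> b)^2))"
      unfolding ennreal_norm_sq_sum
    proof (rule nn_integral_sum)
      fix b :: 'h
      have [measurable]: "(%w. (I1 T w - I2 T w) \<bullet> b) : meas M" by (rule cont_prog_M[OF cb T])
      show "(%w. ennreal (((I1 T w - I2 T w) \<bullet> b)^2)) : meas M" by measurable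
    qed
    then show ?thesis by (simp add: sum_distrib_left)
  qed
  also have "... <= 4 * pn (%t w. \<sigma>1 t w - \<sigma>2 t w)"
    unfolding ito_iso_vec[OF I1 I2 T] pn_def ev_diff by (intro mult_left_mono nn_integral_mono) (auto simp: indicator_def)
  finally show ?thesis .
qed

text \<open>Simple processes approaching \<open>Y\<close> at the rate \<open>4 ^ k\<close> have
  integrals that are Cauchy in the supremum norm. Their continuous limit satisfies the defining
  relation with this same sequence.\<close>

lemma ito_exists:
  fixes Y :: "real => 'w => 'h::euclidean_space"
  assumes Y: "Y : L2P"
  shows "EX I. ito Y I"
proof -
  have Yev: "ev Y : meas Pm" using Y by (auto simp: L2_prog_def intro: prog_ev)
  have "ALL k. EX N \<tau> \<eta>. simple_integrand M F s T N \<tau> \<eta> & pn (%t w. simple_process N \<tau> \<eta> t w - Y t w) < ennreal (1 / 4 ^ k)"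
    using simple_dense[OF Y] by simp
  from choice[OF this] obtain N where
    "ALL k. EX \<tau> \<eta>. simple_integrand M F s T (N k) \<tau> \<eta> & pn (%t w. simple_process (N k) \<tau> \<eta> t w - Y t w) < ennreal (1 / 4 ^ k)" ..
  from choice[OF this] obtain \<tau> where
    "ALL k. EX \<eta>. simple_integrand M F s T (N k) (\<tau> k) \<eta> & pn (%t w. simple_process (N k) (\<tau> k) \<eta> t w - Y t w) < ennreal (1 / 4 ^ k)" ..
  from choice[OF this] obtain \<eta> where p: "!!k::nat. simple_integrand M F s T (N k) (\<tau> k) (\<eta> k)"
    "!!k. pn (%t w. simple_process (N k) (\<tau> k) (\<eta> k) t w - Y t w) < ennreal (1 / 4 ^ k)" by blast
  define P where "P k = simple_process (N k) (\<tau> k) (\<eta> k)" for k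
  define S where "S k = simple_ito B (N k) (\<tau> k) (\<eta> k)" for k
  have PS: "ito (P k) (S k)" for k unfolding P_def S_def by (rule simple_is_ito[OF p(1)])
  have Pev: "ev (P k) : meas Pm" for k unfolding P_def by (rule simple_process_ev[OF p(1)])
  have Sc: "S k : CP" for k unfolding S_def by (rule simple_ito_cont[OF p(1)])
  \<comment> \<open>Maximal inequality 4, triangle inequality 2, and two distances to
    \<open>Y\<close> of at most \<open>1 / 4 ^ k\<close> each: 4 * (2 + 2) = 16.\<close>
  have "(EM w. supsq (%t w. S (Suc k) t w - S k t w) w) <= ennreal (16 / 4 ^ k)" for k
  proof -
    have "(EM w. supsq (%t w. S (Suc k) t w - S k t w) w) <= 4 * pn (%t w. P (Suc k) t w - P k t w)"
      by (rule ito_sup_diff[OF PS PS])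
    also have "... <= 4 * (2 * pn (%t w. P (Suc k) t w - Y t w) + 2 * pn (%t w. Y t w - P k t w))"
      by (intro mult_left_mono pn_diff_triangle Pev Yev) auto
    also have "... <= 4 * (2 * ennreal (1 / 4 ^ k) + 2 * ennreal (1 / 4 ^ k))"
    proof (intro mult_left_mono add_mono)
      have "pn (%t w. P (Suc k) t w - Y t w) <= ennreal (1 / 4 ^ Suc k)" using p(2)[of "Suc k"] by (simp add: P_def less_imp_le)
      also have "... <= ennreal (1 / 4 ^ k)" by (intro ennreal_leI) (simp add: field_simps)
      finally show "pn (%t w. P (Suc k) t w - Y t w) <= ennreal (1 / 4 ^ k)" .
      show "pn (%t w. Y t w - P k t w) <= ennreal (1 / 4 ^ k)"
        using p(2)[of k] by (subst pn_diff_commute) (simp add: P_def less_imp_le)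
    qed auto
    also have "... = ennreal (16 / 4 ^ k)"
    proof -
      have "4 * (2 * ennreal x + 2 * ennreal x) = ennreal (16 * x)" if "0 <= x" for x
        using that by (simp add: ennreal_plus[symmetric] ennreal_mult[symmetric] ennreal_numeral[symmetric] del: ennreal_plus ennreal_numeral)
      from this[of "1 / 4 ^ k"] show ?thesis by simp
    qed
    finally show ?thesis .
  qed
  from cont_limit[OF Sc this] obtain I where I: "I : CP"
    "(%k. EM w. supsq (%t w. S k t w - I t w) w) ----> 0" by blast
  have "ito Y I"
    unfolding ito_integral_def
  proof (intro conjI exI[of _ N] exI[of _ \<tau>] exI[of _ \<eta>] allI ballI p(1) Y I(1))
    have "(%k. pn (%t w. P k t w - Y t w)) ----> 0"
    proof (rule tendsto_sandwich[OF _ _ tendsto_const])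
      show "\<forall>\<^sub>F k in sequentially. pn (%t w. P k t w - Y t w) <= ennreal ((1 / 4) ^ k)"
        using p(2) by (intro always_eventually) (auto simp: P_def less_imp_le power_divide)
      have "(%k. ennreal ((1 / 4) ^ k)) ----> ennreal 0" by (intro tendsto_ennrealI LIMSEQ_power_zero) auto
      then show "(%k. ennreal ((1 / 4) ^ k)) ----> 0" by simp
    qed auto
    moreover have "ev (%t w. P k t w - Y t w) : meas Pm" for k unfolding ev_diff using Pev Yev by auto
    ultimately show "(%k. EM w. (\<integral>\<^sup>+ t\<in>{s..T}. ennreal ((norm (simple_process (N k) (\<tau> k) (\<eta> k) t w - Y t w))^2) \<partial>lborel)) ----> 0"
      using pn_iter unfolding P_def by (subst pn_iter) (auto simp: P_def)
    fix t assume t: "t : {s..T}"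
    show "(%k. EM w. ennreal ((norm (simple_ito B (N k) (\<tau> k) (\<eta> k) t w - I t w))^2)) ----> 0"
      by (rule tendsto_sandwich[OF _ _ tendsto_const I(2)])
         (auto intro!: always_eventually nn_integral_mono supsq_ge[OF t, of "%t w. S _ t w - I t w"] simp: S_def[symmetric])
  qed
  then show ?thesis by blast
qed

lemma ito_sup_finite:
  fixes \<sigma>1 :: "real => 'w => 'h::euclidean_space"
  assumes I1: "ito \<sigma>1 I1"
  shows "(EM w. supsq I1 w) <= 4 * pn \<sigma>1"
  using ito_sup_diff[OF I1 ito_zero] by simp

text \<open>The approximating sequence is kept: neither of the two limits in the definition notices
  a change of the integrand on a null set of \<open>Pm\<close>, or of the integral on a null set at
  each time.\<close>

lemma ito_cong_AE:
  fixes \<sigma>1 \<sigma>2 :: "real => 'w => 'h::euclidean_space"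
  assumes I: "ito \<sigma>1 I1" and \<sigma>2: "\<sigma>2 : L2P" and I2: "I2 : CP"
    and e: "pn (%t w. \<sigma>1 t w - \<sigma>2 t w) = 0" "!!t. t : {s..T} ==> AE w in M. I1 t w = I2 t w"
  shows "ito \<sigma>2 I2"
proof -
  from I obtain N \<tau> \<eta> where
    1: "!!k::nat. simple_integrand M F s T (N k) (\<tau> k) (\<eta> k)" and
    2: "(%k. EM w. (\<integral>\<^sup>+ t\<in>{s..T}. ennreal ((norm (simple_process (N k) (\<tau> k) (\<eta> k) t w - \<sigma>1 t w))^2) \<partial>lborel)) ----> 0" and
    3: "!!t. t : {s..T} ==> (%k. EM w. ennreal ((norm (simple_ito B (N k) (\<tau> k) (\<eta> k) t w - I1 t w))^2)) ----> 0"
    and Y: "\<sigma>1 : L2P"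
    unfolding ito_integral_def by blast
  have ev: "ev \<sigma>1 : meas Pm" "ev \<sigma>2 : meas Pm"
    using Y \<sigma>2 by (auto simp: L2_prog_def intro: prog_ev)
  have "AE z in Pm. ev \<sigma>1 z = ev \<sigma>2 z"
    using e(1) ev unfolding pn_def ev_diff by (subst (asm) nn_integral_0_iff_AE) auto
  then have eq: "pn (%t w. simple_process (N k) (\<tau> k) (\<eta> k) t w - \<sigma>1 t w) = pn (%t w. simple_process (N k) (\<tau> k) (\<eta> k) t w - \<sigma>2 t w)" for k
    unfolding pn_def ev_diff by (intro nn_integral_cong_AE) (auto elim: eventually_mono)
  have evd: "ev (%t w. simple_process (N k) (\<tau> k) (\<eta> k) t w - \<sigma> t w) : meas Pm" if "ev \<sigma> : meas Pm" for k \<sigma>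
    unfolding ev_diff using simple_process_ev[OF 1] that by auto
  show ?thesis
    unfolding ito_integral_def
  proof (intro conjI exI[of _ N] exI[of _ \<tau>] exI[of _ \<eta>] allI ballI 1 \<sigma>2 I2)
    show "(%k. EM w. (\<integral>\<^sup>+ t\<in>{s..T}. ennreal ((norm (simple_process (N k) (\<tau> k) (\<eta> k) t w - \<sigma>2 t w))^2) \<partial>lborel)) ----> 0"
      using 2 unfolding pn_iter[OF evd[OF ev(1)]] pn_iter[OF evd[OF ev(2)]] eq .
    fix t assume t: "t : {s..T}"
    have "(EM w. ennreal ((norm (simple_ito B (N k) (\<tau> k) (\<eta> k) t w - I1 t w))^2)) =
        (EM w. ennreal ((norm (simple_ito B (N k) (\<tau> k) (\<eta> k) t w - I2 t w))^2))" for k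
      using e(2)[OF t] by (intro nn_integral_cong_AE) (auto elim: eventually_mono)
    with 3[OF t] show "(%k. EM w. ennreal ((norm (simple_ito B (N k) (\<tau> k) (\<eta> k) t w - I2 t w))^2)) ----> 0" by simp
  qed
qed

lemma L2_prog_diff:
  fixes X Y :: "real => 'w => 'h::euclidean_space"
  assumes "X : L2P" "Y : L2P"
  shows "(%t w. X t w - Y t w) : L2P"
proof -
  have p: "X : PM" "Y : PM" "pn X < \<infinity>" "pn Y < \<infinity>"
    using assms by (auto simp: L2_prog_pn)
  have "(%t w. X t w - Y t w) : PM"
    using p(1,2) by (auto simp: prog_measurable_def split_beta' intro!: borel_measurable_diff)
  moreover have "pn (%t w. X t w - Y t w) <= 2 * pn X + 2 * pn Y"
  proof -
    have "ev (%_ _. 0 :: 'h) : meas Pm" by (simp add: ev_def[abs_def])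
    from pn_diff_triangle[OF prog_ev[OF p(1)] prog_ev[OF p(2)] this] show ?thesis
      using pn_diff_commute[of "%_ _. 0" Y] by simp
  qed
  then have "pn (%t w. X t w - Y t w) < \<infinity>" using p by (auto simp: ennreal_mult_less_top intro: le_less_trans)
  ultimately show ?thesis by (simp add: L2_prog_pn)
qed

text \<open>The difference of the integrands has some integral by \<open>ito_exists\<close>. The
  isometry shows that at each time it equals the difference of the given integrals almost surely,
  and \<open>ito_cong_AE\<close> transfers the relation to the latter.\<close>

lemma ito_diff:
  fixes \<sigma>1 \<sigma>2 :: "real => 'w => 'h::euclidean_space"
  assumes I1: "ito \<sigma>1 I1" and I2: "ito \<sigma>2 I2"
  shows "ito (%t w. \<sigma>1 t w - \<sigma>2 t w) (%t w. I1 t w - I2 t w)"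
proof -
  have c: "I1 : CP" "I2 : CP"
    "\<sigma>1 : L2P" "\<sigma>2 : L2P" using assms by (auto simp: ito_integral_def)
  have d: "(%t w. \<sigma>1 t w - \<sigma>2 t w) : L2P" by (rule L2_prog_diff[OF c(3,4)])
  from ito_exists[OF d] obtain I0 where I0: "ito (%t w. \<sigma>1 t w - \<sigma>2 t w) I0" by blast
  show ?thesis
  proof (rule ito_cong_AE[OF I0 d cont_prog_diff[OF c(1,2)]])
    show "pn (%t w. \<sigma>1 t w - \<sigma>2 t w - (\<sigma>1 t w - \<sigma>2 t w)) = 0" by (simp add: pn_def ev_def)
    fix t assume t: "t : {s..T}"
    have "AE w in M. ALL b:Basis. I0 t w \<bullet> b - I1 t w \<bullet> b + I2 t w \<bullet> b = 0"
    proof (rule AE_finite_allI[OF finite_Basis])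
      fix b :: 'h assume b: "b : Basis"
      note i = ito_component[OF I0 b] ito_component[OF I1 b] ito_component[OF I2 b]
      have "(LINT w|M. (I0 t w \<bullet> b - I1 t w \<bullet> b + I2 t w \<bullet> b)^2) = 0"
        unfolding ito_iso3[OF i t] by (simp add: ev_def inner_diff_left)
      moreover have "integrable M (%w. (I0 t w \<bullet> b - I1 t w \<bullet> b + I2 t w \<bullet> b)^2)"
        using sq_int_add[OF sq_int_diff[OF ito_sq[OF i(1) t] ito_sq[OF i(2) t]] ito_sq[OF i(3) t]]
        by (simp add: sq_int_def)
      ultimately show "AE w in M. I0 t w \<bullet> b - I1 t w \<bullet> b + I2 t w \<bullet> b = 0"
        by (subst (asm) integral_nonneg_eq_0_iff_AE) auto
    qed
    then show "AE w in M. I0 t w = I1 t w - I2 t w"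
    proof eventually_elim
      case (elim w)
      show ?case
      proof (rule euclidean_eqI)
        fix b :: 'h assume "b : Basis"
        then have "I0 t w \<bullet> b - I1 t w \<bullet> b + I2 t w \<bullet> b = 0" using elim by blast
        then show "I0 t w \<bullet> b = (I1 t w - I2 t w) \<bullet> b" by (simp add: inner_diff_left)
      qed
    qed
  qed
qed

lemma supsq_zero_AE:
  assumes "X : CP" "(EM w. supsq X w) = 0"
  shows "AE w in M. ALL t:{s..T}. X t w = 0"
proof -
  have "AE w in M. supsq X w = 0"
    using assms(2) supsq_meas[OF assms(1)] by (subst (asm) nn_integral_0_iff_AE) auto
  then show ?thesis
  proof eventually_elim
    case (elim w)
    then show ?case using supsq_ge[of _ X w] by (force simp: ennreal_eq_0_iff)
  qed
qed

end

section \<open>Linear stochastic differential equations\<close>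

lemma norm_matrix_vector_mult_le: "norm (A *v x) <= norm A * norm (x :: real^'n)" for A :: "real^'n^'m"
proof -
  have "norm (A *v x) = L2_set (%i. norm (A $ i \<bullet> x)) UNIV"
    by (simp add: norm_vec_def[of "A *v x"] matrix_vector_mul_component)
  also have "... <= L2_set (%i. norm (A $ i) * norm x) UNIV"
    by (rule L2_set_mono) (auto simp: Cauchy_Schwarz_ineq2)
  also have "... = norm A * norm x" by (simp add: L2_set_left_distrib[symmetric] norm_vec_def[of A])
  finally show ?thesis .
qed

lemma bounded_bilinear_matrix_vector_mult:
  "bounded_bilinear ((*v) :: real^'n^'m => real^'n => real^'m)"
proof (unfold_locales)
  show "EX K. ALL a b. norm (a *v b) <= norm (a :: real^'n^'m) * norm (b :: real^'n) * K"
    by (intro exI[of _ 1] allI) (simp add: norm_matrix_vector_mult_le)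
qed (simp_all add: matrix_vector_mult_add_rdistrib matrix_vector_right_distrib scaleR_matrix_vector_assoc
       matrix_vector_mult_scaleR)

lemma borel_measurable_bilinear2:
  fixes h :: "'a::euclidean_space => 'b::euclidean_space => 'c::euclidean_space"
  assumes "bounded_bilinear h" "f : meas N" "g : meas N"
  shows "(%x. h (f x) (g x)) : meas N"
proof -
  have "continuous_on UNIV (%p. h (fst p) (snd p))"
    by (rule bounded_bilinear.continuous_on[OF assms(1)]) (auto intro: continuous_intros)
  from borel_measurable_continuous_on[OF this, of "%x. (f x, g x)" N] show ?thesis using assms by simp
qed

text \<open>The factor \<open>1 / \<mu>\<close> is what makes the weighted norm of
  \<open>wn_volterra\<close> contract.\<close>

lemma nn_integral_exp_tail:
  assumes "\<mu> > 0"
  shows "(\<integral>\<^sup>+t. ennreal (exp (- \<mu> * t)) * indicator {a..} t \<partial>lborel) = ennreal (exp (- \<mu> * a) / \<mu>)"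
proof -
  have "(\<integral>\<^sup>+t. ennreal (exp (- \<mu> * t)) * indicator {a..} t \<partial>lborel) = ennreal (0 - (- exp (- \<mu> * a) / \<mu>))"
  proof (rule nn_integral_FTC_atLeast)
    show "((%t. - exp (- \<mu> * t) / \<mu>) has_real_derivative exp (- \<mu> * t)) (at t)" for t
      using assms by (auto intro!: derivative_eq_intros)
    have "LIM t at_top. - (\<mu> * t) :> at_bot"
      using assms by (intro filterlim_uminus_at_top[THEN iffD1] filterlim_tendsto_pos_mult_at_top[OF tendsto_const]) (auto simp: filterlim_ident)
    then have "((%t. exp (- (\<mu> * t))) \<longlongrightarrow> 0) at_top" by (rule filterlim_compose[OF exp_at_bot])
    then have "((%t. - exp (- (\<mu> * t)) / \<mu>) \<longlongrightarrow> - 0 / \<mu>) at_top" using assms by (intro tendsto_intros) auto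
    then show "((%t. - exp (- \<mu> * t) / \<mu>) \<longlongrightarrow> 0) at_top" by simp
  qed auto
  then show ?thesis by simp
qed

section \<open>Progressive processes, path integrals and weighted norms\<close>

context brownian
begin

lemma prog_bilinear:
  fixes h :: "'a::euclidean_space => 'b::euclidean_space => 'c::euclidean_space"
  assumes "bounded_bilinear h" "X : prog_measurable M F s T H1" "Y : prog_measurable M F s T H2"
  shows "(%t w. h (X t w) (Y t w)) : PM"
  using assms(2,3) by (auto simp: prog_measurable_def split_beta' intro!: borel_measurable_bilinear2[OF assms(1)])

lemma prog_add:
  fixes X Y :: "real => 'w => 'c::euclidean_space"
  assumes "X : prog_measurable M F s T H1" "Y : prog_measurable M F s T H2"
  shows "(%t w. X t w + Y t w) : PM"
  using assms by (auto simp: prog_measurable_def split_beta' intro!: borel_measurable_add)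

lemma prog_UNIV: "X : prog_measurable M F s T H ==> X : PM"
  by (auto simp: prog_measurable_def)

lemma L2_prog_bound:
  fixes X :: "real => 'w => 'a::euclidean_space" and Y :: "real => 'w => 'b::euclidean_space"
  assumes "X : PM" "Y : L2_prog M F s T H" "AE z in Pm. norm (ev X z) <= K * norm (ev Y z)"
  shows "X : L2P"
proof -
  have Y: "sq_int Pm (%z. norm (ev Y z))" using assms by (simp add: L2_prog_iff)
  have "sq_int Pm (%z. norm (ev X z))"
    by (rule sq_int_bound[OF Y, where K = K]) (use assms prog_ev[OF assms(1)] in auto)
  then show ?thesis using assms by (simp add: L2_prog_iff)
qed

lemma L2_prog_add:
  fixes X Y :: "real => 'w => 'h::euclidean_space"
  assumes "X : L2P" "Y : L2P"
  shows "(%t w. X t w + Y t w) : L2P"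
proof -
  have "(%t w. 0 - Y t w) : L2P"
    by (rule L2_prog_diff[OF _ assms(2)]) (auto simp: L2_prog_def prog_measurable_def)
  from L2_prog_diff[OF assms(1) this] show ?thesis by simp
qed

lemma bounded_progD:
  assumes "A : bounded_prog M F s T H"
  obtains K where "0 <= K" "A : PM" "!!t w. t : {s..T} ==> w : space M ==> norm (A t w) <= K"
proof -
  obtain K where "ALL t:{s..T}. ALL w:space M. norm (A t w) <= K" using assms by (auto simp: bounded_prog_def)
  moreover have "A : PM" using assms prog_UNIV by (auto simp: bounded_prog_def)
  ultimately show thesis using that[of "\<bar>K\<bar>"] by (force intro: order_trans[OF _ abs_ge_self])
qed

lemma bounded_mult_L2:
  fixes A :: "real => 'w => real^'n^'m" and X :: "real => 'w => real^'n"
  assumes "A : bounded_prog M F s T H" "X : L2P"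
  shows "(%t w. A t w *v X t w) : L2P"
proof -
  obtain K where K: "0 <= K" "A : PM" "!!t w. t : {s..T} ==> w : space M ==> norm (A t w) <= K"
    using bounded_progD[OF assms(1)] by metis
  have X: "X : PM" using assms by (simp add: L2_prog_def)
  show ?thesis
  proof (rule L2_prog_bound[OF prog_bilinear[OF bounded_bilinear_matrix_vector_mult K(2) X] assms(2), where K = K])
    show "AE z in Pm. norm (ev (%t w. A t w *v X t w) z) <= K * norm (ev X z)"
      using order_trans[OF norm_matrix_vector_mult_le mult_right_mono[OF K(3) norm_ge_zero]]
      by (intro AE_I2) (auto simp: ev_def space_Pm)
  qed
qed

lemma pn_le_supsq:
  assumes "X : CP"
  shows "pn X <= ennreal (T - s) * (EM w. supsq X w)"
proof -
  have ev: "ev X : meas Pm" using assms by (auto simp: cont_prog_def intro: prog_ev)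
  have "pn X = (EM w. (\<integral>\<^sup>+t\<in>{s..T}. ennreal ((norm (X t w))^2) \<partial>lborel))" by (rule pn_iter[OF ev, symmetric])
  also have "... <= (EM w. (\<integral>\<^sup>+t\<in>{s..T}. supsq X w \<partial>lborel))"
    by (intro nn_integral_mono) (auto simp: indicator_def intro: supsq_ge)
  also have "... = (EM w. ennreal (T - s) * supsq X w)"
  proof (rule nn_integral_cong)
    fix w
    show "(\<integral>\<^sup>+t\<in>{s..T}. supsq X w \<partial>lborel) = ennreal (T - s) * supsq X w"
      using sT by (subst nn_integral_cmult_indicator) (auto simp: mult.commute)
  qed
  also have "... = ennreal (T - s) * (EM w. supsq X w)" by (rule nn_integral_cmult) (rule supsq_meas[OF assms])
  finally show ?thesis .
qed

lemma L2_cont_iff: "X : L2_cont M F s T H \<longleftrightarrow> X : cont_prog M F s T H & (EM w. supsq X w) < \<infinity>"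
  by (simp add: L2_cont_def supsq_def)

lemma L2_cont_L2_prog:
  assumes "X : L2C" shows "X : L2P"
proof -
  have X: "X : CP" "(EM w. supsq X w) < \<infinity>" using assms by (auto simp: L2_cont_iff)
  have "pn X < \<infinity>" by (rule le_less_trans[OF pn_le_supsq[OF X(1)]]) (use X(2) in \<open>simp add: ennreal_mult_less_top\<close>)
  then show ?thesis using X by (simp add: L2_prog_pn cont_prog_def)
qed

lemma L2_path_finite:
  assumes b: "b : L2P"
  shows "AE w in M. (\<integral>\<^sup>+t. ennreal ((norm (b t w))^2) \<partial>lam) < \<infinity>"
proof -
  have p: "b : PM" "pn b < \<infinity>" using b by (auto simp: L2_prog_pn)
  have m[measurable]: "ev b : meas (M \<Otimes>\<^sub>M lam)" using prog_ev[OF p(1)] by (simp add: Pm_def)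
  have "(EM w. (\<integral>\<^sup>+t. ennreal ((norm (b t w))^2) \<partial>lam)) = pn b"
    unfolding pn_def Pm_def by (subst lam.nn_integral_fst[symmetric]) auto
  then have *: "(EM w. (\<integral>\<^sup>+t. ennreal ((norm (b t w))^2) \<partial>lam)) ~= \<infinity>" using p by simp
  have "(%w. \<integral>\<^sup>+t. ennreal ((norm (ev b (w, t)))^2) \<partial>lam) : meas M"
    by (rule lam.borel_measurable_nn_integral_fst) measurable
  then have "(%w. \<integral>\<^sup>+t. ennreal ((norm (b t w))^2) \<partial>lam) : meas M" by simp
  from nn_integral_PInf_AE[OF this *] show ?thesis by (auto simp: less_top)
qed

lemma section_lam:
  assumes "ev b : meas Pm" "w : space M" shows "(%t. b t w) : meas lam"
  using measurable_Pair2[of "ev b" M lam borel w] assms by (simp add: Pm_def)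

lemma integrable_lam_iff:
  fixes g :: "real => 'h::euclidean_space"
  shows "integrable lam g \<longleftrightarrow> set_integrable lborel {s..T} g"
  unfolding lam_def set_integrable_def by (subst integrable_restrict_space) auto

lemma lint_lam:
  fixes g :: "real => 'h::euclidean_space"
  assumes "t : {s..T}"
  shows "(LINT r:{s..t}|lborel. g r) = (LINT r|lam. indicator {s..t} r *\<^sub>R g r)"
  unfolding lam_def set_lebesgue_integral_def using assms
  by (subst integral_restrict_space) (auto intro!: Bochner_Integration.integral_cong simp: indicator_def)

lemma L2_path_integrable:
  fixes b :: "real => 'w => 'h::euclidean_space"
  assumes b: "b : L2P"
  shows "AE w in M. sq_int lam (%t. norm (b t w)) & set_integrable lborel {s..T} (%t. b t w)"
  using L2_path_finite[OF b] AE_space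
proof eventually_elim
  case (elim w)
  have m: "(%t. b t w) : meas lam"
    using b elim by (intro section_lam prog_ev[of b UNIV]) (auto simp: L2_prog_def)
  have sq: "sq_int lam (%t. norm (b t w))"
    using m elim by (auto simp: sq_int_iff_nn)
  have "integrable lam (%t. b t w)"
    using lam.sq_int_imp_integrable[OF sq] m by (simp add: integrable_norm_iff)
  then show ?case using sq by (simp add: integrable_lam_iff)
qed

text \<open>Square integrability makes almost every path integrable. On the remaining paths the
  primitive is set to zero, which gives continuity everywhere and, by completeness,
  adaptedness.\<close>

lemma primitive_exists:
  fixes b :: "real => 'w => 'h::euclidean_space"
  assumes b: "b : L2P"
  shows "EX V:CP. AE w in M. ALL t:{s..T}. V t w = (LINT r:{s..t}|lborel. b r w)"
proof -
  have bp: "b : PM" using b by (simp add: L2_prog_def)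
  define V where "V t w = (if set_integrable lborel {s..T} (%r. b r w) then LINT r:{s..t}|lborel. b r w else 0)" for t w
  have AEi: "AE w in M. set_integrable lborel {s..T} (%t. b t w)"
    using L2_path_integrable[OF b] by eventually_elim simp
  have "V : CP"
  proof (rule adapted_cont_prog)
    fix t assume t: "t : {s..T}"
    have "(%w. LINT r:{s..t}|lborel. indicator {s..T} r *\<^sub>R b r w) : meas (F t)"
      by (rule adapted_set_lint[OF bp t])
    moreover have "(LINT r:{s..t}|lborel. indicator {s..T} r *\<^sub>R b r w) = (LINT r:{s..t}|lborel. b r w)" for w
      unfolding set_lebesgue_integral_def using t by (intro Bochner_Integration.integral_cong) (auto simp: indicator_def)
    ultimately have "(%w. LINT r:{s..t}|lborel. b r w) : meas (F t)" by simp
    then show "V t : meas (F t)"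
    proof (rule measurable_F_AE_cong)
      show "AE w in M. (LINT r:{s..t}|lborel. b r w) = V t w" using AEi by eventually_elim (simp add: V_def)
    qed (use t s0 in auto)
  next
    fix w assume "w : space M"
    show "continuous_on {s..T} (%t. V t w)"
    proof (cases "set_integrable lborel {s..T} (%r. b r w)")
      case True
      have sub: "set_integrable lborel {s..t} (%r. b r w)" if "t : {s..T}" for t
        by (rule set_integrable_subset[OF True]) (use that in auto)
      have "continuous_on {s..T} (%t. integral {s..t} (%r. b r w))"
        by (rule indefinite_integral_continuous_1) (rule set_borel_integral_eq_integral(1)[OF True])
      then show ?thesis
        by (rule continuous_on_cong[THEN iffD1, rotated 2]) (auto simp: V_def True sub set_borel_integral_eq_integral(2))
    qed (simp add: V_def)
  qed
  moreover have "AE w in M. ALL t:{s..T}. V t w = (LINT r:{s..t}|lborel. b r w)"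
    using AEi by eventually_elim (simp add: V_def)
  ultimately show ?thesis by blast
qed

text \<open>Cauchy-Schwarz against the indicator of the support: a path supported in a window of
  length \<open>h\<close> gains the factor \<open>h\<close> in place of \<open>T - s\<close>. This
  gain drives the lower bound on the control weight.\<close>

lemma path_integral_bound_supp:
  fixes g :: "real => 'h::euclidean_space"
  assumes g: "g : meas lam" "sq_int lam (%t. norm (g t))" and t: "t : {s..T}"
    and supp: "!!r. r ~: {a..a + h} ==> g r = 0" and h: "0 <= h"
  shows "ennreal ((norm (LINT r:{s..t}|lborel. g r))^2) <= ennreal h * (\<integral>\<^sup>+r. ennreal ((norm (g r))^2) \<partial>lam)"
proof -
  have ind: "sq_int lam (indicator {a..a + h})"
    by (rule sq_int_bounded[OF finite_measure_lam _ , where K = 1]) (auto intro!: measurable_lamI simp: indicator_def)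
  have "norm (LINT r:{s..t}|lborel. g r) <= (LINT r|lam. norm (indicator {s..t} r *\<^sub>R g r))"
    unfolding lint_lam[OF t] by (rule integral_norm_bound)
  also have "... <= (LINT r|lam. \<bar>indicator {a..a + h} r * norm (g r)\<bar>)"
  proof (rule integral_mono)
    show i: "integrable lam (%r. \<bar>indicator {a..a + h} r * norm (g r)\<bar>)" using sq_int_mult[OF ind g(2)] by simp
    show "integrable lam (%r. norm (indicator {s..t} r *\<^sub>R g r))"
    proof (rule Bochner_Integration.integrable_bound[OF i])
      show "(%r. norm (indicator {s..t} r *\<^sub>R g r)) : meas lam"
      proof -
        have [measurable]: "(indicator {s..t} :: real => real) : meas lam" by (rule measurable_lamI) simp
        show ?thesis using g(1) by measurable
      qed
    qed (use supp in \<open>auto simp: indicator_def\<close>)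
    show "norm (indicator {s..t} r *\<^sub>R g r) <= \<bar>indicator {a..a + h} r * norm (g r)\<bar>" for r
      using supp[of r] by (auto simp: indicator_def)
  qed
  also have "... <= sqrt (LINT r|lam. (indicator {a..a + h} r)^2) * sqrt (LINT r|lam. (norm (g r))^2)"
    by (rule cauchy_schwarz_integral[OF ind g(2)])
  finally have "(norm (LINT r:{s..t}|lborel. g r))^2 <= (sqrt (LINT r|lam. (indicator {a..a + h} r)^2) * sqrt (LINT r|lam. (norm (g r))^2))^2"
    by (intro power_mono) auto
  also have "... = (LINT r|lam. (indicator {a..a + h} r)^2) * (LINT r|lam. (norm (g r))^2)"
    by (simp add: power_mult_distrib)
  also have "... <= h * (LINT r|lam. (norm (g r))^2)"
  proof (rule mult_right_mono)
    have "(LINT r|lam. (indicator {a..a + h} r :: real)^2) = (LINT r|lborel. indicator {s..T} r *\<^sub>R (indicator {a..a + h} r)^2)"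
      unfolding lam_def by (rule integral_restrict_space) simp
    also have "... = (LINT r|lborel. indicator ({s..T} \<inter> {a..a + h}) r)"
      by (rule Bochner_Integration.integral_cong[OF refl]) (auto simp: indicator_def)
    also have "... = measure lborel ({s..T} \<inter> {a..a + h})" by simp
    also have "... <= measure lborel {a..a + h}" by (intro measure_mono_fmeasurable) (auto simp: fmeasurable_def emeasure_lborel_Icc_eq)
    also have "... = h" using h by simp
    finally show "(LINT r|lam. (indicator {a..a + h} r :: real)^2) <= h" .
  qed simp
  finally have "ennreal ((norm (LINT r:{s..t}|lborel. g r))^2) <= ennreal (h * (LINT r|lam. (norm (g r))^2))" by (rule ennreal_leI)
  also have "... = ennreal h * (\<integral>\<^sup>+r. ennreal ((norm (g r))^2) \<partial>lam)"
    using h by (subst nn_integral_sq_eq[OF g(2)]) (simp add: ennreal_mult)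
  finally show ?thesis .
qed

lemma path_integral_bound:
  fixes g :: "real => 'h::euclidean_space"
  assumes g: "g : meas lam" "sq_int lam (%t. norm (g t))" and t: "t : {s..T}"
  shows "ennreal ((norm (LINT r:{s..t}|lborel. g r))^2) <= ennreal (T - s) * (\<integral>\<^sup>+r. indicator {s<..t} r * ennreal ((norm (g r))^2) \<partial>lam)"
proof -
  let ?g = "%r. indicator {s<..t} r *\<^sub>R g r"
  have m: "?g : meas lam" by (intro borel_measurable_scaleR g(1) measurable_lamI) simp
  have "sq_int lam (%r. norm (?g r))"
    by (rule sq_int_bound[OF g(2) measurable_compose[OF m borel_measurable_norm], where K = 1]) (auto simp: indicator_def)
  then have "ennreal ((norm (LINT r:{s..t}|lborel. ?g r))^2) <= ennreal (T - s) * (\<integral>\<^sup>+r. ennreal ((norm (?g r))^2) \<partial>lam)"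
    by (rule path_integral_bound_supp[OF m _ t, where a = s and h = "T - s"]) (use t sT in \<open>auto simp: indicator_def\<close>)
  also have "(LINT r:{s..t}|lborel. ?g r) = (LINT r:{s..t}|lborel. g r)"
    unfolding lint_lam[OF t]
  proof (rule integral_cong_AE)
    have "AE r in lam. r ~= s" unfolding lam_def by (subst AE_restrict_space_iff) (auto intro: AE_mp[OF AE_lborel_singleton[of s]])
    then show "AE r in lam. indicator {s..t} r *\<^sub>R ?g r = indicator {s..t} r *\<^sub>R g r" by eventually_elim (auto simp: indicator_def)
  qed (intro borel_measurable_scaleR g(1) m measurable_lamI, simp)+
  also have "(\<integral>\<^sup>+r. ennreal ((norm (?g r))^2) \<partial>lam) = (\<integral>\<^sup>+r. indicator {s<..t} r * ennreal ((norm (g r))^2) \<partial>lam)"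
    by (rule nn_integral_cong) (auto simp: indicator_def)
  finally show ?thesis .
qed

lemma nn_fst: "f : meas Pm ==> (EM w. (\<integral>\<^sup>+r. f (w, r) \<partial>lam)) = (EP z. f z)"
  unfolding Pm_def by (rule lam.nn_integral_fst)

lemma nn_snd: "f : meas Pm ==> (\<integral>\<^sup>+r. (EM w. f (w, r)) \<partial>lam) = (EP z. f z)"
  using pmf.nn_integral_snd[of f] by (simp add: Pm_def)

lemma primitive_bounds:
  fixes b :: "real => 'w => 'h::euclidean_space"
  assumes b: "b : L2P"
    and V: "AE w in M. ALL t:{s..T}. V t w = (LINT r:{s..t}|lborel. b r w)"
  shows "t : {s..T} ==> (EM w. ennreal ((norm (V t w))^2)) <= ennreal (T - s) * (EP z. indicator {s<..t} (snd z) * ennreal ((norm (ev b z))^2))"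
    and "(EM w. supsq V w) <= ennreal (T - s) * pn b"
proof -
  let ?q = "%t w. \<integral>\<^sup>+r. indicator {s<..t} r * ennreal ((norm (b r w))^2) \<partial>lam"
  let ?Q = "%w. \<integral>\<^sup>+r. ennreal ((norm (b r w))^2) \<partial>lam"
  have ev[measurable]: "ev b : meas Pm" using b by (auto simp: L2_prog_def intro: prog_ev)
  have P: "AE w in M. ALL t:{s..T}. ennreal ((norm (V t w))^2) <= ennreal (T - s) * ?q t w"
    using V L2_path_integrable[OF b] AE_space
  proof eventually_elim
    case (elim w)
    show ?case
    proof
      fix t assume t: "t : {s..T}"
      show "ennreal ((norm (V t w))^2) <= ennreal (T - s) * ?q t w"
        using path_integral_bound[OF section_lam[OF ev] _ t, of w] elim t by simp
    qed
  qed
  have mm: "(%w. \<integral>\<^sup>+r. f (w, r) \<partial>lam) : meas M" if "f : meas Pm" for f :: "_ => ennreal"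
    using that unfolding Pm_def by (rule lam.borel_measurable_nn_integral_fst)
  show "(EM w. ennreal ((norm (V t w))^2)) <= ennreal (T - s) * (EP z. indicator {s<..t} (snd z) * ennreal ((norm (ev b z))^2))"
    if t: "t : {s..T}"
  proof -
    have "(EM w. ennreal ((norm (V t w))^2)) <= (EM w. ennreal (T - s) * ?q t w)"
      using P t by (intro nn_integral_mono_AE) (auto elim: eventually_mono)
    also have "... = ennreal (T - s) * (EM w. ?q t w)"
      using mm[of "%z. indicator {s<..t} (snd z) * ennreal ((norm (ev b z))^2)"] by (intro nn_integral_cmult) simp
    also have "(EM w. ?q t w) =
       (EP z. indicator {s<..t} (snd z) * ennreal ((norm (ev b z))^2))"
      using nn_fst[of "%z. indicator {s<..t} (snd z) * ennreal ((norm (ev b z))^2)"] by simp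
    finally show ?thesis .
  qed
  have "(EM w. supsq V w) <= (EM w. ennreal (T - s) * ?Q w)"
  proof (rule nn_integral_mono_AE)
    show "AE w in M. supsq V w <= ennreal (T - s) * ?Q w"
      using P
    proof eventually_elim
      case (elim w)
      show ?case unfolding supsq_def
      proof (rule SUP_least)
        fix t assume t: "t : {s..T}"
        then have "ennreal ((norm (V t w))^2) <= ennreal (T - s) * ?q t w" using elim by blast
        also have "... <= ennreal (T - s) * ?Q w"
          by (intro mult_left_mono nn_integral_mono) (auto simp: indicator_def)
        finally show "ennreal ((norm (V t w))^2) <= ennreal (T - s) * ?Q w" .
      qed
    qed
  qed
  also have "... = ennreal (T - s) * (EM w. ?Q w)"
    using mm[of "%z. ennreal ((norm (ev b z))^2)"] by (intro nn_integral_cmult) simp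
  also have "(EM w. ?Q w) = pn b"
    unfolding pn_def using nn_fst[of "%z. ennreal ((norm (ev b z))^2)"] by simp
  finally show "(EM w. supsq V w) <= ennreal (T - s) * pn b" .
qed

text \<open>The weight \<open>exp (- \<mu> t)\<close> turns the Volterra-type bound below into a contraction, for the Picard
  iteration as well as for the a priori estimate.\<close>

definition wn :: "real => (real => 'w => 'h::euclidean_space) => ennreal" where
  "wn \<mu> X = (EP z. ennreal (exp (- \<mu> * snd z)) * ennreal ((norm (ev X z))^2))"

lemma wn_le_pn: assumes "0 <= \<mu>" "ev X : meas Pm" shows "wn \<mu> X <= pn X"
  unfolding wn_def pn_def
proof (rule nn_integral_mono)
  fix z assume "z : space Pm"
  then have "0 <= snd z" using s0 by (auto simp: space_Pm)
  then have "ennreal (exp (- \<mu> * snd z)) <= 1" using assms(1) by (simp add: ennreal_le_1)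
  then show "ennreal (exp (- \<mu> * snd z)) * ennreal ((norm (ev X z))^2) <= ennreal ((norm (ev X z))^2)"
    using mult_right_mono[of "ennreal (exp (- \<mu> * snd z))" 1 "ennreal ((norm (ev X z))^2)"] by simp
qed

lemma pn_le_wn: assumes "0 <= \<mu>" "ev X : meas Pm" shows "pn X <= ennreal (exp (\<mu> * T)) * wn \<mu> X"
proof -
  have [measurable]: "ev X : meas Pm" by fact
  have "pn X <= (EP z. ennreal (exp (\<mu> * T)) * (ennreal (exp (- \<mu> * snd z)) * ennreal ((norm (ev X z))^2)))"
    unfolding pn_def
  proof (rule nn_integral_mono)
    fix z assume "z : space Pm"
    then have "\<mu> * snd z <= \<mu> * T" using assms(1) by (intro mult_left_mono) (auto simp: space_Pm)
    then have "1 <= ennreal (exp (\<mu> * T)) * ennreal (exp (- \<mu> * snd z))"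
      by (simp add: ennreal_mult[symmetric] exp_add[symmetric] ennreal_ge_1)
    then show "ennreal ((norm (ev X z))^2) <= ennreal (exp (\<mu> * T)) * (ennreal (exp (- \<mu> * snd z)) * ennreal ((norm (ev X z))^2))"
      using mult_right_mono[of 1 "ennreal (exp (\<mu> * T)) * ennreal (exp (- \<mu> * snd z))" "ennreal ((norm (ev X z))^2)"] by (simp add: mult.assoc)
  qed
  also have "... = ennreal (exp (\<mu> * T)) * wn \<mu> X" unfolding wn_def by (rule nn_integral_cmult) measurable
  finally show ?thesis .
qed

text \<open>After exchanging the integrals, the value of \<open>X\<close> at time \<open>r\<close>
  is weighted by the tail \<open>c * exp (- \<mu> * r) / \<mu>\<close>, a quarter of its own weight
  when \<open>\<mu> = 4 * c\<close>. The constant \<open>\<beta>\<close> carries an inhomogeneous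
  term; it is zero in the contraction estimate.\<close>

lemma wn_volterra:
  fixes X Y :: "real => 'w => 'h::euclidean_space"
  assumes X: "ev X : meas Pm" and Y: "ev Y : meas Pm" and c: "0 < c" "0 <= \<beta>"
    and le: "!!t. t : {s..T} ==> (EM w. ennreal ((norm (Y t w))^2)) <=
        ennreal c * (EP z. indicator {s<..t} (snd z) * ennreal ((norm (ev X z))^2)) + ennreal \<beta>"
  shows "wn (4 * c) Y <= ennreal (1/4) * wn (4 * c) X + ennreal (\<beta> * (T - s))"
proof -
  define \<mu> where "\<mu> = 4 * c"
  have \<mu>: "0 < \<mu>" using c by (simp add: \<mu>_def)
  note [measurable] = X Y
  let ?x = "%t. ennreal (exp (- \<mu> * t))"
  let ?h = "%t. EP z. indicator {s<..t} (snd z) * ennreal ((norm (ev X z))^2)"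
  \<comment> \<open>The condition \<open>s < r <= t\<close> is replaced by \<open>r < t\<close>,
    read as a condition on \<open>t\<close>, in order to exchange the integrals; this changes only
    the null sets \<open>r = s\<close> and \<open>r = t\<close>.\<close>
  let ?k = "%t z. ennreal c * (ennreal (exp (- \<mu> * t)) * indicator {snd z<..} t * ennreal ((norm (ev X z))^2))"
  have [measurable]: "(%t::real. exp (- \<mu> * t)) : meas lam" by (rule measurable_lamI) simp
  have "wn \<mu> Y = (\<integral>\<^sup>+t. (EM w. ?x t * ennreal ((norm (Y t w))^2)) \<partial>lam)"
  proof -
    have "(%z. ennreal (exp (- \<mu> * snd z)) * ennreal ((norm (ev Y z))^2)) : meas Pm" using Y by measurable
    from nn_snd[OF this] show ?thesis unfolding wn_def by simp
  qed
  also have "... <= (\<integral>\<^sup>+t. (EP z. ?k t z) + ennreal \<beta> \<partial>lam)"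
  proof (rule nn_integral_mono)
    fix t assume "t : space lam"
    then have t: "t : {s..T}" by simp
    have "(%w. ev Y (w, t)) : meas M" using t Y by (intro measurable_Pair1[of _ M lam]) (auto simp: Pm_def)
    then have "(EM w. ?x t * ennreal ((norm (Y t w))^2)) = ?x t * (EM w. ennreal ((norm (Y t w))^2))"
      by (intro nn_integral_cmult) auto
    also have "... <= ?x t * (ennreal c * ?h t + ennreal \<beta>)"
      by (intro mult_left_mono le[OF t]) auto
    also have "... = ?x t * ennreal c * ?h t + ?x t * ennreal \<beta>"
      by (simp add: distrib_left mult.assoc)
    also have "... <= (EP z. ?k t z) + ennreal \<beta>"
    proof (rule add_mono)
      have "?x t * ennreal c * ?h t =
        (EP z. ?x t * ennreal c * (indicator {s<..t} (snd z) * ennreal ((norm (ev X z))^2)))"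
        by (intro nn_integral_cmult[symmetric]) measurable
      also have "... = (EP z. ?k t z)"
      proof (rule nn_integral_cong_AE)
        have "AE z in Pm. snd z ~= s & snd z ~= t"
        proof -
          have AEr: "AE r in lam. r ~= s & r ~= t"
            unfolding lam_def
          proof (subst AE_restrict_space_iff)
            show "AE x in lborel. x : {s..T} --> x ~= s & x ~= t"
              using AE_lborel_singleton[of s] AE_lborel_singleton[of t] by eventually_elim auto
          qed auto
          show ?thesis unfolding Pm_def
          proof (rule pmf.AE_pair_measure)
            have "{z : space Pm. snd z ~= s & snd z ~= t} : sets Pm" by measurable
            then show "{z : space (M \<Otimes>\<^sub>M lam). snd z ~= s & snd z ~= t} : sets (M \<Otimes>\<^sub>M lam)" by (simp add: Pm_def)
          qed (use AEr in simp)
        qed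
        then show "AE z in Pm. ?x t * ennreal c * (indicator {s<..t} (snd z) * ennreal ((norm (ev X z))^2)) =
          ?k t z"
          using AE_space
        proof eventually_elim
          case (elim z)
          then show ?case by (auto simp: indicator_def space_Pm ac_simps)
        qed
      qed
      finally show "?x t * ennreal c * ?h t <=
        (EP z. ?k t z)" by simp
      have "0 <= t" using t s0 by auto
      then have "?x t <= 1" using \<mu> by (simp add: ennreal_le_1)
      from mult_right_mono[OF this, of "ennreal \<beta>"] show "?x t * ennreal \<beta> <= ennreal \<beta>" by simp
    qed
    finally show "(EM w. ?x t * ennreal ((norm (Y t w))^2)) <=
       (EP z. ?k t z) + ennreal \<beta>" .
  qed
  also have "... = (\<integral>\<^sup>+t. (EP z. ?k t z) \<partial>lam)
      + (\<integral>\<^sup>+t. ennreal \<beta> \<partial>lam)"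
  proof (rule nn_integral_add)
    have idm[measurable]: "(%x. x) : meas lam" by (rule measurable_lamI) simp
    have [measurable]: "snd : meas Pm" "ev X : meas Pm" using X by simp_all
    interpret P: sigma_finite_measure Pm by unfold_locales
    show "(%t. EP z. ?k t z) : meas lam"
      unfolding indicator_def greaterThan_iff by measurable
  qed simp
  also have "(\<integral>\<^sup>+t. ennreal \<beta> \<partial>lam) = ennreal (\<beta> * (T - s))"
    unfolding lam_def using sT c by (simp add: emeasure_restrict_space space_restrict_space ennreal_mult)
  also have "(\<integral>\<^sup>+t. (EP z. ?k t z) \<partial>lam) =
     (EP z. (\<integral>\<^sup>+t. ?k t z \<partial>lam))"
  proof -
    interpret Q: pair_sigma_finite Pm lam by unfold_locales
    have [measurable]: "(%x. x) : meas lam" by (rule measurable_lamI) simp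
    have [measurable]: "snd : meas Pm" "ev X : meas Pm" using X by simp_all
    show ?thesis
      unfolding indicator_def greaterThan_iff by (rule Q.Fubini') measurable
  qed
  also have "... <= (EP z. ennreal (1/4) * (ennreal (exp (- \<mu> * snd z)) * ennreal ((norm (ev X z))^2)))"
  proof (rule nn_integral_mono)
    fix z :: "'w \<times> real"
    have "(\<integral>\<^sup>+t. ?k t z \<partial>lam) <=
      (\<integral>\<^sup>+t. (ennreal c * ennreal ((norm (ev X z))^2)) * (?x t * indicator {snd z..} t) \<partial>lborel)"
      unfolding lam_def by (subst nn_integral_restrict_space) (auto intro!: nn_integral_mono simp: indicator_def ac_simps)
    also have "... = (ennreal c * ennreal ((norm (ev X z))^2)) * ennreal (exp (- \<mu> * snd z) / \<mu>)"
      by (subst nn_integral_cmult) (auto simp: nn_integral_exp_tail[OF \<mu>, simplified])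
    also have "... = ennreal (1/4) * (ennreal (exp (- \<mu> * snd z)) * ennreal ((norm (ev X z))^2))"
      using c by (simp add: ennreal_mult[symmetric] \<mu>_def)
    finally show "(\<integral>\<^sup>+t. ?k t z \<partial>lam) <=
       ennreal (1/4) * (ennreal (exp (- \<mu> * snd z)) * ennreal ((norm (ev X z))^2))" .
  qed
  also have "... = ennreal (1/4) * wn \<mu> X"
    unfolding wn_def using X by (intro nn_integral_cmult) measurable
  finally show ?thesis by (simp add: \<mu>_def)
qed

end

lemma set_lint_point: "(LINT r:{a..a}|lborel. g r) = (0 :: 'h::euclidean_space)" for a :: real
proof -
  have "AE r in lborel. indicator {a..a} r *\<^sub>R g r = 0"
    using AE_lborel_singleton[of a] by eventually_elim (auto simp: indicator_def)
  then show ?thesis unfolding set_lebesgue_integral_def by (rule integral_eq_zero_AE)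
qed

section \<open>Picard iteration and an a priori estimate\<close>

context brownian
begin

lemma supsq_add: "supsq (%t w. X t w + Y t w) w <= 2 * supsq X w + 2 * supsq Y w"
  unfolding supsq_def[of "%t w. X t w + Y t w"]
  by (rule SUP_least, rule order_trans[OF ennreal_norm_add_sq add_mono]) (intro mult_left_mono supsq_ge, auto)+

lemma supsq_add_integral:
  fixes X Y :: "real => 'w => 'h::euclidean_space"
  assumes "X : CP" "Y : CP"
  shows "(EM w. supsq (%t w. X t w + Y t w) w) <= 2 * (EM w. supsq X w) + 2 * (EM w. supsq Y w)"
proof -
  note [measurable] = supsq_meas[OF assms(1)] supsq_meas[OF assms(2)]
  have "(EM w. supsq (%t w. X t w + Y t w) w) <= (EM w. 2 * supsq X w + 2 * supsq Y w)"
    by (intro nn_integral_mono supsq_add)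
  also have "... = 2 * (EM w. supsq X w) + 2 * (EM w. supsq Y w)"
    by (simp add: nn_integral_add nn_integral_cmult)
  finally show ?thesis .
qed

lemma nn_integral_norm_add_sq:
  fixes f g :: "'w => 'h::euclidean_space"
  assumes "f : meas M" "g : meas M"
  shows "(EM w. ennreal ((norm (f w + g w))^2)) <= 2 * (EM w. ennreal ((norm (f w))^2)) + 2 * (EM w. ennreal ((norm (g w))^2))"
proof -
  note [measurable] = assms
  have "(EM w. ennreal ((norm (f w + g w))^2)) <= (EM w. 2 * ennreal ((norm (f w))^2) + 2 * ennreal ((norm (g w))^2))"
    by (intro nn_integral_mono ennreal_norm_add_sq)
  also have "... = 2 * (EM w. ennreal ((norm (f w))^2)) + 2 * (EM w. ennreal ((norm (g w))^2))"
    by (simp add: nn_integral_add nn_integral_cmult)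
  finally show ?thesis .
qed

lemma cont_prog_add:
  fixes X Y :: "real => 'w => 'h::euclidean_space"
  assumes "X : CP" "Y : CP"
  shows "(%t w. X t w + Y t w) : CP"
  by (intro adapted_cont_prog borel_measurable_add continuous_on_add cont_prog_adapted[OF assms(1)]
        cont_prog_adapted[OF assms(2)] cont_prog_cont[OF assms(1)] cont_prog_cont[OF assms(2)])

lemma cont_prog_const: "(%_ _. c :: 'h::euclidean_space) : CP"
  by (intro adapted_cont_prog) auto

lemma weighted_mult_le:
  fixes A :: "real => 'w => real^'n^'m" and X :: "real => 'w => real^'n" and g :: "'w \<times> real => ennreal"
  assumes A: "!!t w. t : {s..T} ==> w : space M ==> norm (A t w) <= K"
    and X: "ev X : meas Pm" and g: "g : meas Pm"
  shows "(EP z. g z * ennreal ((norm (ev (%t w. A t w *v X t w) z))^2)) <= ennreal (K^2) * (EP z. g z * ennreal ((norm (ev X z))^2))"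
proof -
  note [measurable] = X g
  have "(EP z. g z * ennreal ((norm (ev (%t w. A t w *v X t w) z))^2)) <= (EP z. ennreal (K^2) * (g z * ennreal ((norm (ev X z))^2)))"
  proof (rule nn_integral_mono)
    fix z assume z: "z : space Pm"
    have "norm (ev (%t w. A t w *v X t w) z) <= norm (ev A z) * norm (ev X z)" by (simp add: ev_def norm_matrix_vector_mult_le)
    also have "... <= K * norm (ev X z)" using A z by (intro mult_right_mono) (auto simp: space_Pm)
    finally have "(norm (ev (%t w. A t w *v X t w) z))^2 <= (K * norm (ev X z))^2" by (intro power_mono) auto
    then have "ennreal ((norm (ev (%t w. A t w *v X t w) z))^2) <= ennreal (K^2) * ennreal ((norm (ev X z))^2)"
      by (simp add: ennreal_mult[symmetric] power_mult_distrib ennreal_leI)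
    from mult_left_mono[OF this, of "g z"]
    show "g z * ennreal ((norm (ev (%t w. A t w *v X t w) z))^2) <= ennreal (K^2) * (g z * ennreal ((norm (ev X z))^2))"
      by (simp add: ac_simps)
  qed
  also have "... = ennreal (K^2) * (EP z. g z * ennreal ((norm (ev X z))^2))" by (rule nn_integral_cmult) measurable
  finally show ?thesis .
qed

lemma pn_mult_le:
  fixes A :: "real => 'w => real^'n^'m" and X :: "real => 'w => real^'n"
  assumes "!!t w. t : {s..T} ==> w : space M ==> norm (A t w) <= K" "ev X : meas Pm"
  shows "pn (%t w. A t w *v X t w) <= ennreal (K^2) * pn X"
  using weighted_mult_le[of A K X "%_. 1"] assms by (simp add: pn_def)

text \<open>Origin in \<open>growth\<close>: splitting a square twice gives the 4, the path integral
  contributes \<open>(T - s) * K^2\<close> and the stochastic integral \<open>K^2\<close>. The final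
  1 keeps the constant positive when \<open>K = 0\<close>.\<close>

definition growth_const :: "real => real" where "growth_const K = 4 * (T - s + 1) * K^2 + 1"

lemma growth_const_pos: "0 < growth_const K"
proof -
  have "0 <= 4 * (T - s + 1) * K^2" using sT by (intro mult_nonneg_nonneg) auto
  then show ?thesis unfolding growth_const_def by linarith
qed

text \<open>\<open>R\<close> holds whatever does not depend on \<open>X\<close>: it is zero for
  differences of Picard steps and the integral of the forcing term in
  \<open>state_estimate\<close>.\<close>

lemma growth:
  fixes A C :: "real => 'w => real^'n^'n" and X Y R :: "real => 'w => real^'n"
  assumes A: "A : BP" "!!t w. t : {s..T} ==> w : space M ==> norm (A t w) <= K"
    and C: "!!t w. t : {s..T} ==> w : space M ==> norm (C t w) <= K"
    and X: "X : L2P" and J: "ito (%t w. C t w *v X t w) J"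
    and R: "R : CP"
    and Y: "AE w in M. ALL t:{s..T}. Y t w = (LINT r:{s..t}|lborel. A r w *v X r w) + J t w + R t w"
    and t: "t : {s..T}"
  shows "(EM w. ennreal ((norm (Y t w))^2)) <=
     ennreal (growth_const K) * (EP z. indicator {s<..t} (snd z) * ennreal ((norm (ev X z))^2))
     + 2 * (EM w. ennreal ((norm (R t w))^2))"
proof -
  define Q where "Q = (EP z. indicator {s<..t} (snd z) * ennreal ((norm (ev X z))^2))"
  have Xev: "ev X : meas Pm" using X by (auto simp: L2_prog_def intro: prog_ev)
  have AX: "(%t w. A t w *v X t w) : L2P" by (rule bounded_mult_L2[OF A(1) X])
  obtain V where V: "V : CP" "AE w in M. ALL t:{s..T}. V t w = (LINT r:{s..t}|lborel. A r w *v X r w)"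
    using primitive_exists[OF AX] by blast
  have Jc: "J : CP" using J by (simp add: ito_integral_def)
  note [measurable] = cont_prog_M[OF V(1) t] cont_prog_M[OF Jc t] cont_prog_M[OF R t]
  have im: "(%z. indicator {s<..t} (snd z) :: ennreal) : meas Pm" by (rule Pm_sndI) simp
  have a: "(EM w. ennreal ((norm (V t w))^2)) <= ennreal (T - s) * (ennreal (K^2) * Q)"
    unfolding Q_def
    by (rule order_trans[OF primitive_bounds(1)[OF AX V(2) t]]) (intro mult_left_mono weighted_mult_le A(2) Xev im, auto)
  have b: "(EM w. ennreal ((norm (J t w))^2)) <= ennreal (K^2) * Q"
  proof -
    have "(EM w. ennreal ((norm (J t w))^2)) = (EP z. indicator {s<..t} (snd z) * ennreal ((norm (ev (%t w. C t w *v X t w) z))^2))"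
      using ito_iso_vec[OF J ito_zero t] by (simp add: ev_def)
    also have "... <= ennreal (K^2) * Q" unfolding Q_def by (intro weighted_mult_le C Xev im)
    finally show ?thesis .
  qed
  have "(EM w. ennreal ((norm (Y t w))^2)) = (EM w. ennreal ((norm ((V t w + J t w) + R t w))^2))"
    using Y V(2) t by (intro nn_integral_cong_AE) (auto elim!: eventually_elim2)
  also have "... <= 2 * (EM w. ennreal ((norm (V t w + J t w))^2)) + 2 * (EM w. ennreal ((norm (R t w))^2))"
    by (rule nn_integral_norm_add_sq) measurable
  also have "... <= 2 * (2 * (ennreal (T - s) * (ennreal (K^2) * Q)) + 2 * (ennreal (K^2) * Q)) + 2 * (EM w. ennreal ((norm (R t w))^2))"
    by (intro add_mono mult_left_mono order_trans[OF nn_integral_norm_add_sq] a b order_refl)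
       (simp_all add: cont_prog_M[OF V(1) t] cont_prog_M[OF Jc t])
  also have "2 * (2 * (ennreal (T - s) * (ennreal (K^2) * Q)) + 2 * (ennreal (K^2) * Q)) = ennreal (4 * (T - s + 1) * K^2) * Q"
  proof -
    have "ennreal (4 * (d + 1) * k) = 4 * (ennreal d + 1) * ennreal k" if "0 <= d" "0 <= k" for d k
      using that by (simp add: ennreal_mult)
    from this[of "T - s" "K^2"] sT
    have "ennreal (4 * (T - s + 1) * K^2) = 4 * (ennreal (T - s) + 1) * ennreal (K^2)" by simp
    then show ?thesis by (simp add: algebra_simps)
  qed
  also have "... <= ennreal (growth_const K) * Q" by (intro mult_right_mono ennreal_leI) (auto simp: growth_const_def)
  finally show ?thesis by (simp add: Q_def)
qed

lemma growth_sup: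
  fixes A C :: "real => 'w => real^'n^'n" and X Y :: "real => 'w => real^'n"
  assumes A: "A : BP" "!!t w. t : {s..T} ==> w : space M ==> norm (A t w) <= K"
    and C: "!!t w. t : {s..T} ==> w : space M ==> norm (C t w) <= K"
    and X: "X : L2P" and J: "ito (%t w. C t w *v X t w) J"
    and Y: "AE w in M. ALL t:{s..T}. Y t w = (LINT r:{s..t}|lborel. A r w *v X r w) + J t w"
  shows "(EM w. supsq Y w) <= ennreal (2 * growth_const K) * pn X"
proof -
  have Xev: "ev X : meas Pm" using X by (auto simp: L2_prog_def intro: prog_ev)
  have AX: "(%t w. A t w *v X t w) : L2P" by (rule bounded_mult_L2[OF A(1) X])
  obtain V where V: "V : CP" "AE w in M. ALL t:{s..T}. V t w = (LINT r:{s..t}|lborel. A r w *v X r w)"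
    using primitive_exists[OF AX] by blast
  have Jc: "J : CP" using J by (simp add: ito_integral_def)
  have "AE w in M. supsq Y w = supsq (%t w. V t w + J t w) w"
    using Y V(2) by eventually_elim (auto simp: supsq_def intro!: SUP_cong)
  then have "(EM w. supsq Y w) = (EM w. supsq (%t w. V t w + J t w) w)" by (rule nn_integral_cong_AE)
  also have "... <= 2 * (EM w. supsq V w) + 2 * (EM w. supsq J w)" by (rule supsq_add_integral[OF V(1) Jc])
  also have "... <= 2 * (ennreal (T - s) * (ennreal (K^2) * pn X)) + 2 * (4 * (ennreal (K^2) * pn X))"
  proof (intro add_mono mult_left_mono)
    show "(EM w. supsq V w) <= ennreal (T - s) * (ennreal (K^2) * pn X)"
      by (rule order_trans[OF primitive_bounds(2)[OF AX V(2)]]) (intro mult_left_mono pn_mult_le A(2) Xev, auto)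
    show "(EM w. supsq J w) <= 4 * (ennreal (K^2) * pn X)"
      by (rule order_trans[OF ito_sup_finite[OF J]]) (intro mult_left_mono pn_mult_le C Xev, auto)
  qed auto
  also have "... = ennreal ((2 * (T - s) + 8) * K^2) * pn X"
  proof -
    have "ennreal ((2 * d + 8) * k) = (2 * ennreal d + 8) * ennreal k" if "0 <= d" "0 <= k" for d k
      using that by (simp add: ennreal_mult)
    from this[of "T - s" "K^2"] sT
    have "ennreal ((2 * (T - s) + 8) * K^2) = (2 * ennreal (T - s) + 8) * ennreal (K^2)" by simp
    then show ?thesis by (simp add: algebra_simps)
  qed
  also have "... <= ennreal (2 * growth_const K) * pn X"
  proof (intro mult_right_mono ennreal_leI)
    have "(2 * (T - s) + 8) * K^2 <= (8 * (T - s) + 8) * K^2" using sT by (intro mult_right_mono) auto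
    then show "(2 * (T - s) + 8) * K^2 <= 2 * growth_const K" by (simp add: growth_const_def algebra_simps)
  qed auto
  finally show ?thesis .
qed

text \<open>A relation and not a map, since the stochastic integral is itself given by a
  relation.\<close>

definition picard :: "(real => 'w => real^'n^'n) => (real => 'w => real^'n^'n) => (real => 'w => real^'n) => real^'n
    => (real => 'w => real^'n) => (real => 'w => real^'n) => bool" where
  "picard A C f \<xi> X X' \<longleftrightarrow> X' : L2C & (EX I. ito (%t w. C t w *v X t w) I &
     (AE w in M. ALL t:{s..T}. X' t w = \<xi> + (LINT r:{s..t}|lborel. A r w *v X r w + f r w) + I t w))"

lemma picard_exists:
  fixes A C :: "real => 'w => real^'n^'n"
  assumes A: "A : BP" and C: "C : BP"
    and f: "f : L2P" and X: "X : L2P"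
  shows "EX X'. picard A C f \<xi> X X'"
proof -
  have b: "(%t w. A t w *v X t w + f t w) : L2P" by (intro L2_prog_add bounded_mult_L2[OF A X] f)
  have \<sigma>: "(%t w. C t w *v X t w) : L2P" by (rule bounded_mult_L2[OF C X])
  obtain V where V: "V : CP" "AE w in M. ALL t:{s..T}. V t w = (LINT r:{s..t}|lborel. A r w *v X r w + f r w)"
    using primitive_exists[OF b] by blast
  obtain I where I: "ito (%t w. C t w *v X t w) I" using ito_exists[OF \<sigma>] by blast
  have Ic: "I : CP" using I by (simp add: ito_integral_def)
  have Vs: "(EM w. supsq V w) < \<infinity>"
    by (rule le_less_trans[OF primitive_bounds(2)[OF b V(2)]]) (use b in \<open>auto simp: L2_prog_pn ennreal_mult_less_top\<close>)
  have Is: "(EM w. supsq I w) < \<infinity>"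
    by (rule le_less_trans[OF ito_sup_finite[OF I]]) (use \<sigma> in \<open>auto simp: L2_prog_pn ennreal_mult_less_top\<close>)
  have cs: "(EM w. supsq (%_ _. \<xi>) w) < \<infinity>"
  proof -
    have "(EM w. supsq (%_ _. \<xi>) w) <= (EM w. ennreal ((norm \<xi>)^2))" by (intro nn_integral_mono) (auto simp: supsq_def intro: SUP_least)
    then show ?thesis by (auto simp: emeasure_space_1 intro: le_less_trans)
  qed
  have c1: "(%t w. \<xi> + V t w) : CP" by (rule cont_prog_add[OF cont_prog_const V(1)])
  have "(EM w. supsq (%t w. \<xi> + V t w) w) < \<infinity>"
    by (rule le_less_trans[OF supsq_add_integral[OF cont_prog_const V(1)]]) (use cs Vs in \<open>simp add: ennreal_mult_less_top\<close>)
  then have "(EM w. supsq (%t w. \<xi> + V t w + I t w) w) < \<infinity>"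
    by (intro le_less_trans[OF supsq_add_integral[OF c1 Ic]]) (use Is in \<open>simp add: ennreal_mult_less_top\<close>)
  moreover have "(%t w. \<xi> + V t w + I t w) : CP" by (rule cont_prog_add[OF c1 Ic])
  moreover have "AE w in M. ALL t:{s..T}. \<xi> + V t w + I t w = \<xi> + (LINT r:{s..t}|lborel. A r w *v X r w + f r w) + I t w"
    using V(2) by eventually_elim simp
  ultimately show ?thesis unfolding picard_def L2_cont_iff using I by blast
qed

lemma picard_diff:
  fixes A C :: "real => 'w => real^'n^'n"
  assumes A: "A : BP"
    and f: "f : L2P" and X: "X1 : L2P" "X2 : L2P"
    and P: "picard A C f \<xi> X1 Y1" "picard A C f \<xi> X2 Y2"
  shows "EX J. ito (%t w. C t w *v (X1 t w - X2 t w)) J &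
    (AE w in M. ALL t:{s..T}. Y1 t w - Y2 t w = (LINT r:{s..t}|lborel. A r w *v (X1 r w - X2 r w)) + J t w)"
proof -
  from P(1) obtain I1 where I1: "ito (%t w. C t w *v X1 t w) I1"
    "AE w in M. ALL t:{s..T}. Y1 t w = \<xi> + (LINT r:{s..t}|lborel. A r w *v X1 r w + f r w) + I1 t w" by (auto simp: picard_def)
  from P(2) obtain I2 where I2: "ito (%t w. C t w *v X2 t w) I2"
    "AE w in M. ALL t:{s..T}. Y2 t w = \<xi> + (LINT r:{s..t}|lborel. A r w *v X2 r w + f r w) + I2 t w" by (auto simp: picard_def)
  have "ito (%t w. C t w *v (X1 t w - X2 t w)) (%t w. I1 t w - I2 t w)"
    using ito_diff[OF I1(1) I2(1)] by (simp add: matrix_vector_mult_diff_distrib)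
  moreover have "AE w in M. ALL t:{s..T}. Y1 t w - Y2 t w = (LINT r:{s..t}|lborel. A r w *v (X1 r w - X2 r w)) + (I1 t w - I2 t w)"
    using I1(2) I2(2) L2_path_integrable[OF L2_prog_add[OF bounded_mult_L2[OF A X(1)] f]]
      L2_path_integrable[OF L2_prog_add[OF bounded_mult_L2[OF A X(2)] f]]
  proof eventually_elim
    case (elim w)
    show ?case
    proof
      fix t assume t: "t : {s..T}"
      have i: "set_integrable lborel {s..t} (%r. A r w *v X1 r w + f r w)" "set_integrable lborel {s..t} (%r. A r w *v X2 r w + f r w)"
        using elim t by (auto intro: set_integrable_subset)
      have "(LINT r:{s..t}|lborel. A r w *v (X1 r w - X2 r w)) =
        (LINT r:{s..t}|lborel. (A r w *v X1 r w + f r w) - (A r w *v X2 r w + f r w))"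
        by (simp add: matrix_vector_mult_diff_distrib)
      also have "... = (LINT r:{s..t}|lborel. A r w *v X1 r w + f r w) - (LINT r:{s..t}|lborel. A r w *v X2 r w + f r w)"
        by (rule set_integral_diff(2)[OF i])
      finally show "Y1 t w - Y2 t w = (LINT r:{s..t}|lborel. A r w *v (X1 r w - X2 r w)) + (I1 t w - I2 t w)"
        using elim t by simp
    qed
  qed
  ultimately show ?thesis by blast
qed

text \<open>The forcing term and the initial value cancel in the difference of two steps. The first
  bound contracts in the weighted norm; the second raises that convergence to the supremum over
  time, as needed for continuous limits.\<close>

lemma wn_contract:
  fixes A C :: "real => 'w => real^'n^'n"
  assumes A: "A : BP" "!!t w. t : {s..T} ==> w : space M ==> norm (A t w) <= K"
    and C: "!!t w. t : {s..T} ==> w : space M ==> norm (C t w) <= K"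
    and f: "f : L2P" and X: "X1 : L2P" "X2 : L2P"
    and P: "picard A C f \<xi> X1 Y1" "picard A C f \<xi> X2 Y2"
  shows "wn (4 * growth_const K) (%t w. Y1 t w - Y2 t w) <= ennreal (1/4) * wn (4 * growth_const K) (%t w. X1 t w - X2 t w)"
    and "(EM w. supsq (%t w. Y1 t w - Y2 t w) w) <= ennreal (2 * growth_const K) * pn (%t w. X1 t w - X2 t w)"
proof -
  from picard_diff[OF A(1) f X P] obtain J where J: "ito (%t w. C t w *v (X1 t w - X2 t w)) J"
    "AE w in M. ALL t:{s..T}. Y1 t w - Y2 t w = (LINT r:{s..t}|lborel. A r w *v (X1 r w - X2 r w)) + J t w" by blast
  have D: "(%t w. X1 t w - X2 t w) : L2P" by (rule L2_prog_diff[OF X])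
  have J0: "AE w in M. ALL t:{s..T}. Y1 t w - Y2 t w = (LINT r:{s..t}|lborel. A r w *v (X1 r w - X2 r w)) + J t w + (%_ _. 0) t w"
    using J(2) by simp
  have Yc: "(%t w. Y1 t w - Y2 t w) : CP"
    using P by (intro cont_prog_diff) (auto simp: picard_def L2_cont_def)
  have ev: "ev (%t w. X1 t w - X2 t w) : meas Pm" "ev (%t w. Y1 t w - Y2 t w) : meas Pm"
    using D Yc by (auto simp: L2_prog_def cont_prog_def intro: prog_ev)
  have "wn (4 * growth_const K) (%t w. Y1 t w - Y2 t w) <= ennreal (1/4) * wn (4 * growth_const K) (%t w. X1 t w - X2 t w) + ennreal (0 * (T - s))"
  proof (rule wn_volterra[OF ev growth_const_pos])
    fix t assume t: "t : {s..T}"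
    show "(EM w. ennreal ((norm (Y1 t w - Y2 t w))^2)) <= ennreal (growth_const K) *
       (EP z. indicator {s<..t} (snd z) * ennreal ((norm (ev (%t w. X1 t w - X2 t w) z))^2)) + ennreal 0"
      using growth[OF A C D J(1) cont_prog_const J0 t] by simp
  qed simp
  then show "wn (4 * growth_const K) (%t w. Y1 t w - Y2 t w) <= ennreal (1/4) * wn (4 * growth_const K) (%t w. X1 t w - X2 t w)" by simp
  show "(EM w. supsq (%t w. Y1 t w - Y2 t w) w) <= ennreal (2 * growth_const K) * pn (%t w. X1 t w - X2 t w)"
    by (rule growth_sup[OF A C D J])
qed

text \<open>The weighted distance of successive iterates decays like \<open>1 / 4 ^ k\<close>, just
  the rate that \<open>cont_limit\<close> asks for.\<close>

lemma sde_exists: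
  fixes A C :: "real => 'w => real^'n^'n"
  assumes A: "A : BP" and C: "C : BP"
    and f: "f : L2P"
  shows "EX X. lin_state A C f \<xi> X"
proof -
  obtain KA where KA: "0 <= KA" "!!t w. t : {s..T} ==> w : space M ==> norm (A t w) <= KA" using bounded_progD[OF A] by metis
  obtain KC where KC: "0 <= KC" "!!t w. t : {s..T} ==> w : space M ==> norm (C t w) <= KC" using bounded_progD[OF C] by metis
  define K where "K = max KA KC"
  have bA: "norm (A t w) <= K" and bC: "norm (C t w) <= K" if "t : {s..T}" "w : space M" for t w
    using KA(2)[OF that] KC(2)[OF that] by (auto simp: K_def)
  define \<mu> where "\<mu> = 4 * growth_const K"
  have \<mu>: "0 <= \<mu>" using growth_const_pos[of K] by (simp add: \<mu>_def)
  \<comment> \<open>Each step chooses some Picard image. That the choice is good needs the previous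
    iterate in \<open>L2P\<close>, whence the induction in \<open>xL\<close>.\<close>
  define x where "x = rec_nat (%_ _. 0 :: real^'n) (%_ X. SOME X'. picard A C f \<xi> X X')"
  have x0: "x 0 = (%_ _. 0)" by (simp add: x_def)
  have xS: "x k : L2P ==> picard A C f \<xi> (x k) (x (Suc k))" for k
    using someI_ex[OF picard_exists[OF A C f]] by (simp add: x_def)
  have xL: "x k : L2P" for k
  proof (induction k)
    case 0 then show ?case by (auto simp: x0 L2_prog_def prog_measurable_def)
  next
    case (Suc k)
    then show ?case using xS[OF Suc] by (auto simp: picard_def intro: L2_cont_L2_prog)
  qed
  note xP = xS[OF xL]
  have xev: "ev (x k) : meas Pm" for k using xL[of k] by (auto simp: L2_prog_def intro: prog_ev)
  have xdev: "ev (%t w. x (Suc k) t w - x k t w) : meas Pm" for k unfolding ev_diff using xev by auto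
  have W0: "wn \<mu> (%t w. x (Suc 0) t w - x 0 t w) < \<infinity>"
    by (rule le_less_trans[OF wn_le_pn[OF \<mu> xdev]]) (use L2_prog_diff[OF xL xL, of "Suc 0" 0] in \<open>simp add: L2_prog_pn\<close>)
  define ww where "ww = enn2real (wn \<mu> (%t w. x (Suc 0) t w - x 0 t w))"
  have ww: "0 <= ww" "wn \<mu> (%t w. x (Suc 0) t w - x 0 t w) = ennreal ww" using W0 by (simp_all add: ww_def)
  have W: "wn \<mu> (%t w. x (Suc k) t w - x k t w) <= ennreal (ww / 4 ^ k)" for k
  proof (induction k)
    case 0 then show ?case using ww by simp
  next
    case (Suc k)
    have "wn \<mu> (%t w. x (Suc (Suc k)) t w - x (Suc k) t w) <= ennreal (1/4) * wn \<mu> (%t w. x (Suc k) t w - x k t w)"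
      unfolding \<mu>_def by (rule wn_contract(1)[OF A bA bC f xL xL xP xP])
    also have "... <= ennreal (1/4) * ennreal (ww / 4 ^ k)" by (intro mult_left_mono Suc) auto
    also have "... = ennreal (ww / 4 ^ Suc k)" using ww by (simp add: ennreal_mult[symmetric])
    finally show ?case .
  qed
  \<comment> \<open>The constant of the supremum bound times the price
    \<open>exp (\<mu> * T)\<close> of leaving the weighted norm times the first distance.\<close>
  define c where "c = 2 * growth_const K * (exp (\<mu> * T) * ww)"
  have Yc: "x (Suc k) : CP" for k using xP[of k] by (auto simp: picard_def L2_cont_def)
  have "(EM w. supsq (%t w. x (Suc (Suc k)) t w - x (Suc k) t w) w) <= ennreal (c / 4 ^ k)" for k
  proof -
    have "(EM w. supsq (%t w. x (Suc (Suc k)) t w - x (Suc k) t w) w) <= ennreal (2 * growth_const K) * pn (%t w. x (Suc k) t w - x k t w)"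
      by (rule wn_contract(2)[OF A bA bC f xL xL xP xP])
    also have "... <= ennreal (2 * growth_const K) * (ennreal (exp (\<mu> * T)) * ennreal (ww / 4 ^ k))"
      by (intro mult_left_mono order_trans[OF pn_le_wn[OF \<mu> xdev]] W) auto
    also have "... = ennreal (c / 4 ^ k)" using ww growth_const_pos[of K] by (simp add: ennreal_mult[symmetric] c_def ac_simps)
    finally show ?thesis .
  qed
  from cont_limit[of "%k. x (Suc k)", OF Yc this] obtain X where X: "X : CP"
    "(%k. EM w. supsq (%t w. x (Suc k) t w - X t w) w) ----> 0" by blast
  have Xev: "ev X : meas Pm" using X by (auto simp: cont_prog_def intro: prog_ev)
  have XL: "X : L2C"
  proof -
    have "\<forall>\<^sub>F k in sequentially. (EM w. supsq (%t w. x (Suc k) t w - X t w) w) < 1" using X(2) by (rule order_tendstoD) simp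
    then obtain k where k: "(EM w. supsq (%t w. x (Suc k) t w - X t w) w) < 1" by (auto simp: eventually_sequentially)
    have lt1: "(EM w. supsq (%t w. X t w - x (Suc k) t w) w) < 1"
      using k by (simp add: supsq_def norm_minus_commute)
    have fin: "(EM w. supsq (x (Suc k)) w) < \<infinity>" using xP[of k] by (simp add: picard_def L2_cont_iff)
    have "(EM w. supsq X w) = (EM w. supsq (%t w. (X t w - x (Suc k) t w) + x (Suc k) t w) w)" by simp
    also have "... <= 2 * (EM w. supsq (%t w. X t w - x (Suc k) t w) w) + 2 * (EM w. supsq (x (Suc k)) w)"
      by (intro supsq_add_integral cont_prog_diff X Yc)
    also have "... <= 2 * 1 + 2 * (EM w. supsq (x (Suc k)) w)"
      by (intro add_right_mono mult_left_mono less_imp_le[OF lt1]) simp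
    finally have "(EM w. supsq X w) <= 2 * 1 + 2 * (EM w. supsq (x (Suc k)) w)" .
    moreover have "2 * 1 + 2 * (EM w. supsq (x (Suc k)) w) < \<infinity>" using fin by (simp add: ennreal_mult_less_top)
    ultimately have "(EM w. supsq X w) < \<infinity>" by (rule le_less_trans)
    then show ?thesis using X by (simp add: L2_cont_iff)
  qed
  have XL2: "X : L2P" by (rule L2_cont_L2_prog[OF XL])
  \<comment> \<open>A Picard image of the limit. The iterates converge to \<open>X\<close> by
    construction and to \<open>X'\<close> by the contraction, so the two are indistinguishable and
    \<open>X\<close> is a fixed point.\<close>
  obtain X' where X': "picard A C f \<xi> X X'" using picard_exists[OF A C f XL2] by blast
  have X'c: "X' : CP" using X' by (simp add: picard_def L2_cont_def)
  have pn0: "(%k. ennreal (2 * growth_const K) * (ennreal (T - s) * (EM w. supsq (%t w. x (Suc k) t w - X t w) w))) ----> 0"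
  proof -
    have "(%k. ennreal (2 * growth_const K) * (ennreal (T - s) * (EM w. supsq (%t w. x (Suc k) t w - X t w) w))) ----> ennreal (2 * growth_const K) * (ennreal (T - s) * 0)"
      by (intro ennreal_tendsto_cmult X(2)) auto
    then show ?thesis by simp
  qed
  have lim': "(%k. EM w. supsq (%t w. x (Suc (Suc k)) t w - X' t w) w) ----> 0"
  proof (rule tendsto_sandwich[OF _ _ tendsto_const pn0])
    show "\<forall>\<^sub>F k in sequentially. (EM w. supsq (%t w. x (Suc (Suc k)) t w - X' t w) w) <=
      ennreal (2 * growth_const K) * (ennreal (T - s) * (EM w. supsq (%t w. x (Suc k) t w - X t w) w))"
    proof (intro always_eventually allI)
      fix k
      show "(EM w. supsq (%t w. x (Suc (Suc k)) t w - X' t w) w) <=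
        ennreal (2 * growth_const K) * (ennreal (T - s) * (EM w. supsq (%t w. x (Suc k) t w - X t w) w))"
      proof (rule order_trans)
        show "(EM w. supsq (%t w. x (Suc (Suc k)) t w - X' t w) w) <= ennreal (2 * growth_const K) * pn (%t w. x (Suc k) t w - X t w)"
          by (rule wn_contract(2)[OF A bA bC f xL XL2 xP X'])
        show "ennreal (2 * growth_const K) * pn (%t w. x (Suc k) t w - X t w) <=
          ennreal (2 * growth_const K) * (ennreal (T - s) * (EM w. supsq (%t w. x (Suc k) t w - X t w) w))"
          by (intro mult_left_mono pn_le_supsq cont_prog_diff Yc X(1)) auto
      qed
    qed
  qed auto
  have "(EM w. supsq (%t w. X t w - X' t w) w) <= 0"
  proof (rule LIMSEQ_le_const)
    have "(%k. 2 * (EM w. supsq (%t w. x (Suc (Suc k)) t w - X t w) w) + 2 * (EM w. supsq (%t w. x (Suc (Suc k)) t w - X' t w) w)) ----> 2 * 0 + 2 * 0"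
      by (intro tendsto_add ennreal_tendsto_cmult LIMSEQ_Suc[OF X(2)] lim') auto
    then show "(%k. 2 * (EM w. supsq (%t w. x (Suc (Suc k)) t w - X t w) w) + 2 * (EM w. supsq (%t w. x (Suc (Suc k)) t w - X' t w) w)) ----> 0" by simp
    show "EX N. ALL k>=N. (EM w. supsq (%t w. X t w - X' t w) w) <=
      2 * (EM w. supsq (%t w. x (Suc (Suc k)) t w - X t w) w) + 2 * (EM w. supsq (%t w. x (Suc (Suc k)) t w - X' t w) w)"
    proof (intro exI[of _ 0] allI impI)
      fix k
      have "(EM w. supsq (%t w. (X t w - x (Suc (Suc k)) t w) + (x (Suc (Suc k)) t w - X' t w)) w) <=
        2 * (EM w. supsq (%t w. X t w - x (Suc (Suc k)) t w) w) + 2 * (EM w. supsq (%t w. x (Suc (Suc k)) t w - X' t w) w)"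
        by (intro supsq_add_integral cont_prog_diff X(1) X'c Yc)
      moreover have "supsq (%t w. X t w - x (Suc (Suc k)) t w) = supsq (%t w. x (Suc (Suc k)) t w - X t w)"
        by (simp add: supsq_def[abs_def] norm_minus_commute)
      ultimately show "(EM w. supsq (%t w. X t w - X' t w) w) <=
        2 * (EM w. supsq (%t w. x (Suc (Suc k)) t w - X t w) w) + 2 * (EM w. supsq (%t w. x (Suc (Suc k)) t w - X' t w) w)" by simp
    qed
  qed
  then have eq: "AE w in M. ALL t:{s..T}. X t w - X' t w = 0"
    by (intro supsq_zero_AE cont_prog_diff X(1) X'c) simp
  from X' obtain I where I: "ito (%t w. C t w *v X t w) I"
    "AE w in M. ALL t:{s..T}. X' t w = \<xi> + (LINT r:{s..t}|lborel. A r w *v X r w + f r w) + I t w" by (auto simp: picard_def)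
  have fp: "AE w in M. ALL t:{s..T}. X t w = \<xi> + (LINT r:{s..t}|lborel. A r w *v X r w + f r w) + I t w"
    using eq I(2) by eventually_elim auto
  have X0: "AE w in M. X s w = \<xi>"
    using fp ito_start[OF I(1)]
  proof eventually_elim
    case (elim w)
    have "(LINT r:{s..s}|lborel. A r w *v X r w + f r w) = 0" by (rule set_lint_point)
    moreover have "X s w = \<xi> + (LINT r:{s..s}|lborel. A r w *v X r w + f r w) + I s w" using elim sT by (auto dest: bspec[of _ _ s])
    ultimately show ?case using elim by simp
  qed
  have "lin_state A C f \<xi> X"
    unfolding linear_state_def ito_differential_def
  proof (intro conjI exI[of _ I] XL I(1) X0)
    show "AE w in M. set_integrable lborel {s..T} (%r. A r w *v X r w + f r w)"
      using L2_path_integrable[OF L2_prog_add[OF bounded_mult_L2[OF A XL2] f]] by eventually_elim simp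
    show "AE w in M. ALL t:{s..T}. X t w = X s w + (LINT r:{s..t}|lborel. A r w *v X r w + f r w) + I t w"
      using fp X0 by eventually_elim simp
  qed
  then show ?thesis by blast
qed

text \<open>The same weighted inequality with the solution on both sides: the homogeneous part is
  absorbed, and the state is bounded by the mean square of the integrated forcing term. Its factor
  \<open>\<beta>\<close> becomes small for forcing on a short interval.\<close>

lemma state_estimate:
  fixes A C :: "real => 'w => real^'n^'n"
  assumes A: "A : BP" "!!t w. t : {s..T} ==> w : space M ==> norm (A t w) <= K"
    and C: "!!t w. t : {s..T} ==> w : space M ==> norm (C t w) <= K"
    and f: "f : L2P" and X: "lin_state A C f 0 X"
    and \<beta>: "0 <= \<beta>" "!!t. t : {s..T} ==> (EM w. ennreal ((norm (LINT r:{s..t}|lborel. f r w))^2)) <= ennreal \<beta>"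
  shows "pn X <= ennreal (exp (4 * growth_const K * T) * (4 * (T - s)) * \<beta>)"
    and "(EM w. ennreal ((norm (X T w))^2)) <= ennreal ((growth_const K * (exp (4 * growth_const K * T) * (4 * (T - s))) + 2) * \<beta>)"
proof -
  define \<mu> where "\<mu> = 4 * growth_const K"
  have \<mu>: "0 <= \<mu>" using growth_const_pos[of K] by (simp add: \<mu>_def)
  have XL: "X : L2C" using X by (simp add: linear_state_def)
  have XL2: "X : L2P" by (rule L2_cont_L2_prog[OF XL])
  have Xev: "ev X : meas Pm" using XL2 by (auto simp: L2_prog_def intro: prog_ev)
  from X obtain I where I: "ito (%t w. C t w *v X t w) I"
    "AE w in M. ALL t:{s..T}. X t w = X s w + (LINT r:{s..t}|lborel. A r w *v X r w + f r w) + I t w" "AE w in M. X s w = 0"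
    by (auto simp: linear_state_def ito_differential_def)
  obtain R where R: "R : CP" "AE w in M. ALL t:{s..T}. R t w = (LINT r:{s..t}|lborel. f r w)"
    using primitive_exists[OF f] by blast
  have dec: "AE w in M. ALL t:{s..T}. X t w = (LINT r:{s..t}|lborel. A r w *v X r w) + I t w + R t w"
    using I(2,3) R(2) L2_path_integrable[OF f] L2_path_integrable[OF bounded_mult_L2[OF A(1) XL2]]
  proof eventually_elim
    case (elim w)
    show ?case
    proof
      fix t assume t: "t : {s..T}"
      have "(LINT r:{s..t}|lborel. A r w *v X r w + f r w) = (LINT r:{s..t}|lborel. A r w *v X r w) + (LINT r:{s..t}|lborel. f r w)"
        using elim t by (intro set_integral_add(2)) (auto intro: set_integrable_subset)
      then show "X t w = (LINT r:{s..t}|lborel. A r w *v X r w) + I t w + R t w" using elim t by simp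
    qed
  qed
  have Rb: "(EM w. ennreal ((norm (R t w))^2)) <= ennreal \<beta>" if t: "t : {s..T}" for t
  proof -
    have "(EM w. ennreal ((norm (R t w))^2)) = (EM w. ennreal ((norm (LINT r:{s..t}|lborel. f r w))^2))"
      using R(2) t by (intro nn_integral_cong_AE) (auto elim: eventually_mono)
    then show ?thesis using \<beta>(2)[OF t] by simp
  qed
  have g: "(EM w. ennreal ((norm (X t w))^2)) <= ennreal (growth_const K) *
       (EP z. indicator {s<..t} (snd z) * ennreal ((norm (ev X z))^2)) + ennreal (2 * \<beta>)" if t: "t : {s..T}" for t
  proof -
    have "2 * (EM w. ennreal ((norm (R t w))^2)) <= ennreal (2 * \<beta>)"
      using mult_left_mono[OF Rb[OF t], of 2] \<beta>(1) by (simp add: ennreal_mult)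
    then show ?thesis by (intro order_trans[OF growth[OF A C XL2 I(1) R(1) dec t]] add_left_mono)
  qed
  have w1: "wn \<mu> X <= ennreal (1/4) * wn \<mu> X + ennreal (2 * \<beta> * (T - s))"
    unfolding \<mu>_def by (rule wn_volterra[OF Xev Xev growth_const_pos _ g]) (use \<beta> in auto)
  \<comment> \<open>Only a finite quantity can be subtracted from both sides of
    \<open>w1\<close>.\<close>
  have wf: "wn \<mu> X < \<infinity>" by (rule le_less_trans[OF wn_le_pn[OF \<mu> Xev]]) (use XL2 in \<open>simp add: L2_prog_pn\<close>)
  define ww where "ww = enn2real (wn \<mu> X)"
  have ww: "0 <= ww" "wn \<mu> X = ennreal ww" using wf by (simp_all add: ww_def)
  have "ennreal ww <= ennreal (1/4 * ww + 2 * \<beta> * (T - s))"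
    using w1 ww \<beta>(1) sT by (simp add: ennreal_mult[symmetric])
  then have "ww <= 1/4 * ww + 2 * \<beta> * (T - s)" using ww \<beta>(1) sT by (subst (asm) ennreal_le_iff) auto
  moreover have "0 <= \<beta> * (T - s)" using \<beta>(1) sT by simp
  \<comment> \<open>Absorbing a quarter leaves \<open>3/4 * ww <= 2 * \<beta> * (T - s)\<close>; the
    factor 4 is a rounder and larger constant.\<close>
  ultimately have w2: "ww <= 4 * (T - s) * \<beta>" by (simp add: algebra_simps)
  have "pn X <= ennreal (exp (\<mu> * T)) * wn \<mu> X" by (rule pn_le_wn[OF \<mu> Xev])
  also have "... <= ennreal (exp (\<mu> * T)) * ennreal (4 * (T - s) * \<beta>)" unfolding ww using w2 by (intro mult_left_mono ennreal_leI) auto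
  also have "... = ennreal (exp (4 * growth_const K * T) * (4 * (T - s)) * \<beta>)"
    using \<beta>(1) sT by (simp add: ennreal_mult[symmetric] \<mu>_def)
  finally show p: "pn X <= ennreal (exp (4 * growth_const K * T) * (4 * (T - s)) * \<beta>)" .
  have T: "T : {s..T}" using sT by simp
  have "(EM w. ennreal ((norm (X T w))^2)) <= ennreal (growth_const K) * pn X + ennreal (2 * \<beta>)"
    unfolding pn_def by (rule order_trans[OF g[OF T] add_right_mono[OF mult_left_mono[OF nn_integral_mono]]]) (auto simp: indicator_def)
  also have "... <= ennreal (growth_const K) * ennreal (exp (4 * growth_const K * T) * (4 * (T - s)) * \<beta>) + ennreal (2 * \<beta>)"
    by (intro add_right_mono mult_left_mono p) auto
  also have "... = ennreal ((growth_const K * (exp (4 * growth_const K * T) * (4 * (T - s))) + 2) * \<beta>)"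
  proof -
    have "ennreal g * ennreal (x * b) + ennreal (2 * b) = ennreal ((g * x + 2) * b)" if "0 <= g" "0 <= x" "0 <= b" for g x b
      using that by (simp add: ennreal_mult[symmetric] ennreal_plus[symmetric] distrib_right mult.assoc del: ennreal_plus)
    from this[of "growth_const K" "exp (4 * growth_const K * T) * (4 * (T - s))" \<beta>] show ?thesis
      using \<beta>(1) sT growth_const_pos[of K] by simp
  qed
  finally show "(EM w. ennreal ((norm (X T w))^2)) <= ennreal ((growth_const K * (exp (4 * growth_const K * T) * (4 * (T - s))) + 2) * \<beta>)" .
qed

end

section \<open>Coercivity of the cost\<close>

context brownian
begin

lemma L2_inner_integrable:
  fixes X Y :: "real => 'w => 'h::euclidean_space"
  assumes "X : L2P" "Y : L2P"
  shows "integrable Pm (%z. ev X z \<bullet> ev Y z)"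
proof (rule Bochner_Integration.integrable_bound[of _ "%z. norm (ev X z) * norm (ev Y z)"])
  show "integrable Pm (%z. norm (ev X z) * norm (ev Y z))"
    using assms by (intro sq_int_mult) (auto simp: L2_prog_iff)
  have "ev X : meas Pm" "ev Y : meas Pm" using assms by (auto simp: L2_prog_def intro: prog_ev)
  then show "(%z. ev X z \<bullet> ev Y z) : meas Pm" by measurable
  show "AE z in Pm. norm (ev X z \<bullet> ev Y z) <= norm (norm (ev X z) * norm (ev Y z))"
    by (intro AE_I2) (simp add: Cauchy_Schwarz_ineq2)
qed

lemma set_lint_lam:
  fixes g :: "real => 'h::euclidean_space"
  shows "(LINT r:{s..T}|lborel. g r) = (LINT r|lam. g r)"
  unfolding lam_def set_lebesgue_integral_def by (subst integral_restrict_space) auto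

lemma iterated_lint:
  assumes "integrable Pm f"
  shows "integrable M (%w. LINT t:{s..T}|lborel. f (w, t) :: real)"
    and "(LINT w|M. (LINT t:{s..T}|lborel. f (w, t))) = (LINT z|Pm. f z)"
  unfolding set_lint_lam using Pm_fubini[OF assms] pmf.integrable_fst'[of f] assms by (auto simp: Pm_def)

lemma L2_cont_sq:
  fixes X :: "real => 'w => 'h::euclidean_space"
  assumes "X : L2C" "t : {s..T}"
  shows "sq_int M (%w. norm (X t w))"
proof -
  have X: "X : CP" "(EM w. supsq X w) < \<infinity>" using assms by (auto simp: L2_cont_iff)
  have "(EM w. ennreal ((norm (X t w))^2)) <= (EM w. supsq X w)" by (intro nn_integral_mono supsq_ge assms)
  moreover have "X t : meas M" by (rule cont_prog_M[OF X(1) assms(2)])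
  ultimately show ?thesis using X(2) by (auto simp: sq_int_iff_nn intro: le_less_trans)
qed

lemma bounded_quad_integrable:
  fixes x :: "'w => real^'n" and y :: "'w => real^'m"
  assumes G: "G : meas M" "!!w. w : space M ==> norm (G w) <= K"
    and x: "x : meas M" "sq_int M (%w. norm (x w))"
    and y: "y : meas M" "sq_int M (%w. norm (y w))"
  shows "integrable M (%w. (G w *v x w) \<bullet> y w)"
proof (rule Bochner_Integration.integrable_bound[of _ "%w. K * (norm (x w) * norm (y w))"])
  show "integrable M (%w. K * (norm (x w) * norm (y w)))" by (intro integrable_mult_right sq_int_mult x y)
  have "(%w. G w *v x w) : meas M"
    by (rule borel_measurable_bilinear2[OF bounded_bilinear_matrix_vector_mult G(1) x(1)])
  then show "(%w. (G w *v x w) \<bullet> y w) : meas M" using y(1) by measurable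
  show "AE w in M. norm ((G w *v x w) \<bullet> y w) <= norm (K * (norm (x w) * norm (y w)))"
  proof (rule AE_I2)
    fix w assume ww: "w : space M"
    have "\<bar>(G w *v x w) \<bullet> y w\<bar> <= norm (G w *v x w) * norm (y w)" by (rule Cauchy_Schwarz_ineq2)
    also have "... <= (norm (G w) * norm (x w)) * norm (y w)" by (intro mult_right_mono norm_matrix_vector_mult_le) auto
    also have "... <= (K * norm (x w)) * norm (y w)" by (intro mult_right_mono G(2)[OF ww]) auto
    finally show "norm ((G w *v x w) \<bullet> y w) <= norm (K * (norm (x w) * norm (y w)))" by (simp add: mult.assoc)
  qed
qed

lemma quadratic_cost_eq:
  fixes D :: "real => 'w => real^'n^'n" and E :: "real => 'w => real^'m^'m"
  assumes D: "D : bounded_prog M F s T H" and E: "E : bounded_prog M F s T H'"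
    and G: "G : meas M" "!!w. w : space M ==> norm (G w) <= K"
    and X: "X : L2C" and u: "u : L2P"
  shows "quadratic_cost M s T D E G X u = (LINT z|Pm. (ev D z *v ev X z) \<bullet> ev X z) + (LINT z|Pm. (ev E z *v ev u z) \<bullet> ev u z)
      + (LINT w|M. (G w *v X T w) \<bullet> X T w)"
proof -
  have XL: "X : L2P" by (rule L2_cont_L2_prog[OF X])
  have i1: "integrable Pm (%z. (ev D z *v ev X z) \<bullet> ev X z)"
    using L2_inner_integrable[OF bounded_mult_L2[OF D XL] XL] by (simp add: ev_def)
  have i2: "integrable Pm (%z. (ev E z *v ev u z) \<bullet> ev u z)"
    using L2_inner_integrable[OF bounded_mult_L2[OF E u] u] by (simp add: ev_def)
  have T: "T : {s..T}" using sT by simp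
  have Xm: "X T : meas M" using X cont_prog_M[OF _ T] by (auto simp: L2_cont_def)
  have i3: "integrable M (%w. (G w *v X T w) \<bullet> X T w)"
    by (rule bounded_quad_integrable[OF G Xm L2_cont_sq[OF X T] Xm L2_cont_sq[OF X T]])
  show ?thesis
    unfolding quadratic_cost_def
    using iterated_lint[OF Bochner_Integration.integrable_add[OF i1 i2]] i1 i2 i3 by (simp add: set_lebesgue_integral_def)
qed

lemma primitive_bound_supp:
  fixes b :: "real => 'w => 'h::euclidean_space"
  assumes b: "b : L2P" and t: "t : {s..T}" and h: "0 <= h"
    and supp: "!!r w. r ~: {a..a + h} ==> b r w = 0"
  shows "(EM w. ennreal ((norm (LINT r:{s..t}|lborel. b r w))^2)) <= ennreal h * pn b"
proof -
  have ev[measurable]: "ev b : meas Pm" using b by (auto simp: L2_prog_def intro: prog_ev)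
  have "(EM w. ennreal ((norm (LINT r:{s..t}|lborel. b r w))^2)) <= (EM w. ennreal h * (\<integral>\<^sup>+r. ennreal ((norm (b r w))^2) \<partial>lam))"
  proof (rule nn_integral_mono_AE)
    show "AE w in M. ennreal ((norm (LINT r:{s..t}|lborel. b r w))^2) <= ennreal h * (\<integral>\<^sup>+r. ennreal ((norm (b r w))^2) \<partial>lam)"
      using L2_path_integrable[OF b] AE_space
      by eventually_elim (intro path_integral_bound_supp[OF section_lam[OF ev] _ t _ h] supp, auto)
  qed
  also have "... = ennreal h * (EM w. (\<integral>\<^sup>+r. ennreal ((norm (b r w))^2) \<partial>lam))"
  proof (rule nn_integral_cmult)
    have "(%z. ennreal ((norm (ev b z))^2)) : meas Pm" by measurable
    from lam.borel_measurable_nn_integral_fst[OF this[unfolded Pm_def]]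
    show "(%w. \<integral>\<^sup>+r. ennreal ((norm (b r w))^2) \<partial>lam) : meas M" by simp
  qed
  also have "(EM w. (\<integral>\<^sup>+r. ennreal ((norm (b r w))^2) \<partial>lam)) = pn b"
    unfolding pn_def using nn_fst[of "%z. ennreal ((norm (ev b z))^2)"] by simp
  finally show ?thesis .
qed

text \<open>Controls concentrated on a short time interval of length \<open>h\<close> move the state only by \<open>O(h)\<close> (in
  squared norm, relative to the control), so that coercivity of the cost forces the control weight
  \<open>E\<close> itself to be uniformly positive.\<close>

lemma coercive_lower_bound_direction:
  fixes A C D :: "real => 'w => real^'n^'n" and B1 :: "real => 'w => real^'m^'n" and E :: "real => 'w => real^'m^'m"
  assumes A: "A : BP" and C: "C : BP"
    and B1: "B1 : BP"
    and D: "D : bounded_prog M F s T H" and E: "E : bounded_prog M F s T H'"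
    and G: "G : meas M" "!!w. w : space M ==> norm (G w) <= KG"
    and \<epsilon>: "0 < \<epsilon>"
    and coercive: "!!v Y. v : L2P ==> lin_state A C (%t w. B1 t w *v v t w) 0 Y ==>
        \<epsilon> * (LINT w|M. (LINT t:{s..T}|lborel. (norm (v t w))^2)) <= quadratic_cost M s T D E G Y v"
  shows "AE z in Pm. \<epsilon> / 2 * (norm ww)^2 <= (ev E z *v ww) \<bullet> ww"
proof -
  obtain KA where KA: "0 <= KA" "!!t w. t : {s..T} ==> w : space M ==> norm (A t w) <= KA" using bounded_progD[OF A] by metis
  obtain KC where KC: "0 <= KC" "!!t w. t : {s..T} ==> w : space M ==> norm (C t w) <= KC" using bounded_progD[OF C] by metis
  obtain KB where KB: "0 <= KB" "!!t w. t : {s..T} ==> w : space M ==> norm (B1 t w) <= KB" using bounded_progD[OF B1] by metis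
  obtain KD where KD: "0 <= KD" "!!t w. t : {s..T} ==> w : space M ==> norm (D t w) <= KD" using bounded_progD[OF D] by metis
  have Ep: "E : PM" using bounded_progD[OF E] by metis
  have Eev[measurable]: "ev E : meas Pm" by (rule prog_ev[OF Ep])
  define K where "K = max KA KC"
  have bA: "norm (A t w) <= K" and bC: "norm (C t w) <= K" if "t : {s..T}" "w : space M" for t w
    using KA(2)[OF that] KC(2)[OF that] by (auto simp: K_def)
  define c1 where "c1 = exp (4 * growth_const K * T) * (4 * (T - s))"
  define c2 where "c2 = growth_const K * (exp (4 * growth_const K * T) * (4 * (T - s))) + 2"
  have c: "0 <= c1" "0 <= c2" using sT growth_const_pos[of K] by (auto simp: c1_def c2_def)
  \<comment> \<open>\<open>L * h * q\<close> will bound what the state contributes to the cost: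
    \<open>c1\<close> belongs to the running term, \<open>c2\<close> to the terminal term, and
    \<open>KB^2\<close> comes from the control acting through \<open>B1\<close>.\<close>
  define L where "L = (KD * c1 + \<bar>KG\<bar> * c2) * KB^2"
  have L: "0 <= L" using KD c by (auto simp: L_def)
  \<comment> \<open>So short that the state contributes at most \<open>\<epsilon> / 4 * q\<close>.
    With \<open>\<epsilon> / 2 * q\<close> from the control this stays below the
    \<open>\<epsilon> * q\<close> demanded by coercivity unless \<open>q = 0\<close>. The 1 avoids
    division by zero.\<close>
  define h where "h = \<epsilon> / (4 * (L + 1))"
  have h: "0 < h" "L * h <= \<epsilon> / 4" using \<epsilon> L by (auto simp: h_def field_simps)
  have qm: "(%A. (A *v ww) \<bullet> ww) : meas borel"
    by (intro borel_measurable_continuous_onI continuous_intros bounded_linear.continuous_on[OF bounded_bilinear.bounded_linear_left[OF bounded_bilinear_matrix_vector_mult]])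
  have key: "AE z in Pm. ~ (snd z : {a..a + h} & (ev E z *v ww) \<bullet> ww < \<epsilon> / 2 * (norm ww)^2)" for a
  proof (cases "ww = 0")
    case True
    then show ?thesis by simp
  next
    case False
    \<comment> \<open>A constant control, switched on only in the window and where \<open>E\<close>
      is too small in the direction \<open>ww\<close>. The switch looks at \<open>E\<close> at the
      current time only, so the control is progressive.\<close>
    define v where "v t w = (if t : {a..a + h} & (E t w *v ww) \<bullet> ww < \<epsilon> / 2 * (norm ww)^2 then ww else 0)" for t w
    have vp: "v : PM"
    proof -
      have "(%(r, w). v r w) : meas (restrict_space borel {s..t} \<Otimes>\<^sub>M F t)" if "t : {s..T}" for t
      proof -
        have [measurable]: "(%z. E (fst z) (snd z)) : meas (restrict_space borel {s..t} \<Otimes>\<^sub>M F t)"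
          using Ep that by (auto simp: prog_measurable_def split_beta')
        have [measurable]: "fst : meas (restrict_space borel {s..t} \<Otimes>\<^sub>M F t)"
          by (rule measurable_compose[OF measurable_fst]) (simp add: measurable_restrict_space1)
        have [measurable]: "(%z. (E (fst z) (snd z) *v ww) \<bullet> ww) : meas (restrict_space borel {s..t} \<Otimes>\<^sub>M F t)"
          by (rule measurable_compose[OF _ qm]) measurable
        show ?thesis unfolding v_def split_beta' atLeastAtMost_iff by measurable
      qed
      then show ?thesis by (auto simp: prog_measurable_def)
    qed
    have vev[measurable]: "ev v : meas Pm" by (rule prog_ev[OF vp])
    have "sq_int Pm (%z. norm (ev v z))"
    proof (rule sq_int_bounded[OF finite_measure_Pm, where K = "norm ww"])
      show "AE z in Pm. \<bar>norm (ev v z)\<bar> <= norm ww" by (intro AE_I2) (auto simp: ev_def v_def)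
    qed measurable
    then have vL: "v : L2P" using vp by (simp add: L2_prog_iff)
    define q where "q = (LINT z|Pm. (norm (ev v z))^2)"
    have vsq: "integrable Pm (%z. (norm (ev v z))^2)" using vL by (simp add: L2_prog_iff sq_int_def)
    have q0: "0 <= q" by (simp add: q_def)
    have pnv: "pn v = ennreal q" unfolding pn_def q_def using vL by (intro nn_integral_sq_eq) (simp add: L2_prog_iff)
    have fL: "(%t w. B1 t w *v v t w) : L2P" by (rule bounded_mult_L2[OF B1 vL])
    obtain Y where Y: "lin_state A C (%t w. B1 t w *v v t w) 0 Y" using sde_exists[OF A C fL] by blast
    have YL: "Y : L2C" using Y by (simp add: linear_state_def)
    have YL2: "Y : L2P" by (rule L2_cont_L2_prog[OF YL])
    define \<beta> where "\<beta> = h * (KB^2 * q)"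
    have \<beta>0: "0 <= \<beta>" using h q0 by (simp add: \<beta>_def)
    have \<beta>: "(EM w. ennreal ((norm (LINT r:{s..t}|lborel. B1 r w *v v r w))^2)) <= ennreal \<beta>" if t: "t : {s..T}" for t
    proof -
      have "(EM w. ennreal ((norm (LINT r:{s..t}|lborel. B1 r w *v v r w))^2)) <= ennreal h * pn (%t w. B1 t w *v v t w)"
        using h by (intro primitive_bound_supp[OF fL t, of h a]) (auto simp: v_def)
      also have "... <= ennreal h * (ennreal (KB^2) * pn v)" by (intro mult_left_mono pn_mult_le KB(2) vev) auto
      also have "... = ennreal \<beta>" using h q0 by (simp add: pnv \<beta>_def ennreal_mult)
      finally show ?thesis .
    qed
    have T: "T : {s..T}" using sT by simp
    have Ysq: "sq_int Pm (%z. norm (ev Y z))" using YL2 by (simp add: L2_prog_iff)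
    have e1: "(LINT z|Pm. (norm (ev Y z))^2) <= c1 * \<beta>"
    proof -
      have "ennreal (LINT z|Pm. (norm (ev Y z))^2) = pn Y" unfolding pn_def by (rule nn_integral_sq_eq[OF Ysq, symmetric])
      also have "... <= ennreal (c1 * \<beta>)" unfolding c1_def by (rule state_estimate(1)[OF A bA bC fL Y \<beta>0 \<beta>])
      finally show ?thesis using c \<beta>0 by (subst (asm) ennreal_le_iff) auto
    qed
    have e2: "(LINT w|M. (norm (Y T w))^2) <= c2 * \<beta>"
    proof -
      have "ennreal (LINT w|M. (norm (Y T w))^2) = (EM w. ennreal ((norm (Y T w))^2))"
        by (rule nn_integral_sq_eq[OF L2_cont_sq[OF YL T], symmetric])
      also have "... <= ennreal (c2 * \<beta>)" unfolding c2_def by (rule state_estimate(2)[OF A bA bC fL Y \<beta>0 \<beta>])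
      finally show ?thesis using c \<beta>0 by (subst (asm) ennreal_le_iff) auto
    qed
    have ev2: "ev (%t w. P t w *v Z t w) z = ev P z *v ev Z z" for z and P :: "real => 'w => real^'k^'l" and Z
      by (simp add: ev_def)
    have "\<epsilon> * q <= quadratic_cost M s T D E G Y v"
      using coercive[OF vL Y] iterated_lint(2)[OF vsq] by (simp add: q_def)
    also have "... = (LINT z|Pm. (ev D z *v ev Y z) \<bullet> ev Y z) + (LINT z|Pm. (ev E z *v ev v z) \<bullet> ev v z) + (LINT w|M. (G w *v Y T w) \<bullet> Y T w)"
      by (rule quadratic_cost_eq[OF D E G YL vL])
    also have "... <= KD * (c1 * \<beta>) + \<epsilon> / 2 * q + \<bar>KG\<bar> * (c2 * \<beta>)"
    proof (intro add_mono)
      have "(LINT z|Pm. (ev D z *v ev Y z) \<bullet> ev Y z) <= (LINT z|Pm. KD * (norm (ev Y z))^2)"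
      proof (rule integral_mono)
        show "integrable Pm (%z. (ev D z *v ev Y z) \<bullet> ev Y z)"
          using L2_inner_integrable[OF bounded_mult_L2[OF D YL2] YL2] by (simp add: ev2)
        show "integrable Pm (%z. KD * (norm (ev Y z))^2)" using Ysq by (simp add: sq_int_def)
        fix z assume z: "z : space Pm"
        have "(ev D z *v ev Y z) \<bullet> ev Y z <= norm (ev D z *v ev Y z) * norm (ev Y z)" by (rule norm_cauchy_schwarz)
        also have "... <= (norm (ev D z) * norm (ev Y z)) * norm (ev Y z)" by (intro mult_right_mono norm_matrix_vector_mult_le) auto
        also have "... <= (KD * norm (ev Y z)) * norm (ev Y z)" using KD z by (intro mult_right_mono) (auto simp: space_Pm)
        finally show "(ev D z *v ev Y z) \<bullet> ev Y z <= KD * (norm (ev Y z))^2" by (simp add: power2_eq_square mult.assoc)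
      qed
      also have "... = KD * (LINT z|Pm. (norm (ev Y z))^2)" by simp
      also have "... <= KD * (c1 * \<beta>)" by (intro mult_left_mono e1 KD)
      finally show "(LINT z|Pm. (ev D z *v ev Y z) \<bullet> ev Y z) <= KD * (c1 * \<beta>)" .
      have "(LINT z|Pm. (ev E z *v ev v z) \<bullet> ev v z) <= (LINT z|Pm. \<epsilon> / 2 * (norm (ev v z))^2)"
      proof (rule integral_mono)
        show "integrable Pm (%z. (ev E z *v ev v z) \<bullet> ev v z)"
          using L2_inner_integrable[OF bounded_mult_L2[OF E vL] vL] by (simp add: ev2)
        show "integrable Pm (%z. \<epsilon> / 2 * (norm (ev v z))^2)" using vsq by simp
        show "(ev E z *v ev v z) \<bullet> ev v z <= \<epsilon> / 2 * (norm (ev v z))^2" for z by (auto simp: ev_def v_def)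
      qed
      then show "(LINT z|Pm. (ev E z *v ev v z) \<bullet> ev v z) <= \<epsilon> / 2 * q" by (simp add: q_def)
      have Ym: "Y T : meas M" using YL cont_prog_M[OF _ T] by (auto simp: L2_cont_def)
      have "(LINT w|M. (G w *v Y T w) \<bullet> Y T w) <= (LINT w|M. \<bar>KG\<bar> * (norm (Y T w))^2)"
      proof (rule integral_mono)
        show "integrable M (%w. (G w *v Y T w) \<bullet> Y T w)"
          by (rule bounded_quad_integrable[OF G Ym L2_cont_sq[OF YL T] Ym L2_cont_sq[OF YL T]])
        show "integrable M (%w. \<bar>KG\<bar> * (norm (Y T w))^2)" using L2_cont_sq[OF YL T] by (simp add: sq_int_def)
        fix w assume ww: "w : space M"
        have "(G w *v Y T w) \<bullet> Y T w <= norm (G w *v Y T w) * norm (Y T w)" by (rule norm_cauchy_schwarz)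
        also have "... <= (norm (G w) * norm (Y T w)) * norm (Y T w)" by (intro mult_right_mono norm_matrix_vector_mult_le) auto
        also have "... <= (\<bar>KG\<bar> * norm (Y T w)) * norm (Y T w)" using G(2)[OF ww] by (intro mult_right_mono) auto
        finally show "(G w *v Y T w) \<bullet> Y T w <= \<bar>KG\<bar> * (norm (Y T w))^2" by (simp add: power2_eq_square mult.assoc)
      qed
      also have "... = \<bar>KG\<bar> * (LINT w|M. (norm (Y T w))^2)" by simp
      also have "... <= \<bar>KG\<bar> * (c2 * \<beta>)" by (intro mult_left_mono e2) auto
      finally show "(LINT w|M. (G w *v Y T w) \<bullet> Y T w) <= \<bar>KG\<bar> * (c2 * \<beta>)" .
    qed
    also have "... = (L * h) * q + \<epsilon> / 2 * q" by (simp add: L_def \<beta>_def algebra_simps)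
    also have "... <= (\<epsilon> / 4) * q + \<epsilon> / 2 * q" by (intro add_right_mono mult_right_mono h q0)
    finally have "\<epsilon> * q <= 0" by (simp add: algebra_simps)
    then have "q = 0" using q0 \<epsilon> by (simp add: mult_le_0_iff)
    then have "AE z in Pm. (norm (ev v z))^2 = 0"
      unfolding q_def using vsq by (subst (asm) integral_nonneg_eq_0_iff_AE) auto
    then show ?thesis
      by eventually_elim (use False in \<open>auto simp: ev_def v_def split: if_splits\<close>)
  qed
  \<comment> \<open>Countably many windows of length \<open>h\<close> cover the time interval, so
    their exceptional sets unite to one null set.\<close>
  have "AE z in Pm. ALL i::nat. ~ (snd z : {s + real i * h..s + real i * h + h} & (ev E z *v ww) \<bullet> ww < \<epsilon> / 2 * (norm ww)^2)"
    by (subst AE_all_countable) (use key in blast)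
  then show ?thesis
    using AE_space
  proof eventually_elim
    case (elim z)
    define i where "i = nat \<lfloor>(snd z - s) / h\<rfloor>"
    have "0 <= (snd z - s) / h" using elim h by (auto simp: space_Pm)
    then have "real i <= (snd z - s) / h" "(snd z - s) / h <= real i + 1" unfolding i_def by linarith+
    then have "snd z : {s + real i * h..s + real i * h + h}" using h by (simp add: field_simps)
    then show ?case using elim by (meson not_less)
  qed
qed

text \<open>The null set found so far depends on the direction. A countable dense set of directions
  and continuity of the quadratic form give a single null set for all of them.\<close>

lemma coercive_lower_bound:
  fixes A C D :: "real => 'w => real^'n^'n" and B1 :: "real => 'w => real^'m^'n" and E :: "real => 'w => real^'m^'m"
  assumes A: "A : BP" and C: "C : BP"
    and B1: "B1 : BP"
    and D: "D : bounded_prog M F s T H" and E: "E : bounded_prog M F s T H'"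
    and G: "G : meas M" "!!w. w : space M ==> norm (G w) <= KG"
    and \<epsilon>: "0 < \<epsilon>"
    and coercive: "!!v Y. v : L2P ==> lin_state A C (%t w. B1 t w *v v t w) 0 Y ==>
        \<epsilon> * (LINT w|M. (LINT t:{s..T}|lborel. (norm (v t w))^2)) <= quadratic_cost M s T D E G Y v"
  shows "AE z in Pm. ALL ww. \<epsilon> / 2 * (norm ww)^2 <= (ev E z *v ww) \<bullet> ww"
proof -
  obtain W :: "(real^'m) set" where W: "countable W" "!!X. open X ==> X ~= {} ==> EX d:W. d : X"
    using countable_dense_exists[where 'a = "real^'m"] by blast
  have "AE z in Pm. ALL ww:W. \<epsilon> / 2 * (norm ww)^2 <= (ev E z *v ww) \<bullet> ww"
    using coercive_lower_bound_direction[OF A C B1 D E G \<epsilon> coercive] W(1) by (subst AE_ball_countable) auto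
  then show ?thesis
  proof eventually_elim
    case (elim z)
    show ?case
    proof
      fix ww
      let ?f = "%ww. (ev E z *v ww) \<bullet> ww - \<epsilon> / 2 * (norm ww)^2"
      have co: "continuous_on UNIV ?f"
        by (intro continuous_intros bounded_linear.continuous_on[OF bounded_bilinear.bounded_linear_right[OF bounded_bilinear_matrix_vector_mult]])
      have "0 <= ?f ww"
      proof (rule ccontr)
        assume "~ 0 <= ?f ww"
        then have "ww : ?f -` {..<0}" by simp
        moreover have "open (?f -` {..<0})" using co by (intro open_vimage) auto
        ultimately obtain d where "d : W" "d : ?f -` {..<0}" using W(2)[of "?f -` {..<0}"] by blast
        then show False using elim by force
      qed
      then show "\<epsilon> / 2 * (norm ww)^2 <= (ev E z *v ww) \<bullet> ww" by simp
    qed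
  qed
qed

end

section \<open>Product formulas\<close>

lemma sum_pow4_le:
  fixes a :: "nat => real"
  shows "(SUM j<N. a j)^4 <= real N ^ 3 * (SUM j<N. (a j)^4)"
proof -
  have 1: "(SUM j<N. a j)^2 <= real N * (SUM j<N. (a j)^2)" for a :: "nat => real"
    using Cauchy_Schwarz_ineq_sum[of a "%_. 1" "{..<N}"] by (simp add: mult.commute)
  have "(SUM j<N. a j)^4 = ((SUM j<N. a j)^2)^2" by (simp add: power_mult[symmetric])
  also have "... <= (real N * (SUM j<N. (a j)^2))^2" by (intro power_mono 1) auto
  also have "... = (real N)^2 * (SUM j<N. (a j)^2)^2" by (simp add: power_mult_distrib)
  also have "... <= (real N)^2 * (real N * (SUM j<N. ((a j)^2)^2))" by (intro mult_left_mono 1) auto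
  also have "... = real N ^ 3 * (SUM j<N. (a j)^4)"
  proof -
    have e: "((x::real)^2)^2 = x^4" for x by (simp add: power_mult[symmetric])
    show ?thesis unfolding e by (simp add: power2_eq_square power3_eq_cube)
  qed
  finally show ?thesis .
qed

lemma weighted_am_gm: "0 < \<kappa> ==> \<bar>x * y\<bar> <= x^2 / \<kappa> + \<kappa> * (y :: real)^2"
proof -
  assume \<kappa>: "0 < \<kappa>"
  have "0 <= (\<bar>x\<bar> / sqrt \<kappa> - sqrt \<kappa> * \<bar>y\<bar>)^2" by simp
  also have "... = x^2 / \<kappa> + \<kappa> * y^2 - 2 * (\<bar>x\<bar> * \<bar>y\<bar>)" using \<kappa> by (simp add: power2_diff power_divide power_mult_distrib)
  finally have "2 * \<bar>x * y\<bar> <= x^2 / \<kappa> + \<kappa> * y^2" by (simp add: abs_mult)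
  moreover have "0 <= \<bar>x * y\<bar>" by simp
  ultimately show ?thesis by linarith
qed

lemma integrable_AE_bounded_mult:
  fixes f Z :: "'a => real"
  assumes "integrable N f" "Z : meas N" "AE x in N. \<bar>Z x\<bar> <= K"
  shows "integrable N (%x. Z x * f x)"
proof (rule Bochner_Integration.integrable_bound[of _ "%x. K * f x"])
  show "AE x in N. norm (Z x * f x) <= norm (K * f x)"
    using assms(3)
  proof eventually_elim
    case (elim x)
    then have "\<bar>Z x\<bar> <= \<bar>K\<bar>" by linarith
    then show ?case by (simp add: abs_mult mult_right_mono)
  qed
qed (use assms in auto)

context brownian
begin

text \<open>\<open>itoV X a \<sigma> V I\<close>: the scalar process \<open>X\<close> satisfies \<open>dX = a dt + \<sigma> dB\<close>, where \<open>V\<close> and \<open>I\<close> are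
  continuous versions of the two integrals.\<close>

definition itoV :: "(real => 'w => real) => (real => 'w => real) => (real => 'w => real) => (real => 'w => real) => (real => 'w => real) => bool" where
  "itoV X a \<sigma> V I \<longleftrightarrow> X : L2C & a : L2P & V : CP &
    (AE w in M. ALL t:{s..T}. V t w = (LINT r:{s..t}|lborel. a r w)) & ito \<sigma> I &
    (AE w in M. ALL t:{s..T}. X t w = X s w + V t w + I t w)"

lemma itoVD:
  assumes "itoV X a \<sigma> V I"
  shows "X : L2C" "X : CP" "a : L2P" "\<sigma> : L2P"
    "V : CP" "AE w in M. ALL t:{s..T}. V t w = (LINT r:{s..t}|lborel. a r w)"
    "ito \<sigma> I" "AE w in M. ALL t:{s..T}. X t w = X s w + V t w + I t w"
    "sq_int Pm (ev a)" "sq_int Pm (ev \<sigma>)"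
  using assms unfolding itoV_def by (auto simp: L2_cont_def ito_integral_def intro: L2_prog_sq)

section \<open>Increments of Ito processes over the cells of a grid\<close>

lemma primitive_increment:
  fixes a :: "real => 'w => real"
  assumes a: "a : L2P" and V: "AE w in M. ALL t:{s..T}. V t w = (LINT r:{s..t}|lborel. a r w)"
    and rt: "s <= r" "r <= t" "t <= T"
  shows "AE w in M. V t w - V r w = (LINT q|lam. indicator {r<..t} q * a q w) & sq_int lam (%q. a q w)"
  using V L2_path_integrable[OF a] AE_space
proof eventually_elim
  case (elim w)
  have i: "integrable lam (%q. a q w)" using elim by (simp add: integrable_lam_iff)
  have sq: "sq_int lam (%q. a q w)"
    using elim section_lam[OF prog_ev[of a UNIV], of w] a by (auto simp: sq_int_def L2_prog_def)
  have ii: "integrable lam (%q. indicator {s..u} q * a q w)" for u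
    using i by (intro integrable_AE_bounded_mult[where K = 1]) (auto intro!: measurable_lamI simp: indicator_def)
  have "V t w - V r w = (LINT q|lam. indicator {s..t} q * a q w) - (LINT q|lam. indicator {s..r} q * a q w)"
    using elim rt lint_lam[of t "%q. a q w"] lint_lam[of r "%q. a q w"] by auto
  also have "... = (LINT q|lam. indicator {s..t} q * a q w - indicator {s..r} q * a q w)" using ii by simp
  also have "... = (LINT q|lam. indicator {r<..t} q * a q w)"
    using rt by (intro Bochner_Integration.integral_cong) (auto simp: indicator_def)
  finally show ?case using sq by simp
qed

lemma fst_sq_int:
  assumes "sq_int M Z" shows "sq_int Pm (%z. Z (fst z))"
proof -
  have [measurable]: "Z : meas M" using assms by (simp add: sq_int_def)
  have "(EP z. ennreal ((Z (fst z))^2)) = (EM w. (\<integral>\<^sup>+r. ennreal ((Z w)^2) \<partial>lam))"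
    using nn_fst[of "%z. ennreal ((Z (fst z))^2)"] by simp
  also have "... = (EM w. ennreal ((Z w)^2) * emeasure lam (space lam))" by (simp add: nn_integral_const)
  also have "... = (EM w. ennreal ((Z w)^2)) * emeasure lam (space lam)" by (rule nn_integral_multc) measurable
  also have "... < \<infinity>"
  proof -
    have "emeasure lam (space lam) < \<top>" unfolding lam.emeasure_eq_measure by simp
    then show ?thesis using assms by (auto simp: sq_int_iff_nn ennreal_mult_less_top)
  qed
  finally show ?thesis by (simp add: sq_int_iff_nn Pm_fstI)
qed

lemma ind_sq_int:
  assumes "sq_int Pm f" shows "sq_int Pm (%z. indicator {r<..t} (snd z) * f z)"
  by (rule sq_int_bounded_mult[OF assms, where K = 1]) (auto intro!: Pm_sndI simp: indicator_def)

lemma primitive_mean: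
  fixes a :: "real => 'w => real"
  assumes a: "a : L2P" and V: "AE w in M. ALL t:{s..T}. V t w = (LINT r:{s..t}|lborel. a r w)"
    and rt: "s <= r" "r <= t" "t <= T" and Z: "sq_int M Z" and Vm: "V t : meas M" "V r : meas M"
  shows "(LINT w|M. Z w * (V t w - V r w)) = (LINT z|Pm. Z (fst z) * (indicator {r<..t} (snd z) * ev a z))"
proof -
  have [measurable]: "Z : meas M" using Z by (simp add: sq_int_def)
  have int: "integrable Pm (%z. Z (fst z) * (indicator {r<..t} (snd z) * ev a z))"
    by (intro sq_int_mult fst_sq_int Z ind_sq_int L2_prog_sq[OF a])
  have "(LINT w|M. Z w * (V t w - V r w)) = (LINT w|M. (LINT q|lam. Z w * (indicator {r<..t} q * a q w)))"
  proof (rule integral_cong_AE)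
    show "(%w. Z w * (V t w - V r w)) : meas M" using Vm by measurable
    have "(%w. LINT q|lam. Z (fst (w, q)) * (indicator {r<..t} (snd (w, q)) * ev a (w, q))) : meas M"
      using pmf.integrable_fst'[of "%z. Z (fst z) * (indicator {r<..t} (snd z) * ev a z)"] int
      by (auto simp: Pm_def intro: borel_measurable_integrable)
    then show "(%w. LINT q|lam. Z w * (indicator {r<..t} q * a q w)) : meas M" by simp
    show "AE w in M. Z w * (V t w - V r w) = (LINT q|lam. Z w * (indicator {r<..t} q * a q w))"
      using primitive_increment[OF a V rt] by eventually_elim simp
  qed
  also have "... = (LINT z|Pm. Z (fst z) * (indicator {r<..t} (snd z) * ev a z))" using Pm_fubini[OF int] by simp
  finally show ?thesis .
qed

text \<open>Cauchy-Schwarz in time. The factor \<open>t - r\<close> is the advantage of the drift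
  over the martingale part: summed over a grid, squared drift increments are of the order of the
  mesh.\<close>

lemma primitive_inc_sq:
  fixes a :: "real => 'w => real"
  assumes a: "a : L2P" and V: "AE w in M. ALL t:{s..T}. V t w = (LINT r:{s..t}|lborel. a r w)"
    and rt: "s <= r" "r <= t" "t <= T" and Vm: "V t : meas M" "V r : meas M"
  shows "sq_int M (%w. V t w - V r w)"
    "(LINT w|M. (V t w - V r w)^2) <= (t - r) * (LINT z|Pm. indicator {r<..t} (snd z) * (ev a z)^2)"
proof -
  have int: "integrable Pm (%z. indicator {r<..t} (snd z) * (ev a z)^2)"
    using L2_prog_sq[OF a] unfolding sq_int_def
    by (intro integrable_AE_bounded_mult[where K = 1]) (auto intro!: Pm_sndI simp: indicator_def)
  have ii: "integrable M (%w. LINT q|lam. indicator {r<..t} q * (a q w)^2)"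
    using pmf.integrable_fst'[of "%z. indicator {r<..t} (snd z) * (ev a z)^2"] int by (simp add: Pm_def)
  have AEb: "AE w in M. (V t w - V r w)^2 <= (t - r) * (LINT q|lam. indicator {r<..t} q * (a q w)^2)"
    using primitive_increment[OF a V rt]
  proof eventually_elim
    case (elim w)
    have i1: "sq_int lam (indicator {r<..t} :: real => real)"
      by (rule sq_int_bounded[OF finite_measure_lam, where K = 1]) (auto intro!: measurable_lamI simp: indicator_def)
    have i2: "sq_int lam (%q. indicator {r<..t} q * a q w)"
      using elim by (intro sq_int_bounded_mult[where K = 1]) (auto intro!: measurable_lamI simp: indicator_def)
    have "\<bar>V t w - V r w\<bar> <= (LINT q|lam. \<bar>indicator {r<..t} q * (indicator {r<..t} q * a q w)\<bar>)"
    proof -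
      have "\<bar>V t w - V r w\<bar> = \<bar>LINT q|lam. indicator {r<..t} q * (indicator {r<..t} q * a q w)\<bar>"
        using elim by (auto intro!: arg_cong[where f = abs] Bochner_Integration.integral_cong simp: indicator_def)
      also have "... <= (LINT q|lam. \<bar>indicator {r<..t} q * (indicator {r<..t} q * a q w)\<bar>)" by (rule integral_abs_bound)
      finally show ?thesis .
    qed
    also have "... <= sqrt (LINT q|lam. (indicator {r<..t} q)^2) * sqrt (LINT q|lam. (indicator {r<..t} q * a q w)^2)"
      by (rule cauchy_schwarz_integral[OF i1 i2])
    finally have "\<bar>V t w - V r w\<bar>^2 <= (sqrt (LINT q|lam. (indicator {r<..t} q)^2) * sqrt (LINT q|lam. (indicator {r<..t} q * a q w)^2))^2"
      by (intro power_mono) auto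
    also have "... = (LINT q|lam. (indicator {r<..t} q)^2) * (LINT q|lam. (indicator {r<..t} q * a q w)^2)"
      by (simp add: power_mult_distrib)
    also have "(LINT q|lam. (indicator {r<..t} q :: real)^2) = t - r"
    proof -
      have "(LINT q|lam. (indicator {r<..t} q :: real)^2) = (LINT q|lborel. indicator {s..T} q *\<^sub>R (indicator {r<..t} q)^2)"
        unfolding lam_def by (rule integral_restrict_space) simp
      also have "... = (LINT q|lborel. indicator {r<..t} q)"
        using rt by (intro Bochner_Integration.integral_cong) (auto simp: indicator_def)
      finally have "(LINT q|lam. (indicator {r<..t} q :: real)^2) = (LINT q|lborel. indicator {r<..t} q)" .
      then show ?thesis using rt by (simp add: measure_lborel_Ioc_max)
    qed
    also have "(LINT q|lam. (indicator {r<..t} q * a q w)^2) = (LINT q|lam. indicator {r<..t} q * (a q w)^2)"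
      by (intro Bochner_Integration.integral_cong) (auto simp: indicator_def)
    finally show ?case by simp
  qed
  have im: "integrable M (%w. (V t w - V r w)^2)"
  proof (rule Bochner_Integration.integrable_bound[OF integrable_mult_right[OF ii, of "t - r"]])
    show "(%w. (V t w - V r w)^2) : meas M" using Vm by measurable
    show "AE w in M. norm ((V t w - V r w)^2) <= norm ((t - r) * (LINT q|lam. indicator {r<..t} q * (a q w)^2))"
      using AEb by eventually_elim (auto intro: order_trans[OF _ abs_ge_self])
  qed
  then show "sq_int M (%w. V t w - V r w)" using Vm by (auto simp: sq_int_def)
  have "(LINT w|M. (V t w - V r w)^2) <= (LINT w|M. (t - r) * (LINT q|lam. indicator {r<..t} q * (a q w)^2))"
    by (rule integral_mono_AE[OF im integrable_mult_right[OF ii] AEb])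
  also have "... = (t - r) * (LINT z|Pm. indicator {r<..t} (snd z) * (ev a z)^2)"
    using Pm_fubini[OF int] by simp
  finally show "(LINT w|M. (V t w - V r w)^2) <= (t - r) * (LINT z|Pm. indicator {r<..t} (snd z) * (ev a z)^2)" .
qed

lemma L2_cont_real_sq:
  fixes X :: "real => 'w => real"
  assumes "X : L2C" "t : {s..T}" shows "sq_int M (X t)"
  using L2_cont_sq[OF assms] cont_prog_M[of X UNIV t] assms by (auto simp: sq_int_def L2_cont_def)

lemma itoV_inc:
  assumes X: "itoV X a \<sigma> V I" and rt: "s <= r" "r <= t" "t <= T"
  shows "AE w in M. X t w - X r w = (V t w - V r w) + (I t w - I r w)"
    "sq_int M (%w. X t w - X r w)" "sq_int M (%w. V t w - V r w)" "sq_int M (%w. I t w - I r w)"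
    "(LINT w|M. (V t w - V r w)^2) <= (t - r) * (LINT z|Pm. indicator {r<..t} (snd z) * (ev a z)^2)"
    "(LINT w|M. (I t w - I r w)^2) = (LINT z|Pm. indicator {r<..t} (snd z) * (ev \<sigma> z)^2)"
    "(LINT w|M. (X t w - X r w)^2) <= 2 * (LINT w|M. (V t w - V r w)^2) + 2 * (LINT w|M. (I t w - I r w)^2)"
proof -
  note D = itoVD[OF X]
  have r: "r : {s..T}" and t: "t : {s..T}" using rt by auto
  show AEe: "AE w in M. X t w - X r w = (V t w - V r w) + (I t w - I r w)"
    using D(8)
  proof eventually_elim
    case (elim w)
    have "X t w = X s w + V t w + I t w" "X r w = X s w + V r w + I r w" using elim r t by blast+
    then show ?case by simp
  qed
  show sqX: "sq_int M (%w. X t w - X r w)" by (intro sq_int_diff L2_cont_real_sq[OF D(1)] r t)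
  show sqV: "sq_int M (%w. V t w - V r w)"
    by (rule primitive_inc_sq(1)[OF D(3,6) rt cont_prog_M[OF D(5) t] cont_prog_M[OF D(5) r]])
  show sqI: "sq_int M (%w. I t w - I r w)" by (intro sq_int_diff ito_sq[OF D(7)] r t)
  show "(LINT w|M. (V t w - V r w)^2) <= (t - r) * (LINT z|Pm. indicator {r<..t} (snd z) * (ev a z)^2)"
    by (rule primitive_inc_sq(2)[OF D(3,6) rt cont_prog_M[OF D(5) t] cont_prog_M[OF D(5) r]])
  show "(LINT w|M. (I t w - I r w)^2) = (LINT z|Pm. indicator {r<..t} (snd z) * (ev \<sigma> z)^2)"
    using ito_cov[OF D(7) D(7) rt, of "%_. 1" 1] by (simp add: power2_eq_square mult.assoc)
  have "(LINT w|M. (X t w - X r w)^2) <= (LINT w|M. 2 * (V t w - V r w)^2 + 2 * (I t w - I r w)^2)"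
  proof (rule integral_mono_AE)
    show "integrable M (%w. (X t w - X r w)^2)" "integrable M (%w. 2 * (V t w - V r w)^2 + 2 * (I t w - I r w)^2)"
      using sqX sqV sqI by (auto simp: sq_int_def)
    show "AE w in M. (X t w - X r w)^2 <= 2 * (V t w - V r w)^2 + 2 * (I t w - I r w)^2"
      using AEe
    proof eventually_elim
      case (elim w)
      have "0 <= ((V t w - V r w) - (I t w - I r w))^2" by simp
      then show ?case unfolding elim by (simp add: power2_eq_square algebra_simps)
    qed
  qed
  also have "... = 2 * (LINT w|M. (V t w - V r w)^2) + 2 * (LINT w|M. (I t w - I r w)^2)"
    using sqV sqI by (simp add: sq_int_def)
  finally show "(LINT w|M. (X t w - X r w)^2) <= 2 * (LINT w|M. (V t w - V r w)^2) + 2 * (LINT w|M. (I t w - I r w)^2)" .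
qed

abbreviation cell :: "nat => nat => real set" where "cell n i \<equiv> {gr n i<..gr n (Suc i)}"
abbreviation inc :: "nat => nat => (real => 'w => real) => 'w => real" where
  "inc n i X w \<equiv> X (gr n (Suc i)) w - X (gr n i) w"

definition mesh :: "nat => real" where "mesh n = (T - s) / real (Suc n)"

lemma mesh_pos: "0 < mesh n" using sT by (simp add: mesh_def)
lemma mesh_tendsto: "mesh ----> 0"
  unfolding mesh_def[abs_def] by (intro LIMSEQ_Suc lim_const_over_n)
lemma gr_mesh: "gr n (Suc i) - gr n i = mesh n" by (simp add: gr_step mesh_def del: of_nat_Suc)

lemma cell_range: assumes "i < Suc n" shows "s <= gr n i" "gr n i <= gr n (Suc i)" "gr n (Suc i) <= T"
  using gr_range[of i n] gr_range[of "Suc i" n] gr_less[of n i] assms by auto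

lemma cell_sum: assumes "t : {s<..T}" shows "(SUM i<Suc n. indicator (cell n i) t) = (1::real)"
proof -
  have "gr n 0 < t" "t <= gr n (Suc n)" using assms by auto
  from grid_cell[OF this] obtain i where "i < Suc n" "gr n i < t" "t <= gr n (Suc i)" by blast
  from simple_process_at[where \<eta> = "%_ _. 1 :: real" and N = "Suc n" and \<tau> = "gr n", OF _ this] show ?thesis
    by (simp add: simple_process_def gr_less del: sum.lessThan_Suc)
qed

lemma AE_Pm_not_start: "AE z in Pm. snd z : {s<..T}"
proof -
  have l: "AE r in lam. r ~= s"
    unfolding lam_def by (subst AE_restrict_space_iff) (auto intro: AE_mp[OF AE_lborel_singleton[of s]])
  have "AE z in Pm. snd z ~= s"
    unfolding Pm_def
  proof (rule pmf.AE_pair_measure)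
    have "{z : space Pm. snd z ~= s} : sets Pm" by measurable
    then show "{z : space (M \<Otimes>\<^sub>M lam). snd z ~= s} : sets (M \<Otimes>\<^sub>M lam)" by (simp add: Pm_def)
  qed (use l in simp)
  then show ?thesis using AE_space by eventually_elim (auto simp: space_Pm)
qed

lemma cell_integrable:
  fixes f :: "'w \<times> real => real"
  assumes "integrable Pm f" shows "integrable Pm (%z. indicator {r<..t} (snd z) * f z)"
  by (rule integrable_AE_bounded_mult[OF assms, where K = 1]) (auto intro!: Pm_sndI simp: indicator_def)

lemma cell_integral_sum:
  fixes f :: "'w \<times> real => real"
  assumes f: "integrable Pm f"
  shows "(SUM i<Suc n. LINT z|Pm. indicator (cell n i) (snd z) * f z) = (LINT z|Pm. f z)"
proof -
  have [measurable]: "f : meas Pm" using f by simp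
  have "(SUM i<Suc n. LINT z|Pm. indicator (cell n i) (snd z) * f z) = (LINT z|Pm. (SUM i<Suc n. indicator (cell n i) (snd z) * f z))"
    by (rule Bochner_Integration.integral_sum[symmetric]) (rule cell_integrable[OF f])
  also have "... = (LINT z|Pm. f z)"
  proof (rule integral_cong_AE)
    show "AE z in Pm. (SUM i<Suc n. indicator (cell n i) (snd z) * f z) = f z"
      using AE_Pm_not_start
    proof eventually_elim
      case (elim z)
      show ?case using cell_sum[OF elim, of n] by (simp add: sum_distrib_right[symmetric] del: sum.lessThan_Suc)
    qed
  qed measurable
  finally show ?thesis .
qed

text \<open>Squared drift increments sum to the order of the mesh, squared martingale increments to
  a fixed number by the isometry. The error estimates for the product formulas rest on this
  contrast.\<close>

lemma itoV_inc_sums: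
  assumes X: "itoV X a \<sigma> V I"
  shows "(SUM i<Suc n. LINT w|M. (inc n i V w)^2) <= mesh n * (LINT z|Pm. (ev a z)^2)"
    "(SUM i<Suc n. LINT w|M. (inc n i I w)^2) = (LINT z|Pm. (ev \<sigma> z)^2)"
    "(SUM i<Suc n. LINT w|M. (inc n i X w)^2) <= 2 * ((T - s) * (LINT z|Pm. (ev a z)^2)) + 2 * (LINT z|Pm. (ev \<sigma> z)^2)"
proof -
  note D = itoVD[OF X]
  have ia: "integrable Pm (%z. (ev a z)^2)" and ig: "integrable Pm (%z. (ev \<sigma> z)^2)"
    using D(9,10) by (auto simp: sq_int_def)
  have "(SUM i<Suc n. LINT w|M. (inc n i V w)^2) <= (SUM i<Suc n. mesh n * (LINT z|Pm. indicator (cell n i) (snd z) * (ev a z)^2))"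
    using itoV_inc(5)[OF X cell_range] gr_mesh by (intro sum_mono) force
  also have "... = mesh n * (LINT z|Pm. (ev a z)^2)" by (simp only: sum_distrib_left[symmetric] cell_integral_sum[OF ia])
  finally show 1: "(SUM i<Suc n. LINT w|M. (inc n i V w)^2) <= mesh n * (LINT z|Pm. (ev a z)^2)" .
  have "(SUM i<Suc n. LINT w|M. (inc n i I w)^2) = (SUM i<Suc n. LINT z|Pm. indicator (cell n i) (snd z) * (ev \<sigma> z)^2)"
    using itoV_inc(6)[OF X cell_range] by (intro sum.cong) auto
  also have "... = (LINT z|Pm. (ev \<sigma> z)^2)" by (rule cell_integral_sum[OF ig])
  finally show 2: "(SUM i<Suc n. LINT w|M. (inc n i I w)^2) = (LINT z|Pm. (ev \<sigma> z)^2)" .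
  have "(SUM i<Suc n. LINT w|M. (inc n i X w)^2) <= (SUM i<Suc n. 2 * (LINT w|M. (inc n i V w)^2) + 2 * (LINT w|M. (inc n i I w)^2))"
    using itoV_inc(7)[OF X cell_range] by (intro sum_mono) auto
  also have "... = 2 * (SUM i<Suc n. LINT w|M. (inc n i V w)^2) + 2 * (SUM i<Suc n. LINT w|M. (inc n i I w)^2)"
    by (simp only: sum.distrib sum_distrib_left)
  also have "... <= 2 * (mesh n * (LINT z|Pm. (ev a z)^2)) + 2 * (LINT z|Pm. (ev \<sigma> z)^2)"
    unfolding 2 using 1 by simp
  also have "... <= 2 * ((T - s) * (LINT z|Pm. (ev a z)^2)) + 2 * (LINT z|Pm. (ev \<sigma> z)^2)"
  proof -
    have "mesh n <= T - s" unfolding mesh_def using sT by (simp add: divide_le_eq mult_le_cancel_left1)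
    then have "mesh n * (LINT z|Pm. (ev a z)^2) <= (T - s) * (LINT z|Pm. (ev a z)^2)" by (intro mult_right_mono) auto
    then show ?thesis by simp
  qed
  finally show "(SUM i<Suc n. LINT w|M. (inc n i X w)^2) <= 2 * ((T - s) * (LINT z|Pm. (ev a z)^2)) + 2 * (LINT z|Pm. (ev \<sigma> z)^2)" .
qed

text \<open>The arithmetic-geometric inequality with weight \<open>sqrt (mesh n)\<close>: the drift
  sum, of order mesh, is divided by it, and the merely bounded sum for \<open>Q\<close> is
  multiplied by it.\<close>

lemma cross_sum_tendsto:
  assumes P: "itoV P b \<phi> VP IP"
    and sqQ: "!!n i. i < Suc n ==> sq_int M (inc n i Q)"
    and bQ: "!!n. (SUM i<Suc n. LINT w|M. (inc n i Q w)^2) <= c"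
  shows "(%n. SUM i<Suc n. LINT w|M. \<bar>inc n i VP w * inc n i Q w\<bar>) ----> 0"
proof (rule tendsto_sandwich[OF _ _ tendsto_const])
  let ?q = "LINT z|Pm. (ev b z)^2"
  show "\<forall>\<^sub>F n in sequentially. 0 <= (SUM i<Suc n. LINT w|M. \<bar>inc n i VP w * inc n i Q w\<bar>)" by (intro always_eventually allI sum_nonneg) auto
  have "(SUM i<Suc n. LINT w|M. \<bar>inc n i VP w * inc n i Q w\<bar>) <= sqrt (mesh n) * (?q + c)" for n
  proof -
    let ?k = "sqrt (mesh n)"
    have k: "0 < ?k" using mesh_pos by simp
    have "(SUM i<Suc n. LINT w|M. \<bar>inc n i VP w * inc n i Q w\<bar>) <= (SUM i<Suc n. (LINT w|M. (inc n i VP w)^2) / ?k + ?k * (LINT w|M. (inc n i Q w)^2))"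
    proof (rule sum_mono)
      fix i assume "i : {..<Suc n}"
      then have i: "i < Suc n" by simp
      have sV: "sq_int M (inc n i VP)" using itoV_inc(3)[OF P cell_range[OF i]] .
      have "(LINT w|M. \<bar>inc n i VP w * inc n i Q w\<bar>) <= (LINT w|M. (inc n i VP w)^2 / ?k + ?k * (inc n i Q w)^2)"
      proof (rule integral_mono)
        show "integrable M (%w. \<bar>inc n i VP w * inc n i Q w\<bar>)" using sq_int_mult[OF sV sqQ[OF i]] by simp
        show "integrable M (%w. (inc n i VP w)^2 / ?k + ?k * (inc n i Q w)^2)" using sV sqQ[OF i] by (simp add: sq_int_def)
      qed (rule weighted_am_gm[OF k])
      also have "... = (LINT w|M. (inc n i VP w)^2) / ?k + ?k * (LINT w|M. (inc n i Q w)^2)"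
        using sV sqQ[OF i] by (simp add: sq_int_def)
      finally show "(LINT w|M. \<bar>inc n i VP w * inc n i Q w\<bar>) <= (LINT w|M. (inc n i VP w)^2) / ?k + ?k * (LINT w|M. (inc n i Q w)^2)" .
    qed
    also have "... = (SUM i<Suc n. LINT w|M. (inc n i VP w)^2) / ?k + ?k * (SUM i<Suc n. LINT w|M. (inc n i Q w)^2)"
      by (simp only: sum.distrib sum_distrib_left sum_divide_distrib)
    also have "... <= (mesh n * ?q) / ?k + ?k * c"
      using itoV_inc_sums(1)[OF P] bQ k by (intro add_mono divide_right_mono mult_left_mono) auto
    also have "(mesh n * ?q) / ?k = ?k * ?q" using k by (simp add: field_simps)
    finally show ?thesis by (simp add: algebra_simps)
  qed
  then show "\<forall>\<^sub>F n in sequentially. (SUM i<Suc n. LINT w|M. \<bar>inc n i VP w * inc n i Q w\<bar>) <= sqrt (mesh n) * (?q + c)" by simp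
  have "(%n. sqrt (mesh n) * (?q + c)) ----> sqrt 0 * (?q + c)" by (intro tendsto_intros mesh_tendsto)
  then show "(%n. sqrt (mesh n) * (?q + c)) ----> 0" by simp
qed

text \<open>Finitely many cells with bounded coefficients reduce this to fourth moments of Brownian
  increments. \<open>C\<close> depends on the simple integrand but not on \<open>r\<close> and
  \<open>t\<close>.\<close>

lemma simple_ito_fourth_moment:
  fixes \<eta> :: "nat => 'w => real"
  assumes p: "simple_integrand M F s T N \<tau> \<eta>"
  obtains C where "0 <= C" "!!r t. s <= r ==> r <= t ==> t <= T ==>
     integrable M (%w. (simple_ito B N \<tau> \<eta> t w - simple_ito B N \<tau> \<eta> r w)^4) &
     (LINT w|M. (simple_ito B N \<tau> \<eta> t w - simple_ito B N \<tau> \<eta> r w)^4) <= C * (t - r)^2"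
proof -
  have "ALL i. EX K. i < N --> (ALL w:space M. norm (\<eta> i w) <= K)" using simple_integrand_meas(2)[OF p] by auto
  then obtain K where K: "!!i w. i < N ==> w : space M ==> norm (\<eta> i w) <= K i" by metis
  define C where "C = real N ^ 3 * (SUM i<N. 3 * (K i)^4)"
  have "0 <= C" by (auto simp: C_def intro!: mult_nonneg_nonneg sum_nonneg)
  moreover have "integrable M (%w. (simple_ito B N \<tau> \<eta> t w - simple_ito B N \<tau> \<eta> r w)^4) &
     (LINT w|M. (simple_ito B N \<tau> \<eta> t w - simple_ito B N \<tau> \<eta> r w)^4) <= C * (t - r)^2" if rt: "s <= r" "r <= t" "t <= T" for r t
  proof -
    let ?c = "clamp r t"
    let ?D = "%i w. B (?c (\<tau> (Suc i))) w - B (?c (\<tau> i)) w"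
    have c0: "0 <= ?c x" "r <= ?c x" "?c x <= t" for x using s0 rt by (auto simp: clamp_def)
    have cm: "?c (\<tau> i) <= ?c (\<tau> (Suc i))" if "i < N" for i
    proof -
      have "\<tau> i <= \<tau> (Suc i)" using p that by (auto simp: simple_integrand_def less_imp_le)
      then show ?thesis by (auto simp: clamp_def)
    qed
    have dint: "integrable M (%w. (?D i w)^4)" if "i < N" for i using increment_moments(1)[OF c0(1) cm[OF that]] .
    have pw: "(simple_ito B N \<tau> \<eta> t w - simple_ito B N \<tau> \<eta> r w)^4 <= real N ^ 3 * (SUM i<N. (K i)^4 * (?D i w)^4)" if ww: "w : space M" for w
    proof -
      have "(simple_ito B N \<tau> \<eta> t w - simple_ito B N \<tau> \<eta> r w)^4 <= real N ^ 3 * (SUM i<N. (?D i w * \<eta> i w)^4)"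
        unfolding simple_ito_increment[OF rt(2)] real_scaleR_def by (rule sum_pow4_le)
      also have "... <= real N ^ 3 * (SUM i<N. (K i)^4 * (?D i w)^4)"
      proof (intro mult_left_mono sum_mono)
        fix i assume "i : {..<N}"
        then have "\<bar>\<eta> i w\<bar> <= K i" using K ww by auto
        then have "\<bar>\<eta> i w\<bar>^4 <= (K i)^4" by (intro power_mono) auto
        then have "(\<eta> i w)^4 <= (K i)^4" by simp
        then show "(?D i w * \<eta> i w)^4 <= (K i)^4 * (?D i w)^4"
          unfolding power_mult_distrib by (subst mult.commute) (rule mult_right_mono, auto)
      qed auto
      finally show ?thesis .
    qed
    have bint: "integrable M (%w. real N ^ 3 * (SUM i<N. (K i)^4 * (?D i w)^4))"
      by (intro integrable_mult_right Bochner_Integration.integrable_sum dint) auto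
    have m: "(%w. (simple_ito B N \<tau> \<eta> t w - simple_ito B N \<tau> \<eta> r w)^4) : meas M"
      using simple_ito_sq[OF p, of t] simple_ito_sq[OF p, of r] rt by (intro borel_measurable_power borel_measurable_diff) (auto simp: sq_int_def)
    have i4: "integrable M (%w. (simple_ito B N \<tau> \<eta> t w - simple_ito B N \<tau> \<eta> r w)^4)"
    proof (rule Bochner_Integration.integrable_bound[OF bint m])
      show "AE w in M. norm ((simple_ito B N \<tau> \<eta> t w - simple_ito B N \<tau> \<eta> r w)^4) <= norm (real N ^ 3 * (SUM i<N. (K i)^4 * (?D i w)^4))"
        using pw by (intro AE_I2) (auto intro: order_trans[OF _ abs_ge_self])
    qed
    have "(LINT w|M. (simple_ito B N \<tau> \<eta> t w - simple_ito B N \<tau> \<eta> r w)^4) <= (LINT w|M. real N ^ 3 * (SUM i<N. (K i)^4 * (?D i w)^4))"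
      by (rule integral_mono[OF i4 bint pw])
    also have "... = real N ^ 3 * (SUM i<N. (K i)^4 * (LINT w|M. (?D i w)^4))"
      using dint by (simp add: Bochner_Integration.integral_sum)
    also have "... <= real N ^ 3 * (SUM i<N. (K i)^4 * (3 * (t - r)^2))"
    proof (intro mult_left_mono sum_mono)
      fix i assume "i : {..<N}"
      then have i: "i < N" by simp
      have "(LINT w|M. (?D i w)^4) = 3 * (?c (\<tau> (Suc i)) - ?c (\<tau> i))^2" by (rule increment_moments(4)[OF c0(1) cm[OF i]])
      also have "... <= 3 * (t - r)^2"
      proof -
        have "(?c (\<tau> (Suc i)) - ?c (\<tau> i))^2 <= (t - r)^2"
          using c0[of "\<tau> i"] c0[of "\<tau> (Suc i)"] cm[OF i] by (intro power_mono) auto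
        then show ?thesis by simp
      qed
      finally show "(LINT w|M. (?D i w)^4) <= 3 * (t - r)^2" .
    qed auto
    also have "... = C * (t - r)^2" by (simp add: C_def sum_distrib_right sum_distrib_left ac_simps)
    finally show ?thesis using i4 by simp
  qed
  ultimately show thesis using that by blast
qed

end

section \<open>Second-order and third-order terms; products of three processes\<close>

context brownian
begin

lemma itoV_inc_diff:
  assumes I: "ito \<sigma> I" and p: "simple_integrand M F s T N \<tau> \<eta>"
  shows "(SUM i<Suc n. LINT w|M. (inc n i I w - inc n i (simple_ito B N \<tau> \<eta>) w)^2) = (LINT z|Pm. (ev \<sigma> z - ev (simple_process N \<tau> \<eta>) z)^2)"
    and "i < Suc n ==> sq_int M (%w. inc n i I w - inc n i (simple_ito B N \<tau> \<eta>) w)"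
proof -
  let ?S = "simple_ito B N \<tau> \<eta>" and ?p = "simple_process N \<tau> \<eta>"
  have D: "ito (%t w. \<sigma> t w - ?p t w) (%t w. I t w - ?S t w)" by (rule ito_diff[OF I simple_is_ito[OF p]])
  have sq: "sq_int Pm (ev (%t w. \<sigma> t w - ?p t w))" using D by (auto simp: ito_integral_def intro: L2_prog_sq)
  have "(LINT w|M. (inc n i I w - inc n i ?S w)^2) = (LINT z|Pm. indicator (cell n i) (snd z) * (ev (%t w. \<sigma> t w - ?p t w) z)^2)" if "i < Suc n" for i
  proof -
    have "(LINT w|M. 1 * (inc n i (%t w. I t w - ?S t w) w) * (inc n i (%t w. I t w - ?S t w) w)) =
       (LINT z|Pm. (1 * indicator (cell n i) (snd z)) * ev (%t w. \<sigma> t w - ?p t w) z * ev (%t w. \<sigma> t w - ?p t w) z)"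
      by (rule ito_cov[OF D D cell_range[OF that], of "%_. 1" 1]) auto
    moreover have "(%w. 1 * (inc n i (%t w. I t w - ?S t w) w) * (inc n i (%t w. I t w - ?S t w) w)) = (%w. (inc n i I w - inc n i ?S w)^2)"
      by (auto simp: power2_eq_square algebra_simps)
    ultimately show ?thesis by (simp add: power2_eq_square mult.assoc)
  qed
  then have "(SUM i<Suc n. LINT w|M. (inc n i I w - inc n i ?S w)^2) = (SUM i<Suc n. LINT z|Pm. indicator (cell n i) (snd z) * (ev (%t w. \<sigma> t w - ?p t w) z)^2)"
    by (intro sum.cong) auto
  also have "... = (LINT z|Pm. (ev (%t w. \<sigma> t w - ?p t w) z)^2)" using sq by (intro cell_integral_sum) (simp add: sq_int_def)
  finally show "(SUM i<Suc n. LINT w|M. (inc n i I w - inc n i ?S w)^2) = (LINT z|Pm. (ev \<sigma> z - ev ?p z)^2)" by (simp add: ev_diff)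
  show "sq_int M (%w. inc n i I w - inc n i ?S w)" if "i < Suc n"
    using gr_range[of i n] gr_range[of "Suc i" n] that by (intro sq_int_diff ito_sq[OF I] ito_sq[OF simple_is_ito[OF p]]) auto
qed

text \<open>Approximating the integrand of \<open>X\<close> by a bounded simple one leaves an increment that is small in
  quadratic mean, against which \<open>P\<close> is only used through its bound; the increments of the simple
  integral have fourth moments of order \<open>h^2\<close>.\<close>

lemma third_order_tendsto:
  assumes X: "itoV X a \<sigma> V I"
    and P: "ALL t:{s..T}. sq_int M (P t)" "AE w in M. ALL t:{s..T}. \<bar>P t w\<bar> <= K"
    and bP: "!!n. (SUM i<Suc n. LINT w|M. (inc n i P w)^2) <= c"
  shows "i < Suc n ==> integrable M (%w. \<bar>inc n i P w\<bar> * (inc n i X w)^2)"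
    and "(%n. SUM i<Suc n. LINT w|M. \<bar>inc n i P w\<bar> * (inc n i X w)^2) ----> 0"
proof -
  let ?s = "%n. SUM i<Suc n. LINT w|M. \<bar>inc n i P w\<bar> * (inc n i X w)^2"
  have K: "0 <= K"
  proof -
    have "AE w in M. 0 <= K" using P(2) by eventually_elim (use sT in \<open>force intro: order_trans[OF abs_ge_zero]\<close>)
    then show ?thesis by simp
  qed
  have c: "0 <= c" using order_trans[OF sum_nonneg bP[of 0]] by simp
  note D = itoVD[OF X]
  have sqP: "sq_int M (inc n i P)" if "i < Suc n" for n i
    using gr_range[of i n] gr_range[of "Suc i" n] that by (intro sq_int_diff P(1)[rule_format]) auto
  have Pb: "AE w in M. \<bar>inc n i P w\<bar> <= 2 * K" if "i < Suc n" for n i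
    using P(2)
  proof eventually_elim
    case (elim w)
    have "\<bar>P (gr n (Suc i)) w\<bar> <= K" "\<bar>P (gr n i) w\<bar> <= K" using elim gr_range[of i n] gr_range[of "Suc i" n] that by auto
    then show ?case by linarith
  qed
  have Pm': "(%w. \<bar>inc n i P w\<bar>) : meas M" if "i < Suc n" for n i
    using sqP[OF that] by (intro borel_measurable_abs) (simp add: sq_int_def)
  have mult_int: "integrable M (%w. \<bar>inc n i P w\<bar> * f w)" if "i < Suc n" "integrable M f" for n i f
    by (rule integrable_AE_bounded_mult[OF that(2) Pm'[OF that(1)]]) (use Pb[OF that(1)] in simp)
  have mult_le: "(LINT w|M. \<bar>inc n i P w\<bar> * f w) <= 2 * K * (LINT w|M. f w)" if i: "i < Suc n" and f: "integrable M f" "!!w. 0 <= f w" for n i f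
  proof -
    have "(LINT w|M. \<bar>inc n i P w\<bar> * f w) <= (LINT w|M. 2 * K * f w)"
    proof (rule integral_mono_AE[OF mult_int[OF i f(1)]])
      show "integrable M (%w. 2 * K * f w)" using f by simp
      show "AE w in M. \<bar>inc n i P w\<bar> * f w <= 2 * K * f w"
        using Pb[OF i] by eventually_elim (intro mult_right_mono f(2))
    qed
    then show ?thesis by simp
  qed
  have iX: "integrable M (%w. (inc n i X w)^2)" if "i < Suc n" for n i
    using itoV_inc(2)[OF X cell_range[OF that]] by (simp add: sq_int_def)
  show "i < Suc n ==> integrable M (%w. \<bar>inc n i P w\<bar> * (inc n i X w)^2)" by (rule mult_int[OF _ iX])
  show "(%n. SUM i<Suc n. LINT w|M. \<bar>inc n i P w\<bar> * (inc n i X w)^2) ----> 0"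
  proof (rule LIMSEQ_I)
    fix e :: real assume e: "0 < e"
    \<comment> \<open>Of the four parts of the bound \<open>main\<close>, those with
      \<open>\<epsilon>\<close> and \<open>\<kappa>\<close> are kept below \<open>e / 4\<close>
      uniformly in the grid; the other two vanish with the mesh. The added 1 keeps the denominators
      positive when \<open>K\<close> or \<open>c\<close> is zero.\<close>
    define \<epsilon> where "\<epsilon> = e / 4 / (8 * K + 1)"
    have \<epsilon>: "0 < \<epsilon>" "8 * K * \<epsilon> < e / 4"
    proof -
      show "0 < \<epsilon>" using e K by (simp add: \<epsilon>_def)
      have "8 * K * \<epsilon> < (8 * K + 1) * \<epsilon>" using \<open>0 < \<epsilon>\<close> by simp
      also have "... = e / 4"
      proof -
        have g: "x * (y / x) = y" if "x ~= 0" for x y :: real using that by simp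
        show ?thesis unfolding \<epsilon>_def using K by (intro g) linarith
      qed
      finally show "8 * K * \<epsilon> < e / 4" .
    qed
    define \<kappa> where "\<kappa> = e / 8 / (c + 1)"
    have \<kappa>: "0 < \<kappa>" "2 * (\<kappa> * c) < e / 4"
    proof -
      show "0 < \<kappa>" using e c by (simp add: \<kappa>_def)
      have "2 * (\<kappa> * c) < 2 * (\<kappa> * (c + 1))" using \<open>0 < \<kappa>\<close> by simp
      also have "... = e / 4"
      proof -
        have g: "y / x * x = y" if "x ~= 0" for x y :: real using that by simp
        have "\<kappa> * (c + 1) = e / 8" unfolding \<kappa>_def using c by (intro g) linarith
        then show ?thesis by simp
      qed
      finally show "2 * (\<kappa> * c) < e / 4" .
    qed
    from ito_approx[OF D(7)] obtain N \<tau> \<eta> where p: "!!k::nat. simple_integrand M F s T (N k) (\<tau> k) (\<eta> k)"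
      "(%k. LINT z|Pm. (ev (simple_process (N k) (\<tau> k) (\<eta> k)) z - ev \<sigma> z)^2) ----> 0"
      "!!t. t : {s..T} ==> sq_int M (I t)"
      "!!t. t : {s..T} ==> (%k. LINT w|M. (simple_ito B (N k) (\<tau> k) (\<eta> k) t w - I t w)^2) ----> 0" by blast
    have "\<forall>\<^sub>F k in sequentially. (LINT z|Pm. (ev (simple_process (N k) (\<tau> k) (\<eta> k)) z - ev \<sigma> z)^2) < \<epsilon>"
      using p(2) \<epsilon>(1) by (rule order_tendstoD(2))
    then obtain k where k: "(LINT z|Pm. (ev (simple_process (N k) (\<tau> k) (\<eta> k)) z - ev \<sigma> z)^2) < \<epsilon>" by (auto simp: eventually_sequentially)
    define S where "S = simple_ito B (N k) (\<tau> k) (\<eta> k)"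
    from simple_ito_fourth_moment[OF p(1)[of k], folded S_def] obtain C4 where C4: "0 <= C4" "!!r t. s <= r ==> r <= t ==> t <= T ==>
       integrable M (%w. (S t w - S r w)^4) & (LINT w|M. (S t w - S r w)^4) <= C4 * (t - r)^2"
      by blast
    have dIS: "(SUM i<Suc n. LINT w|M. (inc n i I w - inc n i S w)^2) < \<epsilon>" for n
      unfolding S_def itoV_inc_diff(1)[OF D(7) p(1)] using k by (simp add: power2_commute)
    have sqIS: "sq_int M (%w. inc n i I w - inc n i S w)" if "i < Suc n" for n i
      unfolding S_def by (rule itoV_inc_diff(2)[OF D(7) p(1) that])
    let ?qa = "LINT z|Pm. (ev a z)^2"
    \<comment> \<open>The approximation \<open>S\<close>, and with it \<open>C4\<close>, is fixed by
      \<open>\<epsilon>\<close> before the grid is refined; \<open>C4\<close> is not controlled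
      along the approximating sequence.\<close>
    have main: "?s n <= 8 * K * (mesh n * ?qa) + 8 * K * \<epsilon> + 2 * (\<kappa> * c) + 2 * (C4 * (T - s) / \<kappa>) * mesh n" for n
    proof -
      have cellb: "(LINT w|M. \<bar>inc n i P w\<bar> * (inc n i X w)^2) <= 8 * K * (LINT w|M. (inc n i V w)^2) + 8 * K * (LINT w|M. (inc n i I w - inc n i S w)^2)
          + 2 * (\<kappa> * (LINT w|M. (inc n i P w)^2)) + 2 * (C4 * (mesh n)^2 / \<kappa>)" if i: "i < Suc n" for i
      proof -
        have S4: "integrable M (%w. (inc n i S w)^4)" "(LINT w|M. (inc n i S w)^4) <= C4 * (mesh n)^2"
          using C4(2)[OF cell_range[OF i]] gr_mesh by auto
        have iV: "integrable M (%w. (inc n i V w)^2)" using itoV_inc(3)[OF X cell_range[OF i]] by (simp add: sq_int_def)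
        have iIS: "integrable M (%w. (inc n i I w - inc n i S w)^2)" using sqIS[OF i] by (simp add: sq_int_def)
        have iP: "integrable M (%w. (inc n i P w)^2)" using sqP[OF i] by (simp add: sq_int_def)
        have "(LINT w|M. \<bar>inc n i P w\<bar> * (inc n i X w)^2) <=
          (LINT w|M. \<bar>inc n i P w\<bar> * (4 * (inc n i V w)^2) + \<bar>inc n i P w\<bar> * (4 * (inc n i I w - inc n i S w)^2)
             + 2 * (\<kappa> * (inc n i P w)^2 + (inc n i S w)^4 / \<kappa>))"
        proof (rule integral_mono_AE)
          show "integrable M (%w. \<bar>inc n i P w\<bar> * (inc n i X w)^2)" by (rule mult_int[OF i iX[OF i]])
          show "integrable M (%w. \<bar>inc n i P w\<bar> * (4 * (inc n i V w)^2) + \<bar>inc n i P w\<bar> * (4 * (inc n i I w - inc n i S w)^2)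
             + 2 * (\<kappa> * (inc n i P w)^2 + (inc n i S w)^4 / \<kappa>))"
            by (intro Bochner_Integration.integrable_add integrable_mult_right mult_int[OF i] integrable_divide iV iIS iP S4)
          show "AE w in M. \<bar>inc n i P w\<bar> * (inc n i X w)^2 <= \<bar>inc n i P w\<bar> * (4 * (inc n i V w)^2)
             + \<bar>inc n i P w\<bar> * (4 * (inc n i I w - inc n i S w)^2) + 2 * (\<kappa> * (inc n i P w)^2 + (inc n i S w)^4 / \<kappa>)"
            using itoV_inc(1)[OF X cell_range[OF i]]
          proof eventually_elim
            case (elim w)
            have sq: "(x + y + z)^2 <= 4 * x^2 + 4 * y^2 + 2 * z^2" for x y z :: real
            proof -
              have "0 <= (x + y - z)^2" "0 <= (x - y)^2" by simp_all
              then show ?thesis by (simp add: power2_eq_square algebra_simps)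
            qed
            have "inc n i X w = inc n i V w + (inc n i I w - inc n i S w) + inc n i S w" using elim by simp
            then have "(inc n i X w)^2 <= 4 * (inc n i V w)^2 + 4 * (inc n i I w - inc n i S w)^2 + 2 * (inc n i S w)^2"
              using sq by metis
            then have "\<bar>inc n i P w\<bar> * (inc n i X w)^2 <= \<bar>inc n i P w\<bar> * (4 * (inc n i V w)^2 + 4 * (inc n i I w - inc n i S w)^2 + 2 * (inc n i S w)^2)"
              by (intro mult_left_mono) auto
            also have "... = \<bar>inc n i P w\<bar> * (4 * (inc n i V w)^2) + \<bar>inc n i P w\<bar> * (4 * (inc n i I w - inc n i S w)^2)
               + 2 * \<bar>(inc n i S w)^2 * inc n i P w\<bar>" by (simp add: abs_mult distrib_left mult.commute)
            also have "\<bar>(inc n i S w)^2 * inc n i P w\<bar> <= ((inc n i S w)^2)^2 / \<kappa> + \<kappa> * (inc n i P w)^2" by (rule weighted_am_gm[OF \<kappa>(1)])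
            finally show ?case by (simp add: power_mult[symmetric] add.commute)
          qed
        qed
        also have "... = (LINT w|M. \<bar>inc n i P w\<bar> * (4 * (inc n i V w)^2)) + (LINT w|M. \<bar>inc n i P w\<bar> * (4 * (inc n i I w - inc n i S w)^2))
             + 2 * (\<kappa> * (LINT w|M. (inc n i P w)^2) + (LINT w|M. (inc n i S w)^4) / \<kappa>)"
          using mult_int[OF i integrable_mult_right[OF iV]] mult_int[OF i integrable_mult_right[OF iIS]] iP S4(1) by simp
        also have "... <= 2 * K * (LINT w|M. 4 * (inc n i V w)^2) + 2 * K * (LINT w|M. 4 * (inc n i I w - inc n i S w)^2)
             + 2 * (\<kappa> * (LINT w|M. (inc n i P w)^2) + (C4 * (mesh n)^2) / \<kappa>)"
          using \<kappa>(1) S4(2) iV iIS by (intro add_mono mult_le[OF i] mult_left_mono divide_right_mono order_refl) auto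
        finally show ?thesis by (simp add: distrib_left)
      qed
      have "?s n <= (SUM i<Suc n. 8 * K * (LINT w|M. (inc n i V w)^2) + 8 * K * (LINT w|M. (inc n i I w - inc n i S w)^2)
          + 2 * (\<kappa> * (LINT w|M. (inc n i P w)^2)) + 2 * (C4 * (mesh n)^2 / \<kappa>))"
        using cellb by (intro sum_mono) auto
      also have "... = 8 * K * (SUM i<Suc n. LINT w|M. (inc n i V w)^2) + 8 * K * (SUM i<Suc n. LINT w|M. (inc n i I w - inc n i S w)^2)
          + 2 * (\<kappa> * (SUM i<Suc n. LINT w|M. (inc n i P w)^2)) + real (Suc n) * (2 * (C4 * (mesh n)^2 / \<kappa>))"
        by (simp only: sum.distrib sum_distrib_left[symmetric] sum_constant card_lessThan mult.left_commute[of 2 "real (Suc n)"])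
      also have "... <= 8 * K * (mesh n * ?qa) + 8 * K * \<epsilon> + 2 * (\<kappa> * c) + real (Suc n) * (2 * (C4 * (mesh n)^2 / \<kappa>))"
        using K \<kappa>(1) by (intro add_mono mult_left_mono itoV_inc_sums(1)[OF X] less_imp_le[OF dIS] bP order_refl) auto
      \<comment> \<open>The number of cells times the mesh is \<open>T - s\<close>, so terms of
        order mesh squared sum to the order of the mesh.\<close>
      also have "real (Suc n) * (2 * (C4 * (mesh n)^2 / \<kappa>)) = 2 * (C4 * (T - s) / \<kappa>) * mesh n"
      proof -
        have "real (Suc n) * mesh n = T - s" by (simp add: mesh_def del: of_nat_Suc)
        then have "real (Suc n) * (2 * (C4 * (mesh n)^2 / \<kappa>)) = 2 * (C4 / \<kappa>) * (T - s) * mesh n"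
          by (metis (no_types, lifting) mult.assoc mult.commute mult.left_commute power2_eq_square times_divide_eq_right times_divide_eq_left)
        then show ?thesis by simp
      qed
      finally show ?thesis .
    qed
    have "(%n. 8 * K * (mesh n * ?qa) + 2 * (C4 * (T - s) / \<kappa>) * mesh n) ----> 8 * K * (0 * ?qa) + 2 * (C4 * (T - s) / \<kappa>) * 0"
      by (intro tendsto_intros mesh_tendsto)
    then have "\<forall>\<^sub>F n in sequentially. 8 * K * (mesh n * ?qa) + 2 * (C4 * (T - s) / \<kappa>) * mesh n < e / 4"
      using e by (intro order_tendstoD(2)[where y = 0]) auto
    then obtain n0 where n0: "!!n. n >= n0 ==> 8 * K * (mesh n * ?qa) + 2 * (C4 * (T - s) / \<kappa>) * mesh n < e / 4"
      by (auto simp: eventually_sequentially)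
    show "EX no. ALL n>=no. norm (?s n - 0) < e"
    proof (intro exI[of _ n0] allI impI)
      fix n assume n: "n0 <= n"
      have "0 <= ?s n" by (intro sum_nonneg) auto
      moreover have "?s n < e"
        using main[of n] n0[OF n] \<epsilon>(2) \<kappa>(2) e by linarith
      ultimately show "norm (?s n - 0) < e"
        unfolding diff_0_right real_norm_def by linarith
    qed
  qed
qed

text \<open>The martingale increment is orthogonal to the \<open>F r\<close>-measurable weight, so
  only the drift remains.\<close>

lemma cell_mean:
  assumes X: "itoV X a \<sigma> V I" and rt: "s <= r" "r <= t" "t <= T" and Z: "Z : meas (F r)" "sq_int M Z"
  shows "(LINT w|M. Z w * (X t w - X r w)) = (LINT z|Pm. Z (fst z) * (indicator {r<..t} (snd z) * ev a z))"
proof -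
  note D = itoVD[OF X]
  have r: "r : {s..T}" and t: "t : {s..T}" using rt by auto
  have iV: "integrable M (%w. Z w * (V t w - V r w))" by (rule sq_int_mult[OF Z(2) itoV_inc(3)[OF X rt]])
  have iI: "integrable M (%w. Z w * (I t w - I r w))" by (rule sq_int_mult[OF Z(2) itoV_inc(4)[OF X rt]])
  have iX: "integrable M (%w. Z w * (X t w - X r w))" by (rule sq_int_mult[OF Z(2) itoV_inc(2)[OF X rt]])
  have "(LINT w|M. Z w * (X t w - X r w)) = (LINT w|M. Z w * (V t w - V r w) + Z w * (I t w - I r w))"
  proof (rule integral_cong_AE)
    show "AE w in M. Z w * (X t w - X r w) = Z w * (V t w - V r w) + Z w * (I t w - I r w)"
      using itoV_inc(1)[OF X rt] by eventually_elim (simp add: distrib_left)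
  qed (use iX iV iI in auto)
  also have "... = (LINT w|M. Z w * (V t w - V r w))"
    using iV iI mgale_L2[OF mgale_ito[OF D(7)] rt Z] by simp
  also have "... = (LINT z|Pm. Z (fst z) * (indicator {r<..t} (snd z) * ev a z))"
    by (rule primitive_mean[OF D(3,6) rt Z(2) cont_prog_M[OF D(5) t] cont_prog_M[OF D(5) r]])
  finally show ?thesis .
qed

text \<open>The product of increments is drift of \<open>P\<close> times the whole increment of
  \<open>Y\<close>, plus drift of \<open>Y\<close> times the martingale part of \<open>P\<close>,
  plus the product of the martingale parts. The weighted isometry evaluates the last exactly; the
  other two make up the error, which \<open>cross_sum_tendsto\<close> controls.\<close>

lemma cell_cov:
  assumes P: "itoV P b \<phi> VP IP" and Y: "itoV Y c \<theta> VY IY" and rt: "s <= r" "r <= t" "t <= T"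
    and Z: "Z : meas (F r)" "!!w. w : space M ==> \<bar>Z w\<bar> <= L"
  shows "integrable M (%w. Z w * ((P t w - P r w) * (Y t w - Y r w)))"
    "\<bar>(LINT w|M. Z w * ((P t w - P r w) * (Y t w - Y r w))) - (LINT z|Pm. Z (fst z) * (indicator {r<..t} (snd z) * (ev \<phi> z * ev \<theta> z)))\<bar>
      <= L * ((LINT w|M. \<bar>(VP t w - VP r w) * (Y t w - Y r w)\<bar>) + (LINT w|M. \<bar>(VY t w - VY r w) * (IP t w - IP r w)\<bar>))"
proof -
  let ?R = "LINT z|Pm. Z (fst z) * (indicator {r<..t} (snd z) * (ev \<phi> z * ev \<theta> z))"
  note DP = itoVD[OF P] and DY = itoVD[OF Y]
  note iP = itoV_inc[OF P rt] and iY = itoV_inc[OF Y rt]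
  note ZM = measurable_F_M[OF Z(1)]
  have bm: "integrable M (%w. Z w * f w)" if "integrable M f" for f by (rule integrable_bounded_mult[OF that ZM Z(2)])
  have i0: "integrable M (%w. Z w * ((P t w - P r w) * (Y t w - Y r w)))" by (rule bm[OF sq_int_mult[OF iP(2) iY(2)]])
  then show "integrable M (%w. Z w * ((P t w - P r w) * (Y t w - Y r w)))" .
  have j1: "integrable M (%w. (VP t w - VP r w) * (Y t w - Y r w))" by (rule sq_int_mult[OF iP(3) iY(2)])
  have j2: "integrable M (%w. (VY t w - VY r w) * (IP t w - IP r w))" by (rule sq_int_mult[OF iY(3) iP(4)])
  have j3: "integrable M (%w. (IP t w - IP r w) * (IY t w - IY r w))" by (rule sq_int_mult[OF iP(4) iY(4)])
  have cov: "(LINT w|M. Z w * ((IP t w - IP r w) * (IY t w - IY r w))) = ?R"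
    using ito_cov[OF DP(7) DY(7) rt Z] by (simp add: mult.assoc)
  have "(LINT w|M. Z w * ((P t w - P r w) * (Y t w - Y r w))) = (LINT w|M. Z w * ((VP t w - VP r w) * (Y t w - Y r w)) +
      Z w * ((VY t w - VY r w) * (IP t w - IP r w)) + Z w * ((IP t w - IP r w) * (IY t w - IY r w)))"
  proof (rule integral_cong_AE)
    show "AE w in M. Z w * ((P t w - P r w) * (Y t w - Y r w)) = Z w * ((VP t w - VP r w) * (Y t w - Y r w)) +
      Z w * ((VY t w - VY r w) * (IP t w - IP r w)) + Z w * ((IP t w - IP r w) * (IY t w - IY r w))"
      using iP(1) iY(1)
    proof eventually_elim
      case (elim w)
      have g: "z * ((a + b) * y) = z * (a * y) + z * (c * b) + z * (b * d)" if "y = c + d" for z a b c d y :: real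
        using that by (simp add: algebra_simps)
      show ?case unfolding elim(1) by (rule g[OF elim(2)])
    qed
  qed (use i0 bm[OF j1] bm[OF j2] bm[OF j3] in auto)
  also have "... = (LINT w|M. Z w * ((VP t w - VP r w) * (Y t w - Y r w))) + (LINT w|M. Z w * ((VY t w - VY r w) * (IP t w - IP r w)))
     + ?R"
    using bm[OF j1] bm[OF j2] bm[OF j3] by (simp add: cov)
  finally have eq: "(LINT w|M. Z w * ((P t w - P r w) * (Y t w - Y r w))) - ?R =
     (LINT w|M. Z w * ((VP t w - VP r w) * (Y t w - Y r w))) + (LINT w|M. Z w * ((VY t w - VY r w) * (IP t w - IP r w)))" by simp
  have bd: "\<bar>LINT w|M. Z w * f w\<bar> <= L * (LINT w|M. \<bar>f w\<bar>)" if f: "integrable M f" for f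
  proof -
    have "\<bar>LINT w|M. Z w * f w\<bar> <= (LINT w|M. \<bar>Z w * f w\<bar>)" by (rule integral_abs_bound)
    also have "... <= (LINT w|M. L * \<bar>f w\<bar>)"
    proof (rule integral_mono)
      show "integrable M (%w. \<bar>Z w * f w\<bar>)" using bm[OF f] by (rule integrable_abs)
      show "integrable M (%w. L * \<bar>f w\<bar>)" using f by simp
      show "\<bar>Z w * f w\<bar> <= L * \<bar>f w\<bar>" if "w : space M" for w
        unfolding abs_mult by (intro mult_right_mono Z(2)[OF that]) auto
    qed
    finally show ?thesis by simp
  qed
  show "\<bar>(LINT w|M. Z w * ((P t w - P r w) * (Y t w - Y r w))) - ?R\<bar>
      <= L * ((LINT w|M. \<bar>(VP t w - VP r w) * (Y t w - Y r w)\<bar>) + (LINT w|M. \<bar>(VY t w - VY r w) * (IP t w - IP r w)\<bar>))"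
    unfolding eq distrib_left using bd[OF j1] bd[OF j2] by linarith
qed

abbreviation frz :: "nat => (nat => 'w => 'h::euclidean_space) => real => 'w => 'h" where
  "frz n W \<equiv> simple_process (Suc n) (gr n) W"

lemma frozen_sum:
  fixes W :: "nat => 'w => real"
  assumes "!!i. i < Suc n ==> integrable Pm (%z. W i (fst z) * (indicator (cell n i) (snd z) * f z))"
  shows "integrable Pm (%z. ev (frz n W) z * f z)"
    "(SUM i<Suc n. LINT z|Pm. W i (fst z) * (indicator (cell n i) (snd z) * f z)) = (LINT z|Pm. ev (frz n W) z * f z)"
proof -
  have e: "ev (frz n W) z * f z = (SUM i<Suc n. W i (fst z) * (indicator (cell n i) (snd z) * f z))" for z
    unfolding ev_def simple_process_def sum_distrib_right real_scaleR_def by (intro sum.cong refl) (simp add: ac_simps)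
  show "integrable Pm (%z. ev (frz n W) z * f z)"
    unfolding e by (intro Bochner_Integration.integrable_sum assms) auto
  show "(SUM i<Suc n. LINT z|Pm. W i (fst z) * (indicator (cell n i) (snd z) * f z)) = (LINT z|Pm. ev (frz n W) z * f z)"
    unfolding e by (rule Bochner_Integration.integral_sum[symmetric]) (use assms in auto)
qed

lemma bounded_weight_integrable:
  fixes f :: "'w \<times> real => real"
  assumes Z: "Z : meas M" "!!w. w : space M ==> \<bar>Z w\<bar> <= L" and f: "integrable Pm f"
  shows "integrable Pm (%z. Z (fst z) * (indicator {r<..t} (snd z) * f z))"
  by (rule integrable_AE_bounded_mult[OF cell_integrable[OF f] Pm_fstI[OF Z(1)], where K = L])
     (use Z(2) in \<open>auto simp: space_Pm intro!: AE_I2\<close>)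

lemma cov_error_sum_tendsto:
  assumes P: "itoV P b \<phi> VP IP" and Y: "itoV Y c \<theta> VY IY"
  shows "(%n. SUM i<Suc n. (LINT w|M. \<bar>inc n i VP w * inc n i Y w\<bar>) + (LINT w|M. \<bar>inc n i VY w * inc n i IP w\<bar>)) ----> 0"
proof -
  have 1: "(%n. SUM i<Suc n. LINT w|M. \<bar>inc n i VP w * inc n i Y w\<bar>) ----> 0"
    by (rule cross_sum_tendsto[OF P itoV_inc(2)[OF Y cell_range] itoV_inc_sums(3)[OF Y]])
  have 2: "(%n. SUM i<Suc n. LINT w|M. \<bar>inc n i VY w * inc n i IP w\<bar>) ----> 0"
    by (rule cross_sum_tendsto[OF Y itoV_inc(4)[OF P cell_range] eq_refl[OF itoV_inc_sums(2)[OF P]]])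
  show ?thesis using tendsto_add[OF 1 2] by (simp only: sum.distrib add_0_right)
qed

text \<open>The drift in Ito's formula for the product of \<open>P\<close>, \<open>X\<close> and
  \<open>Y\<close>, three first-order and three covariation terms, with the undifferentiated factors
  frozen at the left end of each cell and multiplied by the cutoff.\<close>

definition "product_drift \<zeta> P b \<phi> X a \<sigma> Y c \<theta> n z = ev (frz n (%i w. \<zeta> n i w * X (gr n i) w * Y (gr n i) w)) z * (ev b z :: real)
    + ev (frz n (%i w. \<zeta> n i w * P (gr n i) w * X (gr n i) w)) z * ev c z
    + ev (frz n (%i w. \<zeta> n i w * P (gr n i) w * Y (gr n i) w)) z * ev a z
    + ev (frz n (%i w. \<zeta> n i w * X (gr n i) w)) z * (ev \<phi> z * ev \<theta> z)
    + ev (frz n (%i w. \<zeta> n i w * Y (gr n i) w)) z * (ev \<phi> z * ev \<sigma> z)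
    + ev (frz n (%i w. \<zeta> n i w * P (gr n i) w)) z * (ev \<sigma> z * ev \<theta> z)"

lemma trilinear_scalar:
  assumes P: "itoV P b \<phi> VP IP" and X: "itoV X a \<sigma> VX IX" and Y: "itoV Y c \<theta> VY IY"
    and PK: "AE w in M. ALL t:{s..T}. \<bar>P t w\<bar> <= K"
    and \<zeta>m: "!!n i. i < Suc n ==> \<zeta> n i : meas (F (gr n i))"
    and \<zeta>01: "!!n i w. \<zeta> n i w = 0 \<or> \<zeta> n i w = (1 :: real)"
    and \<zeta>b: "!!n i w. i < Suc n ==> w : space M ==> \<bar>\<zeta> n i w * P (gr n i) w\<bar> <= L"
      "!!n i w. i < Suc n ==> w : space M ==> \<bar>\<zeta> n i w * X (gr n i) w\<bar> <= L"
      "!!n i w. i < Suc n ==> w : space M ==> \<bar>\<zeta> n i w * Y (gr n i) w\<bar> <= L"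
  shows "!!n. integrable Pm (product_drift \<zeta> P b \<phi> X a \<sigma> Y c \<theta> n)"
    and "!!n i. i < Suc n ==> integrable M (%w. \<zeta> n i w * inc n i (%t w. P t w * X t w * Y t w) w)"
    and "(%n. (SUM i<Suc n. LINT w|M. \<zeta> n i w * inc n i (%t w. P t w * X t w * Y t w) w)
      - (LINT z|Pm. product_drift \<zeta> P b \<phi> X a \<sigma> Y c \<theta> n z)) ----> 0"
proof -
  let ?p = "%t w. P t w * X t w * Y t w"
  note DP = itoVD[OF P] and DX = itoVD[OF X] and DY = itoVD[OF Y]
  have adP: "P (gr n i) : meas (F (gr n i))" and adX: "X (gr n i) : meas (F (gr n i))"
    and adY: "Y (gr n i) : meas (F (gr n i))" if "i < Suc n" for n i
    using cont_prog_adapted[OF DP(2) gr_range[of i n]] cont_prog_adapted[OF DX(2) gr_range[of i n]] cont_prog_adapted[OF DY(2) gr_range[of i n]] that by auto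
  have L0: "0 <= L" using \<zeta>b(1)[of 0 0] not_empty by (metis abs_ge_zero all_not_in_conv order_trans zero_less_Suc)
  \<comment> \<open>A cutoff with values 0 and 1 equals its square, so a single one bounds both
    factors.\<close>
  have w2: "\<bar>\<zeta> n i w * u * v\<bar> <= L * L" if "\<bar>\<zeta> n i w * u\<bar> <= L" "\<bar>\<zeta> n i w * v\<bar> <= L" for n i w u v
  proof -
    have "\<zeta> n i w * u * v = (\<zeta> n i w * u) * (\<zeta> n i w * v)" using \<zeta>01[of n i w] by auto
    then have "\<bar>\<zeta> n i w * u * v\<bar> = \<bar>\<zeta> n i w * u\<bar> * \<bar>\<zeta> n i w * v\<bar>" by (simp only: abs_mult)
    also have "... <= L * L" using that L0 by (intro mult_mono) auto
    finally show ?thesis .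
  qed
  define W1 where "W1 n i w = \<zeta> n i w * X (gr n i) w * Y (gr n i) w" for n i w
  define W2 where "W2 n i w = \<zeta> n i w * P (gr n i) w * X (gr n i) w" for n i w
  define W3 where "W3 n i w = \<zeta> n i w * P (gr n i) w * Y (gr n i) w" for n i w
  define W4 where "W4 n i w = \<zeta> n i w * X (gr n i) w" for n i w
  define W5 where "W5 n i w = \<zeta> n i w * Y (gr n i) w" for n i w
  define W6 where "W6 n i w = \<zeta> n i w * P (gr n i) w" for n i w
  note Wd = W1_def[abs_def] W2_def[abs_def] W3_def[abs_def] W4_def[abs_def] W5_def[abs_def] W6_def[abs_def]
  have Wm: "W1 n i : meas (F (gr n i))" "W2 n i : meas (F (gr n i))" "W3 n i : meas (F (gr n i))"
    "W4 n i : meas (F (gr n i))" "W5 n i : meas (F (gr n i))" "W6 n i : meas (F (gr n i))" if i: "i < Suc n" for n i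
    unfolding Wd by (intro borel_measurable_times \<zeta>m[OF i] adP[OF i] adX[OF i] adY[OF i])+
  have Wb: "\<bar>W1 n i w\<bar> <= L * L" "\<bar>W2 n i w\<bar> <= L * L" "\<bar>W3 n i w\<bar> <= L * L" "\<bar>W4 n i w\<bar> <= L" "\<bar>W5 n i w\<bar> <= L" "\<bar>W6 n i w\<bar> <= L"
    if "i < Suc n" "w : space M" for n i w
    unfolding Wd using w2 \<zeta>b[OF that] by auto
  have Wsq: "sq_int M W" if "W : meas (F t)" "!!w. w : space M ==> \<bar>W w\<bar> <= K'" for W t K'
    by (rule sq_int_bounded[OF finite_measure_axioms measurable_F_M[OF that(1)], where K = K']) (use that(2) in auto)
  have fi: "integrable Pm (ev b)" "integrable Pm (ev c)" "integrable Pm (ev a)" "integrable Pm (%z. ev \<phi> z * ev \<theta> z)"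
    "integrable Pm (%z. ev \<phi> z * ev \<sigma> z)" "integrable Pm (%z. ev \<sigma> z * ev \<theta> z)"
    using DP DX DY by (auto intro: Pm.sq_int_imp_integrable sq_int_mult)
  have ci: "integrable Pm (%z. W1 n i (fst z) * (indicator (cell n i) (snd z) * ev b z))"
      "integrable Pm (%z. W2 n i (fst z) * (indicator (cell n i) (snd z) * ev c z))"
      "integrable Pm (%z. W3 n i (fst z) * (indicator (cell n i) (snd z) * ev a z))"
      "integrable Pm (%z. W4 n i (fst z) * (indicator (cell n i) (snd z) * (ev \<phi> z * ev \<theta> z)))"
      "integrable Pm (%z. W5 n i (fst z) * (indicator (cell n i) (snd z) * (ev \<phi> z * ev \<sigma> z)))"
      "integrable Pm (%z. W6 n i (fst z) * (indicator (cell n i) (snd z) * (ev \<sigma> z * ev \<theta> z)))" if i: "i < Suc n" for n i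
    using bounded_weight_integrable[OF measurable_F_M[OF Wm(1)[OF i]] Wb(1)[OF i] fi(1)]
      bounded_weight_integrable[OF measurable_F_M[OF Wm(2)[OF i]] Wb(2)[OF i] fi(2)]
      bounded_weight_integrable[OF measurable_F_M[OF Wm(3)[OF i]] Wb(3)[OF i] fi(3)]
      bounded_weight_integrable[OF measurable_F_M[OF Wm(4)[OF i]] Wb(4)[OF i] fi(4)]
      bounded_weight_integrable[OF measurable_F_M[OF Wm(5)[OF i]] Wb(5)[OF i] fi(5)]
      bounded_weight_integrable[OF measurable_F_M[OF Wm(6)[OF i]] Wb(6)[OF i] fi(6)] by blast+
  note fs = frozen_sum[OF ci(1)] frozen_sum[OF ci(2)] frozen_sum[OF ci(3)] frozen_sum[OF ci(4)] frozen_sum[OF ci(5)] frozen_sum[OF ci(6)]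
  define R where "R n = (LINT z|Pm. ev (frz n (W1 n)) z * ev b z + ev (frz n (W2 n)) z * ev c z + ev (frz n (W3 n)) z * ev a z
     + ev (frz n (W4 n)) z * (ev \<phi> z * ev \<theta> z) + ev (frz n (W5 n)) z * (ev \<phi> z * ev \<sigma> z) + ev (frz n (W6 n)) z * (ev \<sigma> z * ev \<theta> z))" for n
  show "integrable Pm (product_drift \<zeta> P b \<phi> X a \<sigma> Y c \<theta> n)" for n
    using fs[of n] unfolding product_drift_def[abs_def] Wd by (intro Bochner_Integration.integrable_add) auto
  define m where "m n i j = (if j = 1 then (LINT z|Pm. W1 n i (fst z) * (indicator (cell n i) (snd z) * ev b z))
     else if j = 2 then (LINT z|Pm. W2 n i (fst z) * (indicator (cell n i) (snd z) * ev c z))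
     else if j = 3 then (LINT z|Pm. W3 n i (fst z) * (indicator (cell n i) (snd z) * ev a z))
     else if j = 4 then (LINT z|Pm. W4 n i (fst z) * (indicator (cell n i) (snd z) * (ev \<phi> z * ev \<theta> z)))
     else if j = 5 then (LINT z|Pm. W5 n i (fst z) * (indicator (cell n i) (snd z) * (ev \<phi> z * ev \<sigma> z)))
     else (LINT z|Pm. W6 n i (fst z) * (indicator (cell n i) (snd z) * (ev \<sigma> z * ev \<theta> z))))" for n i and j :: nat
  have R_eq: "R n = (SUM i<Suc n. m n i 1 + m n i 2 + m n i 3 + m n i 4 + m n i 5 + m n i 6)" for n
    unfolding R_def m_def using fs[of n] by (simp add: sum.distrib del: sum.lessThan_Suc)
  define e4 where "e4 n i = (LINT w|M. \<bar>inc n i VP w * inc n i Y w\<bar>) + (LINT w|M. \<bar>inc n i VY w * inc n i IP w\<bar>)" for n i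
  define e5 where "e5 n i = (LINT w|M. \<bar>inc n i VP w * inc n i X w\<bar>) + (LINT w|M. \<bar>inc n i VX w * inc n i IP w\<bar>)" for n i
  define e6 where "e6 n i = (LINT w|M. \<bar>inc n i VX w * inc n i Y w\<bar>) + (LINT w|M. \<bar>inc n i VY w * inc n i IX w\<bar>)" for n i
  define e7 where "e7 n i = (LINT w|M. \<bar>inc n i P w\<bar> * (inc n i X w)^2) + (LINT w|M. \<bar>inc n i P w\<bar> * (inc n i Y w)^2)" for n i
  have sqP: "ALL t:{s..T}. sq_int M (P t)" using L2_cont_real_sq[OF DP(1)] by blast
  note thX = third_order_tendsto[OF X sqP PK itoV_inc_sums(3)[OF P]]
  note thY = third_order_tendsto[OF Y sqP PK itoV_inc_sums(3)[OF P]]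
  have cellres: "integrable M (%w. \<zeta> n i w * inc n i ?p w) &
     \<bar>(LINT w|M. \<zeta> n i w * inc n i ?p w) - (m n i 1 + m n i 2 + m n i 3 + m n i 4 + m n i 5 + m n i 6)\<bar>
     <= L * e4 n i + L * e5 n i + L * e6 n i + e7 n i" if i: "i < Suc n" for n i
  proof -
    note rt = cell_range[OF i]
    have x1: "(LINT w|M. W1 n i w * inc n i P w) = m n i 1" "integrable M (%w. W1 n i w * inc n i P w)"
      using cell_mean[OF P rt Wm(1)[OF i] Wsq[OF Wm(1)[OF i] Wb(1)[OF i]]]
        sq_int_mult[OF Wsq[OF Wm(1)[OF i] Wb(1)[OF i]] itoV_inc(2)[OF P rt]] by (simp_all add: m_def)
    have x2: "(LINT w|M. W2 n i w * inc n i Y w) = m n i 2" "integrable M (%w. W2 n i w * inc n i Y w)"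
      using cell_mean[OF Y rt Wm(2)[OF i] Wsq[OF Wm(2)[OF i] Wb(2)[OF i]]]
        sq_int_mult[OF Wsq[OF Wm(2)[OF i] Wb(2)[OF i]] itoV_inc(2)[OF Y rt]] by (simp_all add: m_def)
    have x3: "(LINT w|M. W3 n i w * inc n i X w) = m n i 3" "integrable M (%w. W3 n i w * inc n i X w)"
      using cell_mean[OF X rt Wm(3)[OF i] Wsq[OF Wm(3)[OF i] Wb(3)[OF i]]]
        sq_int_mult[OF Wsq[OF Wm(3)[OF i] Wb(3)[OF i]] itoV_inc(2)[OF X rt]] by (simp_all add: m_def)
    have x4: "\<bar>(LINT w|M. W4 n i w * (inc n i P w * inc n i Y w)) - m n i 4\<bar> <= L * e4 n i" "integrable M (%w. W4 n i w * (inc n i P w * inc n i Y w))"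
      using cell_cov[OF P Y rt Wm(4)[OF i] Wb(4)[OF i]] by (simp_all add: m_def e4_def)
    have x5: "\<bar>(LINT w|M. W5 n i w * (inc n i P w * inc n i X w)) - m n i 5\<bar> <= L * e5 n i" "integrable M (%w. W5 n i w * (inc n i P w * inc n i X w))"
      using cell_cov[OF P X rt Wm(5)[OF i] Wb(5)[OF i]] by (simp_all add: m_def e5_def)
    have x6: "\<bar>(LINT w|M. W6 n i w * (inc n i X w * inc n i Y w)) - m n i 6\<bar> <= L * e6 n i" "integrable M (%w. W6 n i w * (inc n i X w * inc n i Y w))"
      using cell_cov[OF X Y rt Wm(6)[OF i] Wb(6)[OF i]] by (simp_all add: m_def e6_def)
    let ?t = "%w. \<zeta> n i w * (inc n i P w * (inc n i X w * inc n i Y w))"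
    have tm: "?t : meas M"
      using measurable_F_M[OF \<zeta>m[OF i]] itoV_inc(2)[OF P rt] itoV_inc(2)[OF X rt] itoV_inc(2)[OF Y rt]
      by (intro borel_measurable_times) (auto simp: sq_int_def)
    have tb: "\<bar>?t w\<bar> <= \<bar>inc n i P w\<bar> * (inc n i X w)^2 + \<bar>inc n i P w\<bar> * (inc n i Y w)^2" for w
    proof -
      have "\<bar>?t w\<bar> <= \<bar>inc n i P w\<bar> * \<bar>inc n i X w * inc n i Y w\<bar>" using \<zeta>01[of n i w] by (auto simp: abs_mult)
      also have "... <= \<bar>inc n i P w\<bar> * ((inc n i X w)^2 + (inc n i Y w)^2)"
        using weighted_am_gm[of 1 "inc n i X w" "inc n i Y w"] by (intro mult_left_mono) auto
      finally show ?thesis by (simp add: distrib_left)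
    qed
    have ti: "integrable M ?t"
      by (rule Bochner_Integration.integrable_bound[OF Bochner_Integration.integrable_add[OF thX(1)[OF i] thY(1)[OF i]] tm])
         (use tb in \<open>auto intro!: AE_I2 intro: order_trans[OF _ abs_ge_self]\<close>)
    have x7: "\<bar>LINT w|M. ?t w\<bar> <= e7 n i"
    proof -
      have "\<bar>LINT w|M. ?t w\<bar> <= (LINT w|M. \<bar>?t w\<bar>)" by (rule integral_abs_bound)
      also have "... <= (LINT w|M. \<bar>inc n i P w\<bar> * (inc n i X w)^2 + \<bar>inc n i P w\<bar> * (inc n i Y w)^2)"
        using ti thX(1)[OF i] thY(1)[OF i] by (intro integral_mono tb) auto
      also have "... = e7 n i" unfolding e7_def using thX(1)[OF i] thY(1)[OF i] by simp
      finally show ?thesis .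
    qed
    \<comment> \<open>An exact identity: every weight is taken at the left end of the cell and is
      therefore measurable there; all three increments meet only in the last term.\<close>
    have expand: "\<zeta> n i w * inc n i ?p w = W1 n i w * inc n i P w + W2 n i w * inc n i Y w + W3 n i w * inc n i X w
       + W4 n i w * (inc n i P w * inc n i Y w) + W5 n i w * (inc n i P w * inc n i X w) + W6 n i w * (inc n i X w * inc n i Y w) + ?t w" for w
      unfolding W1_def W2_def W3_def W4_def W5_def W6_def by (simp add: algebra_simps)
    have int: "integrable M (%w. \<zeta> n i w * inc n i ?p w)"
      unfolding expand by (intro Bochner_Integration.integrable_add x1 x2 x3 x4 x5 x6 ti)
    have "(LINT w|M. \<zeta> n i w * inc n i ?p w) = m n i 1 + m n i 2 + m n i 3
      + (LINT w|M. W4 n i w * (inc n i P w * inc n i Y w)) + (LINT w|M. W5 n i w * (inc n i P w * inc n i X w))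
      + (LINT w|M. W6 n i w * (inc n i X w * inc n i Y w)) + (LINT w|M. ?t w)"
      unfolding expand x1(1)[symmetric] x2(1)[symmetric] x3(1)[symmetric]
      using x1(2) x2(2) x3(2) x4(2) x5(2) x6(2) ti by (simp only: Bochner_Integration.integral_add Bochner_Integration.integrable_add)
    then show ?thesis using int x4(1) x5(1) x6(1) x7 by linarith
  qed
  then show "i < Suc n ==> integrable M (%w. \<zeta> n i w * inc n i ?p w)" for n i by blast
  have bound: "\<bar>(SUM i<Suc n. LINT w|M. \<zeta> n i w * inc n i ?p w) - R n\<bar> <=
     L * (SUM i<Suc n. e4 n i) + L * (SUM i<Suc n. e5 n i) + L * (SUM i<Suc n. e6 n i) + (SUM i<Suc n. e7 n i)" for n
  proof -
    have eq: "(SUM i<Suc n. LINT w|M. \<zeta> n i w * inc n i ?p w) - R n =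
      (SUM i<Suc n. (LINT w|M. \<zeta> n i w * inc n i ?p w) - (m n i 1 + m n i 2 + m n i 3 + m n i 4 + m n i 5 + m n i 6))"
      unfolding R_eq by (simp only: sum_subtractf)
    have eq2: "L * (SUM i<Suc n. e4 n i) + L * (SUM i<Suc n. e5 n i) + L * (SUM i<Suc n. e6 n i) + (SUM i<Suc n. e7 n i) =
      (SUM i<Suc n. L * e4 n i + L * e5 n i + L * e6 n i + e7 n i)"
      by (simp only: sum.distrib sum_distrib_left)
    show ?thesis unfolding eq eq2 using cellres by (intro order_trans[OF sum_abs] sum_mono) auto
  qed
  have lim: "(%n. L * (SUM i<Suc n. e4 n i) + L * (SUM i<Suc n. e5 n i) + L * (SUM i<Suc n. e6 n i) + (SUM i<Suc n. e7 n i)) ----> L * 0 + L * 0 + L * 0 + (0 + 0)"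
    unfolding e4_def e5_def e6_def e7_def sum.distrib[of "%i. LINT w|M. \<bar>inc _ i P w\<bar> * (inc _ i X w)^2"]
    by (intro tendsto_add tendsto_mult tendsto_const cov_error_sum_tendsto[OF P Y] cov_error_sum_tendsto[OF P X]
          cov_error_sum_tendsto[OF X Y] thX(2) thY(2))
  have "(%n. (SUM i<Suc n. LINT w|M. \<zeta> n i w * inc n i ?p w) - R n) ----> 0"
    by (rule Lim_null_comparison[OF always_eventually]) (use bound lim in auto)
  then show "(%n. (SUM i<Suc n. LINT w|M. \<zeta> n i w * inc n i ?p w)
      - (LINT z|Pm. product_drift \<zeta> P b \<phi> X a \<sigma> Y c \<theta> n z)) ----> 0"
    unfolding R_def product_drift_def Wd .
qed

end

lemma matrix_quad_sum: "(A *v x) \<bullet> y = (SUM j:UNIV. SUM k:UNIV. A $ j $ k * x $ k * y $ j)" for A :: "real^'n^'m"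
  by (simp add: inner_vec_def matrix_vector_mult_def sum_distrib_right)

lemma matrix_quad_bound: "\<bar>(A *v x) \<bullet> y\<bar> <= norm A * norm x * norm y" for A :: "real^'n^'m"
  by (rule order_trans[OF Cauchy_Schwarz_ineq2 mult_right_mono[OF norm_matrix_vector_mult_le norm_ge_zero]])

text \<open>A cutoff that never switches on again acts as stopping, so the sum telescopes up to the
  stopping index.\<close>

lemma telescope_cutoff:
  fixes \<zeta> \<psi> :: "nat => real"
  assumes "!!i. \<zeta> i = 0 \<or> \<zeta> i = 1" "!!i. \<zeta> (Suc i) = 1 ==> \<zeta> i = 1"
  shows "EX k<=N. (SUM i<N. \<zeta> i * (\<psi> (Suc i) - \<psi> i)) = \<psi> k - \<psi> 0"
proof (induction N)
  case (Suc N)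
  show ?case
  proof (cases "\<zeta> N = 1")
    case True
    have "\<zeta> i = 1" if "i <= N" for i
      using that
    proof (induction "N - i" arbitrary: i)
      case 0 then show ?case using True by simp
    next
      case (Suc d)
      then have "\<zeta> (Suc i) = 1" by simp
      then show ?case by (rule assms(2))
    qed
    then have "(SUM i<Suc N. \<zeta> i * (\<psi> (Suc i) - \<psi> i)) = (SUM i<Suc N. \<psi> (Suc i) - \<psi> i)" by (intro sum.cong) auto
    also have "... = \<psi> (Suc N) - \<psi> 0" by (rule sum_lessThan_telescope)
    finally show ?thesis by blast
  next
    case False
    then have "\<zeta> N = 0" using assms(1)[of N] by blast
    then show ?thesis using Suc by (auto intro: le_SucI)
  qed
qed simp

section \<open>Frozen coefficients and products of two processes\<close>

context brownian
begin

text \<open>The maximum of the path over time: one square-integrable majorant for all frozen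
  versions of the process.\<close>

lemma L2_cont_dominated:
  fixes X :: "real => 'w => 'h::euclidean_space"
  assumes "X : L2C"
  obtains R where "sq_int M R" "!!w. 0 <= R w" "AE w in M. ALL t:{s..T}. norm (X t w) <= R w"
proof -
  have X: "X : CP" "(EM w. supsq X w) < \<infinity>" using assms by (auto simp: L2_cont_iff)
  note [measurable] = supsq_meas[OF X(1)]
  have fin: "AE w in M. supsq X w < \<infinity>" using X(2) nn_integral_PInf_AE[of "supsq X" M] by (auto simp: less_top)
  define R where "R w = sqrt (enn2real (supsq X w))" for w
  have "(EM w. ennreal ((R w)^2)) <= (EM w. supsq X w)"
    using fin by (intro nn_integral_mono_AE) (auto simp: R_def elim: eventually_mono)
  then have "sq_int M R" using X(2) by (auto simp: sq_int_iff_nn R_def[abs_def] intro: le_less_trans)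
  moreover have "AE w in M. ALL t:{s..T}. norm (X t w) <= R w"
    using fin
  proof eventually_elim
    case (elim w)
    show ?case
    proof
      fix t assume "t : {s..T}"
      then have "ennreal ((norm (X t w))^2) <= ennreal (enn2real (supsq X w))" using supsq_ge[of t X w] elim by simp
      then have "(norm (X t w))^2 <= enn2real (supsq X w)" by (simp del: ennreal_enn2real)
      then show "norm (X t w) <= R w" unfolding R_def by (rule real_le_rsqrt)
    qed
  qed
  ultimately show thesis using that[of R] by (simp add: R_def)
qed

lemma AE_Pm_fst:
  assumes "AE w in M. Q w" shows "AE z in Pm. Q (fst z)"
proof -
  obtain N where N: "N : null_sets M" "!!w. w : space M - N ==> Q w" using assms by (auto elim!: AE_E3)
  have "emeasure Pm (N \<times> {s..T}) = emeasure M N * emeasure lam {s..T}"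
    unfolding Pm_def using N(1) sets.top[of lam] by (intro lam.emeasure_pair_measure_Times) auto
  then have "N \<times> {s..T} : null_sets Pm"
    using N(1) sets.top[of lam] by (auto simp: null_sets_def Pm_def)
  then show ?thesis by (rule AE_I') (use N(2) in \<open>force simp: space_Pm\<close>)
qed

text \<open>The cell whose half-open interval contains \<open>t\<close>, so its left end lies
  strictly before \<open>t\<close>. Unlike \<open>idx\<close>, it is meaningful only for
  \<open>t > s\<close>, which is almost everywhere on \<open>Pm\<close>.\<close>

definition cidx :: "nat => real => nat" where "cidx n t = (SOME i. i < Suc n & gr n i < t & t <= gr n (Suc i))"

lemma cidx: assumes "t : {s<..T}" shows "cidx n t < Suc n" "gr n (cidx n t) < t" "t <= gr n (Suc (cidx n t))"
proof -
  have "gr n 0 < t" "t <= gr n (Suc n)" using assms by auto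
  from someI_ex[OF grid_cell[OF this]] show "cidx n t < Suc n" "gr n (cidx n t) < t" "t <= gr n (Suc (cidx n t))"
    unfolding cidx_def by auto
qed

lemma gr_cidx: "t : {s<..T} ==> gr n (cidx n t) : {s..T}"
  using cidx(1)[of t n] gr_range[of "cidx n t" n] by auto

lemma frz_at: "t : {s<..T} ==> frz n W t w = W (cidx n t) w"
  using cidx[of t n] by (intro simple_process_at) (auto simp: gr_less)

lemma gr_cidx_tendsto: assumes t: "t : {s<..T}" shows "(%n. gr n (cidx n t)) ----> t"
proof (rule tendsto_sandwich[OF _ _ _ tendsto_const])
  show "\<forall>\<^sub>F n in sequentially. t - mesh n <= gr n (cidx n t)"
  proof (intro always_eventually allI)
    fix n show "t - mesh n <= gr n (cidx n t)" using cidx(3)[OF t, of n] gr_mesh[of n "cidx n t"] by linarith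
  qed
  show "\<forall>\<^sub>F n in sequentially. gr n (cidx n t) <= t" using cidx(2)[OF t] by (auto simp: less_imp_le)
  show "(%n. t - mesh n) ----> t" using tendsto_diff[OF tendsto_const mesh_tendsto, of t] by simp
qed

lemma cont_frozen_tendsto:
  fixes X :: "real => 'w => 'h::euclidean_space"
  assumes "X : cont_prog M F s T H" "w : space M" "t : {s<..T}"
  shows "(%n. X (gr n (cidx n t)) w) ----> X t w"
  using assms gr_cidx[OF assms(3)]
  by (intro continuous_on_tendsto_compose[OF cont_prog_cont[OF assms(1,2)] gr_cidx_tendsto] always_eventually) auto

lemma itoV_component:
  fixes X a \<sigma> :: "real => 'w => 'h::euclidean_space"
  assumes X: "X : L2C" and a: "a : L2P" and d: "ito_eq X a \<sigma>"
    and b: "b : Basis"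
  obtains V I where "itoV (%t w. X t w \<bullet> b) (%t w. a t w \<bullet> b) (%t w. \<sigma> t w \<bullet> b) V I"
proof -
  from d obtain I where I: "ito \<sigma> I"
    "AE w in M. ALL t:{s..T}. X t w = X s w + (LINT r:{s..t}|lborel. a r w) + I t w" by (auto simp: ito_differential_def)
  have pb: "(%t w. Y t w \<bullet> b) : PM" if "Y : PM" for Y
    using that by (auto simp: prog_measurable_def split_beta')
  have ab: "(%t w. a t w \<bullet> b) : L2P"
    by (rule L2_prog_bound[OF pb a, where K = 1]) (use a in \<open>auto simp: L2_prog_def ev_def Basis_le_norm[OF b] intro!: AE_I2\<close>)
  obtain V where V: "V : CP" "AE w in M. ALL t:{s..T}. V t w = (LINT r:{s..t}|lborel. a r w \<bullet> b)"
    using primitive_exists[OF ab] by blast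
  have Xb: "(%t w. X t w \<bullet> b) : L2C"
  proof -
    have "(EM w. supsq (%t w. X t w \<bullet> b) w) <= (EM w. supsq X w)"
    proof -
      have le: "ennreal ((norm (x \<bullet> b))^2) <= ennreal ((norm x)^2)" for x
        using Basis_le_norm[OF b, of x] by (intro ennreal_leI power_mono) auto
      show ?thesis unfolding supsq_def by (intro nn_integral_mono SUP_mono' le)
    qed
    then show ?thesis using X by (auto simp: L2_cont_iff intro: cont_prog_inner le_less_trans)
  qed
  have "AE w in M. ALL t:{s..T}. X t w \<bullet> b = X s w \<bullet> b + V t w + I t w \<bullet> b"
    using I(2) V(2) L2_path_integrable[OF a]
  proof eventually_elim
    case (elim w)
    show ?case
    proof
      fix t assume t: "t : {s..T}"
      have "set_integrable lborel {s..t} (%r. a r w)" using elim t by (auto intro: set_integrable_subset)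
      then have "(LINT r:{s..t}|lborel. a r w) \<bullet> b = (LINT r:{s..t}|lborel. a r w \<bullet> b)"
        unfolding set_lebesgue_integral_def set_integrable_def by (simp add: integral_inner_left[symmetric])
      moreover have "X t w = X s w + (LINT r:{s..t}|lborel. a r w) + I t w" "V t w = (LINT r:{s..t}|lborel. a r w \<bullet> b)"
        using elim t by blast+
      ultimately show "X t w \<bullet> b = X s w \<bullet> b + V t w + I t w \<bullet> b" by (simp add: inner_add_left)
    qed
  qed
  then show thesis using that[of V "%t w. I t w \<bullet> b"] Xb ab V ito_component[OF I(1) b] by (simp add: itoV_def)
qed

lemma bilinear_scalar:
  assumes P: "itoV P b \<phi> VP IP" and Y: "itoV Y c \<theta> VY IY"
  shows "(LINT w|M. P T w * Y T w) - (LINT w|M. P s w * Y s w) = (LINT z|Pm. ev Y z * ev b z + ev P z * ev c z + ev \<phi> z * ev \<theta> z)"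
    and "integrable Pm (%z. ev Y z * ev b z + ev P z * ev c z + ev \<phi> z * ev \<theta> z)"
proof -
  let ?q = "LINT z|Pm. ev \<phi> z * ev \<theta> z"
  note DP = itoVD[OF P] and DY = itoVD[OF Y]
  from L2_cont_dominated[OF DP(1)] obtain RP where RP: "sq_int M RP" "!!w. 0 <= RP w" "AE w in M. ALL t:{s..T}. norm (P t w) <= RP w" by blast
  from L2_cont_dominated[OF DY(1)] obtain RY where RY: "sq_int M RY" "!!w. 0 <= RY w" "AE w in M. ALL t:{s..T}. norm (Y t w) <= RY w" by blast
  have sqP: "sq_int M (P t)" and sqY: "sq_int M (Y t)" if "t : {s..T}" for t
    using L2_cont_real_sq[OF DP(1) that] L2_cont_real_sq[OF DY(1) that] .
  have LP: "sq_int Pm (ev P)" and LY: "sq_int Pm (ev Y)"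
    using L2_prog_sq[OF L2_cont_L2_prog[OF DP(1)]] L2_prog_sq[OF L2_cont_L2_prog[OF DY(1)]] .
  have i3: "integrable Pm (%z. ev \<phi> z * ev \<theta> z)" by (rule sq_int_mult[OF DP(10) DY(10)])
  have i1: "integrable Pm (%z. ev Y z * ev b z)" by (rule sq_int_mult[OF LY DP(9)])
  have i2: "integrable Pm (%z. ev P z * ev c z)" by (rule sq_int_mult[OF LP DY(9)])
  show "integrable Pm (%z. ev Y z * ev b z + ev P z * ev c z + ev \<phi> z * ev \<theta> z)" using i1 i2 i3 by simp
  define fY where "fY n = frz n (%i. Y (gr n i))" for n
  define fP where "fP n = frz n (%i. P (gr n i))" for n
  have ci: "integrable Pm (%z. Y (gr n i) (fst z) * (indicator (cell n i) (snd z) * ev b z))"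
     "integrable Pm (%z. P (gr n i) (fst z) * (indicator (cell n i) (snd z) * ev c z))" if "i < Suc n" for n i
    using gr_range[of i n] that
    by (auto intro!: sq_int_mult fst_sq_int sqY sqP ind_sq_int DP(9) DY(9))
  note fs1 = frozen_sum[OF ci(1), folded fY_def] and fs2 = frozen_sum[OF ci(2), folded fP_def]
  define e where "e n = (SUM i<Suc n. (LINT w|M. \<bar>inc n i VP w * inc n i Y w\<bar>) + (LINT w|M. \<bar>inc n i VY w * inc n i IP w\<bar>))" for n
  have e0: "e ----> 0" unfolding e_def[abs_def] by (rule cov_error_sum_tendsto[OF P Y])
  let ?D = "(LINT w|M. P T w * Y T w) - (LINT w|M. P s w * Y s w)"
  have approx: "\<bar>?D - ((LINT z|Pm. ev (fY n) z * ev b z) + (LINT z|Pm. ev (fP n) z * ev c z) + ?q)\<bar> <= e n" for n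
  proof -
    have PY: "integrable M (%w. P t w * Y t w)" if "t : {s..T}" for t by (rule sq_int_mult[OF sqP[OF that] sqY[OF that]])
    define d where "d i = (LINT w|M. inc n i P w * inc n i Y w)" for i
    define q where "q i = (LINT z|Pm. indicator (cell n i) (snd z) * (ev \<phi> z * ev \<theta> z))" for i
    have cellD: "(LINT w|M. P (gr n (Suc i)) w * Y (gr n (Suc i)) w) - (LINT w|M. P (gr n i) w * Y (gr n i) w) =
        (LINT z|Pm. Y (gr n i) (fst z) * (indicator (cell n i) (snd z) * ev b z)) + (LINT z|Pm. P (gr n i) (fst z) * (indicator (cell n i) (snd z) * ev c z)) + d i"
      and cellE: "\<bar>d i - q i\<bar> <= (LINT w|M. \<bar>inc n i VP w * inc n i Y w\<bar>) + (LINT w|M. \<bar>inc n i VY w * inc n i IP w\<bar>)" if i: "i < Suc n" for i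
    proof -
      note rt = cell_range[OF i]
      have gi: "gr n i : {s..T}" "gr n (Suc i) : {s..T}" using gr_range[of i n] gr_range[of "Suc i" n] i by auto
      have y: "integrable M (%w. Y (gr n i) w * inc n i P w)" by (rule sq_int_mult[OF sqY[OF gi(1)] itoV_inc(2)[OF P rt]])
      have p: "integrable M (%w. P (gr n i) w * inc n i Y w)" by (rule sq_int_mult[OF sqP[OF gi(1)] itoV_inc(2)[OF Y rt]])
      have dd: "integrable M (%w. inc n i P w * inc n i Y w)" by (rule sq_int_mult[OF itoV_inc(2)[OF P rt] itoV_inc(2)[OF Y rt]])
      have "(LINT w|M. P (gr n (Suc i)) w * Y (gr n (Suc i)) w) - (LINT w|M. P (gr n i) w * Y (gr n i) w) =
        (LINT w|M. P (gr n (Suc i)) w * Y (gr n (Suc i)) w - P (gr n i) w * Y (gr n i) w)" using PY[OF gi(1)] PY[OF gi(2)] by simp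
      also have "... = (LINT w|M. Y (gr n i) w * inc n i P w + P (gr n i) w * inc n i Y w + inc n i P w * inc n i Y w)"
        by (rule Bochner_Integration.integral_cong) (auto simp: algebra_simps)
      also have "... = (LINT w|M. Y (gr n i) w * inc n i P w) + (LINT w|M. P (gr n i) w * inc n i Y w) + d i"
        using y p dd by (simp add: d_def)
      finally show "(LINT w|M. P (gr n (Suc i)) w * Y (gr n (Suc i)) w) - (LINT w|M. P (gr n i) w * Y (gr n i) w) =
        (LINT z|Pm. Y (gr n i) (fst z) * (indicator (cell n i) (snd z) * ev b z)) + (LINT z|Pm. P (gr n i) (fst z) * (indicator (cell n i) (snd z) * ev c z)) + d i"
        unfolding cell_mean[OF P rt cont_prog_adapted[OF DY(2) gi(1)] sqY[OF gi(1)]] cell_mean[OF Y rt cont_prog_adapted[OF DP(2) gi(1)] sqP[OF gi(1)]] .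
      show "\<bar>d i - q i\<bar> <= (LINT w|M. \<bar>inc n i VP w * inc n i Y w\<bar>) + (LINT w|M. \<bar>inc n i VY w * inc n i IP w\<bar>)"
        using cell_cov(2)[OF P Y rt, of "%_. 1" 1] by (simp add: d_def q_def)
    qed
    have "?D = (SUM i<Suc n. (LINT w|M. P (gr n (Suc i)) w * Y (gr n (Suc i)) w) - (LINT w|M. P (gr n i) w * Y (gr n i) w))"
      using sum_lessThan_telescope[of "%i. LINT w|M. P (gr n i) w * Y (gr n i) w" "Suc n"] by (simp del: sum.lessThan_Suc)
    also have "... = (SUM i<Suc n. (LINT z|Pm. Y (gr n i) (fst z) * (indicator (cell n i) (snd z) * ev b z))
        + (LINT z|Pm. P (gr n i) (fst z) * (indicator (cell n i) (snd z) * ev c z)) + d i)"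
      using cellD by (intro sum.cong) auto
    also have "... = (LINT z|Pm. ev (fY n) z * ev b z) + (LINT z|Pm. ev (fP n) z * ev c z) + (SUM i<Suc n. d i)"
      by (simp only: sum.distrib fs1(2) fs2(2))
    finally have "?D - ((LINT z|Pm. ev (fY n) z * ev b z) + (LINT z|Pm. ev (fP n) z * ev c z) + ?q) = (SUM i<Suc n. d i) - ?q"
      by simp
    then have eq: "?D - ((LINT z|Pm. ev (fY n) z * ev b z) + (LINT z|Pm. ev (fP n) z * ev c z) + ?q) = (SUM i<Suc n. d i - q i)"
      unfolding q_def sum_subtractf cell_integral_sum[OF i3] .
    show ?thesis unfolding eq e_def using cellE by (intro order_trans[OF sum_abs] sum_mono) auto
  qed
  \<comment> \<open>Freezing is undone along continuous paths; the majorant is the path maximum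
    times the square-integrable factor \<open>h\<close>.\<close>
  have conv: "(%n. LINT z|Pm. ev (frz n (%i. Q (gr n i))) z * ev h z) ----> (LINT z|Pm. ev Q z * ev h z)"
    if Q: "Q : CP" and R: "sq_int M R" "!!w. 0 <= R w" "AE w in M. ALL t:{s..T}. norm (Q t w) <= R w"
      and h: "sq_int Pm (ev h)" and i: "!!n. integrable Pm (%z. ev (frz n (%i. Q (gr n i))) z * ev h z)"
      and iQ: "integrable Pm (%z. ev Q z * ev h z)" for Q R and h :: "real => 'w => real"
  proof (rule integral_dominated_convergence[where w = "%z. R (fst z) * \<bar>ev h z\<bar>"])
    have "sq_int Pm (%z. \<bar>ev h z\<bar>)" using h by (auto simp: sq_int_def)
    then show "integrable Pm (%z. R (fst z) * \<bar>ev h z\<bar>)" by (rule sq_int_mult[OF fst_sq_int[OF R(1)]])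
    show "AE z in Pm. (%n. ev (frz n (%i. Q (gr n i))) z * ev h z) ----> ev Q z * ev h z"
      using AE_Pm_not_start AE_space
    proof eventually_elim
      case (elim z)
      then show ?case using cont_frozen_tendsto[OF Q, of "fst z" "snd z"]
        by (intro tendsto_mult tendsto_const) (auto simp: ev_def frz_at space_Pm)
    qed
    have "AE z in Pm. ALL t:{s..T}. norm (Q t (fst z)) <= R (fst z)" by (rule AE_Pm_fst[OF R(3)])
    then show "AE z in Pm. norm (ev (frz n (%i. Q (gr n i))) z * ev h z) <= R (fst z) * \<bar>ev h z\<bar>" for n
      using AE_Pm_not_start
    proof eventually_elim
      case (elim z)
      then show ?case using gr_cidx[OF elim(2), of n] by (auto simp: ev_def frz_at abs_mult intro!: mult_right_mono)
    qed
  qed (use i iQ in auto)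
  have "(%n. (LINT z|Pm. ev (fY n) z * ev b z) + (LINT z|Pm. ev (fP n) z * ev c z) + ?q) ---->
     (LINT z|Pm. ev Y z * ev b z) + (LINT z|Pm. ev P z * ev c z) + ?q"
    unfolding fY_def fP_def
    by (intro tendsto_add tendsto_const conv[OF DY(2) RY DP(9) _ i1] conv[OF DP(2) RP DY(9) _ i2] fs1(1)[unfolded fY_def] fs2(1)[unfolded fP_def])
  moreover have "(%n. ?D - ((LINT z|Pm. ev (fY n) z * ev b z) + (LINT z|Pm. ev (fP n) z * ev c z) + ?q)) ----> 0"
    by (rule Lim_null_comparison[OF always_eventually e0]) (use approx in auto)
  ultimately have "(%n. ?D) ----> 0 + ((LINT z|Pm. ev Y z * ev b z) + (LINT z|Pm. ev P z * ev c z) + ?q)"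
    using tendsto_add by fastforce
  then show "?D = (LINT z|Pm. ev Y z * ev b z + ev P z * ev c z + ev \<phi> z * ev \<theta> z)"
    using i1 i2 i3 by (simp add: LIMSEQ_const_iff)
qed

end

section \<open>Dualities with the Riccati equation and with the adjoint equation\<close>

lemma transpose_mult_inner: "(transpose A *v u) \<bullet> v = u \<bullet> (A *v v)" for A :: "real^'n^'m"
  by (simp add: transpose_matrix_vector dot_lmul_matrix)

lemma tendsto_matrix_vector_mult:
  fixes f :: "'a => real^'n^'m"
  shows "(f \<longlongrightarrow> a) G ==> (g \<longlongrightarrow> b) G ==> ((%x. f x *v g x) \<longlongrightarrow> a *v b) G"
  by (rule bounded_bilinear.tendsto[OF bounded_bilinear_matrix_vector_mult])

context brownian
begin

lemma vec_component:
  fixes X a \<sigma> :: "real => 'w => real^'n"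
  assumes "X : L2C" "a : L2P" "ito_eq X a \<sigma>"
  obtains V I where "itoV (%t w. X t w $ k) (%t w. a t w $ k) (%t w. \<sigma> t w $ k) V I"
proof -
  have b: "axis k (1::real) : Basis" by (simp add: axis_in_Basis_iff)
  show thesis using itoV_component[OF assms b] that by (auto simp: inner_axis)
qed

lemma mat_component:
  fixes X a \<sigma> :: "real => 'w => real^'n^'m"
  assumes "X : L2C" "a : L2P" "ito_eq X a \<sigma>"
  obtains V I where "itoV (%t w. X t w $ j $ k) (%t w. a t w $ j $ k) (%t w. \<sigma> t w $ j $ k) V I"
proof -
  have b: "axis j (axis k (1::real)) : Basis" by (simp add: axis_in_Basis_iff)
  show thesis using itoV_component[OF assms b] that by (auto simp: inner_axis)
qed

lemma inner_duality:
  fixes P Y b c \<phi> \<theta> :: "real => 'w => real^'n"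
  assumes P: "P : L2C" "b : L2P" "ito_eq P b \<phi>"
    and Y: "Y : L2C" "c : L2P" "ito_eq Y c \<theta>"
  shows "(LINT w|M. P T w \<bullet> Y T w) - (LINT w|M. P s w \<bullet> Y s w) = (LINT z|Pm. ev Y z \<bullet> ev b z + ev P z \<bullet> ev c z + ev \<phi> z \<bullet> ev \<theta> z)"
proof -
  let ?g = "%k z. ev Y z $ k * ev b z $ k + ev P z $ k * ev c z $ k + ev \<phi> z $ k * ev \<theta> z $ k"
  have comp: "(LINT w|M. P T w $ k * Y T w $ k) - (LINT w|M. P s w $ k * Y s w $ k) = (LINT z|Pm. ?g k z) & integrable Pm (?g k)
     & (ALL t:{s..T}. integrable M (%w. P t w $ k * Y t w $ k))" for k
  proof -
    obtain V I where 1: "itoV (%t w. P t w $ k) (%t w. b t w $ k) (%t w. \<phi> t w $ k) V I" by (rule vec_component[OF P])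
    obtain V' I' where 2: "itoV (%t w. Y t w $ k) (%t w. c t w $ k) (%t w. \<theta> t w $ k) V' I'" by (rule vec_component[OF Y])
    have "integrable M (%w. P t w $ k * Y t w $ k)" if "t : {s..T}" for t
      by (rule sq_int_mult[OF L2_cont_real_sq[OF itoVD(1)[OF 1] that] L2_cont_real_sq[OF itoVD(1)[OF 2] that]])
    then show ?thesis using bilinear_scalar[OF 1 2] by (simp add: ev_def)
  qed
  have st: "s : {s..T}" "T : {s..T}" using sT by auto
  have "(LINT w|M. P t w \<bullet> Y t w) = (SUM k:UNIV. LINT w|M. P t w $ k * Y t w $ k)" if "t : {s..T}" for t
    unfolding inner_vec_def inner_real_def using comp that by (intro Bochner_Integration.integral_sum) auto
  then have "(LINT w|M. P T w \<bullet> Y T w) - (LINT w|M. P s w \<bullet> Y s w) = (SUM k:UNIV. LINT z|Pm. ?g k z)"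
    using comp st by (simp add: sum_subtractf[symmetric])
  also have "... = (LINT z|Pm. (SUM k:UNIV. ?g k z))" using comp by (intro Bochner_Integration.integral_sum[symmetric]) auto
  finally show ?thesis by (simp add: inner_vec_def sum.distrib)
qed

text \<open>\<open>beq\<close> isolates the terms of the drift that contain \<open>\<phi>t\<close>.
  They have left the conclusion because on each grid, under the cutoff, they cancel against the
  covariation of \<open>\<phi>\<close> with \<open>X\<close> and with \<open>Y\<close>, whose
  diffusion coefficients are \<open>C X\<close> and \<open>C Y\<close>. Everything that remains has
  an integrable majorant.\<close>

lemma riccati_duality:
  fixes \<phi> \<phi>t b b0 C :: "real => 'w => real^'n^'n" and X Y a c :: "real => 'w => real^'n"
  assumes \<phi>: "\<phi> : L2C" "AE w in M. ALL t:{s..T}. norm (\<phi> t w) <= K"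
    and b: "b : L2P" and d\<phi>: "ito_eq \<phi> b \<phi>t"
    and beq: "AE z in Pm. ev b z = ev b0 z - (ev \<phi>t z ** ev C z + transpose (ev C z) ** ev \<phi>t z)"
    and b0: "ev b0 : meas Pm" "AE z in Pm. norm (ev b0 z) <= K0"
    and C: "!!t w. t : {s..T} ==> w : space M ==> norm (C t w) <= KC"
    and X: "X : L2C" "a : L2P" "ito_eq X a (%t w. C t w *v X t w)"
    and Y: "Y : L2C" "c : L2P" "ito_eq Y c (%t w. C t w *v Y t w)"
    and K0s: "0 <= K" "0 <= K0" "0 <= KC"
  shows "(LINT w|M. (\<phi> T w *v X T w) \<bullet> Y T w) - (LINT w|M. (\<phi> s w *v X s w) \<bullet> Y s w) =
    (LINT z|Pm. (ev b0 z *v ev X z) \<bullet> ev Y z + (ev \<phi> z *v ev X z) \<bullet> ev c z + (ev \<phi> z *v ev a z) \<bullet> ev Y z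
       + (ev \<phi> z *v (ev C z *v ev X z)) \<bullet> (ev C z *v ev Y z))"
proof -
  define \<sigma> where "\<sigma> t w = C t w *v X t w" for t w
  define \<theta> where "\<theta> t w = C t w *v Y t w" for t w
  have \<sigma>L: "\<sigma> : L2P" and \<theta>L: "\<theta> : L2P" and \<phi>tL: "\<phi>t : L2P"
    using X(3) Y(3) d\<phi> by (auto simp: ito_differential_def ito_integral_def \<sigma>_def[abs_def] \<theta>_def[abs_def])
  have ev\<sigma>: "ev \<sigma> z = ev C z *v ev X z" and ev\<theta>: "ev \<theta> z = ev C z *v ev Y z" for z by (auto simp: ev_def \<sigma>_def \<theta>_def)
  have \<phi>c: "\<phi> : CP" and Xc: "X : CP" and Yc: "Y : CP"
    using \<phi>(1) X(1) Y(1) by (auto simp: L2_cont_def)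
  have XL: "X : L2P" and YL: "Y : L2P" using L2_cont_L2_prog X(1) Y(1) by auto
  note L2D = XL YL \<sigma>L \<theta>L \<phi>tL X(2) Y(2)
  have evm[measurable]: "ev X : meas Pm" "ev Y : meas Pm" "ev \<sigma> : meas Pm" "ev \<theta> : meas Pm"
    "ev \<phi>t : meas Pm" "ev a : meas Pm" "ev c : meas Pm"
    using L2D by (auto simp: L2_prog_def intro: prog_ev)
  have \<phi>ev[measurable]: "ev \<phi> : meas Pm" using \<phi>c by (auto simp: cont_prog_def intro: prog_ev)
  from L2_cont_dominated[OF X(1)] obtain RX where RX: "sq_int M RX" "!!w. 0 <= RX w" "AE w in M. ALL t:{s..T}. norm (X t w) <= RX w" by blast
  from L2_cont_dominated[OF Y(1)] obtain RY where RY: "sq_int M RY" "!!w. 0 <= RY w" "AE w in M. ALL t:{s..T}. norm (Y t w) <= RY w" by blast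
  have [measurable]: "RX : meas M" "RY : meas M" using RX RY by (auto simp: sq_int_def)
  define k where "k z = (ev b0 z *v ev X z) \<bullet> ev Y z + (ev \<phi> z *v ev X z) \<bullet> ev c z + (ev \<phi> z *v ev a z) \<bullet> ev Y z + (ev \<phi> z *v ev \<sigma> z) \<bullet> ev \<theta> z" for z
  define wk where "wk z = K0 * (RX (fst z) * RY (fst z)) + K * (RX (fst z) * norm (ev c z)) + K * (norm (ev a z) * RY (fst z)) + K * (norm (ev \<sigma> z) * norm (ev \<theta> z))" for z
  have nsq: "sq_int Pm (%z. norm (ev a z))" "sq_int Pm (%z. norm (ev c z))" "sq_int Pm (%z. norm (ev \<sigma> z))"
    "sq_int Pm (%z. norm (ev \<theta> z))" "sq_int Pm (%z. norm (ev \<phi>t z))"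
    using L2D by (auto simp: L2_prog_iff)
  note fRX = fst_sq_int[OF RX(1)] and fRY = fst_sq_int[OF RY(1)]
  have wki: "integrable Pm wk"
    unfolding wk_def[abs_def]
    by (intro Bochner_Integration.integrable_add integrable_mult_right sq_int_mult fRX fRY nsq)
  have qb: "\<bar>(P *v x) \<bullet> y\<bar> <= q * (u * v)" if "norm P <= q" "norm x <= u" "norm y <= v" "0 <= q" for P :: "real^'n^'n" and x y q u v
  proof -
    have u: "0 <= u" "0 <= v" using that norm_ge_zero order_trans by blast+
    have "\<bar>(P *v x) \<bullet> y\<bar> <= norm P * norm x * norm y" by (rule matrix_quad_bound)
    also have "... <= q * u * v" using that u by (intro mult_mono mult_nonneg_nonneg) auto
    finally show ?thesis by (simp add: mult.assoc)
  qed
  have AEfst: "AE z in Pm. (ALL t:{s..T}. norm (\<phi> t (fst z)) <= K) & (ALL t:{s..T}. norm (X t (fst z)) <= RX (fst z)) & (ALL t:{s..T}. norm (Y t (fst z)) <= RY (fst z))"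
    using AE_Pm_fst[OF \<phi>(2)] AE_Pm_fst[OF RX(3)] AE_Pm_fst[OF RY(3)] by eventually_elim auto
  have kb: "AE z in Pm. ALL r:{s..T}. \<bar>(ev b0 z *v X r (fst z)) \<bullet> Y r (fst z) + (\<phi> r (fst z) *v X r (fst z)) \<bullet> ev c z
      + (\<phi> r (fst z) *v ev a z) \<bullet> Y r (fst z) + (\<phi> r (fst z) *v ev \<sigma> z) \<bullet> ev \<theta> z\<bar> <= wk z"
    using AEfst b0(2)
  proof eventually_elim
    case (elim z)
    show ?case
    proof
      fix r assume r: "r : {s..T}"
      have n: "norm (\<phi> r (fst z)) <= K" "norm (X r (fst z)) <= RX (fst z)" "norm (Y r (fst z)) <= RY (fst z)" using elim r by auto
      have "\<bar>(ev b0 z *v X r (fst z)) \<bullet> Y r (fst z)\<bar> <= K0 * (RX (fst z) * RY (fst z))" by (rule qb[OF elim(2) n(2,3) K0s(2)])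
      moreover have "\<bar>(\<phi> r (fst z) *v X r (fst z)) \<bullet> ev c z\<bar> <= K * (RX (fst z) * norm (ev c z))" by (rule qb[OF n(1,2) order_refl K0s(1)])
      moreover have "\<bar>(\<phi> r (fst z) *v ev a z) \<bullet> Y r (fst z)\<bar> <= K * (norm (ev a z) * RY (fst z))" by (rule qb[OF n(1) order_refl n(3) K0s(1)])
      moreover have "\<bar>(\<phi> r (fst z) *v ev \<sigma> z) \<bullet> ev \<theta> z\<bar> <= K * (norm (ev \<sigma> z) * norm (ev \<theta> z))" by (rule qb[OF n(1) order_refl order_refl K0s(1)])
      ultimately show "\<bar>(ev b0 z *v X r (fst z)) \<bullet> Y r (fst z) + (\<phi> r (fst z) *v X r (fst z)) \<bullet> ev c z
        + (\<phi> r (fst z) *v ev a z) \<bullet> Y r (fst z) + (\<phi> r (fst z) *v ev \<sigma> z) \<bullet> ev \<theta> z\<bar> <= wk z" unfolding wk_def by linarith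
    qed
  qed
  have kwk: "AE z in Pm. \<bar>k z\<bar> <= wk z"
    using kb AE_space
  proof eventually_elim
    case (elim z)
    have "snd z : {s..T}" using elim(2) by (auto simp: space_Pm)
    from elim(1)[rule_format, OF this] show ?case unfolding k_def by (simp add: ev_def)
  qed
  have km[measurable]: "k : meas Pm"
    unfolding k_def[abs_def]
    by (intro borel_measurable_add borel_measurable_inner borel_measurable_bilinear2[OF bounded_bilinear_matrix_vector_mult] evm \<phi>ev b0(1))
  have ki: "integrable Pm k"
    by (rule Bochner_Integration.integrable_bound[OF wki km]) (use kwk in \<open>auto elim!: eventually_mono\<close>)
  define \<Psi> where "\<Psi> t w = (\<phi> t w *v X t w) \<bullet> Y t w" for t w
  have \<Psi>b: "AE w in M. ALL t:{s..T}. \<bar>\<Psi> t w\<bar> <= K * (RX w * RY w)"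
    using \<phi>(2) RX(3) RY(3) by eventually_elim (auto simp: \<Psi>_def intro!: qb K0s)
  have \<Psi>m: "\<Psi> t : meas M" if "t : {s..T}" for t
    unfolding \<Psi>_def[abs_def]
    by (intro borel_measurable_inner borel_measurable_bilinear2[OF bounded_bilinear_matrix_vector_mult]
          cont_prog_M[OF \<phi>c that] cont_prog_M[OF Xc that] cont_prog_M[OF Yc that])
  have \<Psi>ww: "integrable M (%w. K * (RX w * RY w))" by (intro integrable_mult_right sq_int_mult RX RY)
  have \<Psi>i: "integrable M (\<Psi> t)" if t: "t : {s..T}" for t
    by (rule Bochner_Integration.integrable_bound[OF \<Psi>ww \<Psi>m[OF t]])
       (use \<Psi>b t in \<open>auto elim!: eventually_mono intro: order_trans[OF _ abs_ge_self]\<close>)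
  have st: "s : {s..T}" "T : {s..T}" using sT by auto
  \<comment> \<open>The cutoff for cell \<open>i\<close> inspects all grid points up to
    \<open>i\<close>: it is measurable at the left end of the cell, and once off it stays off, as
    \<open>telescope_cutoff\<close> requires. The bound on \<open>\<phi>\<close>, which holds only
    almost surely, is included so that weights are bounded everywhere.\<close>
  define \<zeta> where "\<zeta> m n i w = (if ALL j<=i. norm (\<phi> (gr n j) w) <= K & norm (X (gr n j) w) <= real m & norm (Y (gr n j) w) <= real m then 1 else 0 :: real)"
    for m n i :: nat and w
  have \<zeta>m: "\<zeta> m n i : meas (F (gr n i))" if i: "i < Suc n" for m n i
  proof -
    have ad: "(%w. norm (Q (gr n j) w)) : meas (F (gr n i))" if "j <= i" "Q : CP"
      for j and Q :: "real => 'w => 'q::euclidean_space"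
    proof -
      have "gr n j <= gr n i" using grid_mono[of "Suc n" "gr n" j i] gr_less that i by auto
      then have "Q (gr n j) : meas (F (gr n i))"
        using measurable_F_mono[OF cont_prog_adapted[OF that(2) gr_range[of j n]]] that i by auto
      then show ?thesis by measurable
    qed
    have "{w : space (F (gr n i)). ALL j:{..i}. norm (\<phi> (gr n j) w) <= K & norm (X (gr n j) w) <= real m & norm (Y (gr n j) w) <= real m} : sets (F (gr n i))"
    proof (rule sets.sets_Collect_finite_All)
      fix j assume "j : {..i}"
      then have [measurable]: "(%w. norm (\<phi> (gr n j) w)) : meas (F (gr n i))" "(%w. norm (X (gr n j) w)) : meas (F (gr n i))"
        "(%w. norm (Y (gr n j) w)) : meas (F (gr n i))" using ad \<phi>c Xc Yc by auto
      show "{w : space (F (gr n i)). norm (\<phi> (gr n j) w) <= K & norm (X (gr n j) w) <= real m & norm (Y (gr n j) w) <= real m} : sets (F (gr n i))"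
        by measurable
    qed simp
    then have P: "{w : space (F (gr n i)). ALL j<=i. norm (\<phi> (gr n j) w) <= K & norm (X (gr n j) w) <= real m & norm (Y (gr n j) w) <= real m} : sets (F (gr n i))"
      by (simp only: Ball_def atMost_iff)
    have "(%w. if ALL j<=i. norm (\<phi> (gr n j) w) <= K & norm (X (gr n j) w) <= real m & norm (Y (gr n j) w) <= real m then 1 else 0 :: real) : meas (F (gr n i))"
      by (rule measurable_If[OF measurable_const measurable_const P]) simp_all
    then show ?thesis unfolding \<zeta>_def[abs_def] .
  qed
  have \<zeta>01: "\<zeta> m n i w = 0 \<or> \<zeta> m n i w = 1" for m n i w by (auto simp: \<zeta>_def)
  have \<zeta>dec: "\<zeta> m n (Suc i) w = 1 ==> \<zeta> m n i w = 1" for m n i w by (auto simp: \<zeta>_def split: if_splits)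
  have \<zeta>1: "norm (\<phi> (gr n i) w) <= K & norm (X (gr n i) w) <= real m & norm (Y (gr n i) w) <= real m" if "\<zeta> m n i w = 1" for m n i w
    using that by (auto simp: \<zeta>_def split: if_splits)
  have \<zeta>good: "\<zeta> m n i w = 1" if "ALL t:{s..T}. norm (\<phi> t w) <= K" "ALL t:{s..T}. norm (X t w) <= RX w" "ALL t:{s..T}. norm (Y t w) <= RY w"
    "RX w <= real m" "RY w <= real m" "i < Suc n" for m n i w
  proof -
    have "norm (\<phi> (gr n j) w) <= K & norm (X (gr n j) w) <= real m & norm (Y (gr n j) w) <= real m" if "j <= i" for j
    proof -
      have "gr n j : {s..T}" using gr_range[of j n] that \<open>i < Suc n\<close> by auto
      then show ?thesis using \<open>ALL t:{s..T}. norm (\<phi> t w) <= K\<close> \<open>ALL t:{s..T}. norm (X t w) <= RX w\<close> \<open>ALL t:{s..T}. norm (Y t w) <= RY w\<close>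
          \<open>RX w <= real m\<close> \<open>RY w <= real m\<close> by (auto intro: order_trans)
    qed
    then show ?thesis by (simp add: \<zeta>_def)
  qed
  define Z where "Z m n = frz n (\<zeta> m n)" for m n
  have Zev[measurable]: "ev (Z m n) : meas Pm" for m n
  proof -
    have "simple_integrand M F s T (Suc n) (gr n) (\<zeta> m n)"
      unfolding simple_integrand_def
    proof (intro conjI allI impI)
      show "\<zeta> m n i : meas (F (gr n i))" if "i < Suc n" for i by (rule \<zeta>m[OF that])
      show "EX K. ALL w:space M. norm (\<zeta> m n i w) <= K" for i by (intro exI[of _ 1]) (auto simp: \<zeta>_def)
    qed (auto simp: gr_less)
    then show ?thesis unfolding Z_def by (rule simple_process_ev)
  qed
  have Zval: "ev (Z m n) z = \<zeta> m n (cidx n (snd z)) (fst z)" if "snd z : {s<..T}" for m n z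
    unfolding Z_def ev_def by (rule frz_at[OF that])
  have Zb: "AE z in Pm. \<bar>ev (Z m n) z\<bar> <= 1" for m n
    using AE_Pm_not_start by eventually_elim (simp add: Zval \<zeta>_def)
  have Zki: "integrable Pm (%z. ev (Z m n) z * k z)" for m n
    by (rule integrable_AE_bounded_mult[OF ki Zev Zb])
  define S where "S m n = (SUM i<Suc n. LINT w|M. \<zeta> m n i w * inc n i \<Psi> w)" for m n
  \<comment> \<open>The level \<open>m\<close> is fixed while the grid is refined. The entries of
    the matrix are treated one by one and reassembled into \<open>H\<close>.\<close>
  have step1: "(%n. S m n - (LINT z|Pm. ev (Z m n) z * k z)) ----> 0" for m
  proof -
    define L where "L = max K (real m)"
    let ?p = "%j l t w. \<phi> t w $ j $ l * X t w $ l * Y t w $ j"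
    define G where "G j l = product_drift (\<zeta> m) (%t w. \<phi> t w $ j $ l) (%t w. b t w $ j $ l) (%t w. \<phi>t t w $ j $ l)
      (%t w. X t w $ l) (%t w. a t w $ l) (%t w. \<sigma> t w $ l) (%t w. Y t w $ j) (%t w. c t w $ j) (%t w. \<theta> t w $ j)" for j l
    define s' where "s' j l n = (SUM i<Suc n. LINT w|M. \<zeta> m n i w * inc n i (?p j l) w)" for j l :: 'n and n
    have tri: "(ALL n. integrable Pm (G j l n)) & (ALL n. ALL i<Suc n. integrable M (%w. \<zeta> m n i w * inc n i (?p j l) w))
       & (%n. s' j l n - (LINT z|Pm. G j l n z)) ----> 0" for j l
    proof -
      obtain VP IP where 1: "itoV (%t w. \<phi> t w $ j $ l) (%t w. b t w $ j $ l) (%t w. \<phi>t t w $ j $ l) VP IP" by (rule mat_component[OF \<phi>(1) b d\<phi>])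
      obtain VX IX where 2: "itoV (%t w. X t w $ l) (%t w. a t w $ l) (%t w. \<sigma> t w $ l) VX IX"
        by (rule vec_component[OF X(1,2), of \<sigma>]) (use X(3) in \<open>simp add: \<sigma>_def[abs_def]\<close>)
      obtain VY IY where 3: "itoV (%t w. Y t w $ j) (%t w. c t w $ j) (%t w. \<theta> t w $ j) VY IY"
        by (rule vec_component[OF Y(1,2), of \<theta>]) (use Y(3) in \<open>simp add: \<theta>_def[abs_def]\<close>)
      have ent: "\<bar>P $ j $ l\<bar> <= norm P" for P :: "real^'n^'n"
        using component_le_norm_cart[of "P $ j" l] Finite_Cartesian_Product.norm_nth_le[of P j] by linarith
      have PK: "AE w in M. ALL t:{s..T}. \<bar>\<phi> t w $ j $ l\<bar> <= K"
        using \<phi>(2) by eventually_elim (auto intro: order_trans[OF ent])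
      have L0: "0 <= L" using K0s by (auto simp: L_def)
      note T3 = trilinear_scalar[OF 1 2 3 PK, of "\<zeta> m" L]
      show ?thesis
      proof (intro conjI allI impI)
        have x1: "\<bar>\<zeta> m n i w * \<phi> (gr n i) w $ j $ l\<bar> <= L" for n i w
          using \<zeta>01[of m n i w] \<zeta>1[of m n i w] ent[of "\<phi> (gr n i) w"] L0 by (auto simp: L_def)
        have x2: "\<bar>\<zeta> m n i w * X (gr n i) w $ l\<bar> <= L" for n i w
          using \<zeta>01[of m n i w] \<zeta>1[of m n i w] component_le_norm_cart[of "X (gr n i) w" l] L0 by (auto simp: L_def)
        have x3: "\<bar>\<zeta> m n i w * Y (gr n i) w $ j\<bar> <= L" for n i w
          using \<zeta>01[of m n i w] \<zeta>1[of m n i w] component_le_norm_cart[of "Y (gr n i) w" j] L0 by (auto simp: L_def)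
        show "integrable Pm (G j l n)" for n
          using T3(1)[OF \<zeta>m \<zeta>01 x1 x2 x3] by (simp add: G_def)
        show "integrable M (%w. \<zeta> m n i w * inc n i (?p j l) w)" if "i < Suc n" for n i
          using T3(2)[OF \<zeta>m \<zeta>01 x1 x2 x3 that] .
        show "(%n. s' j l n - (LINT z|Pm. G j l n z)) ----> 0"
          using T3(3)[OF \<zeta>m \<zeta>01 x1 x2 x3] by (simp add: s'_def G_def del: sum.lessThan_Suc)
      qed
    qed
    define H where "H n z = (SUM j:UNIV. SUM l:UNIV. G j l n z)" for n z
    have Hi: "integrable Pm (H n)" for n unfolding H_def[abs_def] using tri by (intro Bochner_Integration.integrable_sum) auto
    have Seq: "S m n = (SUM j:UNIV. SUM l:UNIV. s' j l n)" for n
    proof -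
      have "(LINT w|M. \<zeta> m n i w * inc n i \<Psi> w) = (SUM j:UNIV. SUM l:UNIV. LINT w|M. \<zeta> m n i w * inc n i (?p j l) w)" if "i < Suc n" for i
      proof -
        have "(LINT w|M. \<zeta> m n i w * inc n i \<Psi> w) = (LINT w|M. (SUM j:UNIV. SUM l:UNIV. \<zeta> m n i w * inc n i (?p j l) w))"
          unfolding \<Psi>_def matrix_quad_sum by (simp add: sum_subtractf[symmetric] sum_distrib_left)
        also have "... = (SUM j:UNIV. LINT w|M. (SUM l:UNIV. \<zeta> m n i w * inc n i (?p j l) w))"
          using tri that by (intro Bochner_Integration.integral_sum Bochner_Integration.integrable_sum) auto
        also have "... = (SUM j:UNIV. SUM l:UNIV. LINT w|M. \<zeta> m n i w * inc n i (?p j l) w)"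
          using tri that by (intro sum.cong refl Bochner_Integration.integral_sum) auto
        finally show ?thesis .
      qed
      then have "S m n = (SUM i<Suc n. SUM j:UNIV. SUM l:UNIV. LINT w|M. \<zeta> m n i w * inc n i (?p j l) w)"
        unfolding S_def by (intro sum.cong) auto
      also have "... = (SUM j:UNIV. SUM i<Suc n. SUM l:UNIV. LINT w|M. \<zeta> m n i w * inc n i (?p j l) w)" by (rule sum.swap)
      also have "... = (SUM j:UNIV. SUM l:UNIV. s' j l n)" unfolding s'_def by (intro sum.cong refl sum.swap)
      finally show ?thesis .
    qed
    have HS: "(%n. S m n - (LINT z|Pm. H n z)) ----> 0"
    proof -
      have "(LINT z|Pm. H n z) = (SUM j:UNIV. SUM l:UNIV. LINT z|Pm. G j l n z)" for n
      proof -
        have "(LINT z|Pm. H n z) = (SUM j:UNIV. LINT z|Pm. (SUM l:UNIV. G j l n z))"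
          unfolding H_def using tri by (intro Bochner_Integration.integral_sum Bochner_Integration.integrable_sum) auto
        also have "... = (SUM j:UNIV. SUM l:UNIV. LINT z|Pm. G j l n z)"
          using tri by (intro sum.cong refl Bochner_Integration.integral_sum) auto
        finally show ?thesis .
      qed
      then have "(%n. S m n - (LINT z|Pm. H n z)) = (%n. SUM j:UNIV. SUM l:UNIV. s' j l n - (LINT z|Pm. G j l n z))"
        by (simp add: Seq sum_subtractf)
      moreover have "(%n. SUM j:UNIV. SUM l:UNIV. s' j l n - (LINT z|Pm. G j l n z)) ----> (SUM j:(UNIV::'n set). SUM l:(UNIV::'n set). 0)"
        using tri by (intro tendsto_sum) blast
      ultimately show ?thesis by simp
    qed
    \<comment> \<open>The cutoff depends on the grid, so convergence of \<open>H n\<close> itself is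
      not asserted; its difference to the target under the same cutoff tends to zero.\<close>
    have HD: "(%n. LINT z|Pm. H n z - ev (Z m n) z * k z) ----> (LINT z|Pm. 0)"
    proof (rule integral_dominated_convergence[where w = "%z. 2 * wk z + real m * KC * (norm (ev \<phi>t z) * (2 * RY (fst z)) + norm (ev \<phi>t z) * (2 * RX (fst z)))"])
      show "integrable Pm (%z. 2 * wk z + real m * KC * (norm (ev \<phi>t z) * (2 * RY (fst z)) + norm (ev \<phi>t z) * (2 * RX (fst z))))"
        by (intro Bochner_Integration.integrable_add integrable_mult_right wki sq_int_mult nsq sq_int_cmult fRX fRY)
      show "(%z. H n z - ev (Z m n) z * k z) : meas Pm" for n using Hi[of n] Zki[of m n] by auto
      define kn where "kn n z = (ev b0 z *v X (gr n (cidx n (snd z))) (fst z)) \<bullet> Y (gr n (cidx n (snd z))) (fst z)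
         + (\<phi> (gr n (cidx n (snd z))) (fst z) *v X (gr n (cidx n (snd z))) (fst z)) \<bullet> ev c z
         + (\<phi> (gr n (cidx n (snd z))) (fst z) *v ev a z) \<bullet> Y (gr n (cidx n (snd z))) (fst z)
         + (\<phi> (gr n (cidx n (snd z))) (fst z) *v ev \<sigma> z) \<bullet> ev \<theta> z" for n z
      define dX where "dX n z = norm (ev X z - X (gr n (cidx n (snd z))) (fst z))" for n z
      define dY where "dY n z = norm (ev Y z - Y (gr n (cidx n (snd z))) (fst z))" for n z
      \<comment> \<open>In the Riccati drift both states are frozen, whereas the covariation terms
        contain one current and one frozen state. The cancellation therefore leaves the differences
        \<open>dX\<close> and \<open>dY\<close>, multiplied by \<open>\<phi>t\<close> and by a
        frozen state. The cutoff bounds that state by \<open>m\<close>, and a product of only two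
        square-integrable functions is left.\<close>
      have bound: "AE z in Pm. ALL n. \<bar>H n z - ev (Z m n) z * k z\<bar> <= \<bar>kn n z - k z\<bar> + real m * KC * (norm (ev \<phi>t z) * dY n z + norm (ev \<phi>t z) * dX n z)"
        using beq AE_Pm_not_start AE_space
      proof eventually_elim
        case (elim z)
        have Cz: "norm (ev C z) <= KC" using C elim(3) by (auto simp: space_Pm)
        show ?case
        proof
          fix n
          define i where "i = cidx n (snd z)"
          define x where "x = X (gr n i) (fst z)"
          define y where "y = Y (gr n i) (fst z)"
          define p where "p = \<phi> (gr n i) (fst z)"
          define zz where "zz = \<zeta> m n i (fst z)"
          have G_val: "G j l n z = zz * (ev b z $ j $ l * x $ l * y $ j) + zz * (p $ j $ l * x $ l * ev c z $ j) + zz * (p $ j $ l * ev a z $ l * y $ j)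
            + zz * (ev \<phi>t z $ j $ l * x $ l * ev \<theta> z $ j) + zz * (ev \<phi>t z $ j $ l * ev \<sigma> z $ l * y $ j) + zz * (p $ j $ l * ev \<sigma> z $ l * ev \<theta> z $ j)" for j l
          proof -
            have fv: "ev (frz n W) z = W i (fst z)" for W :: "nat => 'w => real" unfolding ev_def i_def by (rule frz_at[OF elim(2)])
            show ?thesis unfolding G_def product_drift_def fv zz_def x_def y_def p_def by (simp add: ev_def ac_simps)
          qed
          have "H n z = zz * ((ev b z *v x) \<bullet> y) + zz * ((p *v x) \<bullet> ev c z) + zz * ((p *v ev a z) \<bullet> y)
            + zz * ((ev \<phi>t z *v x) \<bullet> ev \<theta> z) + zz * ((ev \<phi>t z *v ev \<sigma> z) \<bullet> y) + zz * ((p *v ev \<sigma> z) \<bullet> ev \<theta> z)"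
            unfolding H_def G_val matrix_quad_sum sum.distrib sum_distrib_left ..
          moreover have "(ev b z *v x) \<bullet> y = (ev b0 z *v x) \<bullet> y - (ev \<phi>t z *v (ev C z *v x)) \<bullet> y - (ev \<phi>t z *v x) \<bullet> (ev C z *v y)"
            unfolding elim(1)
            by (simp add: matrix_vector_mult_diff_rdistrib matrix_vector_mult_add_rdistrib inner_diff_left inner_add_left
                matrix_vector_mul_assoc[symmetric] transpose_matrix_vector dot_lmul_matrix)
          ultimately have Hz: "H n z = zz * (kn n z + (ev \<phi>t z *v x) \<bullet> (ev C z *v (ev Y z - y)) + (ev \<phi>t z *v (ev C z *v (ev X z - x))) \<bullet> y)"
            unfolding kn_def i_def[symmetric] x_def[symmetric] y_def[symmetric] p_def[symmetric] ev\<sigma> ev\<theta>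
            by (simp add: matrix_vector_mult_diff_distrib inner_diff_right inner_diff_left algebra_simps)
          have Zz: "ev (Z m n) z = zz" unfolding zz_def i_def by (rule Zval[OF elim(2)])
          have D: "H n z - ev (Z m n) z * k z = zz * ((kn n z - k z) + ((ev \<phi>t z *v x) \<bullet> (ev C z *v (ev Y z - y)) + (ev \<phi>t z *v (ev C z *v (ev X z - x))) \<bullet> y))"
            unfolding Hz Zz by (simp add: algebra_simps)
          show "\<bar>H n z - ev (Z m n) z * k z\<bar> <= \<bar>kn n z - k z\<bar> + real m * KC * (norm (ev \<phi>t z) * dY n z + norm (ev \<phi>t z) * dX n z)"
          proof (cases "zz = 1")
            case True
            have xm: "norm x <= real m" and ym: "norm y <= real m" using \<zeta>1[of m n i "fst z"] True by (auto simp: zz_def x_def y_def)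
            have Cv: "norm (ev C z *v u) <= KC * norm u" for u
              by (rule order_trans[OF norm_matrix_vector_mult_le mult_right_mono[OF Cz norm_ge_zero]])
            have t1: "\<bar>(ev \<phi>t z *v x) \<bullet> (ev C z *v (ev Y z - y))\<bar> <= norm (ev \<phi>t z) * (real m * (KC * norm (ev Y z - y)))"
              by (rule qb[OF order_refl xm Cv]) simp
            have t2: "\<bar>(ev \<phi>t z *v (ev C z *v (ev X z - x))) \<bullet> y\<bar> <= norm (ev \<phi>t z) * ((KC * norm (ev X z - x)) * real m)"
              by (rule qb[OF order_refl Cv ym]) simp
            have dd: "dX n z = norm (ev X z - x)" "dY n z = norm (ev Y z - y)" by (simp_all add: dX_def dY_def x_def y_def i_def)
            have "\<bar>H n z - ev (Z m n) z * k z\<bar> <= \<bar>kn n z - k z\<bar> + (norm (ev \<phi>t z) * (real m * (KC * norm (ev Y z - y))) + norm (ev \<phi>t z) * ((KC * norm (ev X z - x)) * real m))"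
              unfolding D True mult_1
              by (rule order_trans[OF abs_triangle_ineq add_left_mono[OF order_trans[OF abs_triangle_ineq add_mono[OF t1 t2]]]])
            then show ?thesis unfolding dd by (simp add: algebra_simps)
          next
            case False
            then have "zz = 0" using \<zeta>01[of m n i "fst z"] by (auto simp: zz_def)
            then show ?thesis unfolding D using K0s(3) by (simp add: dX_def dY_def)
          qed
        qed
      qed
      show "AE z in Pm. (%n. H n z - ev (Z m n) z * k z) ----> 0"
        using bound AE_Pm_not_start AE_space
      proof eventually_elim
        case (elim z)
        have ww: "fst z : space M" using elim(3) by (auto simp: space_Pm)
        note cX = cont_frozen_tendsto[OF Xc ww elim(2)] and cY = cont_frozen_tendsto[OF Yc ww elim(2)] and c\<phi> = cont_frozen_tendsto[OF \<phi>c ww elim(2)]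
        have "(%n. kn n z) ----> (ev b0 z *v X (snd z) (fst z)) \<bullet> Y (snd z) (fst z) + (\<phi> (snd z) (fst z) *v X (snd z) (fst z)) \<bullet> ev c z
           + (\<phi> (snd z) (fst z) *v ev a z) \<bullet> Y (snd z) (fst z) + (\<phi> (snd z) (fst z) *v ev \<sigma> z) \<bullet> ev \<theta> z"
          unfolding kn_def by (intro tendsto_add tendsto_inner tendsto_matrix_vector_mult tendsto_const cX cY c\<phi>)
        then have "(%n. kn n z) ----> k z" by (simp add: k_def ev_def)
        moreover have "(%n. dX n z) ----> norm (ev X z - X (snd z) (fst z))" unfolding dX_def by (intro tendsto_intros cX)
        moreover have "(%n. dY n z) ----> norm (ev Y z - Y (snd z) (fst z))" unfolding dY_def by (intro tendsto_intros cY)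
        ultimately have "(%n. \<bar>kn n z - k z\<bar> + real m * KC * (norm (ev \<phi>t z) * dY n z + norm (ev \<phi>t z) * dX n z)) ---->
           \<bar>k z - k z\<bar> + real m * KC * (norm (ev \<phi>t z) * norm (ev Y z - Y (snd z) (fst z)) + norm (ev \<phi>t z) * norm (ev X z - X (snd z) (fst z)))"
          by (intro tendsto_add tendsto_mult tendsto_rabs tendsto_diff tendsto_const)
        then have "(%n. \<bar>kn n z - k z\<bar> + real m * KC * (norm (ev \<phi>t z) * dY n z + norm (ev \<phi>t z) * dX n z)) ----> 0" by (simp add: ev_def)
        then show ?case by (rule Lim_null_comparison[OF always_eventually, rotated]) (use elim(1) in auto)
      qed
      show "AE z in Pm. norm (H n z - ev (Z m n) z * k z) <= 2 * wk z + real m * KC * (norm (ev \<phi>t z) * (2 * RY (fst z)) + norm (ev \<phi>t z) * (2 * RX (fst z)))" for n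
        using bound AE_Pm_not_start AE_space AEfst kb kwk
      proof eventually_elim
        case (elim z)
        have g: "gr n (cidx n (snd z)) : {s..T}" by (rule gr_cidx[OF elim(2)])
        have sz: "snd z : {s..T}" using elim(2) by auto
        have "\<bar>kn n z\<bar> <= wk z" unfolding kn_def using elim(5)[rule_format, OF g] .
        then have k1: "\<bar>kn n z - k z\<bar> <= 2 * wk z" using elim(6) by linarith
        have "norm (ev X z) <= RX (fst z)" "norm (X (gr n (cidx n (snd z))) (fst z)) <= RX (fst z)"
          "norm (ev Y z) <= RY (fst z)" "norm (Y (gr n (cidx n (snd z))) (fst z)) <= RY (fst z)"
          using elim(4) g sz by (auto simp: ev_def)
        then have d: "dX n z <= 2 * RX (fst z)" "dY n z <= 2 * RY (fst z)"
          unfolding dX_def dY_def using norm_triangle_ineq4[of "ev X z" "X (gr n (cidx n (snd z))) (fst z)"]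
            norm_triangle_ineq4[of "ev Y z" "Y (gr n (cidx n (snd z))) (fst z)"] by linarith+
        have "real m * KC * (norm (ev \<phi>t z) * dY n z + norm (ev \<phi>t z) * dX n z) <= real m * KC * (norm (ev \<phi>t z) * (2 * RY (fst z)) + norm (ev \<phi>t z) * (2 * RX (fst z)))"
          using d K0s(3) by (intro mult_left_mono add_mono) auto
        then show ?case using elim(1)[rule_format, of n] k1 by simp
      qed
    qed auto
    have "(%n. (S m n - (LINT z|Pm. H n z)) + (LINT z|Pm. H n z - ev (Z m n) z * k z)) ----> 0 + (LINT z|Pm. 0)" by (rule tendsto_add[OF HS HD])
    then show ?thesis using Hi Zki by simp
  qed
  \<comment> \<open>Off this event the cutoff of level \<open>m\<close> is inactive for almost every
    path, whatever the grid. Each path leaves the event once \<open>m\<close> exceeds both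
    majorants.\<close>
  define bad where "bad m = {w : space M. ~ (RX w <= real m & RY w <= real m)}" for m
  have bad_sets[measurable]: "bad m : sets M" for m unfolding bad_def by measurable
  have bad0: "(%m. indicator (bad m) w * q) ----> (0::real)" for w q
  proof (rule tendsto_eventually)
    obtain N where N: "max (RX w) (RY w) <= real N" using real_arch_simple by blast
    show "\<forall>\<^sub>F m in sequentially. indicator (bad m) w * q = 0"
      unfolding eventually_sequentially using N by (intro exI[of _ N]) (force simp: bad_def indicator_def)
  qed
  \<comment> \<open>On the bad event the stopped and the full increment are differences of values of
    \<open>\<Psi>\<close>, each bounded by \<open>K * (RX * RY)\<close>; four such values occur at
    most.\<close>
  define \<delta> where "\<delta> m = (LINT w|M. indicator (bad m) w * (4 * (K * (RX w * RY w))))" for m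
  define \<delta>' where "\<delta>' m = (LINT z|Pm. indicator (bad m) (fst z) * \<bar>k z\<bar>)" for m
  have \<delta>0: "\<delta> ----> (LINT w|M. 0)"
    unfolding \<delta>_def[abs_def]
  proof (rule integral_dominated_convergence[where w = "%w. 4 * (K * (RX w * RY w))"])
    show "AE w in M. norm (indicator (bad m) w * (4 * (K * (RX w * RY w)))) <= 4 * (K * (RX w * RY w))" for m
      using K0s(1) RX(2) RY(2) by (auto simp: indicator_def)
    show "AE w in M. (%m. indicator (bad m) w * (4 * (K * (RX w * RY w)))) ----> 0" using bad0 by auto
  qed (use \<Psi>ww in auto)
  have \<delta>'0: "\<delta>' ----> (LINT z|Pm. 0)"
    unfolding \<delta>'_def[abs_def]
    by (rule integral_dominated_convergence[where w = "%z. \<bar>k z\<bar>"])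
       (use ki bad0 in \<open>auto simp: indicator_def intro!: borel_measurable_times Pm_fstI[of "indicator (bad _)"] borel_measurable_indicator\<close>)
  let ?D = "(LINT w|M. \<Psi> T w) - (LINT w|M. \<Psi> s w)"
  have \<zeta>mM: "\<zeta> m n i : meas M" if "i < Suc n" for m n i by (rule measurable_F_M[OF \<zeta>m[OF that]])
  have Sb: "\<bar>S m n - ?D\<bar> <= \<delta> m" for m n
  proof -
    have ii: "integrable M (%w. \<zeta> m n i w * inc n i \<Psi> w)" if "i < Suc n" for i
    proof (rule integrable_AE_bounded_mult[OF _ \<zeta>mM[OF that], where K = 1])
      show "integrable M (inc n i \<Psi>)" using \<Psi>i gr_range[of i n] gr_range[of "Suc i" n] that by (intro Bochner_Integration.integrable_diff) auto
    qed (auto simp: \<zeta>_def)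
    have isum: "integrable M (%w. SUM i<Suc n. \<zeta> m n i w * inc n i \<Psi> w)" by (intro Bochner_Integration.integrable_sum ii) auto
    have "S m n = (LINT w|M. (SUM i<Suc n. \<zeta> m n i w * inc n i \<Psi> w))"
      unfolding S_def by (rule Bochner_Integration.integral_sum[symmetric]) (use ii in auto)
    then have e: "S m n - ?D = (LINT w|M. (SUM i<Suc n. \<zeta> m n i w * inc n i \<Psi> w) - (\<Psi> T w - \<Psi> s w))"
      using isum \<Psi>i[OF st(1)] \<Psi>i[OF st(2)] by (simp del: sum.lessThan_Suc)
    have "\<bar>S m n - ?D\<bar> <= (LINT w|M. \<bar>(SUM i<Suc n. \<zeta> m n i w * inc n i \<Psi> w) - (\<Psi> T w - \<Psi> s w)\<bar>)" unfolding e by (rule integral_abs_bound)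
    moreover have "(LINT w|M. \<bar>(SUM i<Suc n. \<zeta> m n i w * inc n i \<Psi> w) - (\<Psi> T w - \<Psi> s w)\<bar>) <= \<delta> m"
      unfolding \<delta>_def
    proof (rule integral_mono_AE)
      show "integrable M (%w. \<bar>(SUM i<Suc n. \<zeta> m n i w * inc n i \<Psi> w) - (\<Psi> T w - \<Psi> s w)\<bar>)"
        using isum \<Psi>i[OF st(1)] \<Psi>i[OF st(2)] by (intro integrable_abs Bochner_Integration.integrable_diff)
      show "integrable M (%w. indicator (bad m) w * (4 * (K * (RX w * RY w))))"
        by (rule integrable_AE_bounded_mult[OF integrable_mult_right[OF \<Psi>ww], where K = 1]) (auto simp: indicator_def)
      show "AE w in M. \<bar>(SUM i<Suc n. \<zeta> m n i w * inc n i \<Psi> w) - (\<Psi> T w - \<Psi> s w)\<bar> <= indicator (bad m) w * (4 * (K * (RX w * RY w)))"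
        using \<phi>(2) RX(3) RY(3) \<Psi>b AE_space
      proof eventually_elim
        case (elim w)
        show ?case
        proof (cases "w : bad m")
          case True
          have "EX \<kappa><=Suc n. (SUM i<Suc n. \<zeta> m n i w * (\<Psi> (gr n (Suc i)) w - \<Psi> (gr n i) w)) = \<Psi> (gr n \<kappa>) w - \<Psi> (gr n 0) w"
            by (rule telescope_cutoff[where \<zeta> = "%i. \<zeta> m n i w" and \<psi> = "%i. \<Psi> (gr n i) w", OF \<zeta>01 \<zeta>dec])
          then obtain \<kappa> where \<kappa>: "\<kappa> <= Suc n" "(SUM i<Suc n. \<zeta> m n i w * inc n i \<Psi> w) = \<Psi> (gr n \<kappa>) w - \<Psi> s w" by auto
          have "\<bar>\<Psi> (gr n \<kappa>) w\<bar> <= K * (RX w * RY w)" "\<bar>\<Psi> s w\<bar> <= K * (RX w * RY w)" "\<bar>\<Psi> T w\<bar> <= K * (RX w * RY w)"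
            using elim(4) gr_range[OF \<kappa>(1)] st by auto
          then have "\<bar>(SUM i<Suc n. \<zeta> m n i w * inc n i \<Psi> w) - (\<Psi> T w - \<Psi> s w)\<bar> <= 4 * (K * (RX w * RY w))" unfolding \<kappa>(2) by linarith
          then show ?thesis using True by simp
        next
          case False
          then have good: "RX w <= real m" "RY w <= real m" using elim(5) by (auto simp: bad_def)
          have "(SUM i<Suc n. \<zeta> m n i w * inc n i \<Psi> w) = (SUM i<Suc n. inc n i \<Psi> w)"
            using \<zeta>good[OF elim(1-3) good] by (intro sum.cong) auto
          also have "... = \<Psi> (gr n (Suc n)) w - \<Psi> (gr n 0) w" by (rule sum_lessThan_telescope[where f = "%i. \<Psi> (gr n i) w"])
          finally show ?thesis using False by simp
        qed
      qed
    qed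
    ultimately show ?thesis by (rule order_trans)
  qed
  have Zkb: "\<bar>(LINT z|Pm. ev (Z m n) z * k z) - (LINT z|Pm. k z)\<bar> <= \<delta>' m" for m n
  proof -
    have "(LINT z|Pm. ev (Z m n) z * k z) - (LINT z|Pm. k z) = (LINT z|Pm. ev (Z m n) z * k z - k z)" using Zki ki by simp
    then have "\<bar>(LINT z|Pm. ev (Z m n) z * k z) - (LINT z|Pm. k z)\<bar> <= (LINT z|Pm. \<bar>ev (Z m n) z * k z - k z\<bar>)"
      using integral_abs_bound[of Pm "%z. ev (Z m n) z * k z - k z"] by simp
    also have "... <= \<delta>' m"
      unfolding \<delta>'_def
    proof (rule integral_mono_AE)
      show "integrable Pm (%z. \<bar>ev (Z m n) z * k z - k z\<bar>)" using Zki[of m n] ki by (intro integrable_abs Bochner_Integration.integrable_diff)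
      show "integrable Pm (%z. indicator (bad m) (fst z) * \<bar>k z\<bar>)"
        by (rule integrable_AE_bounded_mult[OF integrable_abs[OF ki], where K = 1])
           (auto simp: indicator_def intro!: Pm_fstI[of "indicator (bad _)"])
      show "AE z in Pm. \<bar>ev (Z m n) z * k z - k z\<bar> <= indicator (bad m) (fst z) * \<bar>k z\<bar>"
        using AEfst AE_Pm_not_start AE_space
      proof eventually_elim
        case (elim z)
        show ?case
        proof (cases "fst z : bad m")
          case True
          have "ev (Z m n) z = 0 \<or> ev (Z m n) z = 1" unfolding Zval[OF elim(2)] by (rule \<zeta>01)
          then show ?thesis using True by auto
        next
          case False
          then have good: "RX (fst z) <= real m" "RY (fst z) <= real m" using elim(3) by (auto simp: bad_def space_Pm)
          have "ev (Z m n) z = 1" unfolding Zval[OF elim(2)] using elim(1) by (intro \<zeta>good good cidx(1)[OF elim(2)]) auto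
          then show ?thesis by simp
        qed
      qed
    qed
    finally show ?thesis .
  qed
  \<comment> \<open>Here the mesh goes to zero at fixed \<open>m\<close>. The errors
    \<open>\<delta>\<close> and \<open>\<delta>'\<close> do not depend on the grid and are removed
    afterwards by letting \<open>m\<close> grow.\<close>
  have fin: "\<bar>?D - (LINT z|Pm. k z)\<bar> <= \<delta> m + \<delta>' m" for m
  proof (rule LIMSEQ_le_const)
    show "(%n. \<delta> m + \<delta>' m + \<bar>S m n - (LINT z|Pm. ev (Z m n) z * k z)\<bar>) ----> \<delta> m + \<delta>' m"
      using tendsto_add[OF tendsto_const tendsto_rabs[OF step1], of "\<delta> m + \<delta>' m" m] by simp
    show "EX N. ALL n>=N. \<bar>?D - (LINT z|Pm. k z)\<bar> <= \<delta> m + \<delta>' m + \<bar>S m n - (LINT z|Pm. ev (Z m n) z * k z)\<bar>"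
    proof (intro exI[of _ 0] allI impI)
      fix n show "\<bar>?D - (LINT z|Pm. k z)\<bar> <= \<delta> m + \<delta>' m + \<bar>S m n - (LINT z|Pm. ev (Z m n) z * k z)\<bar>"
        using Sb[of m n] Zkb[of m n] by linarith
    qed
  qed
  have "(%m. \<delta> m + \<delta>' m) ----> 0" using tendsto_add[OF \<delta>0 \<delta>'0] by simp
  then have "\<bar>?D - (LINT z|Pm. k z)\<bar> <= 0" by (rule LIMSEQ_le_const) (use fin in auto)
  then show ?thesis unfolding \<Psi>_def k_def ev\<sigma> ev\<theta> by simp
qed

end

section \<open>Essentially bounded coefficients\<close>

lemma norm_transpose: "norm (transpose P) = norm P" for P :: "real^'n^'m"
proof -
  have "(norm (transpose P))^2 = (SUM i:UNIV. SUM j:UNIV. P $ j $ i * P $ j $ i)"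
    by (simp add: power2_norm_eq_inner inner_vec_def transpose_def)
  also have "... = (SUM j:UNIV. SUM i:UNIV. P $ j $ i * P $ j $ i)" by (rule sum.swap)
  also have "... = (norm P)^2" by (simp add: power2_norm_eq_inner inner_vec_def)
  finally show ?thesis by simp
qed

lemma norm_matrix_mult_le: "norm (P ** Q) <= norm P * norm Q" for P :: "real^'n^'m" and Q :: "real^'p^'n"
proof -
  have row: "(P ** Q) $ i = transpose Q *v (P $ i)" for i
    by (simp add: vec_eq_iff matrix_matrix_mult_def matrix_vector_mult_def transpose_def mult.commute)
  have "norm (P ** Q) = L2_set (%i. norm (transpose Q *v (P $ i))) UNIV" by (simp add: norm_vec_def[of "P ** Q"] row)
  also have "... <= L2_set (%i. norm (P $ i) * norm Q) UNIV"
  proof (rule L2_set_mono)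
    show "norm (transpose Q *v P $ i) <= norm (P $ i) * norm Q" for i
      using norm_matrix_vector_mult_le[of "transpose Q" "P $ i"] unfolding norm_transpose by (simp only: mult.commute)
  qed simp
  also have "... = norm P * norm Q" by (simp add: L2_set_left_distrib[symmetric] norm_vec_def[of P])
  finally show ?thesis .
qed

lemma bounded_bilinear_matrix_mult: "bounded_bilinear ((**) :: real^'n^'m => real^'p^'n => real^'p^'m)"
proof (unfold_locales)
  show "EX K. ALL a b. norm (a ** b) <= norm (a :: real^'n^'m) * norm (b :: real^'p^'n) * K"
    by (intro exI[of _ 1] allI) (simp add: norm_matrix_mult_le)
qed (simp_all add: matrix_add_ldistrib scalar_matrix_assoc matrix_scalar_ac,
     simp add: matrix_matrix_mult_def vec_eq_iff sum.distrib distrib_right)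

lemma borel_measurable_transpose:
  fixes f :: "'a => real^'n^'m"
  assumes "f : meas N" shows "(%x. transpose (f x)) : meas N"
proof -
  have "linear (transpose :: real^'n^'m => _)" by (rule linearI) (auto simp: transpose_def vec_eq_iff)
  then show ?thesis using borel_measurable_continuous_on[OF linear_continuous_on assms] by (simp add: linear_conv_bounded_linear)
qed

lemma borel_measurable_entry:
  fixes f :: "'a => real^'n^'m"
  assumes "f : meas N" shows "(%x. f x $ i $ j) : meas N"
  using borel_measurable_continuous_on[OF _ assms, of "%P. P $ i $ j"] by (simp add: continuous_on_component)

lemma borel_measurable_matrixI:
  fixes f :: "'a => real^'n^'m"
  assumes "!!i j. (%x. f x $ i $ j) : meas N" shows "f : meas N"
  unfolding borel_measurable_euclidean_space[of f]
  using assms by (auto simp: Basis_vec_def inner_axis)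

lemma borel_measurable_det:
  fixes f :: "'a => real^'n^'n"
  assumes "!!i j. (%x. f x $ i $ j) : meas N" shows "(%x. det (f x)) : meas N"
  unfolding det_def using assms by (intro borel_measurable_sum borel_measurable_times borel_measurable_prod) auto

section \<open>Measurability and bounds for inverse matrices\<close>

lemma matrix_inv_mult:
  assumes "invertible A" shows "A ** matrix_inv A = mat 1" "matrix_inv A ** A = mat 1"
  using assms unfolding invertible_def matrix_inv_def by (metis (mono_tags, lifting) someI_ex)+

text \<open>Cramer's rule for the columns of the inverse. Entries become quotients of determinants,
  from which measurability of the inverse follows.\<close>

lemma matrix_inv_entry:
  fixes A :: "real^'n^'n"
  assumes "invertible A"
  shows "matrix_inv A $ k $ j = det (\<chi> i l. if l = k then axis j 1 $ i else A $ i $ l) / det A"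
proof -
  have "A *v (matrix_inv A *v axis j 1) = axis j 1" by (simp add: matrix_vector_mul_assoc matrix_inv_mult[OF assms])
  then have "matrix_inv A *v axis j 1 = (\<chi> k. det (\<chi> i l. if l = k then axis j 1 $ i else A $ i $ l) / det A)"
    using cramer[of A "matrix_inv A *v axis j 1" "axis j 1"] assms by (simp add: invertible_det_nz)
  then show ?thesis by (simp add: column_def vec_eq_iff matrix_vector_mult_basis)
qed

lemma borel_measurable_matrix_inv:
  fixes f :: "'a => real^'n^'n"
  assumes f: "f : meas N" and i: "!!x. x : space N ==> invertible (f x)"
  shows "(%x. matrix_inv (f x)) : meas N"
proof (rule borel_measurable_matrixI)
  fix k j
  have "(%x. det (\<chi> i l. if l = k then axis j 1 $ i else f x $ i $ l) / det (f x)) : meas N"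
  proof (intro borel_measurable_divide borel_measurable_det)
    show "(%x. (\<chi> i l. if l = k then axis j 1 $ i else f x $ i $ l) $ i $ l) : meas N" for i l
      by (cases "l = k") (simp_all add: borel_measurable_entry[OF f])
  qed (rule borel_measurable_entry[OF f])
  then show "(%x. matrix_inv (f x) $ k $ j) : meas N"
    by (rule measurable_cong[THEN iffD1, rotated]) (use matrix_inv_entry[OF i] in simp)
qed

text \<open>Coercivity at \<open>y = matrix_inv A *v ww\<close> gives
  \<open>\<delta> * norm y <= norm ww\<close>. This bounds every entry by
  \<open>1 / \<delta>\<close>, and summing over columns and rows produces the two factors
  \<open>CARD('n)\<close>.\<close>

lemma coercive_matrix_inv_bound:
  fixes A :: "real^'n^'n"
  assumes "invertible A" "0 < \<delta>" "ALL ww. \<delta> * (norm ww)^2 <= (A *v ww) \<bullet> ww"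
  shows "norm (matrix_inv A) <= real CARD('n) * (real CARD('n) / \<delta>)"
proof -
  have v: "norm (matrix_inv A *v ww) <= norm ww / \<delta>" for ww
  proof -
    let ?y = "matrix_inv A *v ww"
    have "\<delta> * (norm ?y)^2 <= ww \<bullet> ?y" using assms(3)[rule_format, of ?y] by (simp add: matrix_vector_mul_assoc matrix_inv_mult[OF assms(1)])
    also have "... <= norm ww * norm ?y" by (rule norm_cauchy_schwarz)
    finally have "norm ?y * (\<delta> * norm ?y) <= norm ?y * norm ww" by (simp add: power2_eq_square algebra_simps)
    then have "?y = 0 \<or> \<delta> * norm ?y <= norm ww" by (auto simp: mult_le_cancel_left)
    then show ?thesis using assms(2) by (auto simp: field_simps)
  qed
  have e: "\<bar>matrix_inv A $ i $ j\<bar> <= 1 / \<delta>" for i j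
  proof -
    have "\<bar>matrix_inv A $ i $ j\<bar> = \<bar>(matrix_inv A *v axis j 1) $ i\<bar>" by (simp add: matrix_vector_mult_basis column_def)
    also have "... <= norm (matrix_inv A *v axis j 1)" by (rule component_le_norm_cart)
    also have "... <= 1 / \<delta>" using v[of "axis j 1"] by simp
    finally show ?thesis .
  qed
  have "norm (matrix_inv A) <= (SUM i:UNIV. norm (matrix_inv A $ i))" unfolding norm_vec_def[of "matrix_inv A"] by (rule L2_set_le_sum) simp
  also have "... <= (SUM i:(UNIV::'n set). real CARD('n) / \<delta>)"
  proof (rule sum_mono)
    fix i
    have "norm (matrix_inv A $ i) <= (SUM j:UNIV. \<bar>matrix_inv A $ i $ j\<bar>)" by (rule norm_le_l1_cart)
    also have "... <= (SUM j:(UNIV::'n set). 1 / \<delta>)" by (intro sum_mono e)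
    finally show "norm (matrix_inv A $ i) <= real CARD('n) / \<delta>" by simp
  qed
  finally show ?thesis by simp
qed

section \<open>Essentially bounded processes\<close>

context brownian
begin

text \<open>The bound in \<open>bounded_prog\<close> holds at every point. For the inverse of the
  control weight and for \<open>\<phi>\<^sub>1\<close> a bound is available only almost
  everywhere.\<close>

definition ess_bounded :: "(real => 'w => 'h::euclidean_space) => bool" where
  "ess_bounded X \<longleftrightarrow> X : PM & (EX K>=0. AE z in Pm. norm (ev X z) <= K)"

lemma ess_bounded_bounded_prog: "X : bounded_prog M F s T H ==> ess_bounded X"
  unfolding ess_bounded_def by (erule bounded_progD) (auto simp: ev_def space_Pm intro!: AE_I2)

lemma ess_bounded_add:
  assumes "ess_bounded X" "ess_bounded Y" shows "ess_bounded (%t w. X t w + Y t w)"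
proof -
  obtain K L where K: "0 <= K" "AE z in Pm. norm (ev X z) <= K" and L: "0 <= L" "AE z in Pm. norm (ev Y z) <= L"
    using assms by (auto simp: ess_bounded_def)
  have "AE z in Pm. norm (ev (%t w. X t w + Y t w) z) <= K + L"
    using K(2) L(2) by eventually_elim (auto simp: ev_def intro: order_trans[OF norm_triangle_ineq])
  then show ?thesis using assms K(1) L(1) by (auto simp: ess_bounded_def prog_add intro: exI[of _ "K + L"])
qed

lemma prog_uminus: "X : prog_measurable M F s T H ==> (%t w. - X t w) : PM"
  by (auto simp: prog_measurable_def split_beta' intro!: borel_measurable_uminus)

lemma ess_bounded_uminus: "ess_bounded X ==> ess_bounded (%t w. - X t w)"
  by (auto simp: ess_bounded_def prog_uminus ev_def)

lemma ess_bounded_mult: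
  fixes P :: "real => 'w => real^'n^'m" and Q :: "real => 'w => real^'p^'n"
  assumes "ess_bounded P" "ess_bounded Q" shows "ess_bounded (%t w. P t w ** Q t w)"
proof -
  obtain K L where K: "0 <= K" "AE z in Pm. norm (ev P z) <= K" and L: "0 <= L" "AE z in Pm. norm (ev Q z) <= L"
    using assms by (auto simp: ess_bounded_def)
  have "AE z in Pm. norm (ev (%t w. P t w ** Q t w) z) <= K * L"
    using K(2) L(2)
  proof eventually_elim
    case (elim z)
    have "norm (ev P z ** ev Q z) <= K * L"
      by (rule order_trans[OF norm_matrix_mult_le mult_mono]) (use elim K(1) in auto)
    then show ?case by (simp add: ev_def)
  qed
  then show ?thesis using assms K(1) L(1)
    by (auto simp: ess_bounded_def intro!: prog_bilinear[OF bounded_bilinear_matrix_mult] exI[of _ "K * L"])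
qed

lemma prog_transpose:
  fixes P :: "real => 'w => real^'n^'m"
  shows "P : prog_measurable M F s T H ==> (%t w. transpose (P t w)) : PM"
  by (auto simp: prog_measurable_def split_beta' intro!: borel_measurable_transpose)

lemma ess_bounded_transpose:
  fixes P :: "real => 'w => real^'n^'m"
  shows "ess_bounded P ==> ess_bounded (%t w. transpose (P t w))"
  by (auto simp: ess_bounded_def prog_transpose ev_def norm_transpose)

lemma prog_matrix_inv:
  fixes P :: "real => 'w => real^'n^'n"
  assumes "P : prog_measurable M F s T H" "!!t w. t : {s..T} ==> w : space M ==> invertible (P t w)"
  shows "(%t w. matrix_inv (P t w)) : PM"
  using assms by (auto simp: prog_measurable_def split_beta' space_pair_measure space_restrict_space space_F
      intro!: borel_measurable_matrix_inv)

lemma ess_bounded_L2: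
  fixes P :: "real => 'w => 'a::euclidean_space" and X :: "real => 'w => 'b::euclidean_space" and h :: "'a => 'b => 'c::euclidean_space"
  assumes h: "bounded_bilinear h" "!!a b. norm (h a b) <= norm a * norm b"
    and P: "ess_bounded P" and X: "X : L2_prog M F s T H"
  shows "(%t w. h (P t w) (X t w)) : L2P"
proof -
  obtain K where K: "AE z in Pm. norm (ev P z) <= K" using P by (auto simp: ess_bounded_def)
  have pr: "P : PM" "X : prog_measurable M F s T H" using P X by (auto simp: ess_bounded_def L2_prog_def)
  show ?thesis
  proof (rule L2_prog_bound[OF prog_bilinear[OF h(1) pr] X, where K = K])
    show "AE z in Pm. norm (ev (%t w. h (P t w) (X t w)) z) <= K * norm (ev X z)"
      using K
    proof eventually_elim
      case (elim z)
      have "norm (h (ev P z) (ev X z)) <= K * norm (ev X z)"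
        by (rule order_trans[OF h(2) mult_right_mono[OF elim norm_ge_zero]])
      then show ?case by (simp add: ev_def)
    qed
  qed
qed

lemmas ess_bounded_mult_L2 = ess_bounded_L2[OF bounded_bilinear_matrix_vector_mult norm_matrix_vector_mult_le]

lemma L2_prog_uminus: "X : L2_prog M F s T H ==> (%t w. - X t w) : L2P"
  by (auto simp: L2_prog_def prog_uminus)

lemma Linf_cont_bound:
  assumes "X : Linf_cont M F s T H"
  obtains K where "0 <= K" "AE w in M. ALL t:{s..T}. norm (X t w) <= K" "X : L2C" "ess_bounded X"
proof -
  have X: "X : cont_prog M F s T H" "esssup M (%w. SUP t\<in>{s..T}. ereal (norm (X t w))) < \<infinity>"
    using assms by (auto simp: Linf_cont_def)
  from X(2) obtain k where k: "esssup M (%w. SUP t\<in>{s..T}. ereal (norm (X t w))) <= ereal k"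
    by (cases "esssup M (%w. SUP t\<in>{s..T}. ereal (norm (X t w)))") auto
  have K: "AE w in M. ALL t:{s..T}. norm (X t w) <= \<bar>k\<bar>"
    using esssup_AE[of "%w. SUP t\<in>{s..T}. ereal (norm (X t w))" M]
  proof eventually_elim
    case (elim w)
    show ?case
    proof
      fix t assume "t : {s..T}"
      then have "ereal (norm (X t w)) <= (SUP t\<in>{s..T}. ereal (norm (X t w)))" by (rule SUP_upper)
      also have "... <= ereal k" using elim k by (rule order_trans)
      finally show "norm (X t w) <= \<bar>k\<bar>" by simp
    qed
  qed
  have XU: "X : CP" using X(1) by (auto simp: cont_prog_def prog_measurable_def)
  have "(EM w. supsq X w) <= (EM w. ennreal (k^2))"
  proof (rule nn_integral_mono_AE)
    show "AE w in M. supsq X w <= ennreal (k^2)"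
      using K
    proof eventually_elim
      case (elim w)
      show ?case unfolding supsq_def
        by (rule SUP_least) (use elim in \<open>auto intro!: ennreal_leI simp: abs_le_square_iff[symmetric]\<close>)
    qed
  qed
  also have "... < \<infinity>" by (simp add: emeasure_space_1)
  finally have L: "X : L2C" using XU by (simp add: L2_cont_iff)
  have "AE z in Pm. norm (ev X z) <= \<bar>k\<bar>"
    using AE_Pm_fst[OF K] AE_space by eventually_elim (auto simp: ev_def space_Pm)
  then have "ess_bounded X" using XU by (auto simp: ess_bounded_def cont_prog_def intro: exI[of _ "\<bar>k\<bar>"])
  then show thesis using that[of "\<bar>k\<bar>"] K L by auto
qed

text \<open>By Fubini, equality almost everywhere on \<open>Pm\<close> means that almost every path
  agrees at almost every time, and the path integral sees no more than that.\<close>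

lemma ito_differential_drift_cong:
  fixes X b b' :: "real => 'w => 'h::euclidean_space"
  assumes d: "ito_eq X b \<sigma>" and b: "b : L2P" and b': "b' : L2P"
    and e: "AE z in Pm. ev b z = ev b' z"
  shows "ito_eq X b' \<sigma>"
proof -
  from d obtain I where I: "ito \<sigma> I" "AE w in M. ALL t:{s..T}. X t w = X s w + (LINT r:{s..t}|lborel. b r w) + I t w"
    by (auto simp: ito_differential_def)
  have e': "AE w in M. AE t in lam. b t w = b' t w" using pmf.AE_pair[OF e[unfolded Pm_def]] by simp
  have m: "ev b : meas Pm" "ev b' : meas Pm" using b b' by (auto simp: L2_prog_def intro: prog_ev)
  have "AE w in M. ALL t:{s..T}. X t w = X s w + (LINT r:{s..t}|lborel. b' r w) + I t w"
    using I(2) e' AE_space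
  proof eventually_elim
    case (elim w)
    have "(LINT r:{s..t}|lborel. b r w) = (LINT r:{s..t}|lborel. b' r w)" if "t : {s..T}" for t
      unfolding lint_lam[OF that]
    proof (rule integral_cong_AE)
      show "(%r. indicator {s..t} r *\<^sub>R b r w) : meas lam" "(%r. indicator {s..t} r *\<^sub>R b' r w) : meas lam"
        by (intro borel_measurable_scaleR section_lam m elim(3) measurable_lamI; simp)+
      show "AE r in lam. indicator {s..t} r *\<^sub>R b r w = indicator {s..t} r *\<^sub>R b' r w" using elim(2) by eventually_elim simp
    qed
    then show ?case using elim(1) by metis
  qed
  moreover have "AE w in M. set_integrable lborel {s..T} (%r. b' r w)" using L2_path_integrable[OF b'] by eventually_elim simp
  ultimately show ?thesis using I(1) by (auto simp: ito_differential_def)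
qed

text \<open>Replacing \<open>A\<close> by zero where it exceeds its essential bound gives a
  coefficient bounded everywhere and changes the drift on a null set only.\<close>

lemma sde_exists_ess_bounded:
  fixes A C :: "real => 'w => real^'n^'n"
  assumes A: "ess_bounded A" and C: "C : BP" and f: "f : L2P"
  shows "EX X. lin_state A C f \<xi> X"
proof -
  obtain K where K: "0 <= K" "A : PM" "AE z in Pm. norm (ev A z) <= K" using A by (auto simp: ess_bounded_def)
  define A' where "A' t w = (if norm (A t w) <= K then A t w else 0)" for t w
  have A': "A' : BP"
  proof -
    have "(%z. case z of (r, w) => A' r w) : meas (restrict_space borel {s..t} \<Otimes>\<^sub>M F t)" if "t : {s..T}" for t
    proof -
      have [measurable]: "(%z. A (fst z) (snd z)) : meas (restrict_space borel {s..t} \<Otimes>\<^sub>M F t)"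
        using K(2) that by (auto simp: prog_measurable_def split_beta')
      show ?thesis unfolding A'_def split_beta' by measurable
    qed
    moreover have "norm (A' t w) <= K" for t w using K(1) by (simp add: A'_def)
    ultimately show ?thesis by (auto simp: bounded_prog_def prog_measurable_def)
  qed
  obtain X where X: "lin_state A' C f \<xi> X" using sde_exists[OF A' C f] by blast
  have XL: "X : L2P" using X by (auto simp: linear_state_def intro: L2_cont_L2_prog)
  have "ito_eq X (%t w. A t w *v X t w + f t w) (%t w. C t w *v X t w)"
  proof (rule ito_differential_drift_cong)
    show "ito_eq X (%t w. A' t w *v X t w + f t w) (%t w. C t w *v X t w)" using X by (simp add: linear_state_def)
    show "(%t w. A' t w *v X t w + f t w) : L2P" by (rule L2_prog_add[OF bounded_mult_L2[OF A' XL] f])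
    show "(%t w. A t w *v X t w + f t w) : L2P" by (rule L2_prog_add[OF ess_bounded_mult_L2[OF A XL] f])
    show "AE z in Pm. ev (%t w. A' t w *v X t w + f t w) z = ev (%t w. A t w *v X t w + f t w) z"
      using K(3) by eventually_elim (simp add: ev_def A'_def)
  qed
  then show ?thesis using X by (auto simp: linear_state_def)
qed

lemma L2_cont_diff:
  fixes X Y :: "real => 'w => 'h::euclidean_space"
  assumes "X : L2C" "Y : L2C"
  shows "(%t w. X t w - Y t w) : L2C"
proof -
  have X: "X : CP" "(EM w. supsq X w) < \<infinity>" and Y: "Y : CP" "(EM w. supsq Y w) < \<infinity>"
    using assms by (auto simp: L2_cont_iff)
  note [measurable] = supsq_meas[OF X(1)] supsq_meas[OF Y(1)]
  have "(EM w. supsq (%t w. X t w - Y t w) w) <= (EM w. 2 * supsq X w + 2 * supsq Y w)"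
    using supsq_add[of X "%t w. - Y t w"] by (intro nn_integral_mono) (simp add: supsq_def)
  also have "... = 2 * (EM w. supsq X w) + 2 * (EM w. supsq Y w)" by (simp add: nn_integral_add nn_integral_cmult)
  also have "... < \<infinity>" using X(2) Y(2) by (simp add: ennreal_mult_less_top)
  finally show ?thesis using cont_prog_diff[OF X(1) Y(1)] by (simp add: L2_cont_iff)
qed

lemma linear_state_diff:
  fixes A C :: "real => 'w => real^'n^'n"
  assumes X: "lin_state A C f \<xi> X" and Y: "lin_state A C g \<upsilon> Y"
  shows "lin_state A C (%t w. f t w - g t w) (\<xi> - \<upsilon>) (%t w. X t w - Y t w)"
proof -
  from X obtain I where I: "AE w in M. set_integrable lborel {s..T} (%r. A r w *v X r w + f r w)" "ito (%t w. C t w *v X t w) I"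
    "AE w in M. ALL t:{s..T}. X t w = X s w + (LINT r:{s..t}|lborel. A r w *v X r w + f r w) + I t w"
    by (auto simp: linear_state_def ito_differential_def)
  from Y obtain J where J: "AE w in M. set_integrable lborel {s..T} (%r. A r w *v Y r w + g r w)" "ito (%t w. C t w *v Y t w) J"
    "AE w in M. ALL t:{s..T}. Y t w = Y s w + (LINT r:{s..t}|lborel. A r w *v Y r w + g r w) + J t w"
    by (auto simp: linear_state_def ito_differential_def)
  have r: "A r w *v (X r w - Y r w) + (f r w - g r w) = (A r w *v X r w + f r w) - (A r w *v Y r w + g r w)" for r w
    by (simp add: matrix_vector_mult_diff_distrib)
  have "ito (%t w. C t w *v (X t w - Y t w)) (%t w. I t w - J t w)"
    using ito_diff[OF I(2) J(2)] by (simp add: matrix_vector_mult_diff_distrib)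
  moreover have "AE w in M. set_integrable lborel {s..T} (%r. A r w *v (X r w - Y r w) + (f r w - g r w))"
    using I(1) J(1) unfolding r by eventually_elim (rule set_integral_diff(1))
  moreover have "AE w in M. ALL t:{s..T}. X t w - Y t w = X s w - Y s w + (LINT r:{s..t}|lborel. A r w *v (X r w - Y r w) + (f r w - g r w)) + (I t w - J t w)"
    using I(1,3) J(1,3)
  proof eventually_elim
    case (elim w)
    show ?case
    proof
      fix t assume t: "t : {s..T}"
      have "set_integrable lborel {s..t} (%r. A r w *v X r w + f r w)" "set_integrable lborel {s..t} (%r. A r w *v Y r w + g r w)"
        by (rule set_integrable_subset[OF elim(1)] set_integrable_subset[OF elim(3)]; use t in simp)+
      then show "X t w - Y t w = X s w - Y s w + (LINT r:{s..t}|lborel. A r w *v (X r w - Y r w) + (f r w - g r w)) + (I t w - J t w)"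
        unfolding r using bspec[OF elim(2) t] bspec[OF elim(4) t] by (simp add: set_integral_diff(2))
    qed
  qed
  moreover have "AE w in M. X s w - Y s w = \<xi> - \<upsilon>" using X Y by (auto simp: linear_state_def)
  moreover have "(%t w. X t w - Y t w) : L2C" using X Y L2_cont_diff by (auto simp: linear_state_def)
  ultimately show ?thesis by (auto simp: linear_state_def ito_differential_def)
qed

end

section \<open>The optimal feedback\<close>

text \<open>Symmetry merges the two mixed terms into one.\<close>

lemma symmetric_quad_expand:
  fixes P :: "real^'n^'n"
  assumes "P : sym_matrices"
  shows "(P *v x) \<bullet> x = (P *v y) \<bullet> y + 2 * ((P *v y) \<bullet> (x - y)) + (P *v (x - y)) \<bullet> (x - y)"
proof -
  have "(P *v x) \<bullet> y = (P *v y) \<bullet> x"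
    using transpose_mult_inner[of P y x] assms unfolding sym_matrices_def mem_Collect_eq by (metis inner_commute)
  then show ?thesis by (simp add: matrix_vector_mult_diff_distrib inner_diff_left inner_diff_right)
qed

lemma integral_quad_expand:
  fixes P :: "'a => real^'n^'n" and x y :: "'a => real^'n"
  assumes "!!z. z : space N ==> P z : sym_matrices"
    and i: "integrable N (%z. (P z *v y z) \<bullet> y z)" "integrable N (%z. (P z *v y z) \<bullet> (x z - y z))"
      "integrable N (%z. (P z *v (x z - y z)) \<bullet> (x z - y z))"
  shows "(LINT z|N. (P z *v x z) \<bullet> x z) =
    (LINT z|N. (P z *v y z) \<bullet> y z) + 2 * (LINT z|N. (P z *v y z) \<bullet> (x z - y z)) + (LINT z|N. (P z *v (x z - y z)) \<bullet> (x z - y z))"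
proof -
  have "(LINT z|N. (P z *v x z) \<bullet> x z) = (LINT z|N. ((P z *v y z) \<bullet> y z + 2 * ((P z *v y z) \<bullet> (x z - y z))) + (P z *v (x z - y z)) \<bullet> (x z - y z))"
    by (intro Bochner_Integration.integral_cong refl symmetric_quad_expand assms(1))
  also have "... = (LINT z|N. (P z *v y z) \<bullet> y z + 2 * ((P z *v y z) \<bullet> (x z - y z))) + (LINT z|N. (P z *v (x z - y z)) \<bullet> (x z - y z))"
    by (intro Bochner_Integration.integral_add Bochner_Integration.integrable_add integrable_mult_right i)
  also have "(LINT z|N. (P z *v y z) \<bullet> y z + 2 * ((P z *v y z) \<bullet> (x z - y z))) = (LINT z|N. (P z *v y z) \<bullet> y z) + (LINT z|N. 2 * ((P z *v y z) \<bullet> (x z - y z)))"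
    by (intro Bochner_Integration.integral_add integrable_mult_right i)
  finally show ?thesis by simp
qed

text \<open>Pointwise algebra behind the vanishing cross term. \<open>e\<close> stands for the
  control weight applied to the feedback, \<open>ww\<close> for its effect on the drift,
  \<open>g\<close> for the leader's part. The Riccati drift appears without its
  \<open>\<phi>t\<close> terms, which \<open>riccati_duality\<close> has already removed.\<close>

lemma stationarity_identity:
  fixes D P A C S :: "real^'n^'n" and B1 :: "real^'m^'n"
  assumes "e = - (transpose B1 *v (P *v x + \<psi>))" "ww = - (S *v (P *v x + \<psi>))"
  shows "(D *v x) \<bullet> y + e \<bullet> v
    + (((- (D + P ** A + transpose A ** P + transpose C ** P ** C + - (P ** S ** P)) *v x) \<bullet> y + (P *v x) \<bullet> (A *v y + B1 *v v)
        + (P *v (A *v x + (ww + g))) \<bullet> y + (P *v (C *v x)) \<bullet> (C *v y))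
      + (y \<bullet> (- ((transpose A + - (P ** S)) *v \<psi> + transpose C *v \<psi>t + P *v g)) + \<psi> \<bullet> (A *v y + B1 *v v) + \<psi>t \<bullet> (C *v y))) = 0"
  unfolding assms inner_commute[of y]
  by (simp add: matrix_vector_mult_add_rdistrib matrix_vector_right_distrib inner_add_left inner_add_right
      bounded_bilinear.minus_left[OF bounded_bilinear_matrix_vector_mult] bounded_bilinear.minus_right[OF bounded_bilinear_matrix_vector_mult]
      matrix_vector_mult_diff_rdistrib matrix_vector_mult_diff_distrib inner_diff_left
      matrix_vector_mul_assoc[symmetric] transpose_matrix_vector dot_lmul_matrix)

context brownian
begin

lemma quadratic_cost_expand:
  fixes D :: "real => 'w => real^'n^'n" and E :: "real => 'w => real^'m^'m"
  assumes D: "D : bounded_prog M F s T sym_matrices" and E: "E : bounded_prog M F s T sym_matrices"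
    and G: "G : meas M" "!!w. w : space M ==> norm (G w) <= K" "!!w. w : space M ==> G w : sym_matrices"
    and X: "X : L2C" "u : L2P"
    and X': "X' : L2C" "u' : L2P"
  shows "quadratic_cost M s T D E G X u = quadratic_cost M s T D E G X' u'
    + 2 * ((LINT z|Pm. (ev D z *v ev X' z) \<bullet> (ev X z - ev X' z)) + (LINT z|Pm. (ev E z *v ev u' z) \<bullet> (ev u z - ev u' z))
      + (LINT w|M. (G w *v X' T w) \<bullet> (X T w - X' T w)))
    + quadratic_cost M s T D E G (%t w. X t w - X' t w) (%t w. u t w - u' t w)"
proof -
  have T: "T : {s..T}" using sT by simp
  note Y = L2_cont_diff[OF X(1) X'(1)] and v = L2_prog_diff[OF X(2) X'(2)]
  note XL = L2_cont_L2_prog[OF X'(1)] L2_cont_L2_prog[OF Y]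
  have mT: "R T : meas M" if "R : L2C" for R :: "real => 'w => real^'n"
    using that cont_prog_M[OF _ T] by (auto simp: L2_cont_def)
  have symD: "ev D z : sym_matrices" and symE: "ev E z : sym_matrices" if "z : space Pm" for z
    using that D E by (auto simp: bounded_prog_def prog_measurable_def ev_def space_Pm)
  have evd: "ev (%t w. R t w - Q t w) z = ev R z - ev Q z" for R Q :: "real => 'w => real^'q" and z by (simp add: ev_def)
  have iD: "integrable Pm (%z. (ev D z *v ev R z) \<bullet> ev Q z)" if "R : L2P" "Q : L2P" for R Q
    using L2_inner_integrable[OF bounded_mult_L2[OF D that(1)] that(2)] by (simp add: ev_def)
  have iE: "integrable Pm (%z. (ev E z *v ev R z) \<bullet> ev Q z)" if "R : L2P" "Q : L2P" for R Q
    using L2_inner_integrable[OF bounded_mult_L2[OF E that(1)] that(2)] by (simp add: ev_def)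
  have iG: "integrable M (%w. (G w *v R T w) \<bullet> Q T w)" if "R : L2C" "Q : L2C" for R Q
    by (rule bounded_quad_integrable[OF G(1,2) mT[OF that(1)] L2_cont_sq[OF that(1) T] mT[OF that(2)] L2_cont_sq[OF that(2) T]])
  have eD: "(LINT z|Pm. (ev D z *v ev X z) \<bullet> ev X z) = (LINT z|Pm. (ev D z *v ev X' z) \<bullet> ev X' z) + 2 * (LINT z|Pm. (ev D z *v ev X' z) \<bullet> (ev X z - ev X' z))
    + (LINT z|Pm. (ev D z *v (ev X z - ev X' z)) \<bullet> (ev X z - ev X' z))"
    using iD[OF XL(1,1)] iD[OF XL(1,2)] iD[OF XL(2,2)] by (intro integral_quad_expand symD) (simp_all add: evd)
  have eE: "(LINT z|Pm. (ev E z *v ev u z) \<bullet> ev u z) = (LINT z|Pm. (ev E z *v ev u' z) \<bullet> ev u' z) + 2 * (LINT z|Pm. (ev E z *v ev u' z) \<bullet> (ev u z - ev u' z))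
    + (LINT z|Pm. (ev E z *v (ev u z - ev u' z)) \<bullet> (ev u z - ev u' z))"
    using iE[OF X'(2) X'(2)] iE[OF X'(2) v] iE[OF v v] by (intro integral_quad_expand symE) (simp_all add: evd)
  have eG: "(LINT w|M. (G w *v X T w) \<bullet> X T w) = (LINT w|M. (G w *v X' T w) \<bullet> X' T w) + 2 * (LINT w|M. (G w *v X' T w) \<bullet> (X T w - X' T w))
    + (LINT w|M. (G w *v (X T w - X' T w)) \<bullet> (X T w - X' T w))"
    using iG[OF X'(1) X'(1)] iG[OF X'(1) Y] iG[OF Y Y] by (intro integral_quad_expand G(3)) simp_all
  have J: "quadratic_cost M s T D E G R q = (LINT z|Pm. (ev D z *v ev R z) \<bullet> ev R z) + (LINT z|Pm. (ev E z *v ev q z) \<bullet> ev q z)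
      + (LINT w|M. (G w *v R T w) \<bullet> R T w)" if "R : L2C" "q : L2P" for R q
    by (rule quadratic_cost_eq[OF D E G(1,2) that])
  show ?thesis unfolding J[OF X] J[OF X'] J[OF Y v] evd eD eE eG by (simp only: distrib_left add_ac)
qed

text \<open>The terminal values of \<open>\<phi>\<close> and \<open>\<psi>\<close> turn the terminal
  cross term into time integrals, and \<open>Y\<close> starting at zero removes the initial values.
  The feedback enters only through \<open>Eu\<close> and \<open>Bu\<close>, so that no inverse
  matrix appears here.\<close>

lemma riccati_stationarity:
  fixes A C D \<phi> \<phi>t S :: "real => 'w => real^'n^'n" and B1 B2 :: "real => 'w => real^'m^'n" and E :: "real => 'w => real^'m^'m"
    and \<psi> \<psi>t X Y :: "real => 'w => real^'n" and u u2 v :: "real => 'w => real^'m"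
  assumes co: "A : BP" "C : BP" "B1 : BP" "B2 : BP"
      "D : bounded_prog M F s T H" "E : bounded_prog M F s T H'" and S: "ess_bounded S"
    and \<phi>: "\<phi> : Linf_cont M F s T H''" "\<phi>t : L2P"
    and riccati: "ito_eq \<phi>
          (%t w. - (D t w + \<phi> t w ** A t w + transpose (A t w) ** \<phi> t w + \<phi>t t w ** C t w + transpose (C t w) ** \<phi>t t w
                    + transpose (C t w) ** \<phi> t w ** C t w - \<phi> t w ** S t w ** \<phi> t w)) \<phi>t"
    and \<phi>T: "AE w in M. \<phi> T w = G w" and G: "G : meas M"
    and \<psi>: "\<psi> : L2C" "\<psi>t : L2P"
    and bsde: "ito_eq \<psi>
          (%t w. - ((transpose (A t w) - \<phi> t w ** S t w) *v \<psi> t w + transpose (C t w) *v \<psi>t t w + \<phi> t w *v (B2 t w *v u2 t w))) \<psi>t"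
    and \<psi>T: "AE w in M. \<psi> T w = 0"
    and u: "u2 : L2P" "u : L2P" "v : L2P"
    and X: "lin_state A C (%t w. B1 t w *v u t w + B2 t w *v u2 t w) \<xi> X"
    and Y: "lin_state A C (%t w. B1 t w *v v t w) 0 Y"
    and Eu: "!!t w. t : {s..T} ==> w : space M ==> E t w *v u t w = - (transpose (B1 t w) *v (\<phi> t w *v X t w + \<psi> t w))"
    and Bu: "!!t w. t : {s..T} ==> w : space M ==> B1 t w *v u t w = - (S t w *v (\<phi> t w *v X t w + \<psi> t w))"
  shows "(LINT z|Pm. (ev D z *v ev X z) \<bullet> ev Y z) + (LINT z|Pm. (ev E z *v ev u z) \<bullet> ev v z) + (LINT w|M. (G w *v X T w) \<bullet> Y T w) = 0"
proof -
  obtain K where K: "0 <= K" "AE w in M. ALL t:{s..T}. norm (\<phi> t w) <= K" "\<phi> : L2C" "ess_bounded \<phi>"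
    by (rule Linf_cont_bound[OF \<phi>(1)])
  obtain KC where KC: "0 <= KC" "!!t w. t : {s..T} ==> w : space M ==> norm (C t w) <= KC" using bounded_progD[OF co(2)] by metis
  note eb = ess_bounded_bounded_prog[OF co(1)] ess_bounded_bounded_prog[OF co(2)] ess_bounded_bounded_prog[OF co(3)]
    ess_bounded_bounded_prog[OF co(4)] ess_bounded_bounded_prog[OF co(5)] S K(4)
  \<comment> \<open>The part of the Riccati drift without \<open>\<phi>t\<close>: it is essentially
    bounded, as \<open>riccati_duality\<close> requires.\<close>
  define b0 where "b0 t w = - (D t w + \<phi> t w ** A t w + transpose (A t w) ** \<phi> t w
      + transpose (C t w) ** \<phi> t w ** C t w + - (\<phi> t w ** S t w ** \<phi> t w))" for t w
  have b0: "ess_bounded b0"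
    unfolding b0_def[abs_def] by (intro ess_bounded_uminus ess_bounded_add ess_bounded_mult ess_bounded_transpose eb)
  obtain K0 where K0: "0 <= K0" "AE z in Pm. norm (ev b0 z) <= K0" using b0 by (auto simp: ess_bounded_def)
  have b0m: "ev b0 : meas Pm" using b0 by (auto simp: ess_bounded_def intro: prog_ev)
  define b where "b t w = b0 t w - (\<phi>t t w ** C t w + transpose (C t w) ** \<phi>t t w)" for t w
  have XL: "X : L2C" and YL: "Y : L2C" using X Y by (auto simp: linear_state_def)
  note L = L2_cont_L2_prog[OF XL] L2_cont_L2_prog[OF YL] L2_cont_L2_prog[OF \<psi>(1)] u \<psi>(2) \<phi>(2)
  have cst: "(%_ _. c) : L2P" for c :: "real^'n^'n"
    using L2_cont_L2_prog[of "%_ _. c"] cont_prog_const[of c] sT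
    by (simp add: L2_cont_def emeasure_space_1 ennreal_less_top)
  \<comment> \<open>Multiplication by the constant identity matrix lets
    \<open>ess_bounded_L2\<close> yield square integrability of an essentially bounded
    process.\<close>
  have b0L: "b0 : L2P"
    using ess_bounded_L2[OF bounded_bilinear_matrix_mult norm_matrix_mult_le b0 cst[of "mat 1"]] by simp
  \<comment> \<open>\<open>ess_bounded_L2\<close> has the bounded factor on the left; transposing
    moves \<open>C\<close> there.\<close>
  have \<phi>tC: "(%t w. \<phi>t t w ** C t w) : L2P"
  proof -
    have "(%t w. transpose (transpose (C t w) ** transpose (\<phi>t t w))) : L2P"
    proof -
      have "(%t w. transpose (\<phi>t t w)) : L2P" using \<phi>(2) by (auto simp: L2_prog_def prog_transpose norm_transpose)
      from ess_bounded_L2[OF bounded_bilinear_matrix_mult norm_matrix_mult_le ess_bounded_transpose[OF eb(2)] this]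
      show ?thesis by (auto simp: L2_prog_def prog_transpose norm_transpose)
    qed
    then show ?thesis by (simp add: matrix_transpose_mul)
  qed
  have bL: "b : L2P"
    unfolding b_def[abs_def]
    by (intro L2_prog_diff L2_prog_add b0L \<phi>tC ess_bounded_L2[OF bounded_bilinear_matrix_mult norm_matrix_mult_le, where H = UNIV]
        ess_bounded_transpose eb L)
  have d: "ito_eq \<phi> b \<phi>t"
    using riccati by (simp add: b_def[abs_def] b0_def algebra_simps)
  define a where "a t w = A t w *v X t w + (B1 t w *v u t w + B2 t w *v u2 t w)" for t w
  define c where "c t w = A t w *v Y t w + B1 t w *v v t w" for t w
  have aL: "a : L2P" and cL: "c : L2P"
    unfolding a_def[abs_def] c_def[abs_def] by (intro L2_prog_add ess_bounded_mult_L2[where H = UNIV] eb L)+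
  have dX: "ito_eq X a (%t w. C t w *v X t w)" and dY: "ito_eq Y c (%t w. C t w *v Y t w)"
    using X Y by (simp_all add: linear_state_def a_def[abs_def] c_def[abs_def])
  define p where "p t w = - ((transpose (A t w) + - (\<phi> t w ** S t w)) *v \<psi> t w + transpose (C t w) *v \<psi>t t w + \<phi> t w *v (B2 t w *v u2 t w))" for t w
  have pL: "p : L2P"
    unfolding p_def[abs_def]
    by (intro L2_prog_uminus[where H = UNIV] L2_prog_add ess_bounded_mult_L2[where H = UNIV] ess_bounded_transpose ess_bounded_add ess_bounded_uminus ess_bounded_mult eb L)
  have d\<psi>: "ito_eq \<psi> p \<psi>t" using bsde by (simp add: p_def[abs_def])
  define q1 where "q1 z = (ev b0 z *v ev X z) \<bullet> ev Y z + (ev \<phi> z *v ev X z) \<bullet> ev c z + (ev \<phi> z *v ev a z) \<bullet> ev Y z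
       + (ev \<phi> z *v (ev C z *v ev X z)) \<bullet> (ev C z *v ev Y z)" for z
  define q2 where "q2 z = ev Y z \<bullet> ev p z + ev \<psi> z \<bullet> ev c z + ev \<psi>t z \<bullet> ev (%t w. C t w *v Y t w) z" for z
  have r1: "(LINT w|M. (\<phi> T w *v X T w) \<bullet> Y T w) - (LINT w|M. (\<phi> s w *v X s w) \<bullet> Y s w) = (LINT z|Pm. q1 z)"
    unfolding q1_def
    by (rule riccati_duality[OF K(3,2) bL d _ b0m K0(2) KC(2) XL aL dX YL cL dY K(1) K0(1) KC(1)]) (simp add: b_def ev_def)
  have r2: "(LINT w|M. \<psi> T w \<bullet> Y T w) - (LINT w|M. \<psi> s w \<bullet> Y s w) = (LINT z|Pm. q2 z)"
    unfolding q2_def by (rule inner_duality[OF \<psi>(1) pL d\<psi> YL cL dY])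
  have Y0: "AE w in M. Y s w = 0" using Y by (simp add: linear_state_def)
  have st: "s : {s..T}" "T : {s..T}" using sT by auto
  have m: "R t : meas M" if "R : L2C" "t : {s..T}" for R :: "real => 'w => 'q::euclidean_space" and t
    using that cont_prog_M by (auto simp: L2_cont_def)
  note mm = m[OF XL] m[OF YL] m[OF \<psi>(1)] m[OF K(3)]
  have "(LINT w|M. (\<phi> s w *v X s w) \<bullet> Y s w) = (LINT w|M. 0)" "(LINT w|M. \<psi> s w \<bullet> Y s w) = (LINT w|M. 0)" "(LINT w|M. \<psi> T w \<bullet> Y T w) = (LINT w|M. 0)"
    by (rule integral_cong_AE; use Y0 \<psi>T st in \<open>auto intro!: borel_measurable_inner borel_measurable_bilinear2[OF bounded_bilinear_matrix_vector_mult] mm\<close>)+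
  moreover have "(LINT w|M. (\<phi> T w *v X T w) \<bullet> Y T w) = (LINT w|M. (G w *v X T w) \<bullet> Y T w)"
  proof (rule integral_cong_AE)
    show e: "AE w in M. (\<phi> T w *v X T w) \<bullet> Y T w = (G w *v X T w) \<bullet> Y T w" using \<phi>T by eventually_elim simp
    show p: "(%w. (\<phi> T w *v X T w) \<bullet> Y T w) : meas M"
      using st by (intro borel_measurable_inner borel_measurable_bilinear2[OF bounded_bilinear_matrix_vector_mult] mm)
    show "(%w. (G w *v X T w) \<bullet> Y T w) : meas M"
      using st G by (intro borel_measurable_inner borel_measurable_bilinear2[OF bounded_bilinear_matrix_vector_mult] mm)
  qed
  ultimately have sum: "(LINT w|M. (G w *v X T w) \<bullet> Y T w) = (LINT z|Pm. q1 z) + (LINT z|Pm. q2 z)" using r1 r2 by simp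
  \<comment> \<open>The feedback makes the combined integrand vanish at every point, not merely on
    average.\<close>
  have q: "(ev D z *v ev X z) \<bullet> ev Y z + (ev E z *v ev u z) \<bullet> ev v z + (q1 z + q2 z) = 0" if "z : space Pm" for z
  proof -
    have z: "snd z : {s..T}" "fst z : space M" using that by (auto simp: space_Pm)
    show ?thesis
      unfolding q1_def q2_def ev_def a_def b0_def c_def p_def by (rule stationarity_identity[OF Eu[OF z] Bu[OF z]])
  qed
  have inn: "integrable Pm (%z. ev R z \<bullet> ev Q z)" if "R : L2P" "Q : L2P" for R Q :: "real => 'w => real^'q"
    by (rule L2_inner_integrable[OF that])
  note CL = ess_bounded_mult_L2[OF eb(2) L(1)] ess_bounded_mult_L2[OF eb(2) L(2)]
  have i1: "integrable Pm q1"
    unfolding q1_def[abs_def]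
    using inn[OF ess_bounded_mult_L2[OF b0 L(1)] L(2)] inn[OF ess_bounded_mult_L2[OF eb(7) L(1)] cL] inn[OF ess_bounded_mult_L2[OF eb(7) aL] L(2)]
      inn[OF ess_bounded_mult_L2[OF eb(7) CL(1)] CL(2)]
    by (intro Bochner_Integration.integrable_add) (simp_all add: ev_def)
  have i2: "integrable Pm q2"
    unfolding q2_def[abs_def] by (intro Bochner_Integration.integrable_add inn pL cL L CL)
  have i3: "integrable Pm (%z. (ev D z *v ev X z) \<bullet> ev Y z)" using inn[OF ess_bounded_mult_L2[OF eb(5) L(1)] L(2)] by (simp add: ev_def)
  have i4: "integrable Pm (%z. (ev E z *v ev u z) \<bullet> ev v z)" using inn[OF bounded_mult_L2[OF co(6) u(2)] u(3)] by (simp add: ev_def)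
  have "(LINT z|Pm. ((ev D z *v ev X z) \<bullet> ev Y z + (ev E z *v ev u z) \<bullet> ev v z) + (q1 z + q2 z)) = (LINT z|Pm. 0)"
    by (intro Bochner_Integration.integral_cong refl q)
  then show ?thesis unfolding sum using i1 i2 i3 i4 by simp
qed

end

theorem theorem3p2:
  fixes M :: "'w measure" and B :: "real \<Rightarrow> 'w \<Rightarrow> real" and F :: "real \<Rightarrow> 'w measure"
    and s T \<epsilon>\<^sub>1 :: real
    and A C D\<^sub>1 :: "real \<Rightarrow> 'w \<Rightarrow> real^'n^'n"
    and B\<^sub>1 B\<^sub>2 :: "real \<Rightarrow> 'w \<Rightarrow> real^'m^'n"
    and E\<^sub>1 :: "real \<Rightarrow> 'w \<Rightarrow> real^'m^'m"
    and G\<^sub>1 :: "'w \<Rightarrow> real^'n^'n"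
    and \<xi> :: "real^'n"
    and u\<^sub>2 :: "real \<Rightarrow> 'w \<Rightarrow> real^'m"
    and S\<^sub>1 \<phi>\<^sub>1 \<phi>t\<^sub>1 :: "real \<Rightarrow> 'w \<Rightarrow> real^'n^'n"
    and \<psi>\<^sub>1 \<psi>t\<^sub>1 :: "real \<Rightarrow> 'w \<Rightarrow> real^'n"
    and J\<^sub>1 :: "(real \<Rightarrow> 'w \<Rightarrow> real^'n) \<Rightarrow> (real \<Rightarrow> 'w \<Rightarrow> real^'m) \<Rightarrow> real"
    and state :: "(real \<Rightarrow> 'w \<Rightarrow> real^'m) \<Rightarrow> (real \<Rightarrow> 'w \<Rightarrow> real^'n) \<Rightarrow> bool"
    and feedback :: "(real \<Rightarrow> 'w \<Rightarrow> real^'n) \<Rightarrow> real \<Rightarrow> 'w \<Rightarrow> real^'m"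
  assumes "0 \<le> s" and "s < T"
    and "prob_space M"
    and "standard_brownian_motion M B"
    and "F = brownian_filtration M B"
    and "usual_conditions M F"
    and "A \<in> bounded_prog M F s T UNIV" and "C \<in> bounded_prog M F s T UNIV"
    and "B\<^sub>1 \<in> bounded_prog M F s T UNIV" and "B\<^sub>2 \<in> bounded_prog M F s T UNIV"
    and "D\<^sub>1 \<in> bounded_prog M F s T sym_matrices"
    and "E\<^sub>1 \<in> bounded_prog M F s T sym_matrices"
    and "\<forall>t\<in>{s..T}. \<forall>\<omega>\<in>space M. invertible (E\<^sub>1 t \<omega>)"
    and "G\<^sub>1 \<in> borel_measurable (F T)" and "\<forall>\<omega>\<in>space M. G\<^sub>1 \<omega> \<in> sym_matrices"
    and "\<exists>K. \<forall>\<omega>\<in>space M. norm (G\<^sub>1 \<omega>) \<le> K"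
    and "u\<^sub>2 \<in> L2_prog M F s T UNIV"
    and state: "state = (\<lambda>u\<^sub>1.
          linear_state M F B s T A C (\<lambda>t \<omega>. B\<^sub>1 t \<omega> *v u\<^sub>1 t \<omega> + B\<^sub>2 t \<omega> *v u\<^sub>2 t \<omega>) \<xi>)"
    and J\<^sub>1: "J\<^sub>1 = quadratic_cost M s T D\<^sub>1 E\<^sub>1 G\<^sub>1"
    and "\<epsilon>\<^sub>1 > 0"
    and coercive: "\<forall>v\<in>L2_prog M F s T UNIV. \<forall>Y.
          linear_state M F B s T A C (\<lambda>t \<omega>. B\<^sub>1 t \<omega> *v v t \<omega>) 0 Y \<longrightarrow>
          quadratic_cost M s T D\<^sub>1 E\<^sub>1 G\<^sub>1 Y v
            \<ge> \<epsilon>\<^sub>1 * (LINT \<omega>|M. (LINT t:{s..T}|lborel. (norm (v t \<omega>))\<^sup>2))"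
    and S\<^sub>1: "S\<^sub>1 = (\<lambda>t \<omega>. B\<^sub>1 t \<omega> ** matrix_inv (E\<^sub>1 t \<omega>) ** transpose (B\<^sub>1 t \<omega>))"
    and "\<phi>\<^sub>1 \<in> Linf_cont M F s T sym_matrices" and "\<phi>t\<^sub>1 \<in> L2_prog M F s T sym_matrices"
    and riccati: "ito_differential M F B s T \<phi>\<^sub>1
          (\<lambda>t \<omega>. - (D\<^sub>1 t \<omega> + \<phi>\<^sub>1 t \<omega> ** A t \<omega> + transpose (A t \<omega>) ** \<phi>\<^sub>1 t \<omega>
                    + \<phi>t\<^sub>1 t \<omega> ** C t \<omega> + transpose (C t \<omega>) ** \<phi>t\<^sub>1 t \<omega>
                    + transpose (C t \<omega>) ** \<phi>\<^sub>1 t \<omega> ** C t \<omega>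
                    - \<phi>\<^sub>1 t \<omega> ** S\<^sub>1 t \<omega> ** \<phi>\<^sub>1 t \<omega>))
          \<phi>t\<^sub>1"
    and "AE \<omega> in M. \<phi>\<^sub>1 T \<omega> = G\<^sub>1 \<omega>"
    and "\<psi>\<^sub>1 \<in> L2_cont M F s T UNIV" and "\<psi>t\<^sub>1 \<in> L2_prog M F s T UNIV"
    and bsde: "ito_differential M F B s T \<psi>\<^sub>1
          (\<lambda>t \<omega>. - ((transpose (A t \<omega>) - \<phi>\<^sub>1 t \<omega> ** S\<^sub>1 t \<omega>) *v \<psi>\<^sub>1 t \<omega>
                    + transpose (C t \<omega>) *v \<psi>t\<^sub>1 t \<omega>
                    + \<phi>\<^sub>1 t \<omega> *v (B\<^sub>2 t \<omega> *v u\<^sub>2 t \<omega>)))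
          \<psi>t\<^sub>1"
    and "AE \<omega> in M. \<psi>\<^sub>1 T \<omega> = 0"
    and feedback: "feedback = (\<lambda>X t \<omega>.
          - (matrix_inv (E\<^sub>1 t \<omega>) *v (transpose (B\<^sub>1 t \<omega>) *v (\<phi>\<^sub>1 t \<omega> *v X t \<omega> + \<psi>\<^sub>1 t \<omega>))))"
  shows "(\<exists>Xs. state (feedback Xs) Xs) \<and>
         (\<forall>Xs. state (feedback Xs) Xs \<longrightarrow>
            feedback Xs \<in> L2_prog M F s T UNIV \<and>
            (\<forall>u\<^sub>1\<in>L2_prog M F s T UNIV. \<forall>X. state u\<^sub>1 X \<longrightarrow>
               J\<^sub>1 Xs (feedback Xs) \<le> J\<^sub>1 X u\<^sub>1))"
proof -
  interpret prob_space M by fact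
  interpret brownian M B F s T by unfold_locales fact+
  note A = \<open>A : bounded_prog M F s T UNIV\<close> and C = \<open>C : bounded_prog M F s T UNIV\<close>
    and B1 = \<open>B\<^sub>1 : bounded_prog M F s T UNIV\<close> and B2 = \<open>B\<^sub>2 : bounded_prog M F s T UNIV\<close>
    and D = \<open>D\<^sub>1 : bounded_prog M F s T sym_matrices\<close> and E = \<open>E\<^sub>1 : bounded_prog M F s T sym_matrices\<close>
    and u2 = \<open>u\<^sub>2 : L2_prog M F s T UNIV\<close> and \<phi> = \<open>\<phi>\<^sub>1 : Linf_cont M F s T sym_matrices\<close> and \<psi> = \<open>\<psi>\<^sub>1 : L2_cont M F s T UNIV\<close>
  have inv: "invertible (E\<^sub>1 t w)" if "t : {s..T}" "w : space M" for t w
    using that \<open>ALL t:{s..T}. ALL w:space M. invertible (E\<^sub>1 t w)\<close> by blast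
  obtain KG where KG: "!!w. w : space M ==> norm (G\<^sub>1 w) <= KG" using \<open>EX K. ALL w:space M. norm (G\<^sub>1 w) <= K\<close> by blast
  have Gm: "G\<^sub>1 : meas M" using \<open>G\<^sub>1 : meas (F T)\<close> by (rule measurable_F_M)
  have lb: "AE z in Pm. ALL ww. \<epsilon>\<^sub>1 / 2 * (norm ww)^2 <= (ev E\<^sub>1 z *v ww) \<bullet> ww"
    by (rule coercive_lower_bound[OF A C B1 D E Gm KG \<open>0 < \<epsilon>\<^sub>1\<close>]) (use coercive in auto)
  define R where "R t w = matrix_inv (E\<^sub>1 t w)" for t w
  \<comment> \<open>The coercive lower bound is what bounds the inverse; invertibility at each point
    provides only its measurability.\<close>
  have R: "ess_bounded R"
  proof -
    have "R : prog_measurable M F s T UNIV"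
      unfolding R_def[abs_def] using E inv by (intro prog_matrix_inv) (auto simp: bounded_prog_def)
    moreover have "AE z in Pm. norm (ev R z) <= real CARD('m) * (real CARD('m) / (\<epsilon>\<^sub>1 / 2))"
      using lb AE_space
    proof eventually_elim
      case (elim z)
      have "norm (matrix_inv (ev E\<^sub>1 z)) <= real CARD('m) * (real CARD('m) / (\<epsilon>\<^sub>1 / 2))"
        by (rule coercive_matrix_inv_bound[OF _ _ elim(1)]) (use elim(2) inv \<open>0 < \<epsilon>\<^sub>1\<close> in \<open>auto simp: ev_def space_Pm\<close>)
      then show ?case by (simp add: ev_def R_def)
    qed
    moreover have "0 <= real CARD('m) * (real CARD('m) / (\<epsilon>\<^sub>1 / 2))" using \<open>0 < \<epsilon>\<^sub>1\<close> by simp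
    ultimately show ?thesis unfolding ess_bounded_def by blast
  qed
  have e\<phi>: "ess_bounded \<phi>\<^sub>1" by (rule Linf_cont_bound[OF \<phi>])
  have eB: "ess_bounded B\<^sub>1" and eBT: "ess_bounded (%t w. transpose (B\<^sub>1 t w))" and eA: "ess_bounded A"
    using ess_bounded_bounded_prog B1 A ess_bounded_transpose by blast+
  have S: "ess_bounded S\<^sub>1" unfolding S\<^sub>1 using ess_bounded_mult[OF ess_bounded_mult[OF eB R] eBT] by (simp add: R_def)
  have \<psi>L: "\<psi>\<^sub>1 : L2_prog M F s T UNIV" by (rule L2_cont_L2_prog[OF \<psi>])
  \<comment> \<open>The feedback acts on the drift through \<open>S\<^sub>1\<close> alone, which
    makes the closed loop a linear equation.\<close>
  have Bfb: "B\<^sub>1 t w *v feedback X t w = - (S\<^sub>1 t w *v (\<phi>\<^sub>1 t w *v X t w + \<psi>\<^sub>1 t w))" for X t w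
    unfolding feedback S\<^sub>1
    by (simp add: bounded_bilinear.minus_right[OF bounded_bilinear_matrix_vector_mult] matrix_vector_mul_assoc matrix_mul_assoc del: transpose_matrix_vector)
  have ex: "EX X. state (feedback X) X"
  proof -
    \<comment> \<open>The part of the feedback linear in the state joins the drift coefficient; the
      part with \<open>\<psi>\<^sub>1\<close> becomes a forcing term.\<close>
    have eA': "ess_bounded (%t w. A t w + - (S\<^sub>1 t w ** \<phi>\<^sub>1 t w))"
      by (intro ess_bounded_add ess_bounded_uminus ess_bounded_mult eA S e\<phi>)
    have fL: "(%t w. - (S\<^sub>1 t w *v \<psi>\<^sub>1 t w) + B\<^sub>2 t w *v u\<^sub>2 t w) : L2_prog M F s T UNIV"
      by (intro L2_prog_add L2_prog_uminus[where H = UNIV] ess_bounded_mult_L2[OF S \<psi>L] bounded_mult_L2[OF B2 u2])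
    obtain X where X: "linear_state M F B s T (%t w. A t w + - (S\<^sub>1 t w ** \<phi>\<^sub>1 t w)) C (%t w. - (S\<^sub>1 t w *v \<psi>\<^sub>1 t w) + B\<^sub>2 t w *v u\<^sub>2 t w) \<xi> X"
      using sde_exists_ess_bounded[OF eA' C fL] by blast
    have drift: "(A t w + - (S\<^sub>1 t w ** \<phi>\<^sub>1 t w)) *v X t w + (- (S\<^sub>1 t w *v \<psi>\<^sub>1 t w) + B\<^sub>2 t w *v u\<^sub>2 t w)
        = A t w *v X t w + (B\<^sub>1 t w *v feedback X t w + B\<^sub>2 t w *v u\<^sub>2 t w)" for t w
      unfolding Bfb by (simp add: matrix_vector_mult_diff_rdistrib matrix_vector_right_distrib matrix_vector_mul_assoc)
    show ?thesis using X unfolding state linear_state_def drift by blast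
  qed
  have opt: "feedback Xs : L2_prog M F s T UNIV &
      (ALL u\<^sub>1:L2_prog M F s T UNIV. ALL X. state u\<^sub>1 X --> J\<^sub>1 Xs (feedback Xs) <= J\<^sub>1 X u\<^sub>1)" if Xs: "state (feedback Xs) Xs" for Xs
  proof (intro conjI ballI allI impI)
    have XsL: "Xs : L2_cont M F s T UNIV" using Xs by (simp add: state linear_state_def)
    \<comment> \<open>Solving the closed loop does not presuppose an admissible control;
      admissibility follows from the essential bounds and the square integrability of
      \<open>Xs\<close> and \<open>\<psi>\<^sub>1\<close>.\<close>
    have "(%t w. - (R t w *v (transpose (B\<^sub>1 t w) *v (\<phi>\<^sub>1 t w *v Xs t w + \<psi>\<^sub>1 t w)))) : L2_prog M F s T UNIV"
      by (intro L2_prog_uminus[where H = UNIV] ess_bounded_mult_L2[OF R, where H = UNIV] ess_bounded_mult_L2[OF eBT, where H = UNIV] L2_prog_add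
          ess_bounded_mult_L2[OF e\<phi>, where H = UNIV] L2_cont_L2_prog[OF XsL] \<psi>L)
    then show us: "feedback Xs : L2_prog M F s T UNIV" by (simp add: feedback R_def)
    fix u X assume u: "u : L2_prog M F s T UNIV" and X: "state u X"
    have XL: "X : L2_cont M F s T UNIV" using X by (simp add: state linear_state_def)
    define v where "v t w = u t w - feedback Xs t w" for t w
    define Y where "Y t w = X t w - Xs t w" for t w
    have vL: "v : L2_prog M F s T UNIV" unfolding v_def[abs_def] by (rule L2_prog_diff[OF u us])
    \<comment> \<open>The initial value and the leader's control cancel, so the difference is a
      state of the coercivity hypothesis.\<close>
    have Y: "linear_state M F B s T A C (%t w. B\<^sub>1 t w *v v t w) 0 Y"
      using linear_state_diff[OF X[unfolded state] Xs[unfolded state]] by (simp add: Y_def[abs_def] v_def matrix_vector_mult_diff_distrib)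
    have Eu: "E\<^sub>1 t w *v feedback Xs t w = - (transpose (B\<^sub>1 t w) *v (\<phi>\<^sub>1 t w *v Xs t w + \<psi>\<^sub>1 t w))" if "t : {s..T}" "w : space M" for t w
      unfolding feedback
      by (simp add: bounded_bilinear.minus_right[OF bounded_bilinear_matrix_vector_mult] matrix_vector_mul_assoc matrix_mul_assoc matrix_inv_mult[OF inv[OF that]]
          del: transpose_matrix_vector)
    have \<phi>t: "\<phi>t\<^sub>1 : L2_prog M F s T UNIV"
      using \<open>\<phi>t\<^sub>1 : L2_prog M F s T sym_matrices\<close> by (auto simp: L2_prog_def intro: prog_UNIV)
    have cross: "(\<integral>z. (ev D\<^sub>1 z *v ev Xs z) \<bullet> ev Y z \<partial>Pm) + (\<integral>z. (ev E\<^sub>1 z *v ev (feedback Xs) z) \<bullet> ev v z \<partial>Pm) + (\<integral>w. (G\<^sub>1 w *v Xs T w) \<bullet> Y T w \<partial>M) = 0"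
      by (rule riccati_stationarity[OF A C B1 B2 D E S \<phi> \<phi>t riccati \<open>AE w in M. \<phi>\<^sub>1 T w = G\<^sub>1 w\<close> Gm \<psi> \<open>\<psi>t\<^sub>1 : L2_prog M F s T UNIV\<close> bsde
            \<open>AE w in M. \<psi>\<^sub>1 T w = 0\<close> u2 us vL Xs[unfolded state] Y Eu Bfb])
    have "J\<^sub>1 X u = J\<^sub>1 Xs (feedback Xs) + 2 * ((\<integral>z. (ev D\<^sub>1 z *v ev Xs z) \<bullet> (ev X z - ev Xs z) \<partial>Pm)
        + (\<integral>z. (ev E\<^sub>1 z *v ev (feedback Xs) z) \<bullet> (ev u z - ev (feedback Xs) z) \<partial>Pm) + (\<integral>w. (G\<^sub>1 w *v Xs T w) \<bullet> (X T w - Xs T w) \<partial>M))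
        + J\<^sub>1 (%t w. X t w - Xs t w) (%t w. u t w - feedback Xs t w)"
      unfolding J\<^sub>1 by (rule quadratic_cost_expand[OF D E Gm KG _ XL u XsL us]) (use \<open>ALL w:space M. G\<^sub>1 w : sym_matrices\<close> in auto)
    then have "J\<^sub>1 X u = J\<^sub>1 Xs (feedback Xs) + 2 * ((\<integral>z. (ev D\<^sub>1 z *v ev Xs z) \<bullet> ev Y z \<partial>Pm) + (\<integral>z. (ev E\<^sub>1 z *v ev (feedback Xs) z) \<bullet> ev v z \<partial>Pm)
        + (\<integral>w. (G\<^sub>1 w *v Xs T w) \<bullet> Y T w \<partial>M)) + J\<^sub>1 Y v"
      by (simp only: ev_def Y_def[abs_def] v_def[abs_def])
    then have eq: "J\<^sub>1 X u = J\<^sub>1 Xs (feedback Xs) + J\<^sub>1 Y v" unfolding cross by simp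
    \<comment> \<open>With the cross term gone, the excess cost is the homogeneous cost of
      \<open>(Y, v)\<close>, which coercivity keeps nonnegative.\<close>
    have "0 <= \<epsilon>\<^sub>1 * (LINT w|M. (LINT t:{s..T}|lborel. (norm (v t w))^2))"
      using \<open>0 < \<epsilon>\<^sub>1\<close> by (intro mult_nonneg_nonneg Bochner_Integration.integral_nonneg) (auto simp: set_lebesgue_integral_def)
    also have "... <= J\<^sub>1 Y v" using coercive vL Y unfolding J\<^sub>1 by blast
    finally show "J\<^sub>1 Xs (feedback Xs) <= J\<^sub>1 X u" unfolding eq by simp
  qed
  show ?thesis using ex opt by blast
qed

end
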